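(* Let $A$ be a Noetherian ring and let $\preceq$ be a monomial ordering. (a) If $A$ is an algebra over a ring $R$ that contains a field $K$ such that $A$ is a subfinite $K$-algebra, then $\operatorname{trdeg}_\preceq(A:R)=\dim(A)$. (b) If $A=B_P$ is the localization at $P$ of a finitely generated algebra $B$ over a field, where $P\in\operatorname{Spec}(B)$, then $\operatorname{trdeg}_\preceq(A)=\dim(A)$. (c) If $\dim(A)\le 1$, then $\operatorname{trdeg}_\preceq(A)=\dim(A)$. (d) If $\dim(A)\le 1$ and $A$ is a subfinite algebra over a Noetherian Jacobson ring $R$, then $\operatorname{trdeg}_\preceq(A:R)=\dim(A)$.
   Context: All rings are commutative with identity element $1$. An $R$-algebra is a ring $A$ together with a ring homomorphism $R\to A$; it is called subfinite if it is a subalgebra of a finitely generated $R$-algebra. $\dim$ denotes the Krull dimension, and the zero ring has dimension $-1$. A Jacobson ring is a ring in which every prime ideal is an intersection of maximal ideals. A monomial ordering is a total ordering $\preceq$ on the set of monomials in infinitely many indeterminates $x_1,x_2,\ldots$ such that $1\preceq s$, and $st_1\preceq st_2$ whenever $t_1\preceq t_2$, for all monomials $s,t_1,t_2$. Let $R$ be a ring. A nonzero polynomial $f\in R[x_1,x_2,\ldots]$ is submonic with respect to $\preceq$ if its trailing coefficient (the coefficient of the $\preceq$-least monomial having nonzero coefficient) is $1$. (Over the zero ring, the polynomial $0$ is regarded as submonic with respect to every monomial ordering.) Let $A$ be an $R$-algebra. Elements $a_1,\ldots,a_n\in A$ are algebraically dependent over $R$ with respect to $\preceq$ if there is an $f\in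 R[x_1,\ldots,x_n]$ that is submonic with respect to $\preceq$ such that $f(a_1,\ldots,a_n)=0$ (the map $R\to A$ being applied to the coefficients of $f$); otherwise they are algebraically independent over $R$ with respect to $\preceq$. $\operatorname{trdeg}_\preceq(A:R)$ is the supremum (possibly $\infty$) of all positive integers $n$ such that there exist $a_1,\ldots,a_n\in A$ that are algebraically independent over $R$ with respect to $\preceq$; if every $a\in A$ is algebraically dependent over $R$ with respect to $\preceq$, one sets $\operatorname{trdeg}_\preceq(A:R):=0$ if $A\neq\{0\}$ and $:=-1$ if $A=\{0\}$. One writes $\operatorname{trdeg}_\preceq(A):=\operatorname{trdeg}_\preceq(A:A)$. *)

theory Defs
  imports
    "HOL-Algebra.Indexed_Polynomials"
    "HOL-Algebra.Generated_Rings"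
    "HOL-Algebra.Ring_Divisibility"
    "HOL-Library.Extended_Real"
begin

text \<open>An algebra is a ring together with a homomorphism from the base ring; the base
  homomorphism is an explicit argument (the locale \<^locale>\<open>algebra\<close> of the library
  describes algebras by a scalar multiplication instead).\<close>

definition ring_algebra ::
  "('r, 'm) ring_scheme \<Rightarrow> ('a, 'n) ring_scheme \<Rightarrow> ('r \<Rightarrow> 'a) \<Rightarrow> bool" where
  "ring_algebra R A \<phi> \<longleftrightarrow> cring R \<and> cring A \<and> \<phi> \<in> ring_hom R A"

definition fg_algebra ::
  "('r, 'm) ring_scheme \<Rightarrow> ('a, 'n) ring_scheme \<Rightarrow> ('r \<Rightarrow> 'a) \<Rightarrow> bool" where
  "fg_algebra R A \<phi> \<longleftrightarrow> ring_algebra R A \<phi> \<and>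
     (\<exists>S. finite S \<and> S \<subseteq> carrier A \<and> generate_ring A (\<phi> ` carrier R \<union> S) = carrier A)"

text \<open>The type argument is the type of elements of the ambient finitely generated algebra.
  In an assumption of a theorem it is to be left as a type variable of its own, so that ambient
  algebras of every type are covered. Being a subalgebra is expressed by an injective
  homomorphism of algebras, since the two rings need not have the same element type.\<close>

definition subfinite_algebra ::
  "'c itself \<Rightarrow> ('r, 'm) ring_scheme \<Rightarrow> ('a, 'n) ring_scheme \<Rightarrow> ('r \<Rightarrow> 'a) \<Rightarrow> bool" where
  "subfinite_algebra T R A \<phi> \<longleftrightarrow> ring_algebra R A \<phi> \<and>
     (\<exists>(C :: 'c ring) \<chi> \<iota>. fg_algebra R C \<chi> \<and> \<iota> \<in> ring_hom A C \<and> inj_on \<iota> (carrier A) \<and>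
        (\<forall>x \<in> carrier R. \<iota> (\<phi> x) = \<chi> x))"

definition prime_chain :: "('a, 'n) ring_scheme \<Rightarrow> nat \<Rightarrow> (nat \<Rightarrow> 'a set) \<Rightarrow> bool" where
  "prime_chain A n P \<longleftrightarrow> (\<forall>i \<le> n. primeideal (P i) A) \<and> (\<forall>i < n. P i \<subset> P (Suc i))"

definition krull_dim :: "('a, 'n) ring_scheme \<Rightarrow> ereal" where
  "krull_dim A = (if carrier A = {\<zero>\<^bsub>A\<^esub>} then -1
     else (SUP n \<in> {n. \<exists>P. prime_chain A n P}. ereal (real n)))"

definition jacobson_ring :: "('r, 'm) ring_scheme \<Rightarrow> bool" where
  "jacobson_ring R \<longleftrightarrow> cring R \<and>
     (\<forall>P. primeideal P R \<longrightarrow>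
        (\<exists>\<M>. \<M> \<noteq> {} \<and> (\<forall>M \<in> \<M>. maximalideal M R) \<and> P = \<Inter>\<M>))"

text \<open>The ring of fractions at a multiplicative subset, whose elements are the classes of pairs
  (numerator, denominator). The operations on classes are unions over all representatives;
  they are well defined when the second argument is multiplicatively closed.\<close>

definition frac_rel :: "('b, 'm) ring_scheme \<Rightarrow> 'b set \<Rightarrow> (('b \<times> 'b) \<times> ('b \<times> 'b)) set" where
  "frac_rel B S = {((a, s), (b, t)). a \<in> carrier B \<and> s \<in> S \<and> b \<in> carrier B \<and> t \<in> S \<and>
     (\<exists>u \<in> S. u \<otimes>\<^bsub>B\<^esub> (t \<otimes>\<^bsub>B\<^esub> a \<ominus>\<^bsub>B\<^esub> s \<otimes>\<^bsub>B\<^esub> b) = \<zero>\<^bsub>B\<^esub>)}"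

definition localization :: "('b, 'm) ring_scheme \<Rightarrow> 'b set \<Rightarrow> ('b \<times> 'b) set ring" where
  "localization B S =
     \<lparr> carrier = (carrier B \<times> S) // frac_rel B S,
       monoid.mult = (\<lambda>U V. \<Union>p \<in> U. \<Union>q \<in> V.
         frac_rel B S `` {(fst p \<otimes>\<^bsub>B\<^esub> fst q, snd p \<otimes>\<^bsub>B\<^esub> snd q)}),
       one = frac_rel B S `` {(\<one>\<^bsub>B\<^esub>, \<one>\<^bsub>B\<^esub>)},
       zero = frac_rel B S `` {(\<zero>\<^bsub>B\<^esub>, \<one>\<^bsub>B\<^esub>)},
       add = (\<lambda>U V. \<Union>p \<in> U. \<Union>q \<in> V.
         frac_rel B S `` {(snd q \<otimes>\<^bsub>B\<^esub> fst p \<oplus>\<^bsub>B\<^esub> snd p \<otimes>\<^bsub>B\<^esub> fst q, snd p \<otimes>\<^bsub>B\<^esub> snd q)}) \<rparr>"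

definition localization_at_prime :: "('b, 'm) ring_scheme \<Rightarrow> 'b set \<Rightarrow> ('b \<times> 'b) set ring" where
  "localization_at_prime B P = localization B (carrier B - P)"

text \<open>As in the library's indexed polynomials, a monomial is the multiset of its indeterminates,
  with multiplicities as exponents: the empty multiset is the monomial 1 and the product of
  monomials is the sum of multisets. The indeterminates are indexed from 0, so index \<open>i\<close>
  stands for the indeterminate written \<open>x\<^sub>i\<^sub>+\<^sub>1\<close> when counting from 1.
  A pair \<open>(s, t)\<close> belongs to the relation iff \<open>s \<preceq> t\<close>.\<close>

definition monomial_ordering :: "(nat multiset \<times> nat multiset) set \<Rightarrow> bool" where
  "monomial_ordering r \<longleftrightarrow> linear_order r \<and>
     (\<forall>s t1 t2. ({#}, s) \<in> r \<and> ((t1, t2) \<in> r \<longrightarrow> (s + t1, s + t2) \<in> r))"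

definition monomials_of :: "('r, 'm) ring_scheme \<Rightarrow> (nat multiset \<Rightarrow> 'r) \<Rightarrow> nat multiset set" where
  "monomials_of R f = {m. f m \<noteq> \<zero>\<^bsub>R\<^esub>}"

definition trailing_coeff ::
  "(nat multiset \<times> nat multiset) set \<Rightarrow> ('r, 'm) ring_scheme \<Rightarrow> (nat multiset \<Rightarrow> 'r) \<Rightarrow> 'r" where
  "trailing_coeff r R f =
     f (THE m. m \<in> monomials_of R f \<and> (\<forall>m' \<in> monomials_of R f. (m, m') \<in> r))"

definition submonic ::
  "(nat multiset \<times> nat multiset) set \<Rightarrow> ('r, 'm) ring_scheme \<Rightarrow> (nat multiset \<Rightarrow> 'r) \<Rightarrow> bool" where
  "submonic r R f \<longleftrightarrow>
     (monomials_of R f \<noteq> {} \<and> trailing_coeff r R f = \<one>\<^bsub>R\<^esub>) \<or>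
     (carrier R = {\<zero>\<^bsub>R\<^esub>} \<and> monomials_of R f = {})"

definition poly_eval ::
  "('r, 'm) ring_scheme \<Rightarrow> ('a, 'n) ring_scheme \<Rightarrow> ('r \<Rightarrow> 'a) \<Rightarrow> (nat \<Rightarrow> 'a) \<Rightarrow>
     (nat multiset \<Rightarrow> 'r) \<Rightarrow> 'a" where
  "poly_eval R A \<phi> a f =
     (\<Oplus>\<^bsub>A\<^esub>m \<in> monomials_of R f.
        \<phi> (f m) \<otimes>\<^bsub>A\<^esub> (\<Otimes>\<^bsub>A\<^esub>i \<in> set_mset m. a i [^]\<^bsub>A\<^esub> count m i))"

text \<open>The set \<^term>\<open>ring.indexed_pset R {..<n} (carrier R)\<close> is the polynomial ring over
  \<open>R\<close> in the first \<open>n\<close> indeterminates.\<close>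

definition alg_dependent ::
  "(nat multiset \<times> nat multiset) set \<Rightarrow> ('r, 'm) ring_scheme \<Rightarrow> ('a, 'n) ring_scheme \<Rightarrow>
     ('r \<Rightarrow> 'a) \<Rightarrow> nat \<Rightarrow> (nat \<Rightarrow> 'a) \<Rightarrow> bool" where
  "alg_dependent r R A \<phi> n a \<longleftrightarrow>
     (\<exists>f \<in> ring.indexed_pset R {..<n} (carrier R).
        submonic r R f \<and> poly_eval R A \<phi> a f = \<zero>\<^bsub>A\<^esub>)"

definition trdeg ::
  "(nat multiset \<times> nat multiset) set \<Rightarrow> ('r, 'm) ring_scheme \<Rightarrow> ('a, 'n) ring_scheme \<Rightarrow>
     ('r \<Rightarrow> 'a) \<Rightarrow> ereal" where
  "trdeg r R A \<phi> =
     (if \<forall>x \<in> carrier A. alg_dependent r R A \<phi> 1 (\<lambda>_. x)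
      then (if carrier A = {\<zero>\<^bsub>A\<^esub>} then -1 else 0)
      else (SUP n \<in> {n. 0 < n \<and>
              (\<exists>a. (\<forall>i < n. a i \<in> carrier A) \<and> \<not> alg_dependent r R A \<phi> n a)}. ereal (real n)))"

abbreviation trdeg_self ::
  "(nat multiset \<times> nat multiset) set \<Rightarrow> ('a, 'n) ring_scheme \<Rightarrow> ereal" where
  "trdeg_self r A \<equiv> trdeg r A A (\<lambda>x. x)"

end

theory Submission
  imports Defs "HOL-Computational_Algebra.Polynomial"
begin

text \<open>Lower bound: a prime of height \<open>n\<close> contains \<open>n\<close> elements all of whose minimal primes have height at
  least \<open>n\<close>. If they satisfied a submonic relation, weights for which its trailing monomial is the unique one of least
  weight would turn it into \<open>n - 1\<close> elements with the same property, contradicting Krull's height theorem.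

  Upper bounds: elements without a submonic relation stay so modulo some prime. Over a field they are then
  algebraically independent, and each transcendental can be specialised in turn, giving a chain of primes. For a
  localization of an affine algebra, the transcendence degree of the residue ring drops by exactly one between adjacent
  primes, and counting monomials in a Noether normalization yields a relation whose coefficients are units or zero.
  In dimension at most one, counting monomials against lengths and the Nullstellensatz for Jacobson rings suffice.

  All of this takes place in a single type of rings: subrings are subsets of it, and a quotient by \<open>I\<close> is replaced by
  the ideals containing \<open>I\<close>. Every commutative ring given as a record is such a quotient.\<close>

section \<open>Ideals and primes relative to a subring\<close>

definition rsub :: "'a::comm_ring_1 set \<Rightarrow> bool" where
  "rsub R \<longleftrightarrow> 1 \<in> R \<and> (\<forall>x\<in>R. \<forall>y\<in>R. x - y \<in> R \<and> x * y \<in> R)"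

definition rmod :: "'a::comm_ring_1 set \<Rightarrow> 'a set \<Rightarrow> bool" where
  "rmod R M \<longleftrightarrow> 0 \<in> M \<and> (\<forall>x\<in>M. \<forall>y\<in>M. x + y \<in> M) \<and> (\<forall>c\<in>R. \<forall>x\<in>M. c * x \<in> M)"

definition rprime :: "'a::comm_ring_1 set \<Rightarrow> 'a set \<Rightarrow> bool" where
  "rprime C P \<longleftrightarrow> P \<subseteq> C \<and> rmod C P \<and> 1 \<notin> P \<and>
     (\<forall>x\<in>C. \<forall>y\<in>C. x * y \<in> P \<longrightarrow> x \<in> P \<or> y \<in> P)"

inductive_set rspan :: "'a::comm_ring_1 set \<Rightarrow> 'a set \<Rightarrow> 'a set" for R W where
  zero: "0 \<in> rspan R W"
| step: "x \<in> rspan R W \<Longrightarrow> c \<in> R \<Longrightarrow> w \<in> W \<Longrightarrow> x + c * w \<in> rspan R W"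

lemma rsub_UNIV [simp]: "rsub UNIV"
  by (simp add: rsub_def)

lemma rsub_1: "rsub R \<Longrightarrow> 1 \<in> R"
  and rsub_diff: "rsub R \<Longrightarrow> x \<in> R \<Longrightarrow> y \<in> R \<Longrightarrow> x - y \<in> R"
  and rsub_mult: "rsub R \<Longrightarrow> x \<in> R \<Longrightarrow> y \<in> R \<Longrightarrow> x * y \<in> R"
  by (auto simp: rsub_def)

lemma rsub_0: "rsub R \<Longrightarrow> 0 \<in> R"
  using rsub_diff[of R 1 1] by (simp add: rsub_1)

lemma rsub_minus: "rsub R \<Longrightarrow> x \<in> R \<Longrightarrow> - x \<in> R"
  using rsub_diff[of R 0 x] by (simp add: rsub_0)

lemma rsub_add: "rsub R \<Longrightarrow> x \<in> R \<Longrightarrow> y \<in> R \<Longrightarrow> x + y \<in> R"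
  using rsub_diff[of R x "- y"] by (simp add: rsub_minus)

lemma rsub_power: "rsub R \<Longrightarrow> x \<in> R \<Longrightarrow> x ^ n \<in> R"
  by (induction n) (auto simp: rsub_1 rsub_mult)

lemma rsub_sum: "rsub R \<Longrightarrow> (\<And>i. i \<in> F \<Longrightarrow> f i \<in> R) \<Longrightarrow> sum f F \<in> R"
  by (induction F rule: infinite_finite_induct) (auto simp: rsub_0 rsub_add)

lemma rsub_prod: "rsub R \<Longrightarrow> (\<And>i. i \<in> F \<Longrightarrow> f i \<in> R) \<Longrightarrow> prod f F \<in> R"
  by (induction F rule: infinite_finite_induct) (auto simp: rsub_1 rsub_mult)

lemmas rsub_intros = rsub_0 rsub_1 rsub_diff rsub_mult rsub_minus rsub_add rsub_power rsub_sum rsub_prod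

lemma rmod_0: "rmod R M \<Longrightarrow> 0 \<in> M"
  and rmod_add: "rmod R M \<Longrightarrow> x \<in> M \<Longrightarrow> y \<in> M \<Longrightarrow> x + y \<in> M"
  and rmod_mult: "rmod R M \<Longrightarrow> c \<in> R \<Longrightarrow> x \<in> M \<Longrightarrow> c * x \<in> M"
  by (auto simp: rmod_def)

lemma rmod_mult2: "rmod R M \<Longrightarrow> c \<in> R \<Longrightarrow> x \<in> M \<Longrightarrow> x * c \<in> M"
  by (metis mult.commute rmod_mult)

lemma rmod_minus: "rsub R \<Longrightarrow> rmod R M \<Longrightarrow> x \<in> M \<Longrightarrow> - x \<in> M"
  using rmod_mult[of R M "- 1" x] by (simp add: rsub_intros)

lemma rmod_diff: "rsub R \<Longrightarrow> rmod R M \<Longrightarrow> x \<in> M \<Longrightarrow> y \<in> M \<Longrightarrow> x - y \<in> M"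
  using rmod_add[of R M x "- y"] by (simp add: rmod_minus)

lemma rmod_sum: "rmod R M \<Longrightarrow> (\<And>i. i \<in> F \<Longrightarrow> f i \<in> M) \<Longrightarrow> sum f F \<in> M"
  by (induction F rule: infinite_finite_induct) (auto simp: rmod_0 rmod_add)

lemma rmod_mono: "rmod R M \<Longrightarrow> R' \<subseteq> R \<Longrightarrow> rmod R' M"
  by (auto simp: rmod_def)

lemma rmod_self: "rsub R \<Longrightarrow> rmod R R"
  by (auto simp: rmod_def rsub_intros)

lemma rmod_UNIV [simp]: "rmod R UNIV"
  by (simp add: rmod_def)

lemma rmod_Int: "rmod R M \<Longrightarrow> rmod R N \<Longrightarrow> rmod R (M \<inter> N)"
  by (auto simp: rmod_def)

lemma rmod_add_cancel: "rsub R \<Longrightarrow> rmod R M \<Longrightarrow> y \<in> M \<Longrightarrow> x + y \<in> M \<longleftrightarrow> x \<in> M"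
  using rmod_diff[of R M "x + y" y] rmod_add[of R M x y] by auto

lemma rmod_diff_cancel: "rsub R \<Longrightarrow> rmod R M \<Longrightarrow> x - y \<in> M \<Longrightarrow> x \<in> M \<longleftrightarrow> y \<in> M"
  using rmod_add[of R M "x - y" y] rmod_diff[of R M x "x - y"] by auto

lemma rmod_eq_UNIV: "rmod UNIV M \<Longrightarrow> 1 \<in> M \<Longrightarrow> M = UNIV"
  using rmod_mult[of UNIV M _ 1] by auto

lemma rprime_rmod: "rprime C P \<Longrightarrow> rmod C P"
  and rprime_sub: "rprime C P \<Longrightarrow> P \<subseteq> C"
  and rprime_1: "rprime C P \<Longrightarrow> 1 \<notin> P"
  and rprime_mult: "rprime C P \<Longrightarrow> x * y \<in> P \<Longrightarrow> x \<in> C \<Longrightarrow> y \<in> C \<Longrightarrow> x \<in> P \<or> y \<in> P"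
  by (auto simp: rprime_def)

lemma rprime_power:
  "rprime C P \<Longrightarrow> rsub C \<Longrightarrow> x \<in> C \<Longrightarrow> x ^ n \<in> P \<Longrightarrow> x \<in> P"
  by (induction n) (auto simp: rprime_1 rsub_power dest: rprime_mult)

lemma rprime_Int:
  assumes "rprime C Q" "rsub C" "rsub B" "B \<subseteq> C"
  shows "rprime B (Q \<inter> B)"
proof -
  have "rmod B (Q \<inter> B)"
    using rmod_Int[OF rmod_mono[OF rprime_rmod[OF assms(1)] assms(4)] rmod_self[OF assms(3)]] .
  then show ?thesis using assms(1,4) unfolding rprime_def by blast
qed

lemma rspan_base: "rsub R \<Longrightarrow> w \<in> W \<Longrightarrow> w \<in> rspan R W"
  using rspan.step[OF rspan.zero, of 1 R w W] by (simp add: rsub_1)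

lemma rspan_add:
  assumes "x \<in> rspan R W" "y \<in> rspan R W"
  shows "x + y \<in> rspan R W"
  using assms(2)
proof (induction rule: rspan.induct)
  case (step y c w)
  from rspan.step[OF step.IH step.hyps(2,3)] show ?case
    by (simp add: add.assoc)
qed (simp add: assms)

lemma rspan_scale:
  assumes "rsub R" "y \<in> rspan R W" "c \<in> R"
  shows "c * y \<in> rspan R W"
  using assms(2)
proof (induction rule: rspan.induct)
  case (step y d w)
  then show ?case
    using assms(1,3) rspan.step[of "c * y" R W "c * d" w]
    by (simp add: algebra_simps rsub_mult)
qed (simp add: rspan.zero)

lemma rspan_rmod: "rsub R \<Longrightarrow> rmod R (rspan R W)"
  by (auto simp: rmod_def rspan.zero rspan_add rspan_scale)

lemma rspan_least: "rmod R M \<Longrightarrow> W \<subseteq> M \<Longrightarrow> rspan R W \<subseteq> M"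
proof
  fix x assume "rmod R M" "W \<subseteq> M" "x \<in> rspan R W"
  from this(3,1,2) show "x \<in> M"
    by (induction rule: rspan.induct) (auto simp: rmod_def)
qed

lemma rspan_mono: "W \<subseteq> W' \<Longrightarrow> R \<subseteq> R' \<Longrightarrow> rspan R W \<subseteq> rspan R' W'"
proof
  fix x assume "W \<subseteq> W'" "R \<subseteq> R'" "x \<in> rspan R W"
  from this(3,1,2) show "x \<in> rspan R' W'"
    by (induction rule: rspan.induct) (auto intro: rspan.intros)
qed

lemma rspan_insert_iff:
  assumes "rsub R" "rmod R I"
  shows "x \<in> rspan R (insert u I) \<longleftrightarrow> (\<exists>i\<in>I. \<exists>t\<in>R. x = i + t * u)"
proof
  assume "x \<in> rspan R (insert u I)"
  then show "\<exists>i\<in>I. \<exists>t\<in>R. x = i + t * u"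
  proof (induction rule: rspan.induct)
    case zero
    show ?case using assms by (auto intro!: bexI[of _ 0] simp: rmod_0 rsub_0)
  next
    case (step x c w)
    then obtain i t where x: "i \<in> I" "t \<in> R" "x = i + t * u" by auto
    show ?case
    proof (cases "w = u")
      case True
      have "x + c * w = i + (t + c) * u" using x True by (simp add: algebra_simps)
      moreover have "t + c \<in> R" using x step assms by (simp add: rsub_add)
      ultimately show ?thesis using x by blast
    next
      case False
      then have "i + c * w \<in> I" using x step assms by (auto simp: rmod_add rmod_mult)
      moreover have "x + c * w = (i + c * w) + t * u" using x by (simp add: algebra_simps)
      ultimately show ?thesis using x by blast
    qed
  qed
next
  assume "\<exists>i\<in>I. \<exists>t\<in>R. x = i + t * u"
  then obtain i t where "i \<in> I" "t \<in> R" "x = i + t * u" by auto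
  then show "x \<in> rspan R (insert u I)"
    using assms by (auto intro: rspan.step rspan_base)
qed

lemma rspan_Un_iff:
  assumes "rsub R" "rmod R I"
  shows "x \<in> rspan R (I \<union> W) \<longleftrightarrow> (\<exists>i\<in>I. \<exists>y\<in>rspan R W. x = i + y)"
proof
  assume "x \<in> rspan R (I \<union> W)"
  then show "\<exists>i\<in>I. \<exists>y\<in>rspan R W. x = i + y"
  proof (induction rule: rspan.induct)
    case zero
    show ?case using assms by (auto intro!: bexI[of _ 0] simp: rmod_0 rspan.zero)
  next
    case (step x c w)
    then obtain i y where x: "i \<in> I" "y \<in> rspan R W" "x = i + y" by auto
    show ?case
    proof (cases "w \<in> W")
      case True
      then show ?thesis using x rspan.step[OF x(2) step.hyps(2) True]
        by (intro bexI[of _ i] bexI[of _ "y + c * w"]) (simp_all add: algebra_simps)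
    next
      case False
      then have "i + c * w \<in> I" using x step assms by (auto simp: rmod_add rmod_mult)
      then show ?thesis using x
        by (intro bexI[of _ "i + c * w"] bexI[of _ y]) (simp_all add: algebra_simps)
    qed
  qed
next
  assume "\<exists>i\<in>I. \<exists>y\<in>rspan R W. x = i + y"
  then obtain i y where "i \<in> I" "y \<in> rspan R W" "x = i + y" by auto
  moreover from this have "y \<in> rspan R (I \<union> W)" using rspan_mono[of W "I \<union> W" R R] by auto
  ultimately show "x \<in> rspan R (I \<union> W)"
    using assms by (auto intro: rspan_add rspan_base)
qed

lemma rspan_mult:
  assumes "rsub R" "x \<in> rspan R V" "y \<in> rspan R W"
    "\<And>v w. v \<in> V \<Longrightarrow> w \<in> W \<Longrightarrow> v * w \<in> M" "rmod R M"
  shows "x * y \<in> M"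
proof -
  have *: "v * y \<in> M" if "v \<in> V" for v
    using assms(3)
  proof (induction rule: rspan.induct)
    case (step y c w)
    have "v * (y + c * w) = v * y + c * (v * w)" by (simp add: algebra_simps)
    then show ?case using step assms(4)[OF that step.hyps(3)]
      by (simp add: rmod_add[OF assms(5)] rmod_mult[OF assms(5)])
  qed (simp add: rmod_0[OF assms(5)])
  show ?thesis
    using assms(2)
  proof (induction rule: rspan.induct)
    case (step x c v)
    have "(x + c * v) * y = x * y + c * (v * y)" by (simp add: algebra_simps)
    then show ?case using step.IH *[OF step.hyps(3)] step.hyps(2)
      by (simp add: rmod_add[OF assms(5)] rmod_mult[OF assms(5)])
  qed (simp add: rmod_0[OF assms(5)])
qed

lemma rmod_Union_chain:
  assumes "\<C> \<noteq> {}" "\<And>J. J \<in> \<C> \<Longrightarrow> rmod C J" "subset.chain \<A> \<C>"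
  shows "rmod C (\<Union>\<C>)"
  unfolding rmod_def
proof (intro conjI ballI)
  show "0 \<in> \<Union>\<C>" using assms(1,2) rmod_0 by blast
next
  fix x y assume "x \<in> \<Union>\<C>" "y \<in> \<Union>\<C>"
  then obtain J K where JK: "J \<in> \<C>" "K \<in> \<C>" "x \<in> J" "y \<in> K" by blast
  then have "J \<subseteq> K \<or> K \<subseteq> J" using assms(3) unfolding subset_chain_def by blast
  then show "x + y \<in> \<Union>\<C>"
    using JK assms(2) rmod_add by (metis UnionI subsetD)
next
  fix c x assume "c \<in> C" "x \<in> \<Union>\<C>"
  then show "c * x \<in> \<Union>\<C>" using assms(2) rmod_mult by blast
qed

lemma exists_prime_avoiding:
  assumes C: "rsub C" and I: "rmod C I" "I \<subseteq> C"
    and S: "S \<subseteq> C" "1 \<in> S" "\<And>x y. x \<in> S \<Longrightarrow> y \<in> S \<Longrightarrow> x * y \<in> S" "I \<inter> S = {}"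
  obtains P where "rprime C P" "I \<subseteq> P" "P \<inter> S = {}"
proof -
  define \<A> where "\<A> = {J. rmod C J \<and> J \<subseteq> C \<and> I \<subseteq> J \<and> J \<inter> S = {}}"
  have "\<exists>M\<in>\<A>. \<forall>Y\<in>\<A>. M \<subseteq> Y \<longrightarrow> Y = M"
  proof (rule subset_Zorn_nonempty)
    show "\<A> \<noteq> {}" using assms by (auto simp: \<A>_def)
    fix \<C> assume "\<C> \<noteq> {}" "subset.chain \<A> \<C>"
    moreover from this have "\<C> \<subseteq> \<A>" by (simp add: subset_chain_def)
    ultimately show "\<Union>\<C> \<in> \<A>" using rmod_Union_chain[of \<C> C \<A>] by (fastforce simp: \<A>_def)
  qed
  then obtain M where M: "M \<in> \<A>" and max: "\<And>Y. Y \<in> \<A> \<Longrightarrow> M \<subseteq> Y \<Longrightarrow> Y = M" by auto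
  have MC: "rmod C M" "M \<subseteq> C" "I \<subseteq> M" "M \<inter> S = {}" using M by (auto simp: \<A>_def)
  have meet: "\<exists>m\<in>M. \<exists>t\<in>C. m + t * x \<in> S" if x: "x \<in> C" "x \<notin> M" for x
  proof -
    let ?X = "rspan C (insert x M)"
    have 1: "insert x M \<subseteq> ?X" using rspan_base[OF C] by blast
    have 2: "?X \<subseteq> C" using rspan_least[OF rmod_self[OF C]] x MC by simp
    have "?X \<notin> \<A>" using max[of ?X] 1 x by auto
    then have "?X \<inter> S \<noteq> {}" using 1 2 MC rspan_rmod[OF C] by (auto simp: \<A>_def)
    then show ?thesis using rspan_insert_iff[OF C MC(1)] by auto
  qed
  have "x \<in> M \<or> y \<in> M" if xy: "x \<in> C" "y \<in> C" "x * y \<in> M" for x y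
  proof (rule ccontr)
    assume "\<not> ?thesis"
    then obtain m t m' t' where *: "m \<in> M" "t \<in> C" "m + t * x \<in> S" "m' \<in> M" "t' \<in> C" "m' + t' * y \<in> S"
      using meet xy by blast
    have "(m + t * x) * (m' + t' * y) = (m' + t' * y) * m + (t * x) * m' + (t * t') * (x * y)"
      by (simp add: algebra_simps)
    also have "\<dots> \<in> M" using * xy MC C S(1)
      by (intro rmod_add[OF MC(1)]) (auto intro!: rmod_mult[OF MC(1)] rsub_mult[OF C] simp del: mult.assoc)
    finally show False using S(3)[OF *(3,6)] MC by auto
  qed
  then have "rprime C M" using MC S(2) by (auto simp: rprime_def)
  then show thesis using that MC by blast
qed

lemma exists_prime_over_complement:
  assumes C: "rsub C" and I: "rmod C I" "I \<subseteq> C" and B: "rsub B" "B \<subseteq> C" and P: "rprime B' P" "B \<subseteq> B'" and disj: "I \<inter> (B - P) = {}"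
  obtains Q where "rprime C Q" "I \<subseteq> Q" "Q \<inter> (B - P) = {}"
proof (rule exists_prime_avoiding[OF C I _ _ _ disj])
  show "1 \<in> B - P" using rsub_1[OF B(1)] rprime_1[OF P(1)] by auto
  show "x * y \<in> B - P" if "x \<in> B - P" "y \<in> B - P" for x y
    using that rsub_mult[OF B(1), of x y] rprime_mult[OF P(1), of x y] P(2) by blast
qed (use B(2) in auto)

definition minimal_over :: "'a::comm_ring_1 set \<Rightarrow> 'a set \<Rightarrow> bool" where
  "minimal_over J P \<longleftrightarrow> rprime UNIV P \<and> J \<subseteq> P \<and> (\<forall>Q. rprime UNIV Q \<and> J \<subseteq> Q \<and> Q \<subseteq> P \<longrightarrow> Q = P)"

lemma minimal_over_power:
  assumes "minimal_over J P" "rmod UNIV J" "u \<in> P"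
  obtains y m where "y \<notin> P" "y * u ^ m \<in> J"
proof (rule ccontr)
  assume "\<not> thesis"
  then have none: "y * u ^ m \<notin> J" if "y \<notin> P" for y m using that \<open>\<not> thesis\<close> \<open>\<And>y m. \<lbrakk>y \<notin> P; y * u ^ m \<in> J\<rbrakk> \<Longrightarrow> thesis\<close> by blast
  have P: "rprime UNIV P" "J \<subseteq> P" using assms by (auto simp: minimal_over_def)
  define S where "S = {y * u ^ m | y m. y \<notin> P}"
  have *: "y * u ^ m \<in> S" if "y \<notin> P" for y m using that by (auto simp: S_def)
  have "1 \<in> S" using *[of 1 0] rprime_1[OF P(1)] by simp
  moreover have "x * y \<in> S" if xy: "x \<in> S" "y \<in> S" for x y
  proof -
    obtain a m b k where ab: "x = a * u ^ m" "y = b * u ^ k" "a \<notin> P" "b \<notin> P"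
      using xy by (auto simp: S_def)
    then have "x * y = (a * b) * u ^ (m + k)" "a * b \<notin> P"
      using rprime_mult[OF P(1)] by (auto simp: power_add algebra_simps)
    then show ?thesis unfolding S_def by blast
  qed
  moreover have "J \<inter> S = {}" using none by (auto simp: S_def)
  ultimately obtain Q where Q: "rprime UNIV Q" "J \<subseteq> Q" "Q \<inter> S = {}"
    using exists_prime_avoiding[of UNIV J S] assms(2) by (metis rsub_UNIV subset_UNIV)
  have "Q \<subseteq> P"
  proof
    fix y assume "y \<in> Q"
    then have "y \<notin> S" using Q by auto
    then show "y \<in> P" using *[of y 0] by auto
  qed
  then have "Q = P" using assms(1) Q by (auto simp: minimal_over_def)
  moreover have "u \<in> S" using *[of 1 1] rprime_1[OF P(1)] by simp
  ultimately show False using Q assms(3) by auto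
qed

definition noeth :: "'a::comm_ring_1 set \<Rightarrow> 'a set \<Rightarrow> bool" where
  "noeth C I \<longleftrightarrow> (\<forall>J :: nat \<Rightarrow> 'a set.
     (\<forall>i. rmod C (J i) \<and> J i \<subseteq> C \<and> I \<subseteq> J i \<and> J i \<subseteq> J (Suc i)) \<longrightarrow> (\<exists>n. \<forall>m\<ge>n. J m = J n))"

lemma noeth_maximal:
  assumes "noeth C I" "\<J> \<noteq> {}" "\<And>J. J \<in> \<J> \<Longrightarrow> rmod C J \<and> J \<subseteq> C \<and> I \<subseteq> J"
  obtains M where "M \<in> \<J>" "\<And>J. J \<in> \<J> \<Longrightarrow> M \<subseteq> J \<Longrightarrow> J = M"
proof (rule ccontr)
  assume "\<not> thesis"
  then have "\<exists>J. J \<in> \<J> \<and> M \<subset> J" if "M \<in> \<J>" for M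
    using that \<open>\<And>M. \<lbrakk>M \<in> \<J>; \<And>J. \<lbrakk>J \<in> \<J>; M \<subseteq> J\<rbrakk> \<Longrightarrow> J = M\<rbrakk> \<Longrightarrow> thesis\<close> by blast
  then have "\<exists>f :: nat \<Rightarrow> 'a set. \<forall>n. f n \<in> \<J> \<and> f n \<subset> f (Suc n)"
    using assms(2) by (intro dependent_nat_choice) auto
  then obtain f :: "nat \<Rightarrow> 'a set" where "\<forall>n. f n \<in> \<J> \<and> f n \<subset> f (Suc n)" ..
  then have f: "f n \<in> \<J>" "f n \<subset> f (Suc n)" for n by simp_all
  then have "\<forall>i. rmod C (f i) \<and> f i \<subseteq> C \<and> I \<subseteq> f i \<and> f i \<subseteq> f (Suc i)"
    using assms(3) by blast
  then obtain n where "\<forall>m\<ge>n. f m = f n" using assms(1) unfolding noeth_def by blast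
  then have "f (Suc n) = f n" using le_SucI[of n n] by blast
  with f(2)[of n] show False by simp
qed

lemma noeth_mono:
  assumes "noeth C I" "I \<subseteq> I'"
  shows "noeth C I'"
  unfolding noeth_def
proof (intro allI impI)
  fix J :: "nat \<Rightarrow> 'a set"
  assume J: "\<forall>i. rmod C (J i) \<and> J i \<subseteq> C \<and> I' \<subseteq> J i \<and> J i \<subseteq> J (Suc i)"
  have "\<forall>i. rmod C (J i) \<and> J i \<subseteq> C \<and> I \<subseteq> J i \<and> J i \<subseteq> J (Suc i)"
  proof
    fix i show "rmod C (J i) \<and> J i \<subseteq> C \<and> I \<subseteq> J i \<and> J i \<subseteq> J (Suc i)"
      using J[THEN spec, of i] assms(2) by fast
  qed
  then show "\<exists>n. \<forall>m\<ge>n. J m = J n" using assms(1) unfolding noeth_def by simp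
qed

definition colon :: "'a::comm_ring_1 set \<Rightarrow> 'a \<Rightarrow> 'a set" where
  "colon I u = {x. x * u \<in> I}"

lemma colon_rmod: "rmod R I \<Longrightarrow> rmod R (colon I u)"
  by (auto simp: rmod_def colon_def algebra_simps)

lemma noeth_ideal_induct [consumes 3, case_names unit prime split]:
  assumes "noeth UNIV I0" "rmod UNIV I" "I0 \<subseteq> I"
    and "Q UNIV"
    and "\<And>P. rprime UNIV P \<Longrightarrow> I \<subseteq> P \<Longrightarrow> Q P"
    and split: "\<And>J u v. rmod UNIV J \<Longrightarrow> I \<subseteq> J \<Longrightarrow> u * v \<in> J \<Longrightarrow> u \<notin> J \<Longrightarrow> v \<notin> J \<Longrightarrow>
        (\<And>K. rmod UNIV K \<Longrightarrow> J \<subset> K \<Longrightarrow> Q K) \<Longrightarrow> Q J"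
  shows "Q I"
proof (rule ccontr)
  assume "\<not> Q I"
  define \<J> where "\<J> = {J. rmod UNIV J \<and> I \<subseteq> J \<and> \<not> Q J}"
  have ne: "\<J> \<noteq> {}" using \<open>\<not> Q I\<close> assms(2) by (auto simp: \<J>_def)
  have J: "rmod UNIV J \<and> J \<subseteq> UNIV \<and> I \<subseteq> J" if "J \<in> \<J>" for J using that by (auto simp: \<J>_def)
  obtain M where M: "M \<in> \<J>" "\<And>J. J \<in> \<J> \<Longrightarrow> M \<subseteq> J \<Longrightarrow> J = M"
    using noeth_maximal[OF noeth_mono[OF assms(1,3)] ne J] by metis
  have M': "rmod UNIV M" "I \<subseteq> M" "\<not> Q M" using M(1) by (auto simp: \<J>_def)
  have up: "Q K" if "rmod UNIV K" "M \<subset> K" for K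
    using M(2)[of K] that M'(2) by (auto simp: \<J>_def)
  have "1 \<notin> M" using M' assms(4) rmod_eq_UNIV by metis
  moreover have "\<not> rprime UNIV M" using M' assms(5) by blast
  ultimately obtain u v where "u * v \<in> M" "u \<notin> M" "v \<notin> M" using M'(1) by (auto simp: rprime_def)
  then show False using split[of M u v] M' up by blast
qed

section \<open>Finite length and the principal ideal theorem\<close>

definition mulset :: "'a::comm_ring_1 set \<Rightarrow> bool" where
  "mulset S \<longleftrightarrow> 1 \<in> S \<and> (\<forall>x\<in>S. \<forall>y\<in>S. x * y \<in> S)"

text \<open>The \<open>S\<close>-saturated submodules stand for the submodules of the localization at \<open>S\<close>.\<close>

definition rsat :: "'a::comm_ring_1 set \<Rightarrow> 'a set \<Rightarrow> 'a set \<Rightarrow> bool" where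
  "rsat R S L \<longleftrightarrow> rmod R L \<and> (\<forall>s\<in>S. \<forall>u. s * u \<in> L \<longrightarrow> u \<in> L)"

definition satcl :: "'a::comm_ring_1 set \<Rightarrow> 'a set \<Rightarrow> 'a set" where
  "satcl S M = {u. \<exists>s\<in>S. s * u \<in> M}"

definition lenb :: "'a::comm_ring_1 set \<Rightarrow> 'a set \<Rightarrow> 'a set \<Rightarrow> 'a set \<Rightarrow> nat \<Rightarrow> bool" where
  "lenb R S I J n \<longleftrightarrow> (\<forall>\<C>. finite \<C> \<and> (\<forall>L\<in>\<C>. rsat R S L \<and> I \<subseteq> L \<and> L \<subseteq> J) \<and>
     (\<forall>L\<in>\<C>. \<forall>L'\<in>\<C>. L \<subseteq> L' \<or> L' \<subseteq> L) \<longrightarrow> card \<C> \<le> Suc n)"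

lemma mulset_compl: "rprime UNIV P \<Longrightarrow> mulset (- P)"
  by (auto simp: mulset_def rprime_def)

lemma mulset_1 [simp]: "mulset {1}"
  by (simp add: mulset_def)

lemma satcl_sub: "mulset S \<Longrightarrow> M \<subseteq> satcl S M"
  by (force simp: satcl_def mulset_def)

lemma satcl_1 [simp]: "satcl {1} M = M"
  by (simp add: satcl_def)

lemma rsat_rmod: "rsat R S L \<Longrightarrow> rmod R L"
  by (simp add: rsat_def)

lemma rsat_Int: "rsat R S L \<Longrightarrow> rsat R S M \<Longrightarrow> rsat R S (L \<inter> M)"
  by (auto simp: rsat_def rmod_Int)

lemma rsat_UNIV [simp]: "rsat R S UNIV"
  by (simp add: rsat_def)

lemma rsat_satcl:
  assumes "rmod R M" "mulset S" "S \<subseteq> R"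
  shows "rsat R S (satcl S M)"
  unfolding rsat_def rmod_def
proof (intro conjI ballI allI impI)
  show "0 \<in> satcl S M" using assms by (auto simp: satcl_def mulset_def rmod_0)
next
  fix x y assume "x \<in> satcl S M" "y \<in> satcl S M"
  then obtain s t where st: "s \<in> S" "t \<in> S" "s * x \<in> M" "t * y \<in> M" by (auto simp: satcl_def)
  then have "t * (s * x) + s * (t * y) \<in> M"
    using assms(3) rmod_mult[OF assms(1), of t] rmod_mult[OF assms(1), of s]
    by (intro rmod_add[OF assms(1)]) auto
  then have "(s * t) * (x + y) \<in> M" by (simp add: algebra_simps)
  moreover have "s * t \<in> S" using st assms(2) by (simp add: mulset_def)
  ultimately show "x + y \<in> satcl S M" by (auto simp: satcl_def)
next
  fix c x assume "c \<in> R" "x \<in> satcl S M"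
  then obtain s where "s \<in> S" "s * x \<in> M" by (auto simp: satcl_def)
  then show "c * x \<in> satcl S M"
    using rmod_mult[OF assms(1) \<open>c \<in> R\<close>, of "s * x"]
    by (auto simp: satcl_def mult.left_commute)
next
  fix s u assume "s \<in> S" "s * u \<in> satcl S M"
  then obtain t where t: "t \<in> S" "t * (s * u) \<in> M" by (auto simp: satcl_def)
  then have "(t * s) * u \<in> M" by (simp add: mult.assoc)
  moreover have "t * s \<in> S" using t \<open>s \<in> S\<close> assms(2) by (simp add: mulset_def)
  ultimately show "u \<in> satcl S M" by (auto simp: satcl_def)
qed

lemma satcl_least: "rsat R S L \<Longrightarrow> M \<subseteq> L \<Longrightarrow> satcl S M \<subseteq> L"
  by (auto simp: rsat_def satcl_def)

lemma satcl_mono: "M \<subseteq> M' \<Longrightarrow> satcl S M \<subseteq> satcl S M'"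
  by (auto simp: satcl_def)

lemma card_chain_of_pairs:
  fixes Z :: "('a set \<times> 'b set) set"
  assumes "finite Z" "Z \<noteq> {}"
    and chain: "\<And>p q. p \<in> Z \<Longrightarrow> q \<in> Z \<Longrightarrow>
      (fst p \<subseteq> fst q \<and> snd p \<subseteq> snd q) \<or> (fst q \<subseteq> fst p \<and> snd q \<subseteq> snd p)"
  shows "card Z + 1 \<le> card (fst ` Z) + card (snd ` Z)"
proof -
  define A B where "A = fst ` Z" and "B = snd ` Z"
  have fin: "finite A" "finite B" using assms(1) by (auto simp: A_def B_def)
  define f where "f p = card {x\<in>A. x \<subseteq> fst p} + card {y\<in>B. y \<subseteq> snd p}" for p
  have mono: "f p < f q" if pq: "p \<in> Z" "q \<in> Z" "p \<noteq> q" "fst p \<subseteq> fst q" "snd p \<subseteq> snd q" for p q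
  proof -
    have le: "card {x\<in>A. x \<subseteq> fst p} \<le> card {x\<in>A. x \<subseteq> fst q}"
      "card {y\<in>B. y \<subseteq> snd p} \<le> card {y\<in>B. y \<subseteq> snd q}"
      using fin pq by (auto intro!: card_mono)
    consider "fst p \<noteq> fst q" | "snd p \<noteq> snd q" using pq(3) by (auto simp: prod_eq_iff)
    then show ?thesis
    proof cases
      case 1
      then have "{x\<in>A. x \<subseteq> fst p} \<subset> {x\<in>A. x \<subseteq> fst q}" using pq by (auto simp: A_def)
      then have "card {x\<in>A. x \<subseteq> fst p} < card {x\<in>A. x \<subseteq> fst q}"
        using fin by (intro psubset_card_mono) auto
      then show ?thesis using le by (simp add: f_def)
    next
      case 2
      then have "{x\<in>B. x \<subseteq> snd p} \<subset> {x\<in>B. x \<subseteq> snd q}" using pq by (auto simp: B_def)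
      then have "card {x\<in>B. x \<subseteq> snd p} < card {x\<in>B. x \<subseteq> snd q}"
        using fin by (intro psubset_card_mono) auto
      then show ?thesis using le by (simp add: f_def)
    qed
  qed
  have "inj_on f Z"
  proof (rule inj_onI, rule ccontr)
    fix p q assume "p \<in> Z" "q \<in> Z" "f p = f q" "p \<noteq> q"
    then show False using chain[of p q] mono[of p q] mono[of q p] by auto
  qed
  moreover have "f ` Z \<subseteq> {2..card A + card B}"
  proof
    fix k assume "k \<in> f ` Z"
    then obtain p where p: "p \<in> Z" "k = f p" by auto
    have "card {x\<in>A. x \<subseteq> fst p} > 0" "card {y\<in>B. y \<subseteq> snd p} > 0"
      using fin p by (auto simp: card_gt_0_iff A_def B_def)
    moreover have "card {x\<in>A. x \<subseteq> fst p} \<le> card A" "card {y\<in>B. y \<subseteq> snd p} \<le> card B"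
      using fin by (auto intro!: card_mono)
    ultimately show "k \<in> {2..card A + card B}" by (simp add: p f_def)
  qed
  ultimately have "card Z \<le> card {2..card A + card B}"
    by (metis card_image card_mono finite_atLeastAtMost)
  moreover have "card Z > 0" using assms by (simp add: card_gt_0_iff)
  ultimately show ?thesis by (simp add: A_def B_def)
qed

lemma lenb_self: "lenb R S I I n"
  unfolding lenb_def
proof (intro allI impI)
  fix \<C> :: "'a set set"
  assume "finite \<C> \<and> (\<forall>L\<in>\<C>. rsat R S L \<and> I \<subseteq> L \<and> L \<subseteq> I) \<and> (\<forall>L\<in>\<C>. \<forall>L'\<in>\<C>. L \<subseteq> L' \<or> L' \<subseteq> L)"
  then have "\<C> \<subseteq> {I}" by auto
  then have "card \<C> \<le> card {I}" by (intro card_mono) auto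
  then show "card \<C> \<le> Suc n" by simp
qed

lemma lenb_mono: "lenb R S I J n \<Longrightarrow> I \<subseteq> I' \<Longrightarrow> J' \<subseteq> J \<Longrightarrow> n \<le> n' \<Longrightarrow> lenb R S I' J' n'"
  unfolding lenb_def by (metis (no_types, lifting) Suc_le_mono order_trans)

lemma lenb_le1:
  assumes "\<And>L. rsat R S L \<Longrightarrow> I \<subseteq> L \<Longrightarrow> L \<subseteq> J \<Longrightarrow> L = I \<or> L = J"
  shows "lenb R S I J 1"
  unfolding lenb_def
proof (intro allI impI)
  fix \<C> :: "'a set set"
  assume "finite \<C> \<and> (\<forall>L\<in>\<C>. rsat R S L \<and> I \<subseteq> L \<and> L \<subseteq> J) \<and> (\<forall>L\<in>\<C>. \<forall>L'\<in>\<C>. L \<subseteq> L' \<or> L' \<subseteq> L)"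
  then have "\<C> \<subseteq> {I, J}" using assms by blast
  then have "card \<C> \<le> card {I, J}" by (intro card_mono) auto
  also have "\<dots> \<le> Suc 1" by (simp add: card_insert_if)
  finally show "card \<C> \<le> Suc 1" .
qed

lemma lenb_trans:
  assumes "lenb R S I J n" "lenb R S J K m" "rsat R S J" "rsat R S K" "I \<subseteq> J" "J \<subseteq> K"
    and R: "rsub R" and S: "mulset S" "S \<subseteq> R"
  shows "lenb R S I K (n + m)"
  unfolding lenb_def
proof (intro allI impI)
  fix \<C> :: "'a set set"
  assume C: "finite \<C> \<and> (\<forall>L\<in>\<C>. rsat R S L \<and> I \<subseteq> L \<and> L \<subseteq> K) \<and> (\<forall>L\<in>\<C>. \<forall>L'\<in>\<C>. L \<subseteq> L' \<or> L' \<subseteq> L)"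
  show "card \<C> \<le> Suc (n + m)"
  proof (cases "\<C> = {}")
    case False
    define g where "g L = (L \<inter> J, satcl S (rspan R (L \<union> J)))" for L
    have inj: "inj_on g \<C>"
    proof (rule inj_onI)
      have *: "L' \<subseteq> L" if L: "L \<in> \<C>" "L' \<in> \<C>" "g L = g L'" "L \<subseteq> L'" for L L'
      proof
        fix u assume "u \<in> L'"
        have LL: "rmod R L" "rmod R L'" "rsat R S L" using L C by (auto simp: rsat_def)
        have "u \<in> rspan R (L' \<union> J)" using \<open>u \<in> L'\<close> rspan_base[OF R] by auto
        then have "u \<in> satcl S (rspan R (L \<union> J))"
          using L(3) satcl_sub[OF S(1)] by (auto simp: g_def)
        then obtain s where s: "s \<in> S" "s * u \<in> rspan R (L \<union> J)" by (auto simp: satcl_def)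
        have "rspan R J = J"
          using rspan_least[OF rsat_rmod[OF assms(3)], of J] rspan_base[OF R, of _ J] by auto
        then obtain l j where lj: "l \<in> L" "j \<in> J" "s * u = l + j"
          using s(2) rspan_Un_iff[OF R LL(1), of "s * u" J] by auto
        have "j = s * u - l" using lj by simp
        moreover have "s * u \<in> L'" using s(1) S \<open>u \<in> L'\<close> by (intro rmod_mult[OF LL(2)]) auto
        ultimately have "j \<in> L'" using rmod_diff[OF R LL(2), of "s * u" l] lj L(4) by auto
        then have "j \<in> L" using lj(2) L(3) by (auto simp: g_def)
        then have "s * u \<in> L" using lj rmod_add[OF LL(1)] by simp
        then show "u \<in> L" using LL(3) s(1) by (simp add: rsat_def)
      qed
      fix L L' assume "L \<in> \<C>" "L' \<in> \<C>" "g L = g L'"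
      then show "L = L'" using *[of L L'] *[of L' L] C by (metis subset_antisym)
    qed
    have "card (g ` \<C>) + 1 \<le> card (fst ` g ` \<C>) + card (snd ` g ` \<C>)"
    proof (rule card_chain_of_pairs)
      fix p q assume "p \<in> g ` \<C>" "q \<in> g ` \<C>"
      then obtain L L' where "L \<in> \<C>" "L' \<in> \<C>" "p = g L" "q = g L'" by auto
      moreover from this have "L \<subseteq> L' \<or> L' \<subseteq> L" using C by blast
      moreover have "fst (g L) \<subseteq> fst (g L') \<and> snd (g L) \<subseteq> snd (g L')" if "L \<subseteq> L'" for L L'
        using that rspan_mono[of "L \<union> J" "L' \<union> J" R R] by (auto simp: g_def intro!: satcl_mono)
      ultimately show "(fst p \<subseteq> fst q \<and> snd p \<subseteq> snd q) \<or> (fst q \<subseteq> fst p \<and> snd q \<subseteq> snd p)"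
        by metis
    qed (use C False in auto)
    moreover have "card (fst ` g ` \<C>) \<le> Suc n"
    proof -
      have "\<forall>L\<in>fst ` g ` \<C>. rsat R S L \<and> I \<subseteq> L \<and> L \<subseteq> J"
        using C assms(3,5) by (auto simp: g_def rsat_Int)
      moreover have "\<forall>L\<in>fst ` g ` \<C>. \<forall>L'\<in>fst ` g ` \<C>. L \<subseteq> L' \<or> L' \<subseteq> L"
      proof (intro ballI)
        fix Z Y assume "Z \<in> fst ` g ` \<C>" "Y \<in> fst ` g ` \<C>"
        then obtain L L' where L: "L \<in> \<C>" "L' \<in> \<C>" "Z = L \<inter> J" "Y = L' \<inter> J" by (auto simp: g_def)
        then have "L \<subseteq> L' \<or> L' \<subseteq> L" using C by blast
        then show "Z \<subseteq> Y \<or> Y \<subseteq> Z" using L by auto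
      qed
      ultimately show ?thesis using assms(1) C unfolding lenb_def by auto
    qed
    moreover have "card (snd ` g ` \<C>) \<le> Suc m"
    proof -
      have "\<forall>Z\<in>snd ` g ` \<C>. rsat R S Z \<and> J \<subseteq> Z \<and> Z \<subseteq> K"
      proof
        fix Z assume "Z \<in> snd ` g ` \<C>"
        then obtain L where L: "L \<in> \<C>" "Z = satcl S (rspan R (L \<union> J))" by (auto simp: g_def)
        have "rsat R S Z" using L rsat_satcl[OF rspan_rmod[OF R] S] by auto
        moreover have "J \<subseteq> Z" using L satcl_sub[OF S(1)] rspan_base[OF R] by blast
        moreover have "Z \<subseteq> K"
          unfolding L(2) using C L(1) assms(6)
          by (intro satcl_least[OF assms(4)] rspan_least[OF rsat_rmod[OF assms(4)]]) auto
        ultimately show "rsat R S Z \<and> J \<subseteq> Z \<and> Z \<subseteq> K" by simp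
      qed
      moreover have "\<forall>L\<in>snd ` g ` \<C>. \<forall>L'\<in>snd ` g ` \<C>. L \<subseteq> L' \<or> L' \<subseteq> L"
      proof (intro ballI)
        fix Z Y assume "Z \<in> snd ` g ` \<C>" "Y \<in> snd ` g ` \<C>"
        then obtain L L' where L: "L \<in> \<C>" "L' \<in> \<C>" "Z = satcl S (rspan R (L \<union> J))"
          "Y = satcl S (rspan R (L' \<union> J))" by (auto simp: g_def)
        then have "L \<subseteq> L' \<or> L' \<subseteq> L" using C by blast
        then show "Z \<subseteq> Y \<or> Y \<subseteq> Z"
          using L rspan_mono[of "L \<union> J" "L' \<union> J" R R] rspan_mono[of "L' \<union> J" "L \<union> J" R R]
          by (metis Un_mono order_refl satcl_mono)
      qed
      ultimately show ?thesis using assms(2) C unfolding lenb_def by auto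
    qed
    ultimately show ?thesis using card_image[OF inj] by linarith
  qed simp
qed

lemma lenb_colon:
  assumes "lenb R S (colon I u) UNIV n" "rmod UNIV I" "rsub R" "mulset S" "S \<subseteq> R"
  shows "lenb R S I (satcl S (rspan UNIV (insert u I))) n"
  unfolding lenb_def
proof (intro allI impI)
  fix \<C> :: "'a set set"
  assume C: "finite \<C> \<and> (\<forall>L\<in>\<C>. rsat R S L \<and> I \<subseteq> L \<and> L \<subseteq> satcl S (rspan UNIV (insert u I))) \<and>
      (\<forall>L\<in>\<C>. \<forall>L'\<in>\<C>. L \<subseteq> L' \<or> L' \<subseteq> L)"
  define g where "g L = colon L u" for L
  have mono: "g L \<subseteq> g L'" if "L \<subseteq> L'" for L L' using that by (auto simp: g_def colon_def)
  have inj: "inj_on g \<C>"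
  proof (rule inj_onI)
    have *: "L' \<subseteq> L" if L: "L \<in> \<C>" "L' \<in> \<C>" "g L = g L'" "L \<subseteq> L'" for L L'
    proof
      fix x assume "x \<in> L'"
      have LL: "rmod R L" "rmod R L'" "rsat R S L" using L C by (auto simp: rsat_def)
      have "x \<in> satcl S (rspan UNIV (insert u I))" using \<open>x \<in> L'\<close> C L(2) by blast
      then obtain s i t where s: "s \<in> S" "i \<in> I" "s * x = i + t * u"
        using rspan_insert_iff[OF rsub_UNIV assms(2)] by (auto simp: satcl_def)
      have "i \<in> L" using C L(1) s by blast
      have "s * x \<in> L'" using s(1) assms(5) \<open>x \<in> L'\<close> by (intro rmod_mult[OF LL(2)]) auto
      then have "t * u \<in> L'"
        using s rmod_diff[OF assms(3) LL(2), of "s * x" i] \<open>i \<in> L\<close> L(4) by auto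
      then have "t \<in> g L" using L(3) by (simp add: g_def colon_def)
      then have "s * x \<in> L" using s(3) \<open>i \<in> L\<close> rmod_add[OF LL(1)] by (simp add: g_def colon_def)
      then show "x \<in> L" using LL(3) s(1) by (simp add: rsat_def)
    qed
    fix L L' assume "L \<in> \<C>" "L' \<in> \<C>" "g L = g L'"
    then show "L = L'" using *[of L L'] *[of L' L] C by (metis subset_antisym)
  qed
  have "\<forall>Z\<in>g ` \<C>. rsat R S Z \<and> colon I u \<subseteq> Z \<and> Z \<subseteq> UNIV"
  proof
    fix Z assume "Z \<in> g ` \<C>"
    then obtain L where L: "L \<in> \<C>" "Z = colon L u" by (auto simp: g_def)
    then have "rsat R S L" "I \<subseteq> L" using C by auto
    then show "rsat R S Z \<and> colon I u \<subseteq> Z \<and> Z \<subseteq> UNIV"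
      using L(2) colon_rmod[of R L u] by (auto simp: rsat_def colon_def mult.assoc)
  qed
  moreover have "\<forall>L\<in>g ` \<C>. \<forall>L'\<in>g ` \<C>. L \<subseteq> L' \<or> L' \<subseteq> L"
    using C mono by (metis imageE)
  ultimately have "card (g ` \<C>) \<le> Suc n" using assms(1) C unfolding lenb_def by auto
  then show "card \<C> \<le> Suc n" using card_image[OF inj] by simp
qed

lemma finite_length:
  assumes "noeth UNIV I" "rmod UNIV I" "rsub R" "mulset S" "S \<subseteq> R"
    and pr: "\<And>P. rprime UNIV P \<Longrightarrow> I \<subseteq> P \<Longrightarrow> P \<inter> S = {} \<Longrightarrow> \<exists>n. lenb R S P UNIV n"
  shows "\<exists>n. lenb R S I UNIV n"
  using assms(1,2) order_refl
proof (induction rule: noeth_ideal_induct)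
  case unit
  show ?case using lenb_self by blast
next
  case (prime P)
  show ?case
  proof (cases "P \<inter> S = {}")
    case False
    then obtain s where s: "s \<in> P" "s \<in> S" by auto
    have "lenb R S P UNIV 1"
    proof (rule lenb_le1)
      fix L assume L: "rsat R S L" "P \<subseteq> L"
      have "x \<in> L" for x
      proof -
        have "s * x \<in> P" using s rmod_mult2[OF rprime_rmod[OF prime(1)]] by simp
        then show ?thesis using L s by (auto simp: rsat_def)
      qed
      then show "L = P \<or> L = UNIV" by auto
    qed
    then show ?thesis ..
  qed (use pr prime in blast)
next
  case (split J u v)
  define K where "K = satcl S (rspan UNIV (insert u J))"
  have sub: "insert u J \<subseteq> K"
    unfolding K_def using satcl_sub[OF assms(4)] rspan_base[OF rsub_UNIV] by blast
  have K: "rsat UNIV S K" unfolding K_def by (rule rsat_satcl[OF rspan_rmod]) (auto simp: assms)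
  then have "\<exists>m. lenb R S K UNIV m" using split sub by (intro split(6)) (auto simp: rsat_def)
  moreover have "J \<subset> colon J u"
    using split(3-5) rmod_mult2[OF split(1)] by (auto simp: colon_def mult.commute[of v u])
  then have "\<exists>n. lenb R S (colon J u) UNIV n" using split colon_rmod[of UNIV J u] by blast
  ultimately obtain n m where nm: "lenb R S K UNIV m" "lenb R S J K n"
    using lenb_colon[OF _ split(1) assms(3-5)] unfolding K_def by blast
  have "rsat R S K" using K by (auto simp: rsat_def intro: rmod_mono)
  then have "lenb R S J UNIV (n + m)"
    using lenb_trans[OF nm(2,1)] sub assms by auto
  then show ?case ..
qed

lemma nakayama:
  assumes "noeth UNIV N" "rprime UNIV P" "rsat UNIV (- P) M" "rsat UNIV (- P) N" "N \<subseteq> M"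
    and M: "M \<subseteq> satcl (- P) (rspan UNIV (N \<union> {p * u | p u. p \<in> P \<and> u \<in> M}))"
  shows "M = N"
proof (rule ccontr)
  assume "M \<noteq> N"
  define \<J> where "\<J> = {L. rsat UNIV (- P) L \<and> N \<subseteq> L \<and> L \<subset> M}"
  have "\<J> \<noteq> {}" using assms \<open>M \<noteq> N\<close> by (auto simp: \<J>_def)
  moreover have "rmod UNIV L \<and> L \<subseteq> UNIV \<and> N \<subseteq> L" if "L \<in> \<J>" for L
    using that by (auto simp: \<J>_def rsat_def)
  ultimately obtain L where L: "L \<in> \<J>" and max: "\<And>J. J \<in> \<J> \<Longrightarrow> L \<subseteq> J \<Longrightarrow> J = L"
    using noeth_maximal[OF assms(1), of \<J>] by metis
  have L': "rsat UNIV (- P) L" "N \<subseteq> L" "L \<subset> M" using L by (auto simp: \<J>_def)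
  have Lm: "rmod UNIV L" using L'(1) by (simp add: rsat_def)
  have ms: "mulset (- P)" by (rule mulset_compl[OF assms(2)])
  have "p * u \<in> L" if pu: "p \<in> P" "u \<in> M" for p u
  proof (rule ccontr)
    assume "p * u \<notin> L"
    define J where "J = satcl (- P) (rspan UNIV (insert (p * u) L))"
    have sat: "rsat UNIV (- P) J"
      unfolding J_def by (rule rsat_satcl[OF rspan_rmod]) (auto simp: ms)
    have sub: "insert (p * u) L \<subseteq> J"
      unfolding J_def using satcl_sub[OF ms] rspan_base[OF rsub_UNIV] by blast
    have "J \<subseteq> M" unfolding J_def
      using pu L' rmod_mult[OF rsat_rmod[OF assms(3)]]
      by (intro satcl_least[OF assms(3)] rspan_least[OF rsat_rmod[OF assms(3)]]) auto
    have "J \<notin> \<J>" using max[of J] sub \<open>p * u \<notin> L\<close> by auto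
    then have "J = M" using sat sub \<open>J \<subseteq> M\<close> L' by (auto simp: \<J>_def)
    then obtain v where v: "v \<notin> P" "v * u \<in> rspan UNIV (insert (p * u) L)"
      using pu by (auto simp: J_def satcl_def)
    then obtain l t where lt: "l \<in> L" "v * u = l + t * (p * u)"
      using rspan_insert_iff[OF rsub_UNIV Lm] by auto
    then have "(v - t * p) * u \<in> L" by (simp add: algebra_simps)
    moreover have "v - t * p \<notin> P"
      using v(1) pu(1) rprime_rmod[OF assms(2)] rmod_mult[of UNIV P t p]
        rmod_add[of UNIV P "v - t * p" "t * p"] by auto
    ultimately have "u \<in> L" using L'(1) by (auto simp: rsat_def)
    then have "p * u \<in> L" using rmod_mult[OF Lm] by simp
    then show False using \<open>p * u \<notin> L\<close> by simp
  qed
  then have "rspan UNIV (N \<union> {p * u | p u. p \<in> P \<and> u \<in> M}) \<subseteq> L"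
    using L' by (intro rspan_least[OF Lm]) auto
  then have "M \<subseteq> L" using M satcl_least[OF L'(1)] by blast
  then show False using L' by auto
qed

text \<open>Krull's principal ideal theorem, by symbolic powers: \<open>D k\<close> is the \<open>k\<close>-th symbolic power of
  \<open>Q\<close> modulo \<open>Q0\<close>, and the chain \<open>D k + (x)\<close> has to stop because \<open>Q0 + (x)\<close> has finite length at
  \<open>P\<close>.\<close>

lemma principal_ideal_theorem:
  assumes "noeth UNIV Q0" "rprime UNIV Q0" "rprime UNIV Q" "Q0 \<subset> Q" "Q \<subset> P"
    and min: "minimal_over (insert x Q0) P"
  shows False
proof -
  have P: "rprime UNIV P" "Q0 \<subseteq> P" "x \<in> P" using min by (auto simp: minimal_over_def)
  note Pm = rprime_rmod[OF P(1)] and Qm = rprime_rmod[OF assms(3)] and Q0m = rprime_rmod[OF assms(2)]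
  note mP = mulset_compl[OF P(1)] and mQ = mulset_compl[OF assms(3)]
  have "x \<notin> Q" using min assms by (auto simp: minimal_over_def)
  define Z where "Z = rspan UNIV (insert x Q0)"
  have Zm: "rmod UNIV Z" and Zs: "insert x Q0 \<subseteq> Z"
    unfolding Z_def using rspan_rmod[OF rsub_UNIV] rspan_base[OF rsub_UNIV] by blast+
  have "\<exists>n. lenb UNIV (- P) Z UNIV n"
  proof (rule finite_length)
    show "noeth UNIV Z" using noeth_mono[OF assms(1)] Zs by auto
    fix P' assume P': "rprime UNIV P'" "Z \<subseteq> P'" "P' \<inter> - P = {}"
    then have "P' = P" using min Zs unfolding minimal_over_def by blast
    have "lenb UNIV (- P) P UNIV 1"
    proof (rule lenb_le1)
      fix L assume L: "rsat UNIV (- P) L" "P \<subseteq> L"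
      show "L = P \<or> L = UNIV"
      proof (rule disjCI)
        assume "L \<noteq> UNIV"
        moreover have "L = UNIV" if "u \<in> L" "u \<notin> P" for u
        proof -
          have "u * 1 \<in> L \<Longrightarrow> 1 \<in> L" using L(1) that unfolding rsat_def by blast
          then show ?thesis using that rmod_eq_UNIV[OF rsat_rmod[OF L(1)]] by simp
        qed
        ultimately show "L = P" using L by auto
      qed
    qed
    then show "\<exists>n. lenb UNIV (- P) P' UNIV n" using \<open>P' = P\<close> by blast
  qed (auto simp: Zm mP)
  then obtain n where n: "lenb UNIV (- P) Z UNIV n" ..

  define F where "F M = rspan UNIV (Q0 \<union> {q * u | q u. q \<in> Q \<and> u \<in> M})" for M
  define D where "D k = ((\<lambda>M. satcl (- Q) (F M)) ^^ k) UNIV" for k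
  have D0: "D 0 = UNIV" and DS: "D (Suc k) = satcl (- Q) (F (D k))" for k by (auto simp: D_def)
  have Fm: "rmod UNIV (F M)" for M unfolding F_def by (rule rspan_rmod) simp
  have Fmono: "F M \<subseteq> F M'" if "M \<subseteq> M'" for M M'
    unfolding F_def using that by (intro rspan_mono) auto
  have Dsat: "rsat UNIV (- Q) (D k)" for k
    by (cases k) (auto simp: D0 DS intro!: rsat_satcl Fm mQ)
  have Dm: "rmod UNIV (D k)" for k using Dsat by (simp add: rsat_def)
  have Ddec: "D (Suc k) \<subseteq> D k" for k
  proof (induction k)
    case (Suc k)
    then show ?case using satcl_mono[OF Fmono] by (simp add: DS)
  qed (simp add: D0)
  have Danti: "D j \<subseteq> D i" if "i \<le> j" for i j
    using lift_Suc_antimono_le[of D, OF Ddec that] .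
  have DQ0: "Q0 \<subseteq> D k" for k
  proof (cases k)
    case (Suc k')
    have "Q0 \<subseteq> F (D k')" unfolding F_def using rspan_base[OF rsub_UNIV] by blast
    then show ?thesis using Suc DS satcl_sub[OF mQ] by blast
  qed (simp add: D0)
  have DsatP: "rsat UNIV (- P) (D k)" for k using Dsat[of k] assms(5) by (auto simp: rsat_def)

  define E where "E k = satcl (- P) (rspan UNIV (insert x (D k)))" for k
  have Eanti: "E j \<subseteq> E i" if "i \<le> j" for i j
    unfolding E_def using Danti[OF that] by (intro satcl_mono rspan_mono) auto
  have "\<exists>k. E k = E (Suc k)"
  proof (rule ccontr)
    assume "\<nexists>k. E k = E (Suc k)"
    then have ne: "E (Suc k) \<subset> E k" for k using Eanti[of k "Suc k"] by auto
    then have strict: "E j \<subset> E i" if "i < j" for i j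
      using Eanti[of "Suc i" j] ne[of i] that by auto
    have inj: "inj_on E {..Suc n}"
      by (rule inj_onI) (metis strict less_irrefl linorder_neqE_nat)
    have "card (E ` {..Suc n}) \<le> Suc n"
    proof (rule n[unfolded lenb_def, rule_format], intro conjI ballI)
      fix L assume "L \<in> E ` {..Suc n}"
      then obtain k where k: "L = E k" by auto
      show "rsat UNIV (- P) L" unfolding k E_def by (rule rsat_satcl[OF rspan_rmod]) (auto simp: mP)
      have "Z \<subseteq> rspan UNIV (insert x (D k))"
        unfolding Z_def using DQ0 by (intro rspan_mono) auto
      then show "Z \<subseteq> L" unfolding k E_def using satcl_sub[OF mP] by blast
    next
      fix L L' assume "L \<in> E ` {..Suc n}" "L' \<in> E ` {..Suc n}"
      then show "L \<subseteq> L' \<or> L' \<subseteq> L" using Eanti by (metis imageE nat_le_linear)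
    qed auto
    then show False using card_image[OF inj] by simp
  qed
  then obtain k where k: "E k = E (Suc k)" ..
  have "D k = D (Suc k)"
  proof (rule nakayama[OF _ P(1) DsatP DsatP Ddec])
    show "noeth UNIV (D (Suc k))" using noeth_mono[OF assms(1) DQ0] .
    show "D k \<subseteq> satcl (- P) (rspan UNIV (D (Suc k) \<union> {p * u | p u. p \<in> P \<and> u \<in> D k}))" (is "_ \<subseteq> ?S")
    proof
      fix u assume u: "u \<in> D k"
      then have "u \<in> E k"
        using satcl_sub[OF mP, of "rspan UNIV (insert x (D k))"]
          rspan_base[OF rsub_UNIV, of u "insert x (D k)"] by (auto simp: E_def)
      then have "u \<in> E (Suc k)" using k by simp
      then obtain v w c where v: "v \<notin> P" "w \<in> D (Suc k)" "v * u = w + c * x"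
        using rspan_insert_iff[OF rsub_UNIV Dm] by (auto simp: E_def satcl_def)
      have "c * x \<in> D k"
        using v Ddec[of k] rmod_diff[OF rsub_UNIV Dm[of k], of "v * u" w] rmod_mult[OF Dm[of k], of v u] u
        by auto
      then have "c \<in> D k" using Dsat[of k] \<open>x \<notin> Q\<close> by (auto simp: rsat_def mult.commute)
      then have "c * x \<in> {p * u | p u. p \<in> P \<and> u \<in> D k}"
        using P(3) mult.commute[of c x] by blast
      then have "v * u \<in> rspan UNIV (D (Suc k) \<union> {p * u | p u. p \<in> P \<and> u \<in> D k})"
        unfolding v(3) using v(2) by (intro rspan_add rspan_base) auto
      then show "u \<in> ?S" using v(1) by (auto simp: satcl_def)
    qed
  qed
  have "D k = Q0"
  proof (rule nakayama[OF assms(1,3) Dsat _ DQ0])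
    show "rsat UNIV (- Q) Q0"
      using Q0m assms(4) rprime_mult[OF assms(2)] by (auto simp: rsat_def)
    show "D k \<subseteq> satcl (- Q) (rspan UNIV (Q0 \<union> {q * u | q u. q \<in> Q \<and> u \<in> D k}))"
      using \<open>D k = D (Suc k)\<close> DS[of k] by (simp add: F_def)
  qed
  moreover obtain y where y: "y \<in> Q" "y \<notin> Q0" using assms(4) by auto
  have "y ^ j \<in> D j" for j
  proof (induction j)
    case (Suc j)
    have "y * y ^ j \<in> F (D j)" unfolding F_def using y Suc by (intro rspan_base) auto
    then show ?case using DS satcl_sub[OF mQ] by (auto simp: subset_iff)
  qed (simp add: D0)
  ultimately show False using y rprime_power[OF assms(2), of y k] by auto
qed

lemma rspan_superset: "rsub R \<Longrightarrow> W \<subseteq> rspan R W"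
  by (simp add: rspan_base subsetI)

section \<open>Heights and parameters\<close>

definition ht_ge :: "'a::comm_ring_1 set \<Rightarrow> nat \<Rightarrow> 'a set \<Rightarrow> bool" where
  "ht_ge I0 n P \<longleftrightarrow> (\<exists>c. c n = P \<and> (\<forall>i\<le>n. rprime UNIV (c i) \<and> I0 \<subseteq> c i) \<and> (\<forall>i<n. c i \<subset> c (Suc i)))"

lemma ht_ge_mono:
  assumes "ht_ge I0 n P" "P \<subseteq> Q" "rprime UNIV Q"
  shows "ht_ge I0 n Q"
proof -
  obtain c where c: "c n = P" "\<And>i. i \<le> n \<Longrightarrow> rprime UNIV (c i) \<and> I0 \<subseteq> c i" "\<And>i. i < n \<Longrightarrow> c i \<subset> c (Suc i)"
    using assms(1) unfolding ht_ge_def by auto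
  have "(c(n := Q)) n = Q" by simp
  moreover have "rprime UNIV ((c(n := Q)) i) \<and> I0 \<subseteq> (c(n := Q)) i" if "i \<le> n" for i
    using c(2)[of i] c(2)[of n] c(1) that assms by auto
  moreover have "(c(n := Q)) i \<subset> (c(n := Q)) (Suc i)" if "i < n" for i
    using c(3)[of i] c(1) that assms by (cases "Suc i = n") auto
  ultimately show ?thesis unfolding ht_ge_def by blast
qed

lemma ht_ge_Suc:
  assumes "ht_ge I0 n P" "P \<subset> Q" "rprime UNIV Q"
  shows "ht_ge I0 (Suc n) Q"
proof -
  obtain c where c: "c n = P" "\<And>i. i \<le> n \<Longrightarrow> rprime UNIV (c i) \<and> I0 \<subseteq> c i" "\<And>i. i < n \<Longrightarrow> c i \<subset> c (Suc i)"
    using assms(1) unfolding ht_ge_def by auto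
  have "(c(Suc n := Q)) (Suc n) = Q" by simp
  moreover have "rprime UNIV ((c(Suc n := Q)) i) \<and> I0 \<subseteq> (c(Suc n := Q)) i" if "i \<le> Suc n" for i
    using c(2)[of i] c(2)[of n] c(1) that assms by (cases "i = Suc n") auto
  moreover have "(c(Suc n := Q)) i \<subset> (c(Suc n := Q)) (Suc i)" if "i < Suc n" for i
    using c(3)[of i] c(1) that assms by (cases "i = n") auto
  ultimately show ?thesis unfolding ht_ge_def by blast
qed

lemma ht_ge_tl:
  assumes "ht_ge I0 (Suc n) P"
  shows "ht_ge I0 n P"
proof -
  obtain c where c: "c (Suc n) = P" "\<And>i. i \<le> Suc n \<Longrightarrow> rprime UNIV (c i) \<and> I0 \<subseteq> c i"
    "\<And>i. i < Suc n \<Longrightarrow> c i \<subset> c (Suc i)"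
    using assms(1) unfolding ht_ge_def by auto
  then show ?thesis unfolding ht_ge_def by (intro exI[of _ "\<lambda>i. c (Suc i)"]) auto
qed

lemma ht_ge_SucE:
  assumes "ht_ge I0 (Suc n) P"
  obtains Q where "ht_ge I0 n Q" "Q \<subset> P" "rprime UNIV Q" "I0 \<subseteq> Q" "rprime UNIV P"
proof -
  obtain c where c: "c (Suc n) = P" "\<And>i. i \<le> Suc n \<Longrightarrow> rprime UNIV (c i) \<and> I0 \<subseteq> c i"
    "\<And>i. i < Suc n \<Longrightarrow> c i \<subset> c (Suc i)"
    using assms(1) unfolding ht_ge_def by auto
  have "ht_ge I0 n (c n)" unfolding ht_ge_def using c by (intro exI[of _ c]) auto
  moreover have "c n \<subset> P" using c(1) c(3)[of n] by simp
  ultimately show thesis using that[of "c n"] c(1) c(2)[of n] c(2)[of "Suc n"] by simp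
qed

lemma ht_ge_0: "rprime UNIV P \<Longrightarrow> I0 \<subseteq> P \<Longrightarrow> ht_ge I0 0 P"
  unfolding ht_ge_def by (intro exI[of _ "\<lambda>_. P"]) auto

lemma ht_geD: "ht_ge I0 n P \<Longrightarrow> rprime UNIV P \<and> I0 \<subseteq> P"
  unfolding ht_ge_def by auto

lemma exists_adjacent_prime:
  assumes "noeth UNIV I0" "rprime UNIV Q" "I0 \<subseteq> Q" "Q \<subset> P"
  obtains Q' where "rprime UNIV Q'" "Q \<subseteq> Q'" "Q' \<subset> P"
    "\<And>K. rprime UNIV K \<Longrightarrow> Q' \<subseteq> K \<Longrightarrow> K \<subset> P \<Longrightarrow> K = Q'"
proof -
  define \<J> where "\<J> = {K. rprime UNIV K \<and> Q \<subseteq> K \<and> K \<subset> P}"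
  have "\<J> \<noteq> {}" using assms by (auto simp: \<J>_def)
  moreover have "rmod UNIV J \<and> J \<subseteq> UNIV \<and> I0 \<subseteq> J" if "J \<in> \<J>" for J
    using that assms(3) by (auto simp: \<J>_def dest: rprime_rmod)
  ultimately obtain M where M: "M \<in> \<J>" "\<And>J. J \<in> \<J> \<Longrightarrow> M \<subseteq> J \<Longrightarrow> J = M"
    using noeth_maximal[OF assms(1), of \<J>] by metis
  show thesis
  proof (rule that[of M])
    fix K assume "rprime UNIV K" "M \<subseteq> K" "K \<subset> P"
    then show "K = M" using M(1) M(2)[of K] by (auto simp: \<J>_def)
  qed (use M in \<open>auto simp: \<J>_def\<close>)
qed

lemma minimal_over_rspan:
  "minimal_over (rspan UNIV W) P \<longleftrightarrow> minimal_over W P"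
proof -
  have "rspan UNIV W \<subseteq> Q \<longleftrightarrow> W \<subseteq> Q" if "rprime UNIV Q" for Q
    using rspan_least[OF rprime_rmod[OF that], of W] rspan_base[OF rsub_UNIV, of _ W] by blast
  then show ?thesis unfolding minimal_over_def by (simp cong: conj_cong)
qed

lemma height_theorem:
  assumes "noeth UNIV I0" "finite A" "card A \<le> n" "minimal_over (I0 \<union> A) P"
  shows "\<not> ht_ge I0 (Suc n) P"
  using assms(2-4)
proof (induction n arbitrary: A P)
  case 0
  then have "A = {}" by simp
  show ?case
  proof
    assume "ht_ge I0 (Suc 0) P"
    then obtain Q where "Q \<subset> P" "rprime UNIV Q" "I0 \<subseteq> Q" by (elim ht_ge_SucE) auto
    then show False using 0(3) \<open>A = {}\<close> unfolding minimal_over_def by auto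
  qed
next
  case (Suc n)
  show ?case
  proof
    assume "ht_ge I0 (Suc (Suc n)) P"
    then obtain Q1 where Q1: "ht_ge I0 (Suc n) Q1" "Q1 \<subset> P" "rprime UNIV Q1" "I0 \<subseteq> Q1" "rprime UNIV P"
      by (rule ht_ge_SucE)
    then obtain Q where Q: "rprime UNIV Q" "Q1 \<subseteq> Q" "Q \<subset> P"
      and adj: "\<And>K. rprime UNIV K \<Longrightarrow> Q \<subseteq> K \<Longrightarrow> K \<subset> P \<Longrightarrow> K = Q"
      using exists_adjacent_prime[OF assms(1) Q1(3,4,2)] by metis
    have htQ: "ht_ge I0 (Suc n) Q" using ht_ge_mono[OF Q1(1) Q(2,1)] .
    have "\<not> A \<subseteq> Q" using Suc.prems(3) Q Q1(4) unfolding minimal_over_def by blast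
    then obtain b where b: "b \<in> A" "b \<notin> Q" by auto
    have AP: "A \<subseteq> P" "I0 \<subseteq> P" using Suc.prems(3) unfolding minimal_over_def by auto
    have mQ: "minimal_over (rspan UNIV (insert b Q)) P"
      unfolding minimal_over_rspan unfolding minimal_over_def
    proof (intro conjI allI impI)
      show "rprime UNIV P" "insert b Q \<subseteq> P" using Q Q1(5) b AP by auto
      fix K assume K: "rprime UNIV K \<and> insert b Q \<subseteq> K \<and> K \<subseteq> P"
      then show "K = P" using adj[of K] b(2) by auto
    qed
    have "\<exists>q. q \<in> Q \<and> (\<exists>y m c. y \<notin> P \<and> y * u ^ m = q + c * b)" if u: "u \<in> A" for u
    proof -
      have "u \<in> P" using u AP by auto
      then obtain y m where y: "y \<notin> P" "y * u ^ m \<in> rspan UNIV (insert b Q)"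
        by (rule minimal_over_power[OF mQ rspan_rmod[OF rsub_UNIV]])
      then obtain q c where "q \<in> Q" "y * u ^ m = q + c * b"
        using rspan_insert_iff[OF rsub_UNIV rprime_rmod[OF Q(1)]] by auto
      then show ?thesis using y(1) by auto
    qed
    then obtain q where q: "\<And>u. u \<in> A \<Longrightarrow> q u \<in> Q"
      "\<And>u. u \<in> A \<Longrightarrow> \<exists>y m c. y \<notin> P \<and> y * u ^ m = q u + c * b"
      by metis
    have fin: "finite (q ` (A - {b}))" using Suc.prems by simp
    have "card (q ` (A - {b})) \<le> card (A - {b})" using Suc.prems by (intro card_image_le) simp
    also have "\<dots> \<le> n" using Suc.prems b by simp
    finally have card: "card (q ` (A - {b})) \<le> n" .
    have "minimal_over (I0 \<union> q ` (A - {b})) Q"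
      unfolding minimal_over_def
    proof (intro conjI allI impI)
      show "rprime UNIV Q" "I0 \<union> q ` (A - {b}) \<subseteq> Q" using Q Q1(4) q(1) by auto
      fix Q' assume Q': "rprime UNIV Q' \<and> I0 \<union> q ` (A - {b}) \<subseteq> Q' \<and> Q' \<subseteq> Q"
      show "Q' = Q"
      proof (rule ccontr)
        assume "Q' \<noteq> Q"
        have "minimal_over (insert b Q') P"
          unfolding minimal_over_def
        proof (intro conjI allI impI)
          show "rprime UNIV P" "insert b Q' \<subseteq> P" using Q1(5) Q' Q b AP by auto
          fix P' assume P': "rprime UNIV P' \<and> insert b Q' \<subseteq> P' \<and> P' \<subseteq> P"
          have "u \<in> P'" if u: "u \<in> A" for u
          proof (cases "u = b")
            case False
            obtain y m c where y: "y \<notin> P" "y * u ^ m = q u + c * b" using q(2)[OF u] by auto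
            have P'm: "rmod UNIV P'" using P' rprime_rmod by auto
            have "q u \<in> P'" using Q' P' u False by auto
            then have "y * u ^ m \<in> P'" unfolding y(2)
              using P' by (intro rmod_add[OF P'm] rmod_mult[OF P'm]) auto
            then have "u ^ m \<in> P'" using rprime_mult[of UNIV P' y "u ^ m"] P' y(1) by auto
            then show ?thesis using rprime_power[of UNIV P' u m] P' by simp
          qed (use P' in auto)
          then have "I0 \<union> A \<subseteq> P'" using Q' P' by auto
          then show "P' = P" using Suc.prems(3) P' unfolding minimal_over_def by auto
        qed
        moreover have "Q' \<subset> Q" using Q' \<open>Q' \<noteq> Q\<close> by auto
        moreover have "noeth UNIV Q'" using Q' noeth_mono[OF assms(1)] by auto
        ultimately show False using principal_ideal_theorem[of Q' Q P b] Q' Q by auto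
      qed
    qed
    then show False using Suc.IH[OF fin card] htQ by simp
  qed
qed

lemma finite_prime_cover:
  assumes "noeth UNIV I" "rmod UNIV I"
  shows "\<exists>F. finite F \<and> (\<forall>Q\<in>F. rprime UNIV Q \<and> I \<subseteq> Q) \<and>
    (\<forall>P. rprime UNIV P \<and> I \<subseteq> P \<longrightarrow> (\<exists>Q\<in>F. Q \<subseteq> P))"
  using assms(1,2) order_refl
proof (induction rule: noeth_ideal_induct)
  case unit
  show ?case by (rule exI[of _ "{}"]) (use rprime_1 in auto)
next
  case (prime P)
  then show ?case by (intro exI[of _ "{P}"]) auto
next
  case (split J u v)
  have *: "\<exists>F. finite F \<and> (\<forall>Q\<in>F. rprime UNIV Q \<and> J \<subseteq> Q) \<and>
    (\<forall>P. rprime UNIV P \<and> insert w J \<subseteq> P \<longrightarrow> (\<exists>Q\<in>F. Q \<subseteq> P))" if w: "w \<notin> J" for w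
  proof -
    let ?K = "rspan UNIV (insert w J)"
    have sub: "insert w J \<subseteq> ?K" using rspan_base[OF rsub_UNIV] by blast
    then have "J \<subset> ?K" using w by auto
    then obtain F where F: "finite F" "\<forall>Q\<in>F. rprime UNIV Q \<and> ?K \<subseteq> Q"
      "\<forall>P. rprime UNIV P \<and> ?K \<subseteq> P \<longrightarrow> (\<exists>Q\<in>F. Q \<subseteq> P)"
      using split(6)[OF rspan_rmod[OF rsub_UNIV]] by metis
    have "\<exists>Q\<in>F. Q \<subseteq> P" if "rprime UNIV P" "insert w J \<subseteq> P" for P
      using rspan_least[OF rprime_rmod[OF that(1)] that(2)] F(3) that(1) by auto
    then show ?thesis using F(1,2) sub by (intro exI[of _ F]) auto
  qed
  obtain F G where F: "finite F" "\<forall>Q\<in>F. rprime UNIV Q \<and> J \<subseteq> Q"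
      "\<And>P. rprime UNIV P \<and> insert u J \<subseteq> P \<Longrightarrow> (\<exists>Q\<in>F. Q \<subseteq> P)"
    and G: "finite G" "\<forall>Q\<in>G. rprime UNIV Q \<and> J \<subseteq> Q"
      "\<And>P. rprime UNIV P \<and> insert v J \<subseteq> P \<Longrightarrow> (\<exists>Q\<in>G. Q \<subseteq> P)"
    using *[OF split(4)] *[OF split(5)] by metis
  have "\<exists>Q\<in>F \<union> G. Q \<subseteq> P" if "rprime UNIV P" "J \<subseteq> P" for P
  proof -
    have "u \<in> P \<or> v \<in> P" using split(3) that rprime_mult[of UNIV P u v] by auto
    then show ?thesis using F(3)[of P] G(3)[of P] that by auto
  qed
  then show ?case using F G by (intro exI[of _ "F \<union> G"]) auto
qed

lemma exists_minimal_prime: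
  assumes noeth: "noeth UNIV I0" "I0 \<subseteq> I" and P: "rprime UNIV P" "I \<subseteq> P"
  obtains P' where "rprime UNIV P'" "I \<subseteq> P'" "P' \<subseteq> P"
    "\<And>Q. rprime UNIV Q \<Longrightarrow> I \<subseteq> Q \<Longrightarrow> Q \<subseteq> P' \<Longrightarrow> Q = P'"
proof -
  let ?J = "rspan UNIV I"
  have IJ: "I \<subseteq> ?J" by (rule rspan_superset[OF rsub_UNIV])
  have JQ: "?J \<subseteq> Q" if "rprime UNIV Q" "I \<subseteq> Q" for Q by (rule rspan_least[OF rprime_rmod[OF that(1)] that(2)])
  obtain F where F: "finite F" "\<forall>Q\<in>F. rprime UNIV Q \<and> ?J \<subseteq> Q" "\<forall>Q. rprime UNIV Q \<and> ?J \<subseteq> Q \<longrightarrow> (\<exists>Q'\<in>F. Q' \<subseteq> Q)"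
    using finite_prime_cover[OF noeth_mono[OF noeth(1) subset_trans[OF noeth(2) IJ]] rspan_rmod[OF rsub_UNIV]] by blast
  obtain Q0 where Q0: "Q0 \<in> F" "Q0 \<subseteq> P" using F(3) P(1) JQ[OF P] by blast
  obtain P' where P': "P' \<in> F" "P' \<subseteq> Q0" and min: "\<forall>Q\<in>F. Q \<subseteq> P' \<longrightarrow> P' = Q"
    using finite_has_minimal2[OF F(1) Q0(1)] by blast
  show thesis
  proof (rule that)
    show "rprime UNIV P'" "I \<subseteq> P'" "P' \<subseteq> P" using F(2) P' Q0(2) IJ by blast+
    fix Q assume Q: "rprime UNIV Q" "I \<subseteq> Q" "Q \<subseteq> P'"
    then obtain Q' where "Q' \<in> F" "Q' \<subseteq> Q" using F(3) JQ[of Q] by blast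
    then show "Q = P'" using min Q(3) by blast
  qed
qed

lemma rprime_prod:
  assumes "rprime UNIV P" "finite F" "prod f F \<in> P"
  shows "\<exists>i\<in>F. f i \<in> P"
  using assms(2,3)
  by (induction F rule: finite_induct) (auto simp: rprime_1[OF assms(1)] dest: rprime_mult[OF assms(1)])

lemma prime_avoidance:
  assumes "finite F" "\<And>Q. Q \<in> F \<Longrightarrow> rprime UNIV Q" "rmod UNIV J" "\<And>Q. Q \<in> F \<Longrightarrow> \<not> J \<subseteq> Q"
  shows "\<exists>x\<in>J. \<forall>Q\<in>F. x \<notin> Q"
  using assms(1,2,4)
proof (induction F rule: finite_psubset_induct)
  case (psubset F)
  show ?case
  proof (cases "F = {}")
    case True
    then show ?thesis using rmod_0[OF assms(3)] by auto
  next
    case False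
    show ?thesis
    proof (cases "\<exists>Q\<in>F. \<exists>Q'\<in>F. Q' \<noteq> Q \<and> Q' \<subseteq> Q")
      case True
      then obtain Q Q' where Q: "Q \<in> F" "Q' \<in> F" "Q' \<noteq> Q" "Q' \<subseteq> Q" by auto
      obtain x where "x \<in> J" "\<forall>Q\<in>F - {Q'}. x \<notin> Q"
        using psubset.IH[of "F - {Q'}"] psubset.prems Q by auto
      then show ?thesis using Q by (intro bexI[of _ x]) auto
    next
      case anti: False
      obtain Q where Q: "Q \<in> F" using False by auto
      obtain x where x: "x \<in> J" "\<forall>Q\<in>F - {Q}. x \<notin> Q"
        using psubset.IH[of "F - {Q}"] psubset.prems Q by auto
      show ?thesis
      proof (cases "x \<in> Q")
        case True
        obtain j where j: "j \<in> J" "j \<notin> Q" using psubset.prems(2)[OF Q] by auto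
        have "\<forall>Q'\<in>F - {Q}. \<exists>z. z \<in> Q' \<and> z \<notin> Q" using anti Q by auto
        then obtain z where z: "\<And>Q'. Q' \<in> F - {Q} \<Longrightarrow> z Q' \<in> Q' \<and> z Q' \<notin> Q" by metis
        define y where "y = j * prod z (F - {Q})"
        have "y \<in> J" unfolding y_def using rmod_mult2[OF assms(3)] j by simp
        have yQ: "y \<notin> Q"
          using rprime_mult[OF psubset.prems(1)[OF Q], of j "prod z (F - {Q})"] j
            rprime_prod[OF psubset.prems(1)[OF Q], of "F - {Q}" z] psubset.hyps z
          unfolding y_def by auto
        have yQ': "y \<in> Q'" if Q': "Q' \<in> F - {Q}" for Q'
        proof -
          have "prod z (F - {Q}) = z Q' * prod z (F - {Q} - {Q'})"
            using psubset.hyps Q' by (intro prod.remove) auto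
          then have "y = (j * prod z (F - {Q} - {Q'})) * z Q'" by (simp add: y_def algebra_simps)
          then show ?thesis
            using rmod_mult[OF rprime_rmod[OF psubset.prems(1)], of Q'] Q' z by auto
        qed
        have "x + y \<notin> Q'" if Q': "Q' \<in> F" for Q'
        proof (cases "Q' = Q")
          case True
          then show ?thesis
            using yQ \<open>x \<in> Q\<close> rmod_add_cancel[OF rsub_UNIV rprime_rmod[OF psubset.prems(1)[OF Q]], of x y]
            by (simp add: add.commute)
        next
          case False
          then show ?thesis
            using yQ'[of Q'] Q' x rmod_add_cancel[OF rsub_UNIV rprime_rmod[OF psubset.prems(1)[OF Q']], of y x]
            by simp
        qed
        then show ?thesis using \<open>y \<in> J\<close> x rmod_add[OF assms(3)] by blast
      qed (use x in auto)
    qed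
  qed
qed

lemma exists_parameters:
  assumes "noeth UNIV I0" "rmod UNIV I0" "ht_ge I0 n P"
  shows "\<exists>b :: nat \<Rightarrow> 'a::comm_ring_1. (\<forall>i<n. b i \<in> P) \<and>
    (\<forall>Q. rprime UNIV Q \<and> I0 \<union> b ` {..<n} \<subseteq> Q \<longrightarrow> ht_ge I0 n Q)"
  using assms(3)
proof (induction n)
  case 0
  then show ?case using ht_ge_0 by blast
next
  case (Suc n)
  obtain b where b': "(\<forall>i<n. b i \<in> P) \<and>
    (\<forall>Q. rprime UNIV Q \<and> I0 \<union> b ` {..<n} \<subseteq> Q \<longrightarrow> ht_ge I0 n Q)"
    using Suc.IH[OF ht_ge_tl[OF Suc.prems]] by (elim exE)
  then have b: "b i \<in> P" if "i < n" for i using that by simp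
  have bht: "ht_ge I0 n Q" if "rprime UNIV Q" "I0 \<union> b ` {..<n} \<subseteq> Q" for Q
    using b' that by simp
  let ?K = "rspan UNIV (I0 \<union> b ` {..<n})"
  have sub: "I0 \<union> b ` {..<n} \<subseteq> ?K" by (rule rspan_superset[OF rsub_UNIV])
  have "I0 \<subseteq> ?K" using sub by simp
  then have nK: "noeth UNIV ?K" by (rule noeth_mono[OF assms(1)])
  obtain F where "finite F \<and> (\<forall>Q\<in>F. rprime UNIV Q \<and> ?K \<subseteq> Q) \<and>
    (\<forall>P. rprime UNIV P \<and> ?K \<subseteq> P \<longrightarrow> (\<exists>Q\<in>F. Q \<subseteq> P))"
    using finite_prime_cover[OF nK rspan_rmod[OF rsub_UNIV]] by (elim exE)
  then have F: "finite F" "\<And>Q. Q \<in> F \<Longrightarrow> rprime UNIV Q \<and> ?K \<subseteq> Q"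
    "\<And>P. rprime UNIV P \<Longrightarrow> ?K \<subseteq> P \<Longrightarrow> \<exists>Q\<in>F. Q \<subseteq> P"
    by simp_all
  have P: "rprime UNIV P" using ht_geD[OF Suc.prems] by simp
  have "\<exists>x\<in>P. \<forall>Q\<in>{Q\<in>F. \<not> ht_ge I0 (Suc n) Q}. x \<notin> Q"
  proof (rule prime_avoidance)
    show "finite {Q\<in>F. \<not> ht_ge I0 (Suc n) Q}" using F(1) by simp
    show "rmod UNIV P" by (rule rprime_rmod[OF P])
    fix Q assume Q: "Q \<in> {Q\<in>F. \<not> ht_ge I0 (Suc n) Q}"
    then show "rprime UNIV Q" using F(2)[of Q] by simp
    then show "\<not> P \<subseteq> Q" using Q ht_ge_mono[OF Suc.prems, of Q] by auto
  qed
  then obtain x where x: "x \<in> P" "\<And>Q. Q \<in> F \<Longrightarrow> \<not> ht_ge I0 (Suc n) Q \<Longrightarrow> x \<notin> Q"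
    by auto
  have "ht_ge I0 (Suc n) Q" if Q: "rprime UNIV Q" "I0 \<union> (b(n := x)) ` {..<Suc n} \<subseteq> Q" for Q
  proof -
    have "(b(n := x)) ` {..<Suc n} = insert x (b ` {..<n})"
      by (auto simp: lessThan_Suc image_iff)
    then have Q': "I0 \<union> b ` {..<n} \<subseteq> Q" "x \<in> Q" using Q(2) by auto
    then have "?K \<subseteq> Q" using rspan_least[OF rprime_rmod[OF Q(1)]] by auto
    then obtain Q1 where Q1: "Q1 \<in> F" "Q1 \<subseteq> Q" using F(3) Q(1) by blast
    show ?thesis
    proof (cases "ht_ge I0 (Suc n) Q1")
      case True
      then show ?thesis using ht_ge_mono Q1 Q by blast
    next
      case False
      then have "Q1 \<subset> Q" using x(2)[OF Q1(1)] Q' Q1 by auto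
      moreover have "ht_ge I0 n Q1" using bht[of Q1] F(2)[OF Q1(1)] sub by auto
      ultimately show ?thesis using ht_ge_Suc Q(1) by blast
    qed
  qed
  then show ?case using b x(1) by (intro exI[of _ "b(n := x)"]) auto
qed

section \<open>Submonic relations and heights\<close>

definition meval :: "(nat \<Rightarrow> 'a::comm_ring_1) \<Rightarrow> nat multiset \<Rightarrow> 'a" where
  "meval a t = prod_mset (image_mset a t)"

definition wt :: "(nat \<Rightarrow> nat) \<Rightarrow> nat multiset \<Rightarrow> nat" where
  "wt w t = sum_mset (image_mset w t)"

abbreviation monomials :: "nat \<Rightarrow> nat multiset set" where
  "monomials n \<equiv> {t. set_mset t \<subseteq> {..<n}}"

abbreviation above :: "(nat multiset \<times> nat multiset) set \<Rightarrow> nat \<Rightarrow> nat multiset \<Rightarrow> nat multiset set" where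
  "above r n t0 \<equiv> {t. set_mset t \<subseteq> {..<n} \<and> (t0, t) \<in> r \<and> t \<noteq> t0}"

text \<open>The values at \<open>a\<close> of the submonic polynomials over \<open>R\<close> in \<open>n\<close> indeterminates.\<close>

definition subm :: "(nat multiset \<times> nat multiset) set \<Rightarrow> 'a::comm_ring_1 set \<Rightarrow> nat \<Rightarrow> (nat \<Rightarrow> 'a) \<Rightarrow> 'a set" where
  "subm r R n a = {meval a t0 + y | t0 y. set_mset t0 \<subseteq> {..<n} \<and>
     y \<in> rspan R (meval a ` above r n t0)}"

lemma meval_empty [simp]: "meval a {#} = 1"
  and meval_add [simp]: "meval a (s + t) = meval a s * meval a t"
  and meval_add_mset [simp]: "meval a (add_mset i t) = a i * meval a t"
  by (simp_all add: meval_def)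

lemma meval_replicate [simp]: "meval a (replicate_mset k i) = a i ^ k"
  by (simp add: meval_def)

lemma meval_eq_prod:
  "set_mset t \<subseteq> {..<n} \<Longrightarrow> meval a t = (\<Prod>i<n. a i ^ count t i)"
proof (induction t)
  case (add i t)
  then have "i < n" by simp
  have "(\<Prod>j<n. a j ^ count (add_mset i t) j) = (\<Prod>j<n. (if j = i then a i else 1) * a j ^ count t j)"
    by (intro prod.cong) auto
  also have "\<dots> = a i * (\<Prod>j<n. a j ^ count t j)"
    using \<open>i < n\<close> by (simp add: prod.distrib prod.delta)
  finally show ?case using add by simp
qed simp

lemma wt_empty [simp]: "wt w {#} = 0"
  and wt_add [simp]: "wt w (s + t) = wt w s + wt w t"
  and wt_add_mset [simp]: "wt w (add_mset i t) = w i + wt w t"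
  by (simp_all add: wt_def)

lemma wt_eq_sum:
  "set_mset t \<subseteq> {..<n} \<Longrightarrow> wt w t = (\<Sum>i<n. w i * count t i)"
proof (induction t)
  case (add i t)
  then have "i < n" by simp
  have "(\<Sum>j<n. w j * count (add_mset i t) j) = (\<Sum>j<n. (if j = i then w i else 0) + w j * count t j)"
    by (intro sum.cong) auto
  also have "\<dots> = w i + (\<Sum>j<n. w j * count t j)"
    using \<open>i < n\<close> by (simp add: sum.distrib sum.delta)
  finally show ?case using add by simp
qed simp

lemma rspan_finite:
  assumes "x \<in> rspan R W"
  shows "\<exists>V. finite V \<and> V \<subseteq> W \<and> x \<in> rspan R V"
  using assms
proof (induction rule: rspan.induct)
  case zero
  then show ?case using rspan.zero by blast
next
  case (step x c w)
  then obtain V where V: "finite V" "V \<subseteq> W" "x \<in> rspan R V" by blast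
  have "x \<in> rspan R (insert w V)" using V(3) rspan_mono[of V "insert w V" R R] by auto
  then have "x + c * w \<in> rspan R (insert w V)" using step.hyps by (intro rspan.step) auto
  then show ?case using V step.hyps by (intro exI[of _ "insert w V"]) auto
qed

lemma rspan_image_finite:
  assumes "x \<in> rspan R (f ` T)"
  obtains F where "finite F" "F \<subseteq> T" "x \<in> rspan R (f ` F)"
proof -
  obtain V where V: "finite V" "V \<subseteq> f ` T" "x \<in> rspan R V" using rspan_finite[OF assms] by blast
  then obtain F where "F \<subseteq> T" "finite F" "V = f ` F" using finite_subset_image by metis
  then show thesis using that V by blast
qed

lemma mono_ordD:
  assumes "monomial_ordering r"
  shows "(t, t) \<in> r" "(s, t) \<in> r \<Longrightarrow> (t, u) \<in> r \<Longrightarrow> (s, u) \<in> r"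
    "(s, t) \<in> r \<Longrightarrow> (t, s) \<in> r \<Longrightarrow> s = t" "(s, t) \<in> r \<or> (t, s) \<in> r"
    "({#}, s) \<in> r" "(s, t) \<in> r \<Longrightarrow> (u + s, u + t) \<in> r"
proof -
  have *: "refl r" "trans r" "antisym r" "total r"
    using assms by (auto simp: monomial_ordering_def linear_order_on_def partial_order_on_def preorder_on_def)
  show "(t, t) \<in> r" using *(1) by (simp add: refl_on_def)
  show "(s, t) \<in> r \<Longrightarrow> (t, u) \<in> r \<Longrightarrow> (s, u) \<in> r" using *(2) by (meson transD)
  show "(s, t) \<in> r \<Longrightarrow> (t, s) \<in> r \<Longrightarrow> s = t" using *(3) by (meson antisymD)
  show "(s, t) \<in> r \<or> (t, s) \<in> r"
    using *(1,4) by (cases "s = t") (simp_all add: total_on_def refl_on_def)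
  show "({#}, s) \<in> r" "(s, t) \<in> r \<Longrightarrow> (u + s, u + t) \<in> r"
    using assms by (auto simp: monomial_ordering_def)
qed

lemma mono_ord_add_strict:
  assumes "monomial_ordering r" "(s, t) \<in> r" "(s', t') \<in> r" "s \<noteq> t \<or> s' \<noteq> t'"
  shows "(s + s', t + t') \<in> r" "s + s' \<noteq> t + t'"
proof -
  have 1: "(s + s', s + t') \<in> r" by (rule mono_ordD(6)[OF assms(1,3)])
  have 2: "(s + t', t + t') \<in> r" using mono_ordD(6)[OF assms(1,2), of t'] by (simp add: add.commute)
  show "(s + s', t + t') \<in> r" by (rule mono_ordD(2)[OF assms(1) 1 2])
  show "s + s' \<noteq> t + t'"
  proof
    assume eq: "s + s' = t + t'"
    then have "s + t' = t + t'" using mono_ordD(3)[OF assms(1) 2] 1 by simp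
    then show False using assms(4) eq by simp
  qed
qed

lemma exists_between_finite:
  fixes L U :: "rat set"
  assumes "finite L" "finite U" "\<And>l u. l \<in> L \<Longrightarrow> u \<in> U \<Longrightarrow> l < u"
  shows "\<exists>x. (\<forall>l\<in>L. l < x) \<and> (\<forall>u\<in>U. x < u)"
proof -
  consider "L = {}" "U = {}" | "L = {}" "U \<noteq> {}" | "L \<noteq> {}" "U = {}" | "L \<noteq> {}" "U \<noteq> {}" by blast
  then show ?thesis
  proof cases
    case 2
    have "Min U - 1 < u" if "u \<in> U" for u using Min_le[OF assms(2) that] by linarith
    then show ?thesis using 2 by auto
  next
    case 3
    have "l < Max L + 1" if "l \<in> L" for l using Max_ge[OF assms(1) that] by linarith
    then show ?thesis using 3 by auto
  next
    case 4
    then have "Max L < Min U" using assms by (intro assms(3)) auto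
    then obtain x where x: "Max L < x" "x < Min U" using dense by blast
    have "l < x" if "l \<in> L" for l using Max_ge[OF assms(1) that] x by linarith
    moreover have "x < u" if "u \<in> U" for u using Min_le[OF assms(2) that] x by linarith
    ultimately show ?thesis by blast
  qed simp
qed

text \<open>Fourier--Motzkin elimination. The closure of \<open>C\<close> under addition takes care of the certificates
  of infeasibility.\<close>

lemma cone_positive_weights:
  fixes C :: "(nat \<Rightarrow> int) set"
  assumes add: "\<And>u v. u \<in> C \<Longrightarrow> v \<in> C \<Longrightarrow> (\<lambda>i. u i + v i) \<in> C" and "(\<lambda>_. 0) \<notin> C"
    and "finite V" "V \<subseteq> C" "\<And>v i. v \<in> V \<Longrightarrow> n \<le> i \<Longrightarrow> v i = 0"
  shows "\<exists>w :: nat \<Rightarrow> rat. \<forall>v\<in>V. 0 < (\<Sum>i<n. w i * of_int (v i))"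
  using assms(3-5)
proof (induction n arbitrary: V)
  case 0
  have "V = {}"
  proof (rule ccontr)
    assume "V \<noteq> {}"
    then obtain v where "v \<in> V" by auto
    moreover from this have "v = (\<lambda>_. 0)" using 0(3) by auto
    ultimately show False using 0(2) assms(2) by auto
  qed
  then show ?case by simp
next
  case (Suc n)
  have scale: "(\<lambda>i. k * v i) \<in> C" if "v \<in> C" "0 < k" for v and k :: int
  proof -
    have "(\<lambda>i. int (Suc m) * v i) \<in> C" for m
    proof (induction m)
      case (Suc m)
      then show ?case using add[OF that(1) Suc] by (simp add: algebra_simps)
    qed (use that in simp)
    from this[of "nat k - 1"] show ?thesis using that(2) by (simp add: Suc_nat_eq_nat_zadd1)
  qed
  define P where "P = {v\<in>V. v n > 0}"
  define N where "N = {v\<in>V. v n < 0}"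
  define h where "h = (\<lambda>(v, u). \<lambda>i :: nat. (- u n) * v i + v n * u i :: int)"
  define V' where "V' = {v\<in>V. v n = 0} \<union> h ` (P \<times> N)"
  have "\<exists>w :: nat \<Rightarrow> rat. \<forall>v\<in>V'. 0 < (\<Sum>i<n. w i * of_int (v i))"
  proof (rule Suc.IH)
    show "finite V'" using Suc.prems(1) by (auto simp: V'_def P_def N_def)
    show "V' \<subseteq> C"
    proof
      fix z assume "z \<in> V'"
      then consider "z \<in> V" | v u where "v \<in> V" "u \<in> V" "v n > 0" "u n < 0" "z = h (v, u)"
        by (auto simp: V'_def P_def N_def)
      then show "z \<in> C"
      proof cases
        case 1
        then show ?thesis using Suc.prems by auto
      next
        case 2
        then have "(\<lambda>i. (- u n) * v i) \<in> C" "(\<lambda>i. v n * u i) \<in> C"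
          using Suc.prems(2) by (intro scale; auto)+
        from add[OF this] show ?thesis unfolding 2(5) h_def by (simp add: algebra_simps)
      qed
    qed
    fix z i assume z: "z \<in> V'" "n \<le> i"
    show "z i = 0"
    proof (cases "i = n")
      case True
      then show ?thesis using z by (auto simp: V'_def h_def)
    next
      case False
      then have "v i = 0" if "v \<in> V" for v using z Suc.prems(3)[of v i] that by simp
      note zero = this
      from z(1) consider "z \<in> V" | v u where "v \<in> V" "u \<in> V" "z = h (v, u)"
        by (auto simp: V'_def P_def N_def)
      then show ?thesis by cases (simp_all add: zero h_def)
    qed
  qed
  then obtain w :: "nat \<Rightarrow> rat" where w: "\<And>v. v \<in> V' \<Longrightarrow> 0 < (\<Sum>i<n. w i * of_int (v i))" by auto
  define f where "f v = (\<Sum>i<n. w i * of_int (v i))" for v :: "nat \<Rightarrow> int"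
  have "\<exists>x. (\<forall>l\<in>(\<lambda>v. - f v / of_int (v n)) ` P. l < x) \<and> (\<forall>u\<in>(\<lambda>u. f u / of_int (- u n)) ` N. x < u)"
  proof (rule exists_between_finite)
    fix l m assume "l \<in> (\<lambda>v. - f v / of_int (v n)) ` P" "m \<in> (\<lambda>u. f u / of_int (- u n)) ` N"
    then obtain v u where vu: "v \<in> P" "u \<in> N" "l = - f v / of_int (v n)" "m = f u / of_int (- u n)"
      by auto
    then have "h (v, u) \<in> V'" by (auto simp: V'_def)
    then have "0 < f (h (v, u))" using w by (simp add: f_def)
    also have "f (h (v, u)) = of_int (- u n) * f v + of_int (v n) * f u"
      by (simp add: f_def h_def sum_distrib_left sum.distrib[symmetric] algebra_simps)
    finally have *: "0 < of_int (- u n) * f v + of_int (v n) * f u" .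
    have pos: "(0 :: rat) < of_int (v n)" "(0 :: rat) < of_int (- u n)" using vu by (auto simp: P_def N_def)
    show "l < m" unfolding vu using pos *
      by (simp add: divide_less_eq less_divide_eq algebra_simps)
  qed (use Suc.prems in \<open>auto simp: P_def N_def\<close>)
  then obtain x where x: "\<And>v. v \<in> P \<Longrightarrow> - f v / of_int (v n) < x"
    "\<And>u. u \<in> N \<Longrightarrow> x < f u / of_int (- u n)" by auto
  have "0 < (\<Sum>i<Suc n. (w(n := x)) i * of_int (v i))" if v: "v \<in> V" for v
  proof -
    have eq: "(\<Sum>i<Suc n. (w(n := x)) i * of_int (v i)) = f v + x * of_int (v n)"
      by (simp add: f_def)
    consider "v n = 0" | "v n > 0" | "v n < 0" by linarith
    then show ?thesis
    proof cases
      case 1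
      then have "v \<in> V'" using v by (auto simp: V'_def)
      then show ?thesis using eq 1 w[of v] by (simp add: f_def)
    next
      case 2
      then have "- f v / of_int (v n) < x" using x(1) v by (auto simp: P_def)
      moreover have "(0 :: rat) < of_int (v n)" using 2 by simp
      ultimately have "- f v < x * of_int (v n)" by (simp only: pos_divide_less_eq)
      then show ?thesis unfolding eq by linarith
    next
      case 3
      then have "x < f v / of_int (- v n)" using x(2) v by (auto simp: N_def)
      moreover have "(0 :: rat) < of_int (- v n)" using 3 by simp
      ultimately have "x * of_int (- v n) < f v" by (simp only: pos_less_divide_eq)
      then show ?thesis unfolding eq by simp
    qed
  qed
  then show ?case by blast
qed

lemma common_denominator:
  fixes w :: "nat \<Rightarrow> rat"
  shows "\<exists>d > 0. \<forall>i<n. of_int d * w i \<in> \<int>"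
proof (induction n)
  case (Suc n)
  then obtain d where d: "d > 0" "\<forall>i<n. of_int d * w i \<in> \<int>" by auto
  obtain p q where pq: "quotient_of (w n) = (p, q)" by fastforce
  then have q: "q > 0" "w n = of_int p / of_int q"
    by (auto simp: quotient_of_denom_pos quotient_of_div)
  have "of_int (d * q) * w i \<in> \<int>" if "i < Suc n" for i
  proof (cases "i = n")
    case True
    have "of_int (d * q) * w n = of_int (d * p)" using q by simp
    then show ?thesis using True by (metis Ints_of_int)
  next
    case False
    then have "of_int d * w i \<in> \<int>" using d that by simp
    then have "of_int q * (of_int d * w i) \<in> \<int>" by (rule Ints_mult[OF Ints_of_int])
    moreover have "of_int q * (of_int d * w i) = of_int (d * q) * w i" by simp
    ultimately show ?thesis by (simp only:)
  qed
  then show ?case using d q by (intro exI[of _ "d * q"]) auto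
qed (auto intro: exI[of _ 1])

lemma exists_weights:
  assumes r: "monomial_ordering r" and F: "finite F" and t0: "set_mset t0 \<subseteq> {..<n}"
    and t: "\<And>t. t \<in> F \<Longrightarrow> set_mset t \<subseteq> {..<n} \<and> (t0, t) \<in> r \<and> t \<noteq> t0"
  shows "\<exists>w. (\<forall>i<n. 0 < w i) \<and> (\<forall>t\<in>F. wt w t0 < wt w t)"
proof -
  define D where "D s t = (\<lambda>i. int (count t i) - int (count s i))" for s t :: "nat multiset"
  define C where "C = {D s t | s t. (s, t) \<in> r \<and> s \<noteq> t}"
  define V where "V = D t0 ` F \<union> (\<lambda>i. D {#} {#i#}) ` {..<n}"
  have "\<exists>w :: nat \<Rightarrow> rat. \<forall>v\<in>V. 0 < (\<Sum>i<n. w i * of_int (v i))"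
  proof (rule cone_positive_weights[of C])
    fix u v assume "u \<in> C" "v \<in> C"
    then obtain s t s' t' where st: "u = D s t" "v = D s' t'" "(s, t) \<in> r" "s \<noteq> t" "(s', t') \<in> r"
      by (auto simp: C_def)
    then have "(\<lambda>i. u i + v i) = D (s + s') (t + t')" by (auto simp: D_def)
    then show "(\<lambda>i. u i + v i) \<in> C"
      unfolding C_def using mono_ord_add_strict[OF r st(3,5)] st(4) by blast
  next
    show "(\<lambda>_. 0) \<notin> C"
    proof
      assume "(\<lambda>_. 0) \<in> C"
      then obtain s t where "s \<noteq> t" "D s t = (\<lambda>_. 0)" by (auto simp: C_def)
      then show False by (auto simp: D_def fun_eq_iff multiset_eq_iff)
    qed
  next
    show "finite V" using F by (simp add: V_def)
    show "V \<subseteq> C" using t mono_ordD(5)[OF r] unfolding V_def C_def by fastforce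
    fix v i assume "v \<in> V" "n \<le> i"
    then show "v i = 0" using t0 t unfolding V_def D_def
      by (auto simp: count_eq_zero_iff) (metis lessThan_iff not_le subsetD count_eq_zero_iff)+
  qed
  then obtain w :: "nat \<Rightarrow> rat" where w: "\<And>v. v \<in> V \<Longrightarrow> 0 < (\<Sum>i<n. w i * of_int (v i))" by auto
  obtain d :: int where d: "d > 0" "\<And>i. i < n \<Longrightarrow> of_int d * w i \<in> \<int>"
    using common_denominator[of n w] by auto
  have wpos: "0 < w i" if "i < n" for i
  proof -
    have "0 < (\<Sum>j<n. w j * of_int (D {#} {#i#} j))" using that by (intro w) (auto simp: V_def)
    also have "\<dots> = (\<Sum>j<n. if j = i then w i else 0)" by (intro sum.cong) (auto simp: D_def)
    also have "\<dots> = w i" using that by simp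
    finally show ?thesis .
  qed
  define w' where "w' i = nat \<lfloor>of_int d * w i\<rfloor>" for i
  have w': "of_nat (w' i) = of_int d * w i" if i: "i < n" for i
  proof -
    obtain z where z: "of_int d * w i = of_int z" by (rule Ints_cases[OF d(2)[OF i]])
    have "0 < of_int d * w i" using d(1) wpos[OF i] by simp
    then show ?thesis using z by (simp add: w'_def)
  qed
  have "0 < w' i" if "i < n" for i
  proof -
    have "(0::rat) < of_nat (w' i)" using w'[OF that] d(1) wpos[OF that] by simp
    then show ?thesis by simp
  qed
  moreover have "wt w' t0 < wt w' t" if "t \<in> F" for t
  proof -
    have *: "(of_nat (wt w' s) :: rat) = of_int d * (\<Sum>i<n. w i * of_nat (count s i))"
      if "set_mset s \<subseteq> {..<n}" for s
      by (simp add: wt_eq_sum[OF that] sum_distrib_left w' mult.assoc)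
    have "0 < (\<Sum>i<n. w i * of_int (D t0 t i))" using that by (intro w) (auto simp: V_def)
    also have "\<dots> = (\<Sum>i<n. w i * of_nat (count t i)) - (\<Sum>i<n. w i * of_nat (count t0 i))"
      by (simp add: D_def algebra_simps sum_subtractf)
    finally have "(of_nat (wt w' t0) :: rat) < of_nat (wt w' t)"
      using *[OF t0] * t that d(1) by simp
    then show ?thesis by simp
  qed
  ultimately show ?thesis by blast
qed

lemma cong_mult:
  assumes "rmod UNIV Q" "x - y \<in> Q" "x' - y' \<in> Q"
  shows "x * x' - y * y' \<in> Q"
proof -
  have "x * x' - y * y' = x' * (x - y) + y * (x' - y')" by (simp add: algebra_simps)
  then show ?thesis using rmod_add[OF assms(1)] rmod_mult[OF assms(1)] assms(2,3) by simp
qed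

lemma cong_power: "rmod UNIV Q \<Longrightarrow> x - y \<in> Q \<Longrightarrow> x ^ n - y ^ n \<in> Q"
  by (induction n) (auto simp: rmod_0 intro: cong_mult)

lemma cong_prod:
  "rmod UNIV Q \<Longrightarrow> (\<And>i. i \<in> F \<Longrightarrow> f i - g i \<in> Q) \<Longrightarrow> prod f F - prod g F \<in> Q"
  by (induction F rule: infinite_finite_induct) (auto simp: rmod_0 intro: cong_mult)

lemma rspan_graded_power:
  assumes "rmod UNIV Q" "meval a t \<in> rspan UNIV (Q \<union> meval a ` {s. set_mset s \<subseteq> {..<n} \<and> e \<le> wt w s})"
  shows "meval a t ^ m \<in> rspan UNIV (Q \<union> meval a ` {s. set_mset s \<subseteq> {..<n} \<and> m * e \<le> wt w s})"
proof (induction m)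
  case 0
  have "meval a {#} \<in> meval a ` {s. set_mset s \<subseteq> {..<n} \<and> 0 * e \<le> wt w s}" by (rule imageI) simp
  then show ?case by (intro rspan_base) auto
next
  case (Suc m)
  let ?S = "\<lambda>k. rspan UNIV (Q \<union> meval a ` {s. set_mset s \<subseteq> {..<n} \<and> k \<le> wt w s})"
  have Q: "x \<in> ?S k" if "x \<in> Q" for x k using that by (intro rspan_base) auto
  have "meval a t * meval a t ^ m \<in> ?S (Suc m * e)"
  proof (rule rspan_mult[OF rsub_UNIV assms(2) Suc _ rspan_rmod[OF rsub_UNIV]])
    fix v u assume v: "v \<in> Q \<union> meval a ` {s. set_mset s \<subseteq> {..<n} \<and> e \<le> wt w s}"
      and u: "u \<in> Q \<union> meval a ` {s. set_mset s \<subseteq> {..<n} \<and> m * e \<le> wt w s}"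
    show "v * u \<in> ?S (Suc m * e)"
    proof (cases "v \<in> Q \<or> u \<in> Q")
      case True
      then have "v * u \<in> Q" using rmod_mult[OF assms(1)] rmod_mult2[OF assms(1)] by auto
      then show ?thesis by (rule Q)
    next
      case False
      then obtain s s' where "set_mset s \<subseteq> {..<n}" "e \<le> wt w s" "v = meval a s"
        "set_mset s' \<subseteq> {..<n}" "m * e \<le> wt w s'" "u = meval a s'" using v u by auto
      then have "v * u = meval a (s + s')" "set_mset (s + s') \<subseteq> {..<n}" "Suc m * e \<le> wt w (s + s')"
        by auto
      then show ?thesis by (intro rspan_base[OF rsub_UNIV]) blast
    qed
  qed
  then show ?case by simp
qed

text \<open>The elements \<open>c j = a j ^ N j - b\<close> below, with \<open>N j = N / w j\<close> and \<open>b = a (n-1) ^ N (n-1)\<close>, make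
  every monomial of weight \<open>N k\<close> congruent to \<open>b ^ k\<close>. A relation whose trailing monomial has the least
  weight therefore says that \<open>b\<close> vanishes wherever they do, so that \<open>n - 1\<close> elements cut out a prime of
  height at least \<open>n\<close>.\<close>

lemma exists_subm_disjoint:
  fixes I0 :: "'a::comm_ring_1 set"
  assumes noeth: "noeth UNIV I0" and I0: "rmod UNIV I0" and ht: "ht_ge I0 n P" and "0 < n"
    and r: "monomial_ordering r"
  shows "\<exists>a. subm r UNIV n a \<inter> I0 = {}"
proof -
  obtain a where a: "\<And>i. i < n \<Longrightarrow> a i \<in> P"
    "\<And>Q. rprime UNIV Q \<Longrightarrow> I0 \<union> a ` {..<n} \<subseteq> Q \<Longrightarrow> ht_ge I0 n Q"
    using exists_parameters[OF noeth I0 ht] by metis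
  have P: "rprime UNIV P" "I0 \<union> a ` {..<n} \<subseteq> P" using ht_geD[OF ht] a(1) by auto
  obtain P1 where P1: "rprime UNIV P1" "I0 \<union> a ` {..<n} \<subseteq> P1"
    and min: "\<And>Q. rprime UNIV Q \<Longrightarrow> I0 \<union> a ` {..<n} \<subseteq> Q \<Longrightarrow> Q \<subseteq> P1 \<Longrightarrow> Q = P1"
    by (rule exists_minimal_prime[OF noeth Un_upper1 P]) (rule that)
  have ht1: "ht_ge I0 n P1" using a(2)[OF P1] .
  have "subm r UNIV n a \<inter> I0 = {}"
  proof (rule ccontr)
    assume "subm r UNIV n a \<inter> I0 \<noteq> {}"
    then obtain t0 y where t0: "set_mset t0 \<subseteq> {..<n}" "meval a t0 + y \<in> I0"
      and y: "y \<in> rspan UNIV (meval a ` above r n t0)"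
      by (auto simp: subm_def)
    obtain F where F: "finite F" "F \<subseteq> above r n t0"
      "y \<in> rspan UNIV (meval a ` F)" by (rule rspan_image_finite[OF y])
    obtain w where w: "\<And>i. i < n \<Longrightarrow> 0 < w i" "\<And>t. t \<in> F \<Longrightarrow> wt w t0 < wt w t"
      using exists_weights[OF r F(1) t0(1)] F(2) by blast
    define N where "N = (\<Prod>i<n. w i)"
    define Nq where "Nq j = (\<Prod>i\<in>{..<n} - {j}. w i)" for j
    have N: "N = w j * Nq j" if "j < n" for j
      unfolding N_def Nq_def using that by (intro prod.remove) auto
    have Nqpos: "0 < Nq j" for j unfolding Nq_def using w(1) by (intro prod_pos) auto
    have Npos: "0 < N" unfolding N_def using w(1) by (intro prod_pos) auto
    define b where "b = a (n - 1) ^ Nq (n - 1)"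
    define c where "c j = a j ^ Nq j - b" for j
    have b1: "b \<in> P1"
    proof -
      have "a (n - 1) \<in> P1" using P1(2) \<open>0 < n\<close> by auto
      then show ?thesis unfolding b_def
        using Nqpos[of "n - 1"] rmod_mult2[OF rprime_rmod[OF P1(1)]]
        by (cases "Nq (n - 1)") auto
    qed
    have "minimal_over (I0 \<union> c ` {..<n - 1}) P1"
      unfolding minimal_over_def
    proof (intro conjI allI impI)
      show "rprime UNIV P1" by fact
      have "c j \<in> P1" if "j < n" for j
      proof -
        have "a j \<in> P1" using P1(2) that by auto
        then have "a j ^ Nq j \<in> P1" using Nqpos[of j] rmod_mult2[OF rprime_rmod[OF P1(1)]]
          by (cases "Nq j") auto
        then show ?thesis unfolding c_def using b1 rmod_diff[OF rsub_UNIV rprime_rmod[OF P1(1)]] by blast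
      qed
      then show "I0 \<union> c ` {..<n - 1} \<subseteq> P1" using P1(2) by auto
      fix Q assume Q': "rprime UNIV Q \<and> I0 \<union> c ` {..<n - 1} \<subseteq> Q \<and> Q \<subseteq> P1"
      then have Q: "rprime UNIV Q" "I0 \<subseteq> Q" "Q \<subseteq> P1" by auto
      note Qm = rprime_rmod[OF Q(1)]
      have cong: "a j ^ Nq j - b \<in> Q" if "j < n" for j
      proof (cases "j = n - 1")
        case True
        then show ?thesis by (simp add: b_def rmod_0[OF Qm])
      next
        case False
        then have "c j \<in> Q" using that Q' by auto
        then show ?thesis by (simp add: c_def)
      qed
      define p where "p = n + 1"
      define d where "d = wt w t0"
      have high: "meval a t \<in> rspan UNIV (insert (b ^ k) Q)"
        if t: "set_mset t \<subseteq> {..<n}" "N * (k + n) \<le> wt w t" for t k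
      proof -
        define q where "q j = count t j div Nq j" for j
        define s where "s j = count t j mod Nq j" for j
        have ct: "count t j = Nq j * q j + s j" for j by (simp add: q_def s_def)
        have "wt w t = (\<Sum>j<n. w j * count t j)" by (rule wt_eq_sum[OF t(1)])
        also have "\<dots> \<le> (\<Sum>j<n. N * (q j + 1))"
        proof (rule sum_mono)
          fix j assume "j \<in> {..<n}"
          have "count t j \<le> Nq j * (q j + 1)"
            using ct[of j] Nqpos[of j] mod_less_divisor[of "Nq j" "count t j"]
            unfolding s_def by (simp del: mult_div_mod_eq mod_less_divisor)
          then have "w j * count t j \<le> w j * (Nq j * (q j + 1))" by (rule mult_left_mono) simp
          also have "\<dots> = N * (q j + 1)" using N[of j] \<open>j \<in> {..<n}\<close> by (simp add: algebra_simps)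
          finally show "w j * count t j \<le> N * (q j + 1)" .
        qed
        also have "\<dots> = N * ((\<Sum>j<n. q j) + n)" 
          by (simp add: sum_distrib_left[symmetric] sum.distrib distrib_left mult.commute)
        finally have "N * (k + n) \<le> N * ((\<Sum>j<n. q j) + n)" using t(2) by (rule order_trans[rotated])
        then have kq: "k \<le> (\<Sum>j<n. q j)" using Npos by simp
        have "meval a t = (\<Prod>j<n. (a j ^ Nq j) ^ q j * a j ^ s j)"
          unfolding meval_eq_prod[OF t(1)] by (intro prod.cong) (auto simp: ct power_add power_mult)
        moreover have "(\<Prod>j<n. (a j ^ Nq j) ^ q j * a j ^ s j) - (\<Prod>j<n. b ^ q j * a j ^ s j) \<in> Q"
        proof (rule cong_prod[OF Qm])
          fix j assume "j \<in> {..<n}"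
          then show "(a j ^ Nq j) ^ q j * a j ^ s j - b ^ q j * a j ^ s j \<in> Q"
            by (intro cong_mult[OF Qm] cong_power[OF Qm] cong) (auto simp: rmod_0[OF Qm])
        qed
        moreover have "(\<Prod>j<n. b ^ q j * a j ^ s j) = b ^ (\<Sum>j<n. q j) * (\<Prod>j<n. a j ^ s j)"
          by (simp add: prod.distrib power_sum)
        moreover have "b ^ (\<Sum>j<n. q j) = b ^ ((\<Sum>j<n. q j) - k) * b ^ k"
          using kq by (simp add: power_add[symmetric])
        ultimately have "meval a t - (b ^ ((\<Sum>j<n. q j) - k) * (\<Prod>j<n. a j ^ s j)) * b ^ k \<in> Q"
          by (simp add: algebra_simps)
        then show ?thesis
          unfolding rspan_insert_iff[OF rsub_UNIV Qm]
          by (intro bexI[of _ "meval a t - (b ^ ((\<Sum>j<n. q j) - k) * (\<Prod>j<n. a j ^ s j)) * b ^ k"]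
              bexI[of _ "b ^ ((\<Sum>j<n. q j) - k) * (\<Prod>j<n. a j ^ s j)"]) auto
      qed
      have low: "meval a t0 ^ N - b ^ d \<in> Q"
      proof -
        have "meval a t0 ^ N = (\<Prod>j<n. (a j ^ Nq j) ^ (w j * count t0 j))"
          unfolding meval_eq_prod[OF t0(1)] prod_power_distrib
        proof (intro prod.cong refl)
          fix j assume "j \<in> {..<n}"
          then have "count t0 j * N = Nq j * (w j * count t0 j)"
            using N[of j] by (simp add: ac_simps)
          then show "(a j ^ count t0 j) ^ N = (a j ^ Nq j) ^ (w j * count t0 j)"
            by (metis power_mult)
        qed
        moreover have "(\<Prod>j<n. (a j ^ Nq j) ^ (w j * count t0 j)) - (\<Prod>j<n. b ^ (w j * count t0 j)) \<in> Q"
          by (intro cong_prod[OF Qm] cong_power[OF Qm] cong) auto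
        moreover have "(\<Prod>j<n. b ^ (w j * count t0 j)) = b ^ d"
          unfolding d_def wt_eq_sum[OF t0(1)] by (simp add: power_sum)
        ultimately show ?thesis by simp
      qed
      have "meval a t0 \<in> rspan UNIV (Q \<union> meval a ` {s. set_mset s \<subseteq> {..<n} \<and> d + 1 \<le> wt w s})" (is "_ \<in> ?M")
      proof -
        have "rspan UNIV (meval a ` F) \<subseteq> ?M" using F(2) w(2) by (intro rspan_mono) (auto simp: d_def Suc_le_eq)
        then have "y \<in> ?M" using F(3) by auto
        moreover have "meval a t0 + y \<in> ?M" using t0(2) Q(2) by (intro rspan_base) auto
        ultimately have "(meval a t0 + y) - y \<in> ?M" 
          by (intro rmod_diff[OF rsub_UNIV] rspan_rmod[OF rsub_UNIV])
        then show ?thesis by simp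
      qed
      then have "meval a t0 ^ (N * p) \<in>
          rspan UNIV (Q \<union> meval a ` {s. set_mset s \<subseteq> {..<n} \<and> (N * p) * (d + 1) \<le> wt w s})"
        by (rule rspan_graded_power[OF Qm])
      also have "\<dots> \<subseteq> rspan UNIV (insert (b ^ (d * p + 1)) Q)"
      proof (intro rspan_least rspan_rmod rsub_UNIV Un_least image_subsetI)
        show "Q \<subseteq> rspan UNIV (insert (b ^ (d * p + 1)) Q)"
          using rspan_superset[OF rsub_UNIV, of "insert (b ^ (d * p + 1)) Q"] by simp
        fix s assume "s \<in> {s. set_mset s \<subseteq> {..<n} \<and> (N * p) * (d + 1) \<le> wt w s}"
        moreover have "(N * p) * (d + 1) = N * ((d * p + 1) + n)" by (simp add: p_def algebra_simps)
        ultimately show "meval a s \<in> rspan UNIV (insert (b ^ (d * p + 1)) Q)" by (intro high) auto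
      qed
      finally obtain i u where i: "i \<in> Q" "meval a t0 ^ (N * p) = i + u * b ^ (d * p + 1)"
        unfolding rspan_insert_iff[OF rsub_UNIV Qm] by auto
      have "(meval a t0 ^ N) ^ p - (b ^ d) ^ p \<in> Q" by (rule cong_power[OF Qm low])
      then have "i + u * b ^ (d * p + 1) - b ^ (d * p) \<in> Q"
        unfolding power_mult[symmetric] i(2) .
      then have "i - (i + u * b ^ (d * p + 1) - b ^ (d * p)) \<in> Q"
        using i(1) rmod_diff[OF rsub_UNIV Qm] by blast
      then have "b ^ (d * p) * (1 - u * b) \<in> Q" by (simp add: algebra_simps)
      moreover have "1 - u * b \<notin> Q"
      proof
        assume "1 - u * b \<in> Q"
        then have "(1 - u * b) + u * b \<in> P1"
          using Q(3) b1 rprime_rmod[OF P1(1)] by (intro rmod_add rmod_mult) auto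
        then show False using rprime_1[OF P1(1)] by simp
      qed
      ultimately have "b ^ (d * p) \<in> Q" using rprime_mult[OF Q(1)] by auto
      then have bQ: "b \<in> Q" using rprime_power[OF Q(1)] by simp
      have "a j \<in> Q" if "j < n" for j
      proof -
        have "a j ^ Nq j \<in> Q" using cong[OF that] bQ rmod_diff_cancel[OF rsub_UNIV Qm] by blast
        then show ?thesis using rprime_power[OF Q(1)] by simp
      qed
      then have "I0 \<union> a ` {..<n} \<subseteq> Q" using Q(2) by auto
      then show "Q = P1" by (rule min[OF Q(1) _ Q(3)])
    qed
    moreover have "card (c ` {..<n - 1}) \<le> n - 1" using card_image_le[of "{..<n - 1}" c] by simp
    ultimately have "\<not> ht_ge I0 (Suc (n - 1)) P1" using height_theorem[OF noeth] by blast
    then show False using ht1 \<open>0 < n\<close> by simp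
  qed
  then show ?thesis by (intro exI[of _ a])
qed

definition polyring :: "'a::comm_ring_1 set \<Rightarrow> nat \<Rightarrow> (nat \<Rightarrow> 'a) \<Rightarrow> 'a set" where
  "polyring R n a = rspan R (meval a ` monomials n)"

lemma submI:
  "set_mset t0 \<subseteq> {..<n} \<Longrightarrow>
    y \<in> rspan R (meval a ` above r n t0) \<Longrightarrow>
    meval a t0 + y \<in> subm r R n a"
  by (auto simp: subm_def)

lemma meval_subm: "set_mset t \<subseteq> {..<n} \<Longrightarrow> meval a t \<in> subm r R n a"
  using submI[of t n 0] by (simp add: rspan.zero)

lemma subm_mono: "m \<le> n \<Longrightarrow> subm r R m a \<subseteq> subm r R n a"
proof
  fix x assume "m \<le> n" "x \<in> subm r R m a"
  then obtain t y where ty: "set_mset t \<subseteq> {..<m}" "x = meval a t + y"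
    "y \<in> rspan R (meval a ` above r m t)" by (auto simp: subm_def)
  have "y \<in> rspan R (meval a ` above r n t)"
    by (rule subsetD[OF rspan_mono[OF image_mono] ty(3)]) (use \<open>m \<le> n\<close> in auto)
  then show "x \<in> subm r R n a" unfolding ty(2) using ty(1) \<open>m \<le> n\<close> by (intro submI) auto
qed

lemma mulset_subm:
  assumes r: "monomial_ordering r" and R: "rsub R"
  shows "mulset (subm r R n a)"
  unfolding mulset_def
proof (intro conjI ballI)
  show "1 \<in> subm r R n a" using meval_subm[of "{#}" n a r R] by simp
next
  fix x x' assume "x \<in> subm r R n a" "x' \<in> subm r R n a"
  then obtain t y t' y' where x: "set_mset t \<subseteq> {..<n}" "x = meval a t + y"
      "y \<in> rspan R (meval a ` above r n t)"
    and x': "set_mset t' \<subseteq> {..<n}" "x' = meval a t' + y'"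
      "y' \<in> rspan R (meval a ` {s. set_mset s \<subseteq> {..<n} \<and> (t', s) \<in> r \<and> s \<noteq> t'})"
    by (auto simp: subm_def)
  let ?M = "rspan R (meval a ` {s. set_mset s \<subseteq> {..<n} \<and> (t + t', s) \<in> r \<and> s \<noteq> t + t'})"
  have M: "rmod R ?M" by (rule rspan_rmod[OF R])
  have prod: "meval a s * meval a s' \<in> ?M"
    if "set_mset s \<subseteq> {..<n}" "set_mset s' \<subseteq> {..<n}" "(t, s) \<in> r" "(t', s') \<in> r" "t \<noteq> s \<or> t' \<noteq> s'" for s s'
  proof -
    have "s + s' \<in> {s. set_mset s \<subseteq> {..<n} \<and> (t + t', s) \<in> r \<and> s \<noteq> t + t'}"
      using mono_ord_add_strict[OF r that(3,4,5)] that by auto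
    then have "meval a (s + s') \<in> ?M" by (intro rspan_base[OF R] imageI)
    then show ?thesis by simp
  qed
  have refl: "(s, s) \<in> r" for s by (rule mono_ordD(1)[OF r])
  have t: "meval a t \<in> rspan R {meval a t}" "meval a t' \<in> rspan R {meval a t'}"
    by (auto intro: rspan_base[OF R])
  have "meval a t * y' \<in> ?M"
    by (rule rspan_mult[OF R t(1) x'(3) _ M]) (use prod x refl in auto)
  moreover have "y * meval a t' \<in> ?M"
    by (rule rspan_mult[OF R x(3) t(2) _ M]) (use prod x' refl in auto)
  moreover have "y * y' \<in> ?M"
    by (rule rspan_mult[OF R x(3) x'(3) _ M]) (use prod in auto)
  ultimately have rest: "meval a t * y' + y * meval a t' + y * y' \<in> ?M" by (intro rmod_add[OF M])
  have eq: "x * x' = meval a (t + t') + (meval a t * y' + y * meval a t' + y * y')"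
    unfolding x(2) x'(2) by (simp add: algebra_simps)
  have "set_mset (t + t') \<subseteq> {..<n}" using x(1) x'(1) by simp
  then show "x * x' \<in> subm r R n a" unfolding eq by (rule submI[OF _ rest])
qed

lemma exists_prime_subm_disjoint:
  assumes "monomial_ordering r" "rsub R" "rmod UNIV I" "subm r R n a \<inter> I = {}"
  obtains Q where "rprime UNIV Q" "I \<subseteq> Q" "subm r R n a \<inter> Q = {}"
proof -
  have m: "mulset (subm r R n a)" by (rule mulset_subm[OF assms(1,2)])
  have "\<exists>P. rprime UNIV P \<and> I \<subseteq> P \<and> P \<inter> subm r R n a = {}"
    by (rule exists_prime_avoiding[of UNIV I "subm r R n a"])
      (use assms m in \<open>auto simp: mulset_def\<close>)
  then show thesis using that by blast
qed

lemma exists_prime_above: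
  assumes "rmod UNIV I" "1 \<notin> I"
  obtains Q where "rprime UNIV Q" "I \<subseteq> Q"
proof -
  have "\<exists>P. rprime UNIV P \<and> I \<subseteq> P \<and> P \<inter> {1} = {}"
    by (rule exists_prime_avoiding[of UNIV I "{1}"]) (use assms in auto)
  then show thesis using that by blast
qed

lemma lenb_power:
  assumes "rmod UNIV Q" "lenb R {1} (rspan UNIV (insert x Q)) UNIV l" "rsub R"
  shows "lenb R {1} (rspan UNIV (insert (x ^ N) Q)) UNIV (N * l)"
proof (induction N)
  case 0
  have "rspan UNIV (insert 1 Q) = UNIV"
    by (rule rmod_eq_UNIV[OF rspan_rmod[OF rsub_UNIV]]) (simp add: rspan_base)
  then show ?case using lenb_self by simp
next
  case (Suc N)
  let ?I = "rspan UNIV (insert (x ^ Suc N) Q)"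
  let ?K = "rspan UNIV (insert (x ^ N) ?I)"
  note Im = rspan_rmod[OF rsub_UNIV, of "insert (x ^ Suc N) Q"]
  have Is: "x ^ Suc N \<in> ?I" "Q \<subseteq> ?I" using rspan_superset[OF rsub_UNIV, of "insert (x ^ Suc N) Q"] by auto
  have "insert x Q \<subseteq> colon ?I (x ^ N)"
    using Is rmod_mult2[OF assms(1)] by (auto simp: colon_def)
  then have "rspan UNIV (insert x Q) \<subseteq> colon ?I (x ^ N)" by (rule rspan_least[OF colon_rmod[OF Im]])
  then have "lenb R {1} (colon ?I (x ^ N)) UNIV l" using lenb_mono[OF assms(2)] by auto
  then have 1: "lenb R {1} ?I ?K l"
    using lenb_colon[OF _ Im assms(3) mulset_1] rsub_1[OF assms(3)] by fastforce
  have "rspan UNIV (insert (x ^ N) Q) \<subseteq> ?K" using Is by (intro rspan_mono) auto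
  then have 2: "lenb R {1} ?K UNIV (N * l)" using lenb_mono[OF Suc] by auto
  have K: "rsat R {1} ?K"
    using rspan_rmod[OF rsub_UNIV, of "insert (x ^ N) ?I"] by (auto simp: rsat_def intro: rmod_mono)
  have IK: "?I \<subseteq> ?K" using rspan_superset[OF rsub_UNIV, of "insert (x ^ N) ?I"] by simp
  have "lenb R {1} ?I UNIV (l + N * l)"
    by (rule lenb_trans[OF 1 2 K rsat_UNIV IK _ assms(3) mulset_1]) (use rsub_1[OF assms(3)] in auto)
  then show ?case by simp
qed

text \<open>If \<open>a i\<close> and \<open>a j\<close> satisfy no submonic relation, the modules spanned by the monomials from \<open>t\<close>
  onwards strictly decrease with \<open>t\<close>. There are about \<open>N\<^sup>2\<close> monomials below \<open>a i ^ N\<close>, but modulo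
  \<open>a i ^ N\<close> only linearly many steps are possible.\<close>

lemma no_relation_infinite_length:
  assumes r: "monomial_ordering r" and R: "rsub R" and Q: "rprime UNIV Q"
    and gen: "polyring R 2 a = UNIV" and ij: "i < 2" "j < 2" "i \<noteq> j" "({#j#}, {#i#}) \<in> r"
    and no: "subm r R 2 a \<inter> Q = {}"
  shows "\<not> lenb R {1} (rspan UNIV (insert (a i) Q)) UNIV l"
proof
  assume l: "lenb R {1} (rspan UNIV (insert (a i) Q)) UNIV l"
  define K where "K = 2 * l + 2"
  define N where "N = 2 * K"
  note Qm = rprime_rmod[OF Q]
  have QmR: "rmod R Q" by (rule rmod_mono[OF Qm]) simp
  define g where "g = (\<lambda>(p, q). replicate_mset p i + replicate_mset q j :: nat multiset)"
  define U where "U = g ` ({..<K} \<times> {..<K})"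
  have "inj_on g ({..<K} \<times> {..<K})"
  proof (rule inj_onI, clarify)
    fix p q p' q' assume "g (p, q) = g (p', q')"
    then have "count (g (p, q)) i = count (g (p', q')) i" "count (g (p, q)) j = count (g (p', q')) j"
      by simp_all
    then show "p = p' \<and> q = q'" using ij(3) by (auto simp: g_def)
  qed
  then have cardU: "card U = K * K" by (simp add: U_def card_image)
  have Uover: "set_mset t \<subseteq> {..<2}" if "t \<in> U" for t
    using that ij by (auto simp: U_def g_def split: if_splits)
  have rep: "(replicate_mset q j, replicate_mset q i) \<in> r" for q
  proof (induction q)
    case (Suc q)
    then have "({#j#} + replicate_mset q j, {#i#} + replicate_mset q i) \<in> r"
      using mono_ordD(2)[OF r] mono_ordD(6)[OF r]
      by (metis ij(4) add.commute)
    then show ?case by simp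
  qed (simp add: mono_ordD(1)[OF r])
  have Ule: "(t, replicate_mset N i) \<in> r" if t: "t \<in> U" for t
  proof -
    obtain p q where pq: "p < K" "q < K" "t = replicate_mset p i + replicate_mset q j"
      using t by (auto simp: U_def g_def)
    have "(t, replicate_mset p i + replicate_mset q i) \<in> r"
      unfolding pq(3) by (rule mono_ordD(6)[OF r rep])
    moreover have "(replicate_mset p i + replicate_mset q i + {#},
        replicate_mset p i + replicate_mset q i + replicate_mset (N - (p + q)) i) \<in> r"
      by (intro mono_ordD(6)[OF r] mono_ordD(5)[OF r])
    moreover have "replicate_mset p i + replicate_mset q i + replicate_mset (N - (p + q)) i = replicate_mset N i"
      using pq by (auto simp: multiset_eq_iff N_def)
    ultimately show ?thesis using mono_ordD(2)[OF r] by simp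
  qed
  define M where "M t = rspan R (Q \<union> meval a ` {s. set_mset s \<subseteq> {..<2} \<and> (t, s) \<in> r})" for t
  have Manti: "M t' \<subseteq> M t" if "(t, t') \<in> r" for t t'
    unfolding M_def using mono_ordD(2)[OF r that] by (intro rspan_mono) auto
  have strict: "meval a t \<notin> M t'" if t: "set_mset t \<subseteq> {..<2}" "(t, t') \<in> r" "t \<noteq> t'" for t t'
  proof
    assume "meval a t \<in> M t'"
    then obtain q y where y: "q \<in> Q" "y \<in> rspan R (meval a ` {s. set_mset s \<subseteq> {..<2} \<and> (t', s) \<in> r})"
      "meval a t = q + y" unfolding M_def rspan_Un_iff[OF R QmR] by auto
    have "- y \<in> rspan R (meval a ` {s. set_mset s \<subseteq> {..<2} \<and> (t', s) \<in> r})"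
      using rmod_minus[OF R rspan_rmod[OF R] y(2)] .
    moreover have "{s. set_mset s \<subseteq> {..<2} \<and> (t', s) \<in> r} \<subseteq> above r 2 t"
      using mono_ordD(2)[OF r t(2)] mono_ordD(3)[OF r t(2)] t(3) by auto
    ultimately have "- y \<in> rspan R (meval a ` above r 2 t)"
      using rspan_mono[OF image_mono subset_refl] by blast
    then have "meval a t + - y \<in> subm r R 2 a" using t(1) by (intro submI)
    then show False using y no by auto
  qed
  have Mself: "meval a t \<in> M t" if "set_mset t \<subseteq> {..<2}" for t
    unfolding M_def using that mono_ordD(1)[OF r] by (intro rspan_base[OF R]) auto
  have "inj_on M U"
  proof (rule inj_onI)
    fix t t' assume "t \<in> U" "t' \<in> U" "M t = M t'"
    then show "t = t'"
      using strict[of t t'] strict[of t' t] Mself[of t] Mself[of t'] Uover mono_ordD(4)[OF r, of t t'] by auto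
  qed
  then have "card (M ` U) = K * K" using cardU by (simp add: card_image)
  moreover have "card (M ` U) \<le> Suc (N * l)"
  proof (rule lenb_power[OF Qm l R, of N, unfolded lenb_def, rule_format], intro conjI ballI)
    show "finite (M ` U)" by (simp add: U_def)
    fix L assume "L \<in> M ` U"
    then obtain t where t: "t \<in> U" "L = M t" by auto
    show "rsat R {1} L" unfolding t(2) M_def rsat_def using rspan_rmod[OF R] by simp
    show "rspan UNIV (insert (a i ^ N) Q) \<subseteq> L"
    proof
      fix x assume "x \<in> rspan UNIV (insert (a i ^ N) Q)"
      then obtain q u where q: "q \<in> Q" "x = q + u * a i ^ N"
        unfolding rspan_insert_iff[OF rsub_UNIV Qm] by auto
      have "u \<in> rspan R (meval a ` monomials 2)"
        using gen by (simp add: polyring_def)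
      moreover have "a i ^ N \<in> rspan R {meval a (replicate_mset N i)}"
        using rspan_base[OF R, of "meval a (replicate_mset N i)"] by simp
      ultimately have "u * a i ^ N \<in> M t"
      proof (rule rspan_mult[OF R])
        show "rmod R (M t)" unfolding M_def by (rule rspan_rmod[OF R])
        fix v w assume "v \<in> meval a ` monomials 2" "w \<in> {meval a (replicate_mset N i)}"
        then obtain s where s: "set_mset s \<subseteq> {..<2}" "v * w = meval a (replicate_mset N i + s)"
          by (auto simp: mult.commute)
        have "(replicate_mset N i + {#}, replicate_mset N i + s) \<in> r"
          by (intro mono_ordD(6)[OF r] mono_ordD(5)[OF r])
        then have "(t, replicate_mset N i + s) \<in> r" using mono_ordD(2)[OF r Ule[OF t(1)]] by simp
        then have "replicate_mset N i + s \<in> {s. set_mset s \<subseteq> {..<2} \<and> (t, s) \<in> r}"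
          using s ij by (auto split: if_splits)
        then show "v * w \<in> M t" unfolding M_def s(2) by (intro rspan_base[OF R] UnI2 imageI)
      qed
      moreover have "q \<in> M t" unfolding M_def using q by (intro rspan_base[OF R]) auto
      ultimately show "x \<in> L" unfolding q(2) t(2) M_def by (intro rspan_add)
    qed
  next
    fix L L' assume "L \<in> M ` U" "L' \<in> M ` U"
    then show "L \<subseteq> L' \<or> L' \<subseteq> L" using Manti mono_ordD(4)[OF r] by (metis imageE)
  qed auto
  ultimately have "K * K \<le> Suc (2 * K * l)" by (simp add: N_def)
  moreover have "K * K = 2 * K * l + 2 * K" by (simp add: K_def algebra_simps)
  ultimately show False by (simp add: K_def)
qed

lemma monomial_ordering_pair:
  assumes "monomial_ordering r"
  obtains i j :: nat where "i < 2" "j < 2" "i \<noteq> j" "({#j#}, {#i#}) \<in> r"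
proof (cases "({#0#}, {#1#}) \<in> r")
  case True
  then show ?thesis using that[of 1 0] by simp
next
  case False
  then show ?thesis using that[of 0 1] mono_ordD(4)[OF assms, of "{#0#}" "{#1#}"] by simp
qed

lemma maximal_lenb:
  assumes P: "rprime UNIV P" and max: "\<And>Q. rprime UNIV Q \<Longrightarrow> P \<subseteq> Q \<Longrightarrow> Q = P"
  shows "lenb UNIV {1} P UNIV 1"
proof (rule lenb_le1)
  fix L assume L: "rsat UNIV {1} L" "P \<subseteq> L"
  show "L = P \<or> L = UNIV"
  proof (rule disjCI)
    assume "L \<noteq> UNIV"
    then have "1 \<notin> L" using rmod_eq_UNIV[OF rsat_rmod[OF L(1)]] by auto
    then obtain Q where "rprime UNIV Q" "L \<subseteq> Q" using exists_prime_above[OF rsat_rmod[OF L(1)]] by metis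
    then show "L = P" using max[of Q] L(2) by auto
  qed
qed

lemma no_relation_chain2:
  assumes noeth: "noeth UNIV I" and I: "rmod UNIV I" and r: "monomial_ordering r"
    and no: "subm r UNIV 2 a \<inter> I = {}"
  shows "\<exists>Q0 Q1 Q2. rprime UNIV Q0 \<and> rprime UNIV Q1 \<and> rprime UNIV Q2 \<and> I \<subseteq> Q0 \<and> Q0 \<subset> Q1 \<and> Q1 \<subset> Q2"
proof (rule ccontr)
  assume none: "\<not> ?thesis"
  obtain Q where Q: "rprime UNIV Q" "I \<subseteq> Q" "subm r UNIV 2 a \<inter> Q = {}"
    using exists_prime_subm_disjoint[OF r rsub_UNIV I no] by metis
  obtain i j :: nat where ij: "i < 2" "j < 2" "i \<noteq> j" "({#j#}, {#i#}) \<in> r"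
    using monomial_ordering_pair[OF r] by metis
  have ai: "a i \<notin> Q" using meval_subm[of "{#i#}" 2 a r UNIV] ij Q(3) by auto
  have "polyring UNIV 2 a = UNIV"
    unfolding polyring_def
  proof (rule rmod_eq_UNIV[OF rspan_rmod[OF rsub_UNIV]])
    have "meval a {#} \<in> rspan UNIV (meval a ` monomials 2)"
      by (intro rspan_base[OF rsub_UNIV] imageI) simp
    then show "1 \<in> rspan UNIV (meval a ` monomials 2)" by simp
  qed
  moreover have "\<exists>l. lenb UNIV {1} (rspan UNIV (insert (a i) Q)) UNIV l"
  proof (rule finite_length)
    have sub: "insert (a i) Q \<subseteq> rspan UNIV (insert (a i) Q)" by (rule rspan_superset[OF rsub_UNIV])
    then show "noeth UNIV (rspan UNIV (insert (a i) Q))" using noeth_mono[OF noeth] Q(2) by auto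
    fix P assume P: "rprime UNIV P" "rspan UNIV (insert (a i) Q) \<subseteq> P"
    then have "Q \<subset> P" using sub ai by auto
    then have "P' = P" if "rprime UNIV P'" "P \<subseteq> P'" for P'
      using none that P(1) Q by blast
    then show "\<exists>n. lenb UNIV {1} P UNIV n" using maximal_lenb[OF P(1)] by blast
  qed (auto simp: rspan_rmod)
  ultimately show False using no_relation_infinite_length[OF r rsub_UNIV Q(1) _ ij Q(3)] by blast
qed

lemma no_relation_chain1:
  assumes I: "rmod UNIV I" and r: "monomial_ordering r" and no: "subm r UNIV 1 a \<inter> I = {}"
  shows "\<exists>Q0 Q1. rprime UNIV Q0 \<and> rprime UNIV Q1 \<and> I \<subseteq> Q0 \<and> Q0 \<subset> Q1"
proof -
  obtain Q where Q: "rprime UNIV Q" "I \<subseteq> Q" "subm r UNIV 1 a \<inter> Q = {}"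
    using exists_prime_subm_disjoint[OF r rsub_UNIV I no] by metis
  have a0: "a 0 \<notin> Q" using meval_subm[of "{#0#}" 1 a r UNIV] Q(3) by auto
  let ?I = "rspan UNIV (insert (a 0) Q)"
  have "1 \<notin> ?I"
  proof
    assume "1 \<in> ?I"
    then obtain q u where q: "q \<in> Q" "1 = q + u * a 0"
      unfolding rspan_insert_iff[OF rsub_UNIV rprime_rmod[OF Q(1)]] by auto
    have "{#0#} \<in> {t. set_mset t \<subseteq> {..<1} \<and> ({#}, t) \<in> r \<and> t \<noteq> {#}}"
      using mono_ordD(5)[OF r] by auto
    then have "meval a {#0#} \<in> rspan UNIV (meval a ` {t. set_mset t \<subseteq> {..<1} \<and> ({#}, t) \<in> r \<and> t \<noteq> {#}})"
      by (intro rspan_base[OF rsub_UNIV] imageI)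
    then have "- u * meval a {#0#} \<in> rspan UNIV (meval a ` {t. set_mset t \<subseteq> {..<1} \<and> ({#}, t) \<in> r \<and> t \<noteq> {#}})"
      by (intro rspan_scale[OF rsub_UNIV]) auto
    then have "meval a {#} + - u * meval a {#0#} \<in> subm r UNIV 1 a" by (intro submI) auto
    moreover have "meval a {#} + - u * meval a {#0#} = q" using q(2) by (simp add: algebra_simps)
    ultimately show False using q(1) Q(3) by auto
  qed
  then obtain P where "rprime UNIV P" "?I \<subseteq> P" using exists_prime_above[OF rspan_rmod[OF rsub_UNIV]] by metis
  moreover have "insert (a 0) Q \<subseteq> ?I" by (rule rspan_superset[OF rsub_UNIV])
  ultimately show ?thesis using Q a0 by blast
qed

lemma rsub_polyring: assumes R: "rsub R" shows "rsub (polyring R n a)"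
  unfolding rsub_def
proof (intro conjI ballI)
  note M = rspan_rmod[OF R, of "meval a ` monomials n"]
  have "meval a {#} \<in> polyring R n a"
    unfolding polyring_def by (intro rspan_base[OF R] imageI) simp
  then show "1 \<in> polyring R n a" by simp
  fix x y assume xy: "x \<in> polyring R n a" "y \<in> polyring R n a"
  then show "x - y \<in> polyring R n a" unfolding polyring_def by (rule rmod_diff[OF R M])
  show "x * y \<in> polyring R n a"
    using xy unfolding polyring_def
  proof (rule rspan_mult[OF R _ _ _ M])
    fix v w assume "v \<in> meval a ` monomials n" "w \<in> meval a ` monomials n"
    then obtain s t where st: "set_mset s \<subseteq> {..<n}" "set_mset t \<subseteq> {..<n}" "v * w = meval a (s + t)" by auto
    show "v * w \<in> rspan R (meval a ` monomials n)"
      unfolding st(3) by (intro rspan_base[OF R] imageI) (use st in auto)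
  qed
qed

lemma polyring_base: "rsub R \<Longrightarrow> R \<subseteq> polyring R n a"
proof
  fix x assume R: "rsub R" and x: "x \<in> R"
  have "meval a {#} \<in> polyring R n a"
    unfolding polyring_def by (intro rspan_base[OF R] imageI) simp
  then have "x * meval a {#} \<in> polyring R n a"
    unfolding polyring_def by (rule rspan_scale[OF R _ x])
  then show "x \<in> polyring R n a" by simp
qed

lemma meval_polyring: "rsub R \<Longrightarrow> set_mset t \<subseteq> {..<n} \<Longrightarrow> meval a t \<in> polyring R n a"
  unfolding polyring_def by (intro rspan_base imageI) auto

lemma polyring_var: "rsub R \<Longrightarrow> i < n \<Longrightarrow> a i \<in> polyring R n a"
  using meval_polyring[of R "{#i#}" n a] by simp

lemma meval_in_rsub:
  "rsub S \<Longrightarrow> (\<And>i. i \<in># t \<Longrightarrow> a i \<in> S) \<Longrightarrow> meval a t \<in> S"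
  by (induction t) (auto simp: rsub_1 rsub_mult)

lemma polyring_least:
  assumes "rsub S" "R \<subseteq> S" "\<And>i. i < n \<Longrightarrow> a i \<in> S"
  shows "polyring R n a \<subseteq> S"
  unfolding polyring_def
proof (rule rspan_least)
  show "rmod R S" using rmod_self[OF assms(1)] assms(2) by (rule rmod_mono)
  show "meval a ` monomials n \<subseteq> S"
    using assms by (auto intro!: meval_in_rsub)
qed

section \<open>Lifting primes through finitely generated extensions\<close>

definition adj :: "'a::comm_ring_1 set \<Rightarrow> 'a \<Rightarrow> 'a set" where
  "adj B c = {poly p c | p. \<forall>i. coeff p i \<in> B}"

lemma adj_iff: "x \<in> adj B c \<longleftrightarrow> (\<exists>p. (\<forall>i. coeff p i \<in> B) \<and> x = poly p c)"
  by (auto simp: adj_def)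

lemma poly_in_rsub:
  assumes "rsub S" "\<And>i. coeff p i \<in> S" "c \<in> S"
  shows "poly p c \<in> S"
  unfolding poly_altdef using assms by (intro rsub_sum rsub_mult rsub_power) auto

lemma poly_in_ideal:
  assumes "rmod UNIV Q" "\<And>i. coeff p i \<in> Q"
  shows "poly p c \<in> Q"
  unfolding poly_altdef using assms(2) by (intro rmod_sum[OF assms(1)] rmod_mult2[OF assms(1)]) auto

lemma coeff_mult_in:
  "rsub B \<Longrightarrow> \<forall>i. coeff p i \<in> B \<Longrightarrow> \<forall>i. coeff p' i \<in> B \<Longrightarrow> coeff (p * p') i \<in> B"
  unfolding coeff_mult by (intro rsub_sum rsub_mult) auto

lemma rsub_adj: assumes B: "rsub B" shows "rsub (adj B c)"
  unfolding rsub_def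
proof (intro conjI ballI)
  show "1 \<in> adj B c" unfolding adj_iff using B by (intro exI[of _ 1]) (auto simp: coeff_1 rsub_intros)
  fix x y assume "x \<in> adj B c" "y \<in> adj B c"
  then obtain p p' where p: "\<forall>i. coeff p i \<in> B" "x = poly p c" "\<forall>i. coeff p' i \<in> B" "y = poly p' c"
    by (auto simp: adj_iff)
  show "x - y \<in> adj B c" unfolding adj_iff
    using p B by (intro exI[of _ "p - p'"]) (auto simp: rsub_diff)
  show "x * y \<in> adj B c" unfolding adj_iff
    using p coeff_mult_in[OF B p(1,3)] by (intro exI[of _ "p * p'"]) auto
qed

lemma coeff_const_in: "rsub B \<Longrightarrow> b \<in> B \<Longrightarrow> coeff [:b:] i \<in> B"
  by (cases i) (auto simp: coeff_pCons rsub_0)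

lemma adj_base: assumes "rsub B" shows "B \<subseteq> adj B c"
proof
  fix b assume "b \<in> B"
  then show "b \<in> adj B c" unfolding adj_iff using coeff_const_in[OF assms]
    by (intro exI[of _ "[:b:]"]) auto
qed

lemma adj_var: assumes "rsub B" shows "c \<in> adj B c"
  unfolding adj_iff using assms
  by (intro exI[of _ "[:0, 1:]"]) (auto simp: coeff_pCons rsub_intros split: nat.split)

lemma adj_least: "rsub S \<Longrightarrow> B \<subseteq> S \<Longrightarrow> c \<in> S \<Longrightarrow> adj B c \<subseteq> S"
  unfolding adj_iff subset_iff by (blast intro: poly_in_rsub)

lemma polyring_Suc:
  assumes R: "rsub R"
  shows "polyring R (Suc n) a = adj (polyring R n a) (a n)"
proof
  note P = rsub_polyring[OF R]
  show "polyring R (Suc n) a \<subseteq> adj (polyring R n a) (a n)"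
  proof (rule polyring_least[OF rsub_adj[OF P]])
    show "R \<subseteq> adj (polyring R n a) (a n)" using polyring_base[OF R] adj_base[OF P] by blast
    fix i assume "i < Suc n"
    then show "a i \<in> adj (polyring R n a) (a n)"
      using polyring_var[OF R, of i n a] adj_base[OF P] adj_var[OF P] by (cases "i = n") auto
  qed
  show "adj (polyring R n a) (a n) \<subseteq> polyring R (Suc n) a"
    by (intro adj_least P polyring_least polyring_base[OF R] polyring_var[OF R]) auto
qed

lemma polyring_0: "rsub R \<Longrightarrow> polyring R 0 a = R"
  using polyring_base[of R 0 a] polyring_least[of R R 0 a] by auto

lemma exists_poly:
  fixes e :: "nat \<Rightarrow> 'a::comm_ring_1"
  obtains p where "\<And>i. coeff p i = (if i < d then e i else 0)" "\<And>x. poly p x = (\<Sum>i<d. e i * x ^ i)"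
proof (rule that[of "\<Sum>j<d. monom (e j) j"])
  show "coeff (\<Sum>j<d. monom (e j) j) i = (if i < d then e i else 0)" for i
    by (simp add: coeff_sum)
  show "poly (\<Sum>j<d. monom (e j) j) x = (\<Sum>i<d. e i * x ^ i)" for x
    by (simp add: poly_sum poly_monom)
qed

lemma coeff_top_exists:
  assumes "0 \<in> P" "coeff p k \<notin> P"
  obtains d where "coeff p d \<notin> P" "\<And>i. d < i \<Longrightarrow> coeff p i \<in> P"
proof -
  let ?S = "{i. coeff p i \<notin> P}"
  have "?S \<subseteq> {..degree p}" using assms(1) by (auto intro: le_degree)
  then have fin: "finite ?S" by (rule finite_subset) simp
  have "Max ?S \<in> ?S" using fin assms(2) by (intro Max_in) auto
  then have "coeff p (Max ?S) \<notin> P" by blast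
  moreover have "coeff p i \<in> P" if "Max ?S < i" for i
    using Max_ge[OF fin, of i] that by (meson mem_Collect_eq not_le)
  ultimately show thesis by (rule that)
qed

lemma coeff_top_mult:
  assumes P: "rprime B P" and B: "\<forall>i. coeff p i \<in> B" "\<forall>i. coeff p' i \<in> B"
    and d: "coeff p d \<notin> P" "\<And>i. d < i \<Longrightarrow> coeff p i \<in> P"
    and e: "coeff p' e \<notin> P" "\<And>i. e < i \<Longrightarrow> coeff p' i \<in> P" and "rsub B"
  shows "coeff (p * p') (d + e) \<notin> P"
proof
  note Pm = rprime_rmod[OF P]
  assume *: "coeff (p * p') (d + e) \<in> P"
  have "coeff (p * p') (d + e) = (\<Sum>i\<in>{..d + e} - {d}. coeff p i * coeff p' (d + e - i)) + coeff p d * coeff p' e"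
    unfolding coeff_mult by (subst sum.remove[of _ d]) (auto simp: add.commute)
  moreover have "(\<Sum>i\<in>{..d + e} - {d}. coeff p i * coeff p' (d + e - i)) \<in> P"
  proof (rule rmod_sum[OF Pm])
    fix i assume "i \<in> {..d + e} - {d}"
    then have "d < i \<or> e < d + e - i" by auto
    then show "coeff p i * coeff p' (d + e - i) \<in> P"
      using d(2) e(2) B rmod_mult[OF Pm] rmod_mult2[OF Pm] by auto
  qed
  ultimately have "coeff p d * coeff p' e \<in> P"
    using * rmod_diff[OF assms(8) Pm, of "coeff (p * p') (d + e)"] by fastforce
  then show False using rprime_mult[OF P] B d(1) e(1) by blast
qed

lemma coeff_mult_prime:
  assumes P: "rprime B P" and B: "\<forall>i. coeff p i \<in> B" "\<forall>i. coeff p' i \<in> B" "rsub B"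
    and "\<And>i. coeff (p * p') i \<in> P"
  shows "(\<forall>i. coeff p i \<in> P) \<or> (\<forall>i. coeff p' i \<in> P)"
proof (rule ccontr)
  have 0: "0 \<in> P" by (rule rmod_0[OF rprime_rmod[OF P]])
  assume "\<not> ?thesis"
  then obtain k k' where "coeff p k \<notin> P" "coeff p' k' \<notin> P" by auto
  then obtain d e where "coeff p d \<notin> P" "\<And>i. d < i \<Longrightarrow> coeff p i \<in> P"
    "coeff p' e \<notin> P" "\<And>i. e < i \<Longrightarrow> coeff p' i \<in> P"
    using coeff_top_exists[OF 0] by metis
  then show False using coeff_top_mult[OF P B(1,2)] assms(5) B(3) by blast
qed

definition alg :: "'a::comm_ring_1 set \<Rightarrow> 'a set \<Rightarrow> 'a \<Rightarrow> bool" where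
  "alg B q h \<longleftrightarrow> (\<exists>p. (\<forall>i. coeff p i \<in> B) \<and> (\<exists>i. coeff p i \<notin> q) \<and> poly p h \<in> q)"

lemma alg_constant_term:
  assumes q: "rprime UNIV q" and h: "h \<notin> q" and a: "alg B q h"
  obtains e p where "e \<in> B" "e \<notin> q" "\<forall>i. coeff p i \<in> B" "e + h * poly p h \<in> q"
proof -
  have "\<exists>e p'. e \<in> B \<and> e \<notin> q \<and> (\<forall>i. coeff p' i \<in> B) \<and> e + h * poly p' h \<in> q"
    if "\<forall>i. coeff p i \<in> B" "\<exists>i. coeff p i \<notin> q" "poly p h \<in> q" for p
    using that
  proof (induction p)
    case 0
    then show ?case using rmod_0[OF rprime_rmod[OF q]] by simp
  next
    case (pCons a p)
    have pB: "\<forall>i. coeff p i \<in> B"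
    proof
      fix i show "coeff p i \<in> B" using pCons.prems(1)[THEN spec, of "Suc i"] by simp
    qed
    have aB: "a \<in> B" using pCons.prems(1)[THEN spec, of 0] by simp
    show ?case
    proof (cases "a \<in> q")
      case False
      then show ?thesis using pCons.prems(3) pB aB by (intro exI[of _ a] exI[of _ p]) simp
    next
      case True
      have "a + h * poly p h \<in> q" using pCons.prems(3) by simp
      then have "h * poly p h \<in> q"
        using True rmod_diff[OF rsub_UNIV rprime_rmod[OF q], of "a + h * poly p h" a] by simp
      then have "poly p h \<in> q" using rprime_mult[OF q] h by auto
      moreover have "\<exists>i. coeff p i \<notin> q"
      proof -
        obtain i where i: "coeff (pCons a p) i \<notin> q" using pCons.prems(2) by auto
        then show ?thesis using True by (cases i) auto
      qed
      ultimately show ?thesis using pCons.IH pB by blast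
    qed
  qed
  then show thesis using a that unfolding alg_def by blast
qed

lemma linear_dependence:
  fixes f :: "'i \<Rightarrow> 'a::comm_ring_1"
  assumes "finite W" "finite U" "card W < card U" "\<And>i. i \<in> U \<Longrightarrow> f i \<in> rspan B (W \<union> q)"
    and B: "rsub B" and q: "rprime UNIV q"
  shows "\<exists>c. (\<forall>i\<in>U. c i \<in> B) \<and> (\<exists>i\<in>U. c i \<notin> q) \<and> (\<Sum>i\<in>U. c i * f i) \<in> q"
  using assms(1-4)
proof (induction W arbitrary: U f rule: finite_induct)
  case empty
  note qm = rprime_rmod[OF q]
  have "rmod B q" by (rule rmod_mono[OF qm]) simp
  then have "f i \<in> q" if "i \<in> U" for i using empty.prems(3)[OF that] rspan_least[of B q q] by auto
  then have "(\<Sum>i\<in>U. 1 * f i) \<in> q" by (auto intro: rmod_sum[OF qm])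
  moreover have "U \<noteq> {}" using empty.prems by auto
  ultimately show ?case using rprime_1[OF q] B by (intro exI[of _ "\<lambda>_. 1"]) (auto simp: rsub_1)
next
  case (insert w W)
  note qm = rprime_rmod[OF q]
  let ?S = "rspan B (W \<union> q)"
  have Sm: "rmod B ?S" by (rule rspan_rmod[OF B])
  have "\<exists>\<alpha> x. \<alpha> \<in> B \<and> x \<in> ?S \<and> f i = x + \<alpha> * w" if "i \<in> U" for i
  proof -
    have "W \<union> q \<subseteq> ?S" by (rule rspan_superset[OF B])
    then have "rspan B (insert w W \<union> q) \<subseteq> rspan B (insert w ?S)"
      by (intro rspan_mono) auto
    then have "f i \<in> rspan B (insert w ?S)" using insert.prems(3)[OF that] by auto
    then show ?thesis unfolding rspan_insert_iff[OF B Sm] by blast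
  qed
  then obtain \<alpha> x where ax: "\<And>i. i \<in> U \<Longrightarrow> \<alpha> i \<in> B" "\<And>i. i \<in> U \<Longrightarrow> x i \<in> ?S"
    "\<And>i. i \<in> U \<Longrightarrow> f i = x i + \<alpha> i * w" by metis
  show ?case
  proof (cases "\<forall>i\<in>U. \<alpha> i \<in> q")
    case True
    have "f i \<in> ?S" if "i \<in> U" for i
    proof -
      have "\<alpha> i * w \<in> q" using True that rmod_mult2[OF qm] by simp
      then have "\<alpha> i * w \<in> ?S" using rspan_superset[OF B, of "W \<union> q"] by auto
      then show ?thesis using ax that rmod_add[OF Sm] by simp
    qed
    then show ?thesis using insert by (intro insert.IH) auto
  next
    case False
    then obtain i0 where i0: "i0 \<in> U" "\<alpha> i0 \<notin> q" by auto
    define g where "g i = \<alpha> i0 * f i - \<alpha> i * f i0" for i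
    have g: "g i \<in> ?S" if "i \<in> U - {i0}" for i
    proof -
      have "g i = \<alpha> i0 * x i - \<alpha> i * x i0" using ax i0 that by (simp add: g_def algebra_simps)
      also have "\<dots> \<in> ?S" using ax i0 that by (intro rmod_diff[OF B Sm] rmod_mult[OF Sm]) auto
      finally show ?thesis .
    qed
    have "\<exists>c. (\<forall>i\<in>U - {i0}. c i \<in> B) \<and> (\<exists>i\<in>U - {i0}. c i \<notin> q) \<and> (\<Sum>i\<in>U - {i0}. c i * g i) \<in> q"
      by (rule insert.IH) (use insert i0 g in auto)
    then obtain c where c: "\<forall>i\<in>U - {i0}. c i \<in> B" "\<exists>i\<in>U - {i0}. c i \<notin> q"
      "(\<Sum>i\<in>U - {i0}. c i * g i) \<in> q" by auto
    define e where "e i = (if i = i0 then - (\<Sum>i\<in>U - {i0}. c i * \<alpha> i) else c i * \<alpha> i0)" for i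
    have "(\<Sum>i\<in>U. e i * f i) = e i0 * f i0 + (\<Sum>i\<in>U - {i0}. e i * f i)"
      using insert.prems i0 by (intro sum.remove) auto
    also have "(\<Sum>i\<in>U - {i0}. e i * f i) = (\<Sum>i\<in>U - {i0}. c i * \<alpha> i0 * f i)"
      by (intro sum.cong) (auto simp: e_def)
    also have "e i0 * f i0 + (\<Sum>i\<in>U - {i0}. c i * \<alpha> i0 * f i) = (\<Sum>i\<in>U - {i0}. c i * g i)"
    proof -
      have "c i * g i = c i * \<alpha> i0 * f i - c i * \<alpha> i * f i0" for i
        by (simp add: g_def right_diff_distrib mult.assoc)
      then show ?thesis by (simp add: e_def sum_subtractf sum_distrib_right)
    qed
    finally have "(\<Sum>i\<in>U. e i * f i) \<in> q" using c(3) by simp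
    moreover have "\<forall>i\<in>U. e i \<in> B"
      using c(1) ax i0 B by (auto simp: e_def intro!: rsub_minus rsub_sum rsub_mult)
    moreover have "\<exists>i\<in>U. e i \<notin> q"
    proof -
      obtain i where i: "i \<in> U" "i \<noteq> i0" "c i \<notin> q" using c(2) by auto
      then have "e i \<notin> q" using i0 rprime_mult[OF q, of "c i" "\<alpha> i0"] by (auto simp: e_def)
      then show ?thesis using i by auto
    qed
    ultimately show ?thesis by blast
  qed
qed

lemma finite_imp_alg:
  assumes B: "rsub B" and q: "rprime UNIV q" and W: "finite W" and s: "s \<in> B" "s \<notin> q"
    and h: "\<And>j. j \<le> card W \<Longrightarrow> s * h ^ j \<in> rspan B (W \<union> q)"
  shows "alg B q h"
proof -
  let ?d = "Suc (card W)"
  have "\<exists>e. (\<forall>i\<in>{..<?d}. e i \<in> B) \<and> (\<exists>i\<in>{..<?d}. e i \<notin> q) \<and> (\<Sum>i<?d. e i * (s * h ^ i)) \<in> q"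
    by (rule linear_dependence[OF W _ _ _ B q]) (simp_all add: h)
  then obtain e j where e: "\<forall>i\<in>{..<?d}. e i \<in> B" "j < ?d" "e j \<notin> q" "(\<Sum>i<?d. e i * (s * h ^ i)) \<in> q" by auto
  obtain p where p: "\<And>i. coeff p i = (if i < ?d then e i * s else 0)" "\<And>x. poly p x = (\<Sum>i<?d. e i * s * x ^ i)"
    by (rule exists_poly[of ?d "\<lambda>i. e i * s"]) blast
  have "\<forall>i. coeff p i \<in> B" using e(1) rsub_mult[OF B _ s(1)] rsub_0[OF B] by (simp add: p(1))
  moreover have "coeff p j \<notin> q" using e(2,3) s(2) rprime_mult[OF q, of "e j" s] by (auto simp: p(1))
  moreover have "poly p h \<in> q" using e(4) by (simp only: p(2) mult.assoc)
  ultimately show ?thesis unfolding alg_def by blast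
qed

lemma nakayama_generators:
  fixes u :: "'i \<Rightarrow> 'a::comm_ring_1"
  assumes "finite J" and B: "rsub B" and p: "rprime B p" and N: "rmod B N"
    and "\<And>j. j \<in> J \<Longrightarrow> \<exists>s\<in>B - p. s * u j \<in> rspan B (N \<union> {x * u i | x i. x \<in> p \<and> i \<in> J})"
  shows "\<exists>s\<in>B - p. \<forall>j\<in>J. s * u j \<in> N"
  using assms(1,5)
proof (induction J rule: finite_induct)
  case empty
  show ?case using rprime_1[OF p] rsub_1[OF B] by auto
next
  case (insert j0 J)
  note pm = rprime_rmod[OF p]
  let ?W = "rspan B (N \<union> {x * u i | x i. x \<in> p \<and> i \<in> J})"
  let ?K = "{y + x * u j0 | y x. y \<in> ?W \<and> x \<in> p}"
  note Wm = rspan_rmod[OF B, of "N \<union> {x * u i | x i. x \<in> p \<and> i \<in> J}"]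
  have pB: "p \<subseteq> B" by (rule rprime_sub[OF p])
  have "rmod B ?K"
    unfolding rmod_def
  proof (intro conjI ballI)
    show "0 \<in> ?K" using rmod_0[OF Wm] rmod_0[OF pm] by force
  next
    fix a b assume "a \<in> ?K" "b \<in> ?K"
    then obtain y x y' x' where "a = y + x * u j0" "b = y' + x' * u j0" "y \<in> ?W" "y' \<in> ?W" "x \<in> p" "x' \<in> p"
      by blast
    then have "a + b = (y + y') + (x + x') * u j0" "y + y' \<in> ?W" "x + x' \<in> p"
      by (simp add: distrib_right) (simp_all add: rmod_add[OF Wm] rmod_add[OF pm] \<open>y \<in> ?W\<close> \<open>y' \<in> ?W\<close> \<open>x \<in> p\<close> \<open>x' \<in> p\<close>)
    then show "a + b \<in> ?K" by blast
  next
    fix c a assume "c \<in> B" "a \<in> ?K"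
    then obtain y x where "a = y + x * u j0" "y \<in> ?W" "x \<in> p" by blast
    then have "c * a = c * y + (c * x) * u j0" by (simp add: distrib_left mult.assoc)
    moreover have "c * y \<in> ?W" "c * x \<in> p"
      using rmod_mult[OF Wm \<open>c \<in> B\<close> \<open>y \<in> ?W\<close>] rmod_mult[OF pm \<open>c \<in> B\<close> \<open>x \<in> p\<close>] by simp_all
    ultimately show "c * a \<in> ?K" by blast
  qed
  moreover have "N \<union> {x * u i | x i. x \<in> p \<and> i \<in> insert j0 J} \<subseteq> ?K"
  proof
    fix a assume "a \<in> N \<union> {x * u i | x i. x \<in> p \<and> i \<in> insert j0 J}"
    then consider "a \<in> ?W" | x where "x \<in> p" "a = x * u j0"
      using rspan_superset[OF B, of "N \<union> {x * u i | x i. x \<in> p \<and> i \<in> J}"] by blast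
    then show "a \<in> ?K"
    proof cases
      case 1
      moreover have "a = a + 0 * u j0" by simp
      ultimately show ?thesis using rmod_0[OF pm] by blast
    next
      case 2
      moreover have "a = 0 + x * u j0" using 2 by simp
      ultimately show ?thesis using rmod_0[OF Wm] by blast
    qed
  qed
  ultimately have K: "rspan B (N \<union> {x * u i | x i. x \<in> p \<and> i \<in> insert j0 J}) \<subseteq> ?K" by (rule rspan_least)
  obtain s0 y0 x0 where s0: "s0 \<in> B - p" "s0 * u j0 = y0 + x0 * u j0" "y0 \<in> ?W" "x0 \<in> p"
    using insert.prems[of j0] K by blast
  define t0 where "t0 = s0 - x0"
  have t0: "t0 \<in> B - p"
    using s0 pB rsub_diff[OF B, of s0 x0] rmod_add[OF pm, of t0 x0] by (auto simp: t0_def)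
  have t0u: "t0 * u j0 \<in> ?W" using s0 by (simp add: t0_def algebra_simps)
  have "\<exists>s\<in>B - p. \<forall>j\<in>J. s * u j \<in> N"
  proof (rule insert.IH)
    fix j assume "j \<in> J"
    then obtain s y x where s: "s \<in> B - p" "s * u j = y + x * u j0" "y \<in> ?W" "x \<in> p"
      using insert.prems[of j] K by blast
    have "(t0 * s) * u j = t0 * y + x * (t0 * u j0)"
      using s(2) by (simp add: mult.assoc) (simp add: algebra_simps)
    also have "\<dots> \<in> ?W"
      using s t0 t0u pB by (intro rmod_add[OF Wm rmod_mult[OF Wm] rmod_mult[OF Wm]]) auto
    finally have "(t0 * s) * u j \<in> ?W" .
    moreover have "t0 * s \<in> B - p"
      using t0 s rprime_mult[OF p, of t0 s] rsub_mult[OF B] by auto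
    ultimately show "\<exists>s\<in>B - p. s * u j \<in> ?W" by blast
  qed
  then obtain s where s: "s \<in> B - p" "\<And>j. j \<in> J \<Longrightarrow> s * u j \<in> N" by auto
  have "?W \<subseteq> colon N s"
  proof (rule rspan_least)
    show "rmod B (colon N s)" by (rule colon_rmod[OF N])
    show "N \<union> {x * u i | x i. x \<in> p \<and> i \<in> J} \<subseteq> colon N s"
    proof
      fix a assume "a \<in> N \<union> {x * u i | x i. x \<in> p \<and> i \<in> J}"
      then consider "a \<in> N" | x i where "a = x * u i" "x \<in> p" "i \<in> J" by blast
      then show "a \<in> colon N s"
      proof cases
        case 1
        then show ?thesis using s rmod_mult2[OF N] by (auto simp: colon_def)
      next
        case 2
        then have "a * s = x * (s * u i)" by (simp add: algebra_simps)
        moreover have "x * (s * u i) \<in> N" 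
          by (rule rmod_mult[OF N]) (use 2 s pB in auto)
        ultimately show ?thesis by (simp add: colon_def)
      qed
    qed
  qed
  then have "t0 * u j0 * s \<in> N" using t0u by (auto simp: colon_def)
  moreover have "s * t0 * u j \<in> N" if "j \<in> J" for j
    using rmod_mult[OF N, of t0 "s * u j"] s(2)[OF that] t0 by (simp add: algebra_simps)
  moreover have "t0 * u j0 * s = (s * t0) * u j0" by (simp add: mult.commute mult.left_commute)
  ultimately have "\<forall>j\<in>insert j0 J. (s * t0) * u j \<in> N" by simp
  moreover have "s * t0 \<in> B - p" using t0 s rprime_mult[OF p, of s t0] rsub_mult[OF B] by auto
  ultimately show ?case by blast
qed

definition generic_lifting :: "'a::comm_ring_1 set \<Rightarrow> 'a set \<Rightarrow> 'a set \<Rightarrow> bool" where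
  "generic_lifting q B C \<longleftrightarrow> (\<forall>h\<in>C - q. \<exists>g\<in>B - q. \<forall>p. rprime B p \<and> q \<inter> B \<subseteq> p \<and> g \<notin> p \<longrightarrow>
     (\<exists>Q. rprime C Q \<and> q \<inter> C \<subseteq> Q \<and> Q \<inter> B = p \<and> h \<notin> Q))"

lemma generic_liftingD:
  assumes "generic_lifting q B C" "h \<in> C" "h \<notin> q"
  obtains g where "g \<in> B" "g \<notin> q" "\<And>p. rprime B p \<Longrightarrow> q \<inter> B \<subseteq> p \<Longrightarrow> g \<notin> p \<Longrightarrow>
    \<exists>Q. rprime C Q \<and> q \<inter> C \<subseteq> Q \<and> Q \<inter> B = p \<and> h \<notin> Q"
  using assms unfolding generic_lifting_def by (metis DiffD1 DiffD2 DiffI)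

lemma generic_lifting_trans:
  assumes "generic_lifting q B C" "generic_lifting q C D" "B \<subseteq> C" "C \<subseteq> D"
  shows "generic_lifting q B D"
  unfolding generic_lifting_def
proof
  fix h assume h: "h \<in> D - q"
  obtain g where g: "g \<in> C" "g \<notin> q" "\<And>p. rprime C p \<Longrightarrow> q \<inter> C \<subseteq> p \<Longrightarrow> g \<notin> p \<Longrightarrow>
    \<exists>Q. rprime D Q \<and> q \<inter> D \<subseteq> Q \<and> Q \<inter> C = p \<and> h \<notin> Q"
    using generic_liftingD[OF assms(2), of h] h by blast
  obtain g' where g': "g' \<in> B" "g' \<notin> q" "\<And>p. rprime B p \<Longrightarrow> q \<inter> B \<subseteq> p \<Longrightarrow> g' \<notin> p \<Longrightarrow>
    \<exists>Q. rprime C Q \<and> q \<inter> C \<subseteq> Q \<and> Q \<inter> B = p \<and> g \<notin> Q"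
    using generic_liftingD[OF assms(1) g(1,2)] by blast
  have "\<exists>Q. rprime D Q \<and> q \<inter> D \<subseteq> Q \<and> Q \<inter> B = p \<and> h \<notin> Q"
    if p: "rprime B p" "q \<inter> B \<subseteq> p" "g' \<notin> p" for p
  proof -
    obtain Q where Q: "rprime C Q" "q \<inter> C \<subseteq> Q" "Q \<inter> B = p" "g \<notin> Q" using g'(3)[OF p] by blast
    obtain Q' where Q': "rprime D Q'" "q \<inter> D \<subseteq> Q'" "Q' \<inter> C = Q" "h \<notin> Q'"
      using g(3)[OF Q(1,2,4)] by blast
    have "Q' \<inter> B = p" using Q'(3) Q(3) assms(3) by blast
    then show ?thesis using Q' by blast
  qed
  then show "\<exists>g\<in>B - q. \<forall>p. rprime B p \<and> q \<inter> B \<subseteq> p \<and> g \<notin> p \<longrightarrow>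
     (\<exists>Q. rprime D Q \<and> q \<inter> D \<subseteq> Q \<and> Q \<inter> B = p \<and> h \<notin> Q)" using g' by blast
qed

lemma generic_lifting_transcendental:
  assumes B: "rsub B" and q: "rprime UNIV q" and na: "\<not> alg B q c"
  shows "generic_lifting q B (adj B c)"
  unfolding generic_lifting_def
proof
  let ?C = "adj B c"
  note C = rsub_adj[OF B, of c] and qm = rprime_rmod[OF q]
  have tr: "coeff p i \<in> q" if "\<forall>i. coeff p i \<in> B" "poly p c \<in> q" for p i
    using na that unfolding alg_def by blast
  fix h assume "h \<in> ?C - q"
  then obtain ph where ph: "\<forall>i. coeff ph i \<in> B" "h = poly ph c" "h \<notin> q" by (auto simp: adj_iff)
  have "\<exists>k. coeff ph k \<notin> q"
  proof (rule ccontr)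
    assume "\<nexists>k. coeff ph k \<notin> q"
    then have "poly ph c \<in> q"
      unfolding poly_altdef by (intro rmod_sum[OF qm] rmod_mult2[OF qm]) auto
    then show False using ph by simp
  qed
  then obtain k where k: "coeff ph k \<notin> q" ..
  show "\<exists>g\<in>B - q. \<forall>p. rprime B p \<and> q \<inter> B \<subseteq> p \<and> g \<notin> p \<longrightarrow>
     (\<exists>Q. rprime ?C Q \<and> q \<inter> ?C \<subseteq> Q \<and> Q \<inter> B = p \<and> h \<notin> Q)"
  proof (intro bexI[of _ "coeff ph k"] allI impI)
    show "coeff ph k \<in> B - q" using ph k by auto
    fix P assume P': "rprime B P \<and> q \<inter> B \<subseteq> P \<and> coeff ph k \<notin> P"
    then have P: "rprime B P" "q \<inter> B \<subseteq> P" "coeff ph k \<notin> P" by auto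
    note Pm = rprime_rmod[OF P(1)] and PB = rprime_sub[OF P(1)]
    define Q where "Q = {u \<in> ?C. \<exists>p. (\<forall>i. coeff p i \<in> P) \<and> u - poly p c \<in> q}"
    have key: "coeff p i \<in> P" if p: "\<forall>i. coeff p i \<in> B" "\<forall>i. coeff p' i \<in> P" "poly p c - poly p' c \<in> q" for p p' i
    proof -
      have "\<forall>i. coeff (p - p') i \<in> B" using p PB by (auto intro!: rsub_diff[OF B])
      then have "coeff (p - p') i \<in> q" "coeff (p - p') i \<in> B" using tr[of "p - p'"] p(3) by auto
      then have "coeff p i - coeff p' i \<in> P" using P(2) by auto
      then show ?thesis using rmod_diff_cancel[OF B Pm] p(2) by blast
    qed
    have "rmod ?C Q"
      unfolding rmod_def
    proof (intro conjI ballI)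
      show "0 \<in> Q" unfolding Q_def using rsub_0[OF C] rmod_0[OF Pm] rmod_0[OF qm]
        by (auto intro!: exI[of _ 0])
    next
      fix x y assume "x \<in> Q" "y \<in> Q"
      then obtain p p' where pp: "x \<in> ?C" "y \<in> ?C" "\<forall>i. coeff p i \<in> P" "\<forall>i. coeff p' i \<in> P"
        "x - poly p c \<in> q" "y - poly p' c \<in> q" by (auto simp: Q_def)
      have "(x - poly p c) + (y - poly p' c) \<in> q" using pp by (intro rmod_add[OF qm])
      then have "x + y - poly (p + p') c \<in> q" by (simp add: algebra_simps)
      then show "x + y \<in> Q" unfolding Q_def using pp rsub_add[OF C] rmod_add[OF Pm]
        by (auto intro!: exI[of _ "p + p'"])
    next
      fix a x assume "a \<in> ?C" "x \<in> Q"
      then obtain pa p where pp: "\<forall>i. coeff pa i \<in> B" "a = poly pa c" "x \<in> ?C" "\<forall>i. coeff p i \<in> P"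
        "x - poly p c \<in> q" by (auto simp: Q_def adj_iff)
      have "a * (x - poly p c) \<in> q" using pp by (intro rmod_mult[OF qm]) auto
      then have "a * x - poly (pa * p) c \<in> q" using pp by (simp add: algebra_simps)
      moreover have "coeff (pa * p) i \<in> P" for i
        unfolding coeff_mult using pp by (intro rmod_sum[OF Pm] rmod_mult[OF Pm]) auto
      ultimately show "a * x \<in> Q" unfolding Q_def using pp rsub_mult[OF C \<open>a \<in> ?C\<close>]
        by (auto intro!: exI[of _ "pa * p"])
    qed
    moreover have QB: "Q \<inter> B = P"
    proof
      show "Q \<inter> B \<subseteq> P"
      proof
        fix b assume "b \<in> Q \<inter> B"
        then obtain p where "b \<in> B" "\<forall>i. coeff p i \<in> P" "poly [:b:] c - poly p c \<in> q" by (auto simp: Q_def)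
        then show "b \<in> P" using key[of "[:b:]" p 0] coeff_const_in[OF B] by simp
      qed
      show "P \<subseteq> Q \<inter> B"
      proof
        fix b assume "b \<in> P"
        moreover have "\<forall>i. coeff [:b:] i \<in> P" using \<open>b \<in> P\<close> rmod_0[OF Pm] by (auto simp: coeff_pCons split: nat.split)
        moreover have "b - poly [:b:] c \<in> q" by (simp add: rmod_0[OF qm])
        ultimately show "b \<in> Q \<inter> B" unfolding Q_def using PB adj_base[OF B, of c] by blast
      qed
    qed
    moreover have "1 \<notin> Q" using QB rsub_1[OF B] rprime_1[OF P(1)] by auto
    moreover have "x \<in> Q \<or> y \<in> Q" if xy: "x \<in> ?C" "y \<in> ?C" "x * y \<in> Q" for x y
    proof -
      obtain px py where p: "\<forall>i. coeff px i \<in> B" "x = poly px c" "\<forall>i. coeff py i \<in> B" "y = poly py c"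
        using xy by (auto simp: adj_iff)
      obtain p where "\<forall>i. coeff p i \<in> P" "poly (px * py) c - poly p c \<in> q" using xy(3) p by (auto simp: Q_def)
      then have "coeff (px * py) i \<in> P" for i
        using key[of "px * py" p i] coeff_mult_in[OF B p(1,3)] by blast
      then have "(\<forall>i. coeff px i \<in> P) \<or> (\<forall>i. coeff py i \<in> P)"
        by (rule coeff_mult_prime[OF P(1) p(1,3) B])
      moreover have "x - poly px c \<in> q" "y - poly py c \<in> q" using p by (simp_all add: rmod_0[OF qm])
      ultimately show ?thesis using xy unfolding Q_def by blast
    qed
    ultimately have "rprime ?C Q" unfolding rprime_def by (auto simp: Q_def)
    moreover have "q \<inter> ?C \<subseteq> Q" unfolding Q_def using rmod_0[OF Pm] by (auto intro!: exI[of _ 0])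
    moreover have "h \<notin> Q"
    proof
      assume "h \<in> Q"
      then obtain p where "\<forall>i. coeff p i \<in> P" "poly ph c - poly p c \<in> q" using ph by (auto simp: Q_def)
      then show False using key[of ph p k] ph P(3) by blast
    qed
    ultimately show "\<exists>Q. rprime ?C Q \<and> q \<inter> ?C \<subseteq> Q \<and> Q \<inter> B = P \<and> h \<notin> Q" using QB by blast
  qed
qed

lemma leading_term_reduction:
  assumes R: "rsub R" and Q: "rmod UNIV Q" and p: "\<forall>i. coeff p i \<in> R" "\<And>i. d < i \<Longrightarrow> coeff p i \<in> Q" "poly p z \<in> Q"
  shows "coeff p d * z ^ d \<in> rspan R ((^) z ` {..<d} \<union> Q)"
proof -
  let ?M = "rspan R ((^) z ` {..<d} \<union> Q)"
  note Mm = rspan_rmod[OF R, of "(^) z ` {..<d} \<union> Q"] and Ms = rspan_superset[OF R, of "(^) z ` {..<d} \<union> Q"]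
  have "poly p z = (\<Sum>i\<le>max d (degree p). coeff p i * z ^ i)"
    unfolding poly_altdef by (intro sum.mono_neutral_left) (auto simp: coeff_eq_0)
  also have "\<dots> = coeff p d * z ^ d + (\<Sum>i\<in>{..max d (degree p)} - {d}. coeff p i * z ^ i)"
    by (intro sum.remove) auto
  finally have eq: "coeff p d * z ^ d = poly p z - (\<Sum>i\<in>{..max d (degree p)} - {d}. coeff p i * z ^ i)" by simp
  have "coeff p i * z ^ i \<in> ?M" if "i \<noteq> d" for i
  proof (cases "i < d")
    case True
    then show ?thesis using Ms p(1) by (intro rmod_mult[OF Mm]) auto
  next
    case False
    then have "coeff p i * z ^ i \<in> Q" using p(2)[of i] that by (intro rmod_mult2[OF Q]) auto
    then show ?thesis using Ms by auto
  qed
  then show ?thesis unfolding eq using p(3) Ms by (intro rmod_diff[OF R Mm] rmod_sum[OF Mm]) auto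
qed

lemma rspan_powers_mult:
  assumes R: "rsub R" and Q: "rmod UNIV Q" and b: "b \<in> R" "b * z ^ d \<in> rspan R ((^) z ` {..<d} \<union> Q)"
    and m: "m \<in> rspan R ((^) z ` {..<d} \<union> Q)"
  shows "b * z * m \<in> rspan R ((^) z ` {..<d} \<union> Q)"
proof -
  let ?M = "rspan R ((^) z ` {..<d} \<union> Q)"
  note Mm = rspan_rmod[OF R, of "(^) z ` {..<d} \<union> Q"] and Ms = rspan_superset[OF R, of "(^) z ` {..<d} \<union> Q"]
  have "?M \<subseteq> colon ?M (b * z)"
  proof (rule rspan_least[OF colon_rmod[OF Mm]])
    have "z ^ i * (b * z) \<in> ?M" if "i < d" for i
    proof -
      have "b * z ^ Suc i \<in> ?M"
      proof (cases "Suc i = d")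
        case False
        then have "z ^ Suc i \<in> ?M" using Ms that by (metis (no_types, lifting) Suc_lessI UnI1 imageI lessThan_iff subsetD)
        then show ?thesis by (rule rmod_mult[OF Mm b(1)])
      qed (use b(2) in simp)
      then show ?thesis by (simp add: ac_simps)
    qed
    moreover have "x * (b * z) \<in> ?M" if "x \<in> Q" for x using subsetD[OF Ms UnI2[OF rmod_mult2[OF Q UNIV_I that]]] .
    ultimately show "(^) z ` {..<d} \<union> Q \<subseteq> colon ?M (b * z)" by (auto simp: colon_def)
  qed
  then show ?thesis using m by (auto simp: colon_def mult.commute)
qed

text \<open>A leading coefficient \<open>b\<close> outside \<open>q\<close> makes \<open>c\<close> integral after inverting \<open>b\<close>; lying over is then
  Nakayama's lemma for the module spanned by the powers of \<open>c\<close> below the degree.\<close>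

lemma generic_lifting_algebraic:
  assumes B: "rsub B" and q: "rprime UNIV q" and a: "alg B q c"
  shows "generic_lifting q B (adj B c)"
  unfolding generic_lifting_def
proof
  let ?C = "adj B c"
  note C = rsub_adj[OF B, of c] and qm = rprime_rmod[OF q]
  note BC = adj_base[OF B, of c] and cC = adj_var[OF B, of c]
  have qB: "rmod B q" by (rule rmod_mono[OF qm]) simp
  obtain p k where p: "\<forall>i. coeff p i \<in> B" "coeff p k \<notin> q" "poly p c \<in> q" using a unfolding alg_def by auto
  obtain d where d: "coeff p d \<notin> q" "\<And>i. d < i \<Longrightarrow> coeff p i \<in> q"
    using coeff_top_exists[OF rmod_0[OF qm] p(2)] by blast
  define b where "b = coeff p d"
  have bB: "b \<in> B" "b \<notin> q" using p d by (auto simp: b_def)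
  define W where "W = (^) c ` {..<d}"
  define M where "M = rspan B (W \<union> q)"
  have Mm: "rmod B M" unfolding M_def by (rule rspan_rmod[OF B])
  have Mq: "q \<subseteq> M" and MW: "\<And>i. i < d \<Longrightarrow> c ^ i \<in> M"
    using rspan_superset[OF B, of "W \<union> q"] by (auto simp: M_def W_def)
  have top: "b * c ^ d \<in> M"
    unfolding M_def W_def b_def by (rule leading_term_reduction[OF B qm p(1) d(2) p(3)])
  have d0: "0 < d"
  proof (rule ccontr)
    assume "\<not> 0 < d"
    then have "M = q" "d = 0" using rspan_least[OF qB, of q] Mq by (auto simp: M_def W_def)
    then show False using top bB by simp
  qed
  have step: "b * c * m \<in> M" if "m \<in> M" for m
    using rspan_powers_mult[OF B qm bB(1)] top that unfolding M_def W_def by blast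
  define S where "S = range (\<lambda>k. b ^ k)"
  have S: "mulset S" "S \<subseteq> B" unfolding S_def mulset_def
    using rsub_power[OF B bB(1)] by (auto simp: power_add[symmetric] intro: range_eqI[of _ _ 0])
  have CM: "?C \<subseteq> satcl S M"
  proof
    fix u assume "u \<in> ?C"
    then obtain pu where pu: "\<forall>i. coeff pu i \<in> B" "u = poly pu c" by (auto simp: adj_iff)
    have sm: "rmod B (satcl S M)" using rsat_satcl[OF Mm S] by (simp add: rsat_def)
    have "c ^ j \<in> satcl S M" for j
    proof -
      have "b ^ j * c ^ j \<in> M"
      proof (induction j)
        case 0
        show ?case using MW[OF d0] by simp
      next
        case (Suc j)
        have "b ^ Suc j * c ^ Suc j = b * c * (b ^ j * c ^ j)" by (simp add: algebra_simps)
        then show ?case using step[OF Suc] by (simp only:)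
      qed
      then show ?thesis by (auto simp: satcl_def S_def)
    qed
    then show "u \<in> satcl S M" unfolding pu(2) poly_altdef
      using pu(1) by (intro rmod_sum[OF sm] rmod_mult[OF sm]) auto
  qed
  fix h assume h: "h \<in> ?C - q"
  have hpow: "h ^ j \<in> ?C" for j using h rsub_power[OF C] by auto
  have "alg B q h"
  proof -
    have "\<exists>k. b ^ k * h ^ j \<in> M" for j using CM hpow[of j] by (auto simp: satcl_def S_def)
    then obtain k where k: "\<And>j. b ^ k j * h ^ j \<in> M" by metis
    define N where "N = (\<Sum>j\<le>d. k j)"
    have cW: "card W \<le> d" unfolding W_def using card_image_le[of "{..<d}" "\<lambda>i. c ^ i"] by simp
    show ?thesis
    proof (rule finite_imp_alg[OF B q])
      show "b ^ N \<in> B" "b ^ N \<notin> q" using rsub_power[OF B bB(1)] rprime_power[OF q, of b N] bB(2) by auto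
      fix j assume "j \<le> card W"
      then have "k j \<le> N" unfolding N_def using cW by (intro member_le_sum) auto
      then have "b ^ N * h ^ j = b ^ (N - k j) * (b ^ k j * h ^ j)"
        by (simp add: mult.assoc[symmetric] power_add[symmetric])
      then show "b ^ N * h ^ j \<in> rspan B (W \<union> q)" using rmod_mult[OF Mm rsub_power[OF B bB(1)] k] by (simp add: M_def)
    qed (simp add: W_def)
  qed
  then obtain e pe where e: "e \<in> B" "e \<notin> q" "\<forall>i. coeff pe i \<in> B" "e + h * poly pe h \<in> q"
    using alg_constant_term[OF q] h by blast
  show "\<exists>g\<in>B - q. \<forall>p. rprime B p \<and> q \<inter> B \<subseteq> p \<and> g \<notin> p \<longrightarrow>
     (\<exists>Q. rprime ?C Q \<and> q \<inter> ?C \<subseteq> Q \<and> Q \<inter> B = p \<and> h \<notin> Q)"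
  proof (intro bexI[of _ "b * e"] allI impI)
    show "b * e \<in> B - q" using bB e rsub_mult[OF B] rprime_mult[OF q, of b e] by auto
    fix P assume "rprime B P \<and> q \<inter> B \<subseteq> P \<and> b * e \<notin> P"
    then have P: "rprime B P" "q \<inter> B \<subseteq> P" "b * e \<notin> P" by auto
    note Pm = rprime_rmod[OF P(1)] and PB = rprime_sub[OF P(1)]
    have beP: "b \<notin> P" "e \<notin> P" using P(3) rmod_mult2[OF Pm e(1)] rmod_mult[OF Pm bB(1)] by auto
    define N0 where "N0 = rspan ?C ((q \<inter> ?C) \<union> P)"
    have N0m: "rmod ?C N0" unfolding N0_def by (rule rspan_rmod[OF C])
    have N0s: "(q \<inter> ?C) \<union> P \<subseteq> N0" unfolding N0_def by (rule rspan_superset[OF C])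
    have N0C: "N0 \<subseteq> ?C" unfolding N0_def using PB BC by (intro rspan_least rmod_self[OF C]) auto
    define N1 where "N1 = rspan B (q \<union> {x * c ^ i | x i. x \<in> P \<and> i \<in> {..<d}})"
    have N1m: "rmod B N1" unfolding N1_def by (rule rspan_rmod[OF B])
    have N1s: "q \<union> {x * c ^ i | x i. x \<in> P \<and> i \<in> {..<d}} \<subseteq> N1" unfolding N1_def by (rule rspan_superset[OF B])
    have wM: "w * m \<in> N1" if "w \<in> P" "m \<in> M" for w m
    proof -
      have "M \<subseteq> colon N1 w" unfolding M_def
      proof (rule rspan_least[OF colon_rmod[OF N1m]])
        have "c ^ i * w \<in> N1" if "i < d" for i
          using subsetD[OF N1s, of "w * c ^ i"] that \<open>w \<in> P\<close> by (auto simp: mult.commute)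
        moreover have "x * w \<in> N1" if "x \<in> q" for x using N1s rmod_mult2[OF qm, of w x] that by auto
        ultimately show "W \<union> q \<subseteq> colon N1 w" by (auto simp: W_def colon_def)
      qed
      then show ?thesis using that(2) by (auto simp: colon_def mult.commute)
    qed
    have sm: "rmod B (satcl S N1)" using rsat_satcl[OF N1m S] by (simp add: rsat_def)
    have N0N1: "N0 \<subseteq> satcl S N1"
    proof
      fix x assume "x \<in> N0"
      then show "x \<in> satcl S N1" unfolding N0_def
      proof (induction rule: rspan.induct)
        case zero
        show ?case by (rule rmod_0[OF sm])
      next
        case (step x a w)
        have "a * w \<in> satcl S N1"
        proof (cases "w \<in> P")
          case True
          obtain s where s: "s \<in> S" "s * a \<in> M" using CM step.hyps(2) by (auto simp: satcl_def)
          have "s * (a * w) = w * (s * a)" by (simp add: algebra_simps)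
          then have "s * (a * w) \<in> N1" using wM[OF True s(2)] by (simp only:)
          then show ?thesis using s(1) by (auto simp: satcl_def)
        next
          case False
          then have "a * w \<in> N1" using step.hyps(3) N1s rmod_mult[OF qm, of a w] by auto
          then show ?thesis using satcl_sub[OF S(1)] by blast
        qed
        then show ?case using step.IH by (intro rmod_add[OF sm])
      qed
    qed
    have disj: "N0 \<inter> (B - P) = {}"
    proof (rule ccontr)
      assume "N0 \<inter> (B - P) \<noteq> {}"
      then obtain s where s: "s \<in> N0" "s \<in> B" "s \<notin> P" by auto
      have "\<exists>s\<in>B - P. \<forall>j\<in>{..<d}. s * c ^ j \<in> q"
      proof (rule nakayama_generators[OF _ B P(1) qB])
        fix j assume "j \<in> {..<d}"
        have "c ^ j * s \<in> N0" using rmod_mult[OF N0m rsub_power[OF C cC] s(1)] .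
        then obtain k where k: "b ^ k * (c ^ j * s) \<in> N1" using N0N1 by (auto simp: satcl_def S_def)
        have "b ^ k \<notin> P" using rprime_power[OF P(1) B bB(1)] beP by auto
        then have "b ^ k * s \<in> B - P"
          using s rsub_power[OF B bB(1)] rsub_mult[OF B] rprime_mult[OF P(1), of "b ^ k" s] by auto
        moreover have "b ^ k * s * c ^ j \<in> N1" using k by (simp add: algebra_simps)
        ultimately show "\<exists>s\<in>B - P. s * c ^ j \<in> rspan B (q \<union> {x * c ^ i | x i. x \<in> P \<and> i \<in> {..<d}})"
          unfolding N1_def by blast
      qed simp
      then obtain s' where s': "s' \<in> B - P" "s' * c ^ 0 \<in> q" using d0 by (meson lessThan_iff)
      then show False using P(2) by auto
    qed
    obtain Q where Q: "rprime ?C Q" "N0 \<subseteq> Q" "Q \<inter> (B - P) = {}"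
      by (rule exists_prime_over_complement[OF C N0m N0C B BC P(1) order_refl disj])
    have QB: "Q \<inter> B = P" using Q N0s PB by auto
    have "h \<notin> Q"
    proof
      assume "h \<in> Q"
      have pC: "poly pe h \<in> ?C" using e(3) h BC by (intro poly_in_rsub[OF C]) auto
      then have hp: "h * poly pe h \<in> Q" by (rule rmod_mult2[OF rprime_rmod[OF Q(1)] _ \<open>h \<in> Q\<close>])
      have "e + h * poly pe h \<in> ?C" using e(1) BC pC h rsub_mult[OF C] rsub_add[OF C] by auto
      then have "e + h * poly pe h \<in> Q" using e(4) N0s Q(2) by auto
      then have "e \<in> Q" using hp rmod_add_cancel[OF C rprime_rmod[OF Q(1)]] by blast
      then show False using QB e(1) beP by auto
    qed
    then show "\<exists>Q. rprime ?C Q \<and> q \<inter> ?C \<subseteq> Q \<and> Q \<inter> B = P \<and> h \<notin> Q" using Q(1,2) QB N0s by blast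
  qed
qed

lemma generic_lifting_polyring:
  assumes B: "rsub B" and q: "rprime UNIV q"
  shows "generic_lifting q B (polyring B m c)"
proof (induction m)
  case 0
  show ?case unfolding polyring_0[OF B] generic_lifting_def
  proof (intro ballI)
    fix h assume "h \<in> B - q"
    moreover have "\<exists>Q. rprime B Q \<and> q \<inter> B \<subseteq> Q \<and> Q \<inter> B = p \<and> h \<notin> Q"
      if "rprime B p \<and> q \<inter> B \<subseteq> p \<and> h \<notin> p" for p
      using that rprime_sub[of B p] by (intro exI[of _ p]) auto
    ultimately show "\<exists>g\<in>B - q. \<forall>p. rprime B p \<and> q \<inter> B \<subseteq> p \<and> g \<notin> p \<longrightarrow>
      (\<exists>Q. rprime B Q \<and> q \<inter> B \<subseteq> Q \<and> Q \<inter> B = p \<and> h \<notin> Q)" by blast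
  qed
next
  case (Suc m)
  note P = rsub_polyring[OF B, of m c]
  have "generic_lifting q (polyring B m c) (adj (polyring B m c) (c m))"
    using generic_lifting_transcendental[OF P q] generic_lifting_algebraic[OF P q] by blast
  then show ?case unfolding polyring_Suc[OF B]
    using generic_lifting_trans[OF Suc] polyring_base[OF B] adj_base[OF P] by blast
qed

text \<open>Zariski's lemma in relative form.\<close>

lemma transcendental_specialisation:
  assumes B: "rsub B" and q: "rprime UNIV q" and gen: "polyring B m c = UNIV" and z: "\<not> alg B q z"
  obtains Q u where "rprime UNIV Q" "q \<subseteq> Q" "Q \<inter> B \<subseteq> q" "u \<in> adj B z" "u \<in> Q" "u \<notin> q"
proof -
  let ?C = "adj B z"
  note C = rsub_adj[OF B, of z] and qm = rprime_rmod[OF q]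
  have tr: "coeff p i \<in> q" if "\<forall>i. coeff p i \<in> B" "poly p z \<in> q" for p i
    using z that unfolding alg_def by blast
  have "polyring B m c \<subseteq> polyring ?C m c"
    unfolding polyring_def using adj_base[OF B] by (intro rspan_mono) auto
  then have "polyring ?C m c = UNIV" using gen by auto
  then have "generic_lifting q ?C UNIV" using generic_lifting_polyring[OF C q, of m c] by simp
  then obtain g where g: "g \<in> ?C" "g \<notin> q" "\<And>p. rprime ?C p \<Longrightarrow> q \<inter> ?C \<subseteq> p \<Longrightarrow> g \<notin> p \<Longrightarrow>
    \<exists>Q. rprime UNIV Q \<and> q \<inter> UNIV \<subseteq> Q \<and> Q \<inter> ?C = p \<and> 1 \<notin> Q"
    using generic_liftingD[of q ?C UNIV 1] rprime_1[OF q] by blast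
  obtain pg where pg: "\<forall>i. coeff pg i \<in> B" "g = poly pg z" using g(1) by (auto simp: adj_iff)
  have "\<exists>k. coeff pg k \<notin> q" using poly_in_ideal[OF qm, of pg z] g pg by auto
  then obtain d where d: "coeff pg d \<notin> q" "\<And>i. d < i \<Longrightarrow> coeff pg i \<in> q"
    using coeff_top_exists[OF rmod_0[OF qm]] by metis
  define pu where "pu = 1 + pCons 0 pg"
  define u where "u = poly pu z"
  have pu: "coeff pu (Suc i) = coeff pg i" "coeff pu 0 = 1" for i by (simp_all add: pu_def coeff_1)
  have puB: "\<forall>i. coeff pu i \<in> B"
  proof
    fix i show "coeff pu i \<in> B" using pu pg rsub_1[OF B] by (cases i) auto
  qed
  have uC: "u \<in> ?C" using puB by (auto simp: u_def adj_iff)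
  have uq: "u \<notin> q" using tr[OF puB, of 0] rprime_1[OF q] by (auto simp: u_def pu(2))
  define I where "I = rspan ?C (insert u (q \<inter> ?C))"
  have qC: "rmod ?C (q \<inter> ?C)" using rmod_Int[OF rmod_mono[OF qm] rmod_self[OF C]] by simp
  have Im: "rmod ?C I" unfolding I_def by (rule rspan_rmod[OF C])
  have IC: "I \<subseteq> ?C" unfolding I_def using uC by (intro rspan_least rmod_self[OF C]) auto
  have Is: "insert u (q \<inter> ?C) \<subseteq> I" unfolding I_def by (rule rspan_superset[OF C])
  have disj: "I \<inter> (B - q) = {}"
  proof (rule ccontr)
    assume "I \<inter> (B - q) \<noteq> {}"
    then obtain s where sB: "s \<in> B" "s \<notin> q" and "s \<in> I" by auto
    then obtain i v where iv: "i \<in> q" "v \<in> ?C" "s = i + v * u"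
      unfolding I_def rspan_insert_iff[OF C qC] by auto
    note s = sB iv
    obtain pv where pv: "\<forall>i. coeff pv i \<in> B" "v = poly pv z" using s(4) by (auto simp: adj_iff)
    have "v \<notin> q" using s rmod_mult2[OF qm] rmod_add[OF qm] by auto
    have "\<exists>k. coeff pv k \<notin> q" using poly_in_ideal[OF qm, of pv z] \<open>v \<notin> q\<close> pv by auto
    then obtain e where e: "coeff pv e \<notin> q" "\<And>i. e < i \<Longrightarrow> coeff pv i \<in> q"
      using coeff_top_exists[OF rmod_0[OF qm]] by metis
    have du: "coeff pu (Suc d) \<notin> q" using pu d by simp
    have du': "coeff pu i \<in> q" if "Suc d < i" for i using that d(2)[of "i - 1"] pu(1)[of "i - 1"] by simp
    have "coeff (pu * pv) (Suc d + e) \<notin> q"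
      by (rule coeff_top_mult[OF q _ _ du du' e]) auto
    moreover have "coeff (pu * pv - [:s:]) (Suc d + e) \<in> q"
    proof (rule tr)
      show "\<forall>i. coeff (pu * pv - [:s:]) i \<in> B"
        using coeff_mult_in[OF B puB pv(1)] coeff_const_in[OF B s(1)] by (auto intro!: rsub_diff[OF B])
      have "poly (pu * pv - [:s:]) z = - i" using s(5) pv(2) by (simp add: u_def algebra_simps)
      then show "poly (pu * pv - [:s:]) z \<in> q" using s(3) rmod_minus[OF rsub_UNIV qm] by simp
    qed
    ultimately show False by simp
  qed
  obtain p where p: "rprime ?C p" "I \<subseteq> p" "p \<inter> (B - q) = {}"
    by (rule exists_prime_over_complement[OF C Im IC B adj_base[OF B] q subset_UNIV disj])
  have "g \<notin> p"
  proof
    assume "g \<in> p"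
    then have "z * g \<in> p" using rmod_mult[OF rprime_rmod[OF p(1)] adj_var[OF B]] by simp
    moreover have "u \<in> p" using p(2) Is by auto
    moreover have "u - z * g = 1" by (simp add: u_def pu_def pg)
    ultimately have "1 \<in> p" using rmod_diff[OF C rprime_rmod[OF p(1)], of u "z * g"] by simp
    then show False using rprime_1[OF p(1)] by simp
  qed
  then obtain Q where Q: "rprime UNIV Q" "q \<subseteq> Q" "Q \<inter> ?C = p" using g(3)[OF p(1)] p(2) Is by auto
  have "Q \<inter> B \<subseteq> q" using Q(3) p(3) adj_base[OF B, of z] by blast
  moreover have "u \<in> Q" using Q(3) p(2) Is by auto
  ultimately show thesis using that Q uC uq by blast
qed

lemma rspan_image_sum:
  assumes "rsub R" "x \<in> rspan R (f ` T)"
  obtains F c where "finite F" "F \<subseteq> T" "\<And>t. t \<in> F \<Longrightarrow> c t \<in> R" "x = (\<Sum>t\<in>F. c t * f t)"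
proof -
  have "\<exists>F c. finite F \<and> F \<subseteq> T \<and> (\<forall>t\<in>F. c t \<in> R) \<and> x = (\<Sum>t\<in>F. c t * f t)"
    using assms(2)
  proof (induction rule: rspan.induct)
    case zero
    show ?case by (intro exI[of _ "{}"]) auto
  next
    case (step x d w)
    then obtain F c where F: "finite F" "F \<subseteq> T" "\<forall>t\<in>F. c t \<in> R" "x = (\<Sum>t\<in>F. c t * f t)" by auto
    obtain s where s: "s \<in> T" "w = f s" using step.hyps by auto
    show ?case
    proof (cases "s \<in> F")
      case True
      let ?c = "c(s := c s + d)"
      have "(\<Sum>t\<in>F. ?c t * f t) = (c s + d) * f s + (\<Sum>t\<in>F - {s}. c t * f t)"
        using F(1) True by (subst sum.remove[of _ s]) (auto intro!: sum.cong)
      also have "\<dots> = x + d * w"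
        unfolding F(4) s(2) using F(1) True by (subst sum.remove[of F s]) (auto simp: algebra_simps)
      finally show ?thesis using F step.hyps True rsub_add[OF assms(1)]
        by (intro exI[of _ F] exI[of _ ?c]) auto
    next
      case False
      let ?c = "c(s := d)"
      have "(\<Sum>t\<in>insert s F. ?c t * f t) = d * f s + (\<Sum>t\<in>F. c t * f t)"
        using F(1) False by (auto intro!: sum.cong)
      then have "x + d * w = (\<Sum>t\<in>insert s F. ?c t * f t)" using F(4) s(2) by (simp add: add.commute)
      then show ?thesis using F step.hyps False s
        by (intro exI[of _ "insert s F"] exI[of _ ?c]) auto
    qed
  qed
  then show thesis using that by blast
qed

lemma rspan_sum: "rsub R \<Longrightarrow> F \<subseteq> T \<Longrightarrow> (\<And>t. t \<in> F \<Longrightarrow> c t \<in> R) \<Longrightarrow> (\<Sum>t\<in>F. c t * f t) \<in> rspan R (f ` T)"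
  by (intro rmod_sum[OF rspan_rmod] rspan_scale rspan_base) auto

section \<open>Algebras over fields and Jacobson rings\<close>

definition indep :: "'a::comm_ring_1 set \<Rightarrow> 'a set \<Rightarrow> nat \<Rightarrow> (nat \<Rightarrow> 'a) \<Rightarrow> bool" where
  "indep K q n a \<longleftrightarrow> (\<forall>F c. finite F \<and> (\<forall>t\<in>F. set_mset t \<subseteq> {..<n} \<and> c t \<in> K) \<and>
     (\<Sum>t\<in>F. c t * meval a t) \<in> q \<longrightarrow> (\<forall>t\<in>F. c t \<in> q))"

lemma indepD:
  assumes "indep K q n a" "finite F" "\<And>t. t \<in> F \<Longrightarrow> set_mset t \<subseteq> {..<n}"
    "\<And>t. t \<in> F \<Longrightarrow> c t \<in> K" "(\<Sum>t\<in>F. c t * meval a t) \<in> q" "t \<in> F"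
  shows "c t \<in> q"
  using assms unfolding indep_def by blast

lemma meval_cong: "(\<And>i. i \<in># t \<Longrightarrow> a i = b i) \<Longrightarrow> meval a t = meval b t"
  by (induction t) auto

lemma indep_not_alg:
  assumes K: "rsub K" and q: "rmod UNIV q" and ind: "indep K q (Suc n) a"
  shows "\<not> alg (polyring K n a) q (a n)"
proof
  assume "alg (polyring K n a) q (a n)"
  then obtain p k where p: "\<And>i. coeff p i \<in> polyring K n a" "coeff p k \<notin> q" "poly p (a n) \<in> q"
    unfolding alg_def by auto
  have "\<exists>F c. finite F \<and> F \<subseteq> monomials n \<and> (\<forall>t\<in>F. c t \<in> K) \<and>
    coeff p i = (\<Sum>t\<in>F. c t * meval a t)" for i
    using rspan_image_sum[OF K p(1)[of i, unfolded polyring_def]] by metis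
  then have "\<forall>i. \<exists>Fc. finite (fst Fc) \<and> fst Fc \<subseteq> monomials n \<and> (\<forall>t\<in>fst Fc. snd Fc t \<in> K) \<and>
    coeff p i = (\<Sum>t\<in>fst Fc. snd Fc t * meval a t)" by simp
  from choice[OF this] obtain Fc where Fc: "\<forall>i. finite (fst (Fc i)) \<and> fst (Fc i) \<subseteq> monomials n \<and>
    (\<forall>t\<in>fst (Fc i). snd (Fc i) t \<in> K) \<and> coeff p i = (\<Sum>t\<in>fst (Fc i). snd (Fc i) t * meval a t)" ..
  define F c where "F i = fst (Fc i)" and "c i = snd (Fc i)" for i
  have F: "finite (F i)" "F i \<subseteq> monomials n" "t \<in> F i \<Longrightarrow> c i t \<in> K"
    "coeff p i = (\<Sum>t\<in>F i. c i t * meval a t)" for i t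
    using Fc by (simp_all add: F_def c_def)
  define S where "S = (SIGMA i:{..degree p}. F i)"
  define g where "g = (\<lambda>(i, t). replicate_mset i n + t)"
  have Sfin: "finite S" using F(1) by (auto simp: S_def)
  have inj: "inj_on g S"
  proof (rule inj_onI, clarify)
    fix i t j s assume *: "(i, t) \<in> S" "(j, s) \<in> S" "g (i, t) = g (j, s)"
    then have "n \<notin># t" "n \<notin># s" using F(2) by (fastforce simp: S_def)+
    then have "count t n = 0" "count s n = 0" by (simp_all add: not_in_iff)
    moreover have "count (g (i, t)) n = count (g (j, s)) n" using *(3) by simp
    ultimately have "i = j" by (simp add: g_def)
    then show "i = j \<and> t = s" using *(3) by (simp add: g_def)
  qed
  define e where "e s = (case the_inv_into S g s of (i, t) \<Rightarrow> c i t)" for s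
  have eg: "e (g (i, t)) = c i t" if "(i, t) \<in> S" for i t
    using the_inv_into_f_f[OF inj that] by (simp add: e_def)
  have "poly p (a n) = (\<Sum>i\<le>degree p. \<Sum>t\<in>F i. c i t * meval a (g (i, t)))"
    unfolding poly_altdef
  proof (intro sum.cong refl)
    fix i
    show "coeff p i * a n ^ i = (\<Sum>t\<in>F i. c i t * meval a (g (i, t)))"
      unfolding F(4)[of i] sum_distrib_right by (intro sum.cong refl) (simp add: g_def mult.assoc mult.commute[of "a n ^ i"])
  qed
  also have "\<dots> = (\<Sum>(i, t)\<in>S. c i t * meval a (g (i, t)))"
    unfolding S_def using F(1) by (intro sum.Sigma) auto
  also have "\<dots> = (\<Sum>x\<in>S. e (g x) * meval a (g x))"
    by (intro sum.cong refl) (use eg in auto)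
  also have "\<dots> = (\<Sum>s\<in>g ` S. e s * meval a s)"
    by (simp add: sum.reindex[OF inj] o_def)
  finally have "(\<Sum>s\<in>g ` S. e s * meval a s) \<in> q" using p(3) by simp
  moreover have "set_mset s \<subseteq> {..<Suc n}" "e s \<in> K" if s: "s \<in> g ` S" for s
  proof -
    obtain x where x: "x \<in> S" "s = g x" using s by blast
    obtain i t where "x = (i, t)" by (cases x)
    then have it: "(i, t) \<in> S" "s = g (i, t)" using x by simp_all
    then have "t \<in> F i" by (simp add: S_def)
    then have "set_mset t \<subseteq> {..<n}" "c i t \<in> K" using F(2)[of i] F(3)[of t i] by auto
    then show "set_mset s \<subseteq> {..<Suc n}" "e s \<in> K" using eg[OF it(1)] it
      by (auto simp: g_def split: if_splits)
  qed
  ultimately have eq: "e s \<in> q" if "s \<in> g ` S" for s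
    using indepD[OF ind, of "g ` S" e s] Sfin that by blast
  have "coeff p k \<in> q"
  proof (cases "k \<le> degree p")
    case True
    have "c k t \<in> q" if "t \<in> F k" for t
    proof -
      have "(k, t) \<in> S" using that True by (simp add: S_def)
      then show ?thesis using eq[of "g (k, t)"] eg by auto
    qed
    then show ?thesis unfolding F(4) by (intro rmod_sum[OF q] rmod_mult2[OF q]) auto
  next
    case False
    then show ?thesis by (simp add: coeff_eq_0 rmod_0[OF q])
  qed
  then show False using p(2) by simp
qed

lemma indep_chain:
  assumes K: "rsub K" and gen: "polyring K m c = UNIV"
  shows "rprime UNIV q \<Longrightarrow> indep K q n a \<Longrightarrow> \<exists>Q. (\<forall>i\<le>n. rprime UNIV (Q i) \<and> q \<subseteq> Q i) \<and>
    (\<forall>i<n. Q i \<subseteq> Q (Suc i) \<and> (\<exists>u\<in>polyring K n a. u \<in> Q (Suc i) \<and> u \<notin> Q i))"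
proof (induction n arbitrary: q)
  case 0
  then show ?case by (intro exI[of _ "\<lambda>_. q"]) auto
next
  case (Suc n)
  let ?B = "polyring K n a"
  have "polyring K m c \<subseteq> polyring ?B m c"
    unfolding polyring_def[of _ m] using polyring_base[OF K] by (intro rspan_mono) auto
  then have genB: "polyring ?B m c = UNIV" using gen by auto
  obtain Q u where Q: "rprime UNIV Q" "q \<subseteq> Q" "Q \<inter> ?B \<subseteq> q" "u \<in> adj ?B (a n)" "u \<in> Q" "u \<notin> q"
    using transcendental_specialisation[OF rsub_polyring[OF K] Suc.prems(1) genB
        indep_not_alg[OF K rprime_rmod[OF Suc.prems(1)] Suc.prems(2)]] by metis
  have "indep K Q n a"
    unfolding indep_def
  proof (intro allI impI ballI)
    fix F c t assume F: "finite F \<and> (\<forall>t\<in>F. set_mset t \<subseteq> {..<n} \<and> c t \<in> K) \<and>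
      (\<Sum>t\<in>F. c t * meval a t) \<in> Q" and t: "t \<in> F"
    then have "(\<Sum>t\<in>F. c t * meval a t) \<in> ?B" unfolding polyring_def by (intro rspan_sum[OF K]) auto
    then have "(\<Sum>t\<in>F. c t * meval a t) \<in> q" using F Q(3) by auto
    moreover have "set_mset t \<subseteq> {..<Suc n}" "c t \<in> K" if "t \<in> F" for t
      using F that by (force, blast)
    ultimately have "c t \<in> q" using F t by (intro indepD[OF Suc.prems(2), of F c t]) auto
    then show "c t \<in> Q" using Q(2) by auto
  qed
  then obtain C where C: "\<forall>i\<le>n. rprime UNIV (C i) \<and> Q \<subseteq> C i"
    "\<forall>i<n. C i \<subseteq> C (Suc i) \<and> (\<exists>u\<in>polyring K n a. u \<in> C (Suc i) \<and> u \<notin> C i)"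
    using Suc.IH[OF Q(1)] by auto
  define D where "D i = (case i of 0 \<Rightarrow> q | Suc j \<Rightarrow> C j)" for i
  have Ds: "?B \<subseteq> polyring K (Suc n) a"
    unfolding polyring_Suc[OF K] by (rule adj_base[OF rsub_polyring[OF K]])
  have "\<forall>i\<le>Suc n. rprime UNIV (D i) \<and> q \<subseteq> D i"
    using C(1) Q(2) Suc.prems(1) by (auto simp: D_def split: nat.split)
  moreover have "D i \<subseteq> D (Suc i) \<and> (\<exists>u\<in>polyring K (Suc n) a. u \<in> D (Suc i) \<and> u \<notin> D i)" if "i < Suc n" for i
  proof (cases i)
    case 0
    have "q \<subseteq> C 0" "u \<in> C 0" using C(1) Q by auto
    moreover have "u \<in> polyring K (Suc n) a" using Q(4) by (simp add: polyring_Suc[OF K])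
    ultimately show ?thesis using 0 Q(6) by (auto simp: D_def)
  next
    case (Suc j)
    then have "C j \<subseteq> C (Suc j) \<and> (\<exists>u\<in>?B. u \<in> C (Suc j) \<and> u \<notin> C j)" using C(2) that by auto
    then show ?thesis using Suc Ds by (auto simp: D_def)
  qed
  ultimately show ?case by blast
qed

lemma finite_monomials_min:
  assumes r: "monomial_ordering r" and "finite F" "F \<noteq> {}"
  obtains t0 where "t0 \<in> F" "\<And>t. t \<in> F \<Longrightarrow> (t0, t) \<in> r"
proof -
  have "\<exists>t0\<in>F. \<forall>t\<in>F. (t0, t) \<in> r"
    using assms(2,3)
  proof (induction F rule: finite_ne_induct)
    case (singleton x)
    then show ?case using mono_ordD(1)[OF r] by simp
  next
    case (insert x F)
    then obtain t0 where t0: "t0 \<in> F" "\<forall>t\<in>F. (t0, t) \<in> r" by auto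
    show ?case
    proof (cases "(t0, x) \<in> r")
      case False
      then have "(x, t0) \<in> r" using mono_ordD(4)[OF r] by blast
      then have "(x, t) \<in> r" if "t \<in> F" for t using t0(2) that mono_ordD(2)[OF r] by blast
      then show ?thesis using mono_ordD(1)[OF r] by blast
    qed (use t0 in auto)
  qed
  then show thesis using that by blast
qed

text \<open>A relation whose coefficients outside \<open>q\<close> are invertible modulo \<open>q\<close> becomes submonic by dividing
  by its trailing coefficient.\<close>

lemma relation_imp_subm:
  assumes r: "monomial_ordering r" and R: "rsub R" and q: "rmod UNIV q"
    and F: "finite F" "\<And>t. t \<in> F \<Longrightarrow> set_mset t \<subseteq> {..<n}" "\<And>t. t \<in> F \<Longrightarrow> c t \<in> R"
    and sum: "(\<Sum>t\<in>F. c t * meval a t) \<in> q" and t1: "t1 \<in> F" "c t1 \<notin> q"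
    and inv: "\<And>t. t \<in> F \<Longrightarrow> c t \<notin> q \<Longrightarrow> \<exists>y\<in>R. c t * y - 1 \<in> q"
  shows "subm r R n a \<inter> q \<noteq> {}"
proof -
  define G where "G = {t \<in> F. c t \<notin> q}"
  have G: "finite G" "G \<noteq> {}" "G \<subseteq> F" using F(1) t1 by (auto simp: G_def)
  obtain t0 where t0: "t0 \<in> G" "\<And>t. t \<in> G \<Longrightarrow> (t0, t) \<in> r" by (rule finite_monomials_min[OF r G(1,2)]) blast
  obtain y where y: "y \<in> R" "c t0 * y - 1 \<in> q" using inv[of t0] t0(1) by (auto simp: G_def)
  have "(\<Sum>t\<in>F. c t * meval a t) = (\<Sum>t\<in>G. c t * meval a t) + (\<Sum>t\<in>F - G. c t * meval a t)"
    using F(1) G(3) by (simp add: sum.subset_diff add.commute)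
  moreover have "(\<Sum>t\<in>F - G. c t * meval a t) \<in> q"
    by (intro rmod_sum[OF q] rmod_mult2[OF q]) (auto simp: G_def)
  ultimately have "(\<Sum>t\<in>G. c t * meval a t) \<in> q"
    using sum rmod_add_cancel[OF rsub_UNIV q] by simp
  then have "y * (\<Sum>t\<in>G. c t * meval a t) \<in> q" by (intro rmod_mult[OF q]) auto
  moreover have "y * (\<Sum>t\<in>G. c t * meval a t) =
      y * c t0 * meval a t0 + (\<Sum>t\<in>G - {t0}. (y * c t) * meval a t)"
    using G(1) t0(1) by (subst sum.remove[of G t0]) (auto simp: algebra_simps sum_distrib_left)
  ultimately have "y * c t0 * meval a t0 + (\<Sum>t\<in>G - {t0}. (y * c t) * meval a t) \<in> q" by simp
  moreover have "(c t0 * y - 1) * meval a t0 \<in> q" using y(2) by (intro rmod_mult2[OF q]) auto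
  ultimately have "(y * c t0 * meval a t0 + (\<Sum>t\<in>G - {t0}. (y * c t) * meval a t)) - (c t0 * y - 1) * meval a t0 \<in> q"
    by (rule rmod_diff[OF rsub_UNIV q])
  moreover have "(y * c t0 * meval a t0 + (\<Sum>t\<in>G - {t0}. (y * c t) * meval a t)) - (c t0 * y - 1) * meval a t0
      = meval a t0 + (\<Sum>t\<in>G - {t0}. (y * c t) * meval a t)"
    by (simp add: algebra_simps)
  moreover have "meval a t0 + (\<Sum>t\<in>G - {t0}. (y * c t) * meval a t) \<in> subm r R n a"
  proof (rule submI)
    show "set_mset t0 \<subseteq> {..<n}" using t0 F(2) G(3) by auto
    show "(\<Sum>t\<in>G - {t0}. (y * c t) * meval a t) \<in>
        rspan R (meval a ` above r n t0)"
      using t0 F(2,3) G(3) y(1) rsub_mult[OF R] by (intro rspan_sum[OF R]) auto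
  qed
  ultimately show ?thesis by auto
qed

lemma no_relation_imp_indep:
  assumes r: "monomial_ordering r" and K: "rsub K" and q: "rmod UNIV q"
    and inv: "\<And>x. x \<in> K \<Longrightarrow> x \<notin> q \<Longrightarrow> \<exists>y\<in>K. x * y - 1 \<in> q"
    and no: "subm r K n a \<inter> q = {}"
  shows "indep K q n a"
  unfolding indep_def
proof (intro allI impI ballI, rule ccontr)
  fix F c t assume F: "finite F \<and> (\<forall>t\<in>F. set_mset t \<subseteq> {..<n} \<and> c t \<in> K) \<and> (\<Sum>t\<in>F. c t * meval a t) \<in> q"
    and t: "t \<in> F" "c t \<notin> q"
  have "subm r K n a \<inter> q \<noteq> {}"
    by (rule relation_imp_subm[OF r K q, of F n c a t]) (use F t inv in auto)
  then show False using no by simp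
qed

lemma subm_sub_polyring: "rsub R \<Longrightarrow> subm r R n a \<subseteq> polyring R n a"
proof
  fix x assume R: "rsub R" and "x \<in> subm r R n a"
  then obtain t y where ty: "set_mset t \<subseteq> {..<n}" "x = meval a t + y"
    "y \<in> rspan R (meval a ` above r n t)" by (auto simp: subm_def)
  have "y \<in> polyring R n a" unfolding polyring_def by (rule subsetD[OF rspan_mono ty(3)]) auto
  then show "x \<in> polyring R n a"
    unfolding ty(2) using ty(1) by (intro rsub_add[OF rsub_polyring[OF R]] meval_polyring[OF R])
qed

lemma alg_imp_subm:
  assumes r: "monomial_ordering r" and R: "rsub R" and q: "rmod UNIV q"
    and inv: "\<And>x. x \<in> R \<Longrightarrow> x \<notin> q \<Longrightarrow> \<exists>y\<in>R. x * y - 1 \<in> q" and a: "alg R q (a 0)"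
  shows "subm r R 1 a \<inter> q \<noteq> {}"
proof -
  obtain p k where p: "\<And>i. coeff p i \<in> R" "coeff p k \<notin> q" "poly p (a 0) \<in> q"
    using a unfolding alg_def by auto
  have inj: "inj_on (\<lambda>i. replicate_mset i (0::nat)) A" for A
    by (rule inj_onI) (metis count_replicate_mset)
  let ?F = "(\<lambda>i. replicate_mset i (0::nat)) ` {..degree p}"
  show ?thesis
  proof (rule relation_imp_subm[OF r R q, of ?F 1 "\<lambda>t. coeff p (count t 0)" a "replicate_mset k 0"])
    have "(\<Sum>t\<in>?F. coeff p (count t 0) * meval a t) = poly p (a 0)"
      by (simp add: sum.reindex[OF inj] poly_altdef)
    then show "(\<Sum>t\<in>?F. coeff p (count t 0) * meval a t) \<in> q" using p(3) by simp
    show "replicate_mset k 0 \<in> ?F" using p(2) rmod_0[OF q] by (auto intro!: imageI le_degree)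
  qed (use p inv in \<open>auto split: if_splits\<close>)
qed

definition jac :: "'a::comm_ring_1 set \<Rightarrow> 'a set \<Rightarrow> bool" where
  "jac R I \<longleftrightarrow> (\<forall>p g. rprime R p \<and> I \<subseteq> p \<and> g \<in> R \<and> g \<notin> p \<longrightarrow>
     (\<exists>m. rprime R m \<and> p \<subseteq> m \<and> g \<notin> m \<and> (\<forall>x\<in>R. x \<notin> m \<longrightarrow> (\<exists>y\<in>R. x * y - 1 \<in> m))))"

lemma exists_maximal_above:
  assumes I: "rmod UNIV I" "1 \<notin> I"
  obtains Q where "rprime UNIV Q" "I \<subseteq> Q" "\<And>Q'. rprime UNIV Q' \<Longrightarrow> Q \<subseteq> Q' \<Longrightarrow> Q' = Q"
proof -
  define \<A> where "\<A> = {J. rmod UNIV J \<and> I \<subseteq> J \<and> 1 \<notin> J}"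
  have "\<exists>M\<in>\<A>. \<forall>Y\<in>\<A>. M \<subseteq> Y \<longrightarrow> Y = M"
  proof (rule subset_Zorn_nonempty)
    show "\<A> \<noteq> {}" using assms by (auto simp: \<A>_def)
    fix \<C> assume "\<C> \<noteq> {}" "subset.chain \<A> \<C>"
    moreover from this have "\<C> \<subseteq> \<A>" by (simp add: subset_chain_def)
    ultimately show "\<Union>\<C> \<in> \<A>" using rmod_Union_chain[of \<C> UNIV \<A>] by (fastforce simp: \<A>_def)
  qed
  then obtain M where M: "M \<in> \<A>" "\<And>Y. Y \<in> \<A> \<Longrightarrow> M \<subseteq> Y \<Longrightarrow> Y = M" by auto
  obtain Q where Q: "rprime UNIV Q" "M \<subseteq> Q" using exists_prime_above[of M] M(1) by (auto simp: \<A>_def)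
  have up: "Y = M" if "rprime UNIV Y" "M \<subseteq> Y" for Y
    using M(1) M(2)[of Y] that rprime_rmod[of UNIV Y] rprime_1[of UNIV Y] by (auto simp: \<A>_def)
  show thesis
  proof (rule that[of Q])
    show "I \<subseteq> Q" using Q M(1) by (auto simp: \<A>_def)
    fix Q' assume "rprime UNIV Q'" "Q \<subseteq> Q'"
    then show "Q' = Q" using up[of Q'] up[of Q] Q by auto
  qed (rule Q(1))
qed

lemma nullstellensatz:
  assumes R: "rsub R" and J: "jac R I" and gen: "polyring R m c = UNIV" and IR: "I \<subseteq> R"
    and Q: "rprime UNIV Q" "I \<subseteq> Q" and max: "\<And>Q'. rprime UNIV Q' \<Longrightarrow> Q \<subseteq> Q' \<Longrightarrow> Q' = Q"
  shows "\<And>x. x \<in> R \<Longrightarrow> x \<notin> Q \<Longrightarrow> \<exists>y\<in>R. x * y - 1 \<in> Q" "alg R Q z"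
proof -
  have "generic_lifting Q R UNIV" using generic_lifting_polyring[OF R Q(1), of m c] gen by simp
  then obtain g where g: "g \<in> R" "g \<notin> Q" "\<And>p. rprime R p \<Longrightarrow> Q \<inter> R \<subseteq> p \<Longrightarrow> g \<notin> p \<Longrightarrow>
    \<exists>Q'. rprime UNIV Q' \<and> Q \<inter> UNIV \<subseteq> Q' \<and> Q' \<inter> R = p \<and> 1 \<notin> Q'"
    using generic_liftingD[of Q R UNIV 1] rprime_1[OF Q(1)] by blast
  have "rprime R (Q \<inter> R)" using rprime_Int[OF Q(1) rsub_UNIV R] by simp
  then obtain p where p: "rprime R p" "Q \<inter> R \<subseteq> p" "g \<notin> p" "\<forall>x\<in>R. x \<notin> p \<longrightarrow> (\<exists>y\<in>R. x * y - 1 \<in> p)"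
    using J Q(2) IR g(1,2) unfolding jac_def by (metis IntD1 Int_greatest)
  then obtain Q' where "rprime UNIV Q'" "Q \<subseteq> Q'" "Q' \<inter> R = p" using g(3)[OF p(1-3)] by auto
  then have "Q \<inter> R = p" using max by auto
  then show "\<exists>y\<in>R. x * y - 1 \<in> Q" if "x \<in> R" "x \<notin> Q" for x using p(4) that by auto
  show "alg R Q z"
  proof (rule ccontr)
    assume "\<not> alg R Q z"
    then obtain Q' u where "rprime UNIV Q'" "Q \<subseteq> Q'" "u \<in> Q'" "u \<notin> Q"
      using transcendental_specialisation[OF R Q(1) gen] by metis
    then show False using max[of Q'] by auto
  qed
qed

lemma jacobson_no_relation1:
  assumes r: "monomial_ordering r" and R: "rsub R" and J: "jac R I" and gen: "polyring R m c = UNIV"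
    and IR: "I \<subseteq> R" and q: "rprime UNIV q" "I \<subseteq> q" and no: "subm r R 1 a \<inter> q = {}"
  obtains Q u where "rprime UNIV Q" "q \<subseteq> Q" "u \<in> polyring R 1 a" "u \<in> Q" "u \<notin> q"
proof -
  obtain Q where Q: "rprime UNIV Q" "q \<subseteq> Q" "\<And>Q'. rprime UNIV Q' \<Longrightarrow> Q \<subseteq> Q' \<Longrightarrow> Q' = Q"
    using exists_maximal_above[OF rprime_rmod[OF q(1)] rprime_1[OF q(1)]] by metis
  have IQ: "I \<subseteq> Q" using q Q by auto
  note ns = nullstellensatz[OF R J gen IR Q(1) IQ Q(3)]
  have "subm r R 1 a \<inter> Q \<noteq> {}"
    by (rule alg_imp_subm[OF r R rprime_rmod[OF Q(1)]]) (use ns in auto)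
  then obtain u where u: "u \<in> subm r R 1 a" "u \<in> Q" by auto
  then have "u \<notin> q" "u \<in> polyring R 1 a" using no subsetD[OF subm_sub_polyring[OF R] u(1)] by auto
  then show thesis using that Q u by blast
qed

lemma alg_field_finite_length:
  assumes R: "rsub R" and P: "rprime UNIV P" and inv: "\<And>x. x \<in> R \<Longrightarrow> x \<notin> P \<Longrightarrow> \<exists>y\<in>R. x * y - 1 \<in> P"
    and gen: "polyring R 2 a = UNIV" and ij: "i < 2" "j < 2" "i \<noteq> j" and ai: "a i \<in> P" and aj: "alg R P (a j)"
  shows "\<exists>n. lenb R {1} P UNIV n"
proof -
  note Pm = rprime_rmod[OF P]
  have PR: "rmod R P" by (rule rmod_mono[OF Pm]) simp
  obtain p k where p: "\<forall>i. coeff p i \<in> R" "coeff p k \<notin> P" "poly p (a j) \<in> P"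
    using aj unfolding alg_def by auto
  obtain e where e: "coeff p e \<notin> P" "\<And>i. e < i \<Longrightarrow> coeff p i \<in> P"
    using coeff_top_exists[OF rmod_0[OF Pm] p(2)] by blast
  define z where "z = a j"
  define J where "J k = rspan R ((^) z ` {..<k} \<union> P)" for k
  have Jm: "rmod R (J k)" for k unfolding J_def by (rule rspan_rmod[OF R])
  have JP: "P \<subseteq> J k" and Jz: "i < k \<Longrightarrow> z ^ i \<in> J k" for k i
    using rspan_superset[OF R, of "(^) z ` {..<k} \<union> P"] by (auto simp: J_def)
  have Jsuc: "J (Suc k) = rspan R (insert (z ^ k) (J k))" for k
  proof
    have "J k \<subseteq> rspan R (insert (z ^ k) (J k))" "z ^ k \<in> rspan R (insert (z ^ k) (J k))"
      using rspan_superset[OF R, of "insert (z ^ k) (J k)"] by auto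
    moreover have "(^) z ` {..<Suc k} \<union> P \<subseteq> insert (z ^ k) (J k)"
      using JP[of k] Jz[of _ k] by (auto simp: less_Suc_eq)
    ultimately show "J (Suc k) \<subseteq> rspan R (insert (z ^ k) (J k))"
      unfolding J_def[of "Suc k"] by (intro rspan_mono) auto
    have "J k \<subseteq> J (Suc k)" unfolding J_def by (intro rspan_mono) auto
    then show "rspan R (insert (z ^ k) (J k)) \<subseteq> J (Suc k)"
      by (intro rspan_least[OF Jm]) (auto intro: Jz)
  qed
  have "lenb R {1} P (J k) k" for k
  proof (induction k)
    case 0
    have "J 0 = P" using rspan_least[OF PR, of P] JP[of 0] by (auto simp: J_def)
    then show ?case by (simp add: lenb_self)
  next
    case (Suc k)
    have one: "lenb R {1} (J k) (J (Suc k)) 1"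
    proof (rule lenb_le1)
      fix L assume L: "rsat R {1} L" "J k \<subseteq> L" "L \<subseteq> J (Suc k)"
      note Lm = rsat_rmod[OF L(1)]
      show "L = J k \<or> L = J (Suc k)"
      proof (rule disjCI)
        assume "L \<noteq> J (Suc k)"
        show "L = J k"
        proof (rule ccontr)
          assume "L \<noteq> J k"
          then obtain l where l: "l \<in> L" "l \<notin> J k" using L(2) by auto
          have "l \<in> rspan R (insert (z ^ k) (J k))" using l(1) L(3) Jsuc by auto
          then obtain x \<rho> where x: "x \<in> J k" "\<rho> \<in> R" "l = x + \<rho> * z ^ k"
            unfolding rspan_insert_iff[OF R Jm] by blast
          have "\<rho> \<notin> P"
          proof
            assume "\<rho> \<in> P"
            then have "\<rho> * z ^ k \<in> J k" using JP rmod_mult2[OF Pm, of "z ^ k" \<rho>] by auto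
            then show False using x l(2) rmod_add[OF Jm] by simp
          qed
          then obtain y where y: "y \<in> R" "\<rho> * y - 1 \<in> P" using inv x(2) by auto
          have "(\<rho> * y - 1) * z ^ k \<in> L" using rmod_mult2[OF Pm UNIV_I y(2), of "z ^ k"] JP[of k] L(2) by auto
          moreover have "y * l - y * x \<in> L"
            using l x y L(2) by (intro rmod_diff[OF R Lm] rmod_mult[OF Lm]) auto
          ultimately have "(y * l - y * x) - (\<rho> * y - 1) * z ^ k \<in> L" using rmod_diff[OF R Lm] by blast
          then have "z ^ k \<in> L" unfolding x(3) by (simp add: algebra_simps)
          then have "J (Suc k) \<subseteq> L" unfolding Jsuc using L(2) by (intro rspan_least[OF Lm]) auto
          then show False using \<open>L \<noteq> J (Suc k)\<close> L(3) by auto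
        qed
      qed
    qed
    have sat: "rsat R {1} (J k)" "rsat R {1} (J (Suc k))" using Jm by (simp_all add: rsat_def)
    have sub: "J k \<subseteq> J (Suc k)" unfolding J_def by (intro rspan_mono) auto
    have "lenb R {1} P (J (Suc k)) (k + 1)"
      by (rule lenb_trans[OF Suc one sat JP sub R mulset_1]) (simp add: rsub_1[OF R])
    then show ?case by simp
  qed
  moreover have "J e = UNIV"
  proof -
    obtain y where y: "y \<in> R" "coeff p e * y - 1 \<in> P" using inv e(1) p(1) by blast
    have ze: "z ^ e \<in> J e"
    proof -
      have "coeff p e * z ^ e \<in> J e"
        unfolding J_def z_def by (rule leading_term_reduction[OF R Pm p(1) e(2) p(3)])
      then have "y * (coeff p e * z ^ e) \<in> J e" by (rule rmod_mult[OF Jm y(1)])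
      moreover have "(coeff p e * y - 1) * z ^ e \<in> J e"
        using subsetD[OF JP rmod_mult2[OF Pm UNIV_I y(2)]] .
      ultimately have "y * (coeff p e * z ^ e) - (coeff p e * y - 1) * z ^ e \<in> J e"
        by (rule rmod_diff[OF R Jm])
      then show ?thesis by (simp add: algebra_simps)
    qed
    have e0: "0 < e"
    proof (rule ccontr)
      assume "\<not> 0 < e"
      then have "1 \<in> J 0" using ze by simp
      moreover have "J 0 = P" using rspan_least[OF PR, of P] JP[of 0] by (auto simp: J_def)
      ultimately show False using rprime_1[OF P] by simp
    qed
    have zJ: "z * x \<in> J e" if "x \<in> J e" for x
      using rspan_powers_mult[OF R Pm rsub_1[OF R], of z e x] ze that unfolding J_def by simp
    have "meval a t \<in> J e" if "set_mset t \<subseteq> {..<2}" for t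
      using that
    proof (induction t)
      case empty
      show ?case using Jz[OF e0] by simp
    next
      case (add l t)
      then have "l = i \<or> l = j" using ij by auto
      then show ?case
      proof
        assume "l = i"
        then have "meval a (add_mset l t) \<in> P" using ai rmod_mult2[OF Pm] by simp
        then show ?thesis using JP by auto
      next
        assume "l = j"
        moreover have "meval a t \<in> J e" using add by simp
        ultimately show ?thesis using zJ[of "meval a t"] by (simp add: z_def mult.commute)
      qed
    qed
    then have "polyring R 2 a \<subseteq> J e" unfolding polyring_def by (intro rspan_least[OF Jm]) auto
    then show ?thesis using gen by auto
  qed
  ultimately show ?thesis by metis
qed

lemma jacobson_no_relation2:
  assumes r: "monomial_ordering r" and noeth: "noeth UNIV I" and R: "rsub R" and J: "jac R I"
    and gen: "polyring R 2 a = UNIV" and IR: "I \<subseteq> R"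
    and q: "rprime UNIV q" "I \<subseteq> q" and no: "subm r R 2 a \<inter> q = {}" and g: "g \<notin> q"
  shows "\<exists>Q M. rprime UNIV Q \<and> rprime UNIV M \<and> q \<subset> Q \<and> Q \<subset> M \<and> g \<notin> Q"
proof -
  obtain i j :: nat where ij: "i < 2" "j < 2" "i \<noteq> j" "({#j#}, {#i#}) \<in> r"
    using monomial_ordering_pair[OF r] by metis
  have ai: "a i \<notin> q" using meval_subm[of "{#i#}" 2 a r R] ij no by auto
  let ?A = "rspan UNIV (insert (a i) q)"
  have As: "insert (a i) q \<subseteq> ?A" by (rule rspan_superset[OF rsub_UNIV])
  note Am = rspan_rmod[OF rsub_UNIV, of "insert (a i) q"]
  have nq: "noeth UNIV q" using noeth_mono[OF noeth q(2)] .
  have infinite: "\<not> lenb R {1} ?A UNIV l" for l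
    by (rule no_relation_infinite_length[OF r R q(1) gen ij no])
  have nA: "noeth UNIV ?A" by (rule noeth_mono[OF nq]) (use As in auto)
  have "\<exists>P. rprime UNIV P \<and> ?A \<subseteq> P \<and> (\<nexists>n. lenb R {1} P UNIV n)"
  proof (rule ccontr)
    assume none: "\<not> ?thesis"
    have "\<exists>n. lenb R {1} ?A UNIV n"
    proof (rule finite_length[OF nA Am R mulset_1])
      fix P assume "rprime UNIV P" "?A \<subseteq> P"
      then show "\<exists>n. lenb R {1} P UNIV n" using none by meson
    qed (use rsub_1[OF R] in simp)
    then show False using infinite by simp
  qed
  then obtain P where P: "rprime UNIV P" "?A \<subseteq> P" "\<nexists>n. lenb R {1} P UNIV n" by auto
  have qP: "q \<subset> P" and aiP: "a i \<in> P" using As P(2) ai by auto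
  have "\<exists>M. rprime UNIV M \<and> P \<subset> M"
  proof (rule ccontr)
    assume none: "\<not> ?thesis"
    then have max: "Q' = P" if "rprime UNIV Q'" "P \<subseteq> Q'" for Q' using that by blast
    have IP: "I \<subseteq> P" using q(2) qP by auto
    note ns = nullstellensatz[OF R J gen IR P(1) IP max]
    have "\<exists>n. lenb R {1} P UNIV n"
      using ns ij(3) by (intro alg_field_finite_length[OF R P(1) _ gen ij(1,2) ij(3) aiP]) auto
    then show False using P(3) by simp
  qed
  then obtain M where M: "rprime UNIV M" "P \<subset> M" by auto
  let ?G = "rspan UNIV (insert g q)"
  have Gs: "insert g q \<subseteq> ?G" by (rule rspan_superset[OF rsub_UNIV])
  have "noeth UNIV ?G" by (rule noeth_mono[OF nq]) (use Gs in auto)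
  from finite_prime_cover[OF this rspan_rmod[OF rsub_UNIV]] obtain F where F: "finite F"
    "\<forall>Q\<in>F. rprime UNIV Q \<and> ?G \<subseteq> Q" "\<forall>P. rprime UNIV P \<and> ?G \<subseteq> P \<longrightarrow> (\<exists>Q\<in>F. Q \<subseteq> P)" by auto
  have "\<exists>x\<in>M. \<forall>Q\<in>insert q {Q\<in>F. \<not> M \<subseteq> Q}. x \<notin> Q"
    by (rule prime_avoidance) (use F q M qP in \<open>auto intro: rprime_rmod\<close>)
  then obtain x where x: "x \<in> M" "x \<notin> q" "\<And>Q. Q \<in> F \<Longrightarrow> \<not> M \<subseteq> Q \<Longrightarrow> x \<notin> Q" by auto
  have "insert x q \<subseteq> M" using x M qP by auto
  then obtain Q where Q: "rprime UNIV Q" "insert x q \<subseteq> Q" "Q \<subseteq> M"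
    and Qmin: "\<And>K. rprime UNIV K \<Longrightarrow> insert x q \<subseteq> K \<Longrightarrow> K \<subseteq> Q \<Longrightarrow> K = Q"
    by (rule exists_minimal_prime[OF nq subset_insertI M(1)]) (rule that)
  have mo: "minimal_over (insert x q) Q" unfolding minimal_over_def using Q Qmin by blast
  have "Q \<noteq> M" using principal_ideal_theorem[OF nq q(1) P(1) qP] M(2) mo by auto
  moreover have "g \<notin> Q"
  proof
    assume "g \<in> Q"
    then have "?G \<subseteq> Q" using Q(2) by (intro rspan_least[OF rprime_rmod[OF Q(1)]]) auto
    then obtain Q1 where Q1: "Q1 \<in> F" "Q1 \<subseteq> Q" using F(3) Q(1) by blast
    have "\<not> M \<subseteq> Q1" using Q1(2) \<open>Q \<noteq> M\<close> Q(3) by auto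
    then have "x \<notin> Q1" using x(3) Q1(1) by simp
    then have "Q1 \<subset> Q" using Q1 Q(2) by auto
    moreover have "rprime UNIV Q1" "q \<subset> Q1" using F(2) Q1(1) Gs g by auto
    ultimately show False using principal_ideal_theorem[OF nq q(1) _ _ _ mo] by blast
  qed
  moreover have "q \<subset> Q" using Q(2) x(2) by auto
  ultimately show ?thesis using Q(1,3) M(1) by blast
qed

section \<open>Noetherian rings and change of types\<close>

text \<open>Hilbert's basis theorem, by the ideals of leading coefficients.\<close>

lemma noeth_adj:
  assumes C: "rsub C" and noeth: "noeth C I" and IC: "I \<subseteq> C"
  shows "noeth (adj C c) I"
  unfolding noeth_def
proof (intro allI impI)
  fix J :: "nat \<Rightarrow> 'a set"
  assume "\<forall>i. rmod (adj C c) (J i) \<and> J i \<subseteq> adj C c \<and> I \<subseteq> J i \<and> J i \<subseteq> J (Suc i)"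
  then have J: "rmod (adj C c) (J i)" "J i \<subseteq> adj C c" "I \<subseteq> J i" "J i \<subseteq> J (Suc i)" for i by auto
  have Jmono: "J i \<subseteq> J j" if "i \<le> j" for i j using lift_Suc_mono_le[of J, OF J(4) that] .
  define L where "L i K = {a. \<exists>p. (\<forall>j. coeff p j \<in> C) \<and> (\<forall>j>i. coeff p j = 0) \<and> coeff p i = a \<and> poly p c \<in> K}"
    for i and K :: "'a set"
  note cA = adj_var[OF C, of c] and A = rsub_adj[OF C, of c] and CA = adj_base[OF C, of c]
  have Lm: "rmod C (L i (J k))" for i k
    unfolding rmod_def
  proof (intro conjI ballI)
    show "0 \<in> L i (J k)" unfolding L_def using rsub_0[OF C] rmod_0[OF J(1)]
      by (auto intro!: exI[of _ 0])
  next
    fix x y assume "x \<in> L i (J k)" "y \<in> L i (J k)"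
    then obtain p p' where "\<forall>j. coeff p j \<in> C" "\<forall>j>i. coeff p j = 0" "coeff p i = x" "poly p c \<in> J k"
      "\<forall>j. coeff p' j \<in> C" "\<forall>j>i. coeff p' j = 0" "coeff p' i = y" "poly p' c \<in> J k" by (auto simp: L_def)
    then show "x + y \<in> L i (J k)" unfolding L_def
      using rsub_add[OF C] rmod_add[OF J(1)] by (auto intro!: exI[of _ "p + p'"])
  next
    fix b x assume b: "b \<in> C" and "x \<in> L i (J k)"
    then obtain p where "\<forall>j. coeff p j \<in> C" "\<forall>j>i. coeff p j = 0" "coeff p i = x" "poly p c \<in> J k"
      by (auto simp: L_def)
    moreover have "b \<in> adj C c" using CA b by auto
    ultimately show "b * x \<in> L i (J k)" unfolding L_def
      using rsub_mult[OF C b] rmod_mult[OF J(1)] by (auto intro!: exI[of _ "smult b p"])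
  qed
  have LC: "L i K \<subseteq> C" for i K by (auto simp: L_def)
  have LI: "I \<subseteq> L i (J k)" for i k
  proof
    fix x assume x: "x \<in> I"
    have "c ^ i * x \<in> J k" using x J(3) by (intro rmod_mult[OF J(1)] rsub_power[OF A cA]) auto
    then show "x \<in> L i (J k)" unfolding L_def
      using x IC rsub_0[OF C] by (auto intro!: exI[of _ "monom x i"] simp: poly_monom mult.commute)
  qed
  have Lmono2: "L i K \<subseteq> L i K'" if "K \<subseteq> K'" for i K K' using that unfolding L_def by blast
  have Lsuc: "L i (J k) \<subseteq> L (Suc i) (J k)" for i k
  proof
    fix x assume "x \<in> L i (J k)"
    then obtain p where p: "\<forall>j. coeff p j \<in> C" "\<forall>j>i. coeff p j = 0" "coeff p i = x" "poly p c \<in> J k"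
      by (auto simp: L_def)
    have "c * poly p c \<in> J k" using rmod_mult[OF J(1) cA p(4)] .
    moreover have "\<forall>j. coeff (pCons 0 p) j \<in> C" using p(1) rsub_0[OF C] by (auto simp: coeff_pCons split: nat.split)
    moreover have "\<forall>j>Suc i. coeff (pCons 0 p) j = 0" using p(2) by (auto simp: coeff_pCons split: nat.split)
    ultimately show "x \<in> L (Suc i) (J k)" unfolding L_def
      using p(3) by (auto intro!: exI[of _ "pCons 0 p"])
  qed
  have Lmono1: "L i (J k) \<subseteq> L j (J k)" if "i \<le> j" for i j k
    using lift_Suc_mono_le[of "\<lambda>i. L i (J k)", OF Lsuc that] .
  have eq: "J k' \<subseteq> J k" if le: "k \<le> k'" and L: "\<And>i. L i (J k') = L i (J k)" for k k'
  proof
    have *: "poly p c \<in> J k" if "\<forall>j. coeff p j \<in> C" "\<forall>j>n. coeff p j = 0" "poly p c \<in> J k'" for p n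
      using that
    proof (induction n arbitrary: p)
      case 0
      then have "coeff p 0 \<in> L 0 (J k')" unfolding L_def by blast
      then have "coeff p 0 \<in> L 0 (J k)" using L by simp
      then obtain p0 where p0: "\<forall>j>0. coeff p0 j = 0" "coeff p0 0 = coeff p 0" "poly p0 c \<in> J k"
        unfolding L_def by blast
      have "p = p0"
      proof (rule poly_eqI)
        fix i show "coeff p i = coeff p0 i" using 0(2) p0 by (cases "i = 0") auto
      qed
      then show ?case using p0 by simp
    next
      case (Suc n)
      then have "coeff p (Suc n) \<in> L (Suc n) (J k')" unfolding L_def by blast
      then have "coeff p (Suc n) \<in> L (Suc n) (J k)" using L by simp
      then obtain p0 where p0: "\<forall>j. coeff p0 j \<in> C" "\<forall>j>Suc n. coeff p0 j = 0"
        "coeff p0 (Suc n) = coeff p (Suc n)" "poly p0 c \<in> J k"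
        unfolding L_def by blast
      have "poly p0 c \<in> J k'" using p0(4) Jmono[OF le] by auto
      then have "poly (p - p0) c \<in> J k'" using Suc.prems(3) rmod_diff[OF A J(1)] by simp
      moreover have "\<forall>j. coeff (p - p0) j \<in> C" using Suc.prems(1) p0(1) rsub_diff[OF C] by simp
      moreover have "\<forall>j>n. coeff (p - p0) j = 0"
      proof (intro allI impI)
        fix j assume "n < j"
        then show "coeff (p - p0) j = 0" using Suc.prems(2) p0(2,3) by (cases "j = Suc n") auto
      qed
      ultimately have "poly (p - p0) c \<in> J k" using Suc.IH by blast
      then have "poly (p - p0) c + poly p0 c \<in> J k" using p0(4) by (rule rmod_add[OF J(1)])
      then show ?case by simp
    qed
    fix u assume u: "u \<in> J k'"
    then obtain p where "\<forall>i. coeff p i \<in> C" "u = poly p c" using J(2) by (auto simp: adj_iff subset_iff)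
    then show "u \<in> J k" using *[of p "degree p"] u by (simp add: coeff_eq_0)
  qed
  have stable: "\<exists>n. \<forall>m\<ge>n. f m = f n"
    if f: "\<And>k. \<exists>i j. f k = L i (J j)" "\<And>k. f k \<subseteq> f (Suc k)" for f
  proof -
    have "\<forall>i. rmod C (f i) \<and> f i \<subseteq> C \<and> I \<subseteq> f i \<and> f i \<subseteq> f (Suc i)"
    proof
      fix i
      obtain a b where "f i = L a (J b)" using f(1)[of i] by blast
      then show "rmod C (f i) \<and> f i \<subseteq> C \<and> I \<subseteq> f i \<and> f i \<subseteq> f (Suc i)"
        using Lm LC LI f(2)[of i] by simp
    qed
    then show ?thesis using noeth unfolding noeth_def by simp
  qed
  have "\<exists>n. \<forall>m\<ge>n. L m (J m) = L n (J n)"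
  proof (rule stable)
    show "L k (J k) \<subseteq> L (Suc k) (J (Suc k))" for k using Lsuc[of k k] Lmono2[OF J(4), of "Suc k" k] by blast
  qed blast
  then obtain p where p: "\<And>m. p \<le> m \<Longrightarrow> L m (J m) = L p (J p)" by blast
  have "\<exists>n. \<forall>m\<ge>n. L i (J m) = L i (J n)" for i
    by (rule stable) (use Lmono2[OF J(4)] in blast)+
  then obtain n where n: "\<And>i m. n i \<le> m \<Longrightarrow> L i (J m) = L i (J (n i))" by metis
  define N where "N = p + (\<Sum>i<p. n i)"
  have "J m = J N" if m: "N \<le> m" for m
  proof
    show "J N \<subseteq> J m" by (rule Jmono[OF m])
    show "J m \<subseteq> J N"
    proof (rule eq[OF m])
      fix i
      show "L i (J m) = L i (J N)"
      proof (cases "i < p")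
        case True
        then have "n i \<le> (\<Sum>i<p. n i)" by (intro member_le_sum) auto
        then have "n i \<le> N" by (simp add: N_def)
        then show ?thesis using n[of i N] n[of i m] m by simp
      next
        case False
        have sub: "L i (J k) \<subseteq> L p (J p)" for k
        proof -
          define m where "m = max p (max i k)"
          have "L i (J k) \<subseteq> L m (J k)" by (rule Lmono1) (simp add: m_def)
          also have "\<dots> \<subseteq> L m (J m)" by (intro Lmono2 Jmono) (simp add: m_def)
          also have "\<dots> = L p (J p)" by (rule p) (simp add: m_def)
          finally show ?thesis .
        qed
        have sup: "L p (J p) \<subseteq> L i (J k)" if "N \<le> k" for k
        proof -
          have "p \<le> k" using that by (simp add: N_def)
          then have "L p (J p) \<subseteq> L p (J k)" using Lmono2[OF Jmono] by blast
          also have "\<dots> \<subseteq> L i (J k)" using Lmono1[of p i k] False by simp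
          finally show ?thesis .
        qed
        show ?thesis using sub[of m] sub[of N] sup[of m] sup[of N] m by blast
      qed
    qed
  qed
  then show "\<exists>n. \<forall>m\<ge>n. J m = J n" by blast
qed

lemma noeth_polyring:
  assumes "rsub C" "noeth C I" "I \<subseteq> C"
  shows "noeth (polyring C n a) I"
proof (induction n)
  case (Suc n)
  then show ?case unfolding polyring_Suc[OF assms(1)]
    using polyring_base[OF assms(1), of n a] assms(3)
    by (intro noeth_adj[OF rsub_polyring[OF assms(1)]]) auto
qed (use assms in \<open>simp add: polyring_0\<close>)

locale comm_ring_hom_type =
  fixes \<pi> :: "'t::comm_ring_1 \<Rightarrow> 'a::comm_ring_1"
  assumes hom1 [simp]: "\<pi> 1 = 1" and hom_add [simp]: "\<pi> (x + y) = \<pi> x + \<pi> y"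
    and hom_mult [simp]: "\<pi> (x * y) = \<pi> x * \<pi> y"
begin

lemma hom0 [simp]: "\<pi> 0 = 0"
  using hom_add[of 0 0] by (metis add_cancel_right_right add_0)

lemma hom_minus [simp]: "\<pi> (- x) = - \<pi> x"
  using hom_add[of x "- x"] by (simp add: eq_neg_iff_add_eq_0 add.commute)

lemma hom_diff [simp]: "\<pi> (x - y) = \<pi> x - \<pi> y"
  using hom_add[of x "- y"] by simp

lemma hom_sum: "\<pi> (sum f F) = (\<Sum>i\<in>F. \<pi> (f i))"
  by (induction F rule: infinite_finite_induct) auto

lemma hom_meval: "\<pi> (meval a t) = meval (\<pi> \<circ> a) t"
  by (induction t) auto

lemma vimage_rsub: "rsub R \<Longrightarrow> rsub (\<pi> -` R)"
  by (auto simp: rsub_def)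

lemma vimage_rmod: "rmod R M \<Longrightarrow> rmod (\<pi> -` R) (\<pi> -` M)"
  by (auto simp: rmod_def)

lemma vimage_rprime: "rprime C P \<Longrightarrow> rprime (\<pi> -` C) (\<pi> -` P)"
  unfolding rprime_def by (auto simp: vimage_rmod)

lemma image_rmod:
  assumes "rmod (\<pi> -` C) J" "C \<subseteq> range \<pi>"
  shows "rmod C (\<pi> ` J)"
  unfolding rmod_def
proof (intro conjI ballI)
  show "0 \<in> \<pi> ` J" using rmod_0[OF assms(1)] hom0 by (metis imageI)
next
  fix x y assume "x \<in> \<pi> ` J" "y \<in> \<pi> ` J"
  then obtain u v where "u \<in> J" "v \<in> J" "x = \<pi> u" "y = \<pi> v" by auto
  then have "x + y = \<pi> (u + v)" "u + v \<in> J" using rmod_add[OF assms(1)] by auto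
  then show "x + y \<in> \<pi> ` J" by blast
next
  fix c x assume c: "c \<in> C" and "x \<in> \<pi> ` J"
  then obtain u d where "u \<in> J" "x = \<pi> u" "c = \<pi> d" using assms(2) by auto
  then have "c * x = \<pi> (d * u)" "d * u \<in> J" using c rmod_mult[OF assms(1), of d u] by auto
  then show "c * x \<in> \<pi> ` J" by blast
qed

lemma vimage_image:
  assumes "rmod C' J" "rsub C'" "\<pi> -` {0} \<subseteq> J"
  shows "\<pi> -` (\<pi> ` J) = J"
proof
  show "\<pi> -` \<pi> ` J \<subseteq> J"
  proof
    fix x assume "x \<in> \<pi> -` \<pi> ` J"
    then obtain u where u: "u \<in> J" "\<pi> x = \<pi> u" by auto
    then have "x - u \<in> J" using assms(3) by auto
    then show "x \<in> J" using u rmod_diff_cancel[OF assms(2,1)] by blast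
  qed
qed auto

lemma image_rprime:
  assumes P: "rprime (\<pi> -` C) P" "\<pi> -` {0} \<subseteq> P" and C: "rsub C" "C \<subseteq> range \<pi>"
  shows "rprime C (\<pi> ` P)"
  unfolding rprime_def
proof (intro conjI ballI impI)
  note vi = vimage_image[OF rprime_rmod[OF P(1)] vimage_rsub[OF C(1)] P(2)]
  show "\<pi> ` P \<subseteq> C" using rprime_sub[OF P(1)] by auto
  show "rmod C (\<pi> ` P)" by (rule image_rmod[OF rprime_rmod[OF P(1)] C(2)])
  show "1 \<notin> \<pi> ` P" using rprime_1[OF P(1)] vi by (metis hom1 vimageI2)
  fix x y assume xy: "x \<in> C" "y \<in> C" "x * y \<in> \<pi> ` P"
  obtain u v where uv: "x = \<pi> u" "y = \<pi> v"
    using subsetD[OF C(2) xy(1)] subsetD[OF C(2) xy(2)] by blast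
  then have "u * v \<in> P" using xy(3) vi by (metis hom_mult vimageI2)
  then have "u \<in> P \<or> v \<in> P" using rprime_mult[OF P(1)] uv xy(1,2) by auto
  then show "x \<in> \<pi> ` P \<or> y \<in> \<pi> ` P" using uv by auto
qed

lemma vimage_noeth:
  assumes "noeth C I" "0 \<in> I" "I \<subseteq> C" "rsub C" "C \<subseteq> range \<pi>"
  shows "noeth (\<pi> -` C) (\<pi> -` I)"
  unfolding noeth_def
proof (intro allI impI)
  fix J :: "nat \<Rightarrow> 't set"
  assume "\<forall>i. rmod (\<pi> -` C) (J i) \<and> J i \<subseteq> \<pi> -` C \<and> \<pi> -` I \<subseteq> J i \<and> J i \<subseteq> J (Suc i)"
  then have J: "rmod (\<pi> -` C) (J i)" "J i \<subseteq> \<pi> -` C" "\<pi> -` I \<subseteq> J i" "J i \<subseteq> J (Suc i)" for i by auto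
  have "\<pi> -` {0} \<subseteq> J i" for i using J(3)[of i] assms(2) by auto
  then have vi: "\<pi> -` (\<pi> ` J i) = J i" for i by (rule vimage_image[OF J(1) vimage_rsub[OF assms(4)]])
  have "I \<subseteq> \<pi> ` J i" for i using J(3)[of i] assms(3,5) by blast
  then have "\<forall>i. rmod C (\<pi> ` J i) \<and> \<pi> ` J i \<subseteq> C \<and> I \<subseteq> \<pi> ` J i \<and> \<pi> ` J i \<subseteq> \<pi> ` J (Suc i)"
    using image_rmod[OF J(1) assms(5)] J(2,4) by blast
  then obtain n where "\<forall>m\<ge>n. \<pi> ` J m = \<pi> ` J n"
    using assms(1)[unfolded noeth_def, rule_format, of "\<lambda>i. \<pi> ` J i"] by blast
  then have "\<forall>m\<ge>n. J m = J n" using vi by metis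
  then show "\<exists>n. \<forall>m\<ge>n. J m = J n" ..
qed

lemma vimage_jac:
  assumes J: "jac R I" and "0 \<in> I" "I \<subseteq> R" "rsub R" "R \<subseteq> range \<pi>"
  shows "jac (\<pi> -` R) (\<pi> -` I)"
  unfolding jac_def
proof (intro allI impI)
  fix P g assume "rprime (\<pi> -` R) P \<and> \<pi> -` I \<subseteq> P \<and> g \<in> \<pi> -` R \<and> g \<notin> P"
  then have P: "rprime (\<pi> -` R) P" "\<pi> -` I \<subseteq> P" "\<pi> g \<in> R" "g \<notin> P" by auto
  have ker: "\<pi> -` {0} \<subseteq> P" using P(2) assms(2) by auto
  note vi = vimage_image[OF rprime_rmod[OF P(1)] vimage_rsub[OF assms(4)] ker]
  have "I \<subseteq> \<pi> ` P" using P(2) assms(3,5) by blast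
  moreover have "\<pi> g \<notin> \<pi> ` P" using vi P(4) by (metis vimageI2)
  ultimately obtain M where M: "rprime R M" "\<pi> ` P \<subseteq> M" "\<pi> g \<notin> M"
    "\<forall>x\<in>R. x \<notin> M \<longrightarrow> (\<exists>y\<in>R. x * y - 1 \<in> M)"
    using J image_rprime[OF P(1) ker assms(4,5)] P(3) unfolding jac_def by metis
  show "\<exists>m. rprime (\<pi> -` R) m \<and> P \<subseteq> m \<and> g \<notin> m \<and>
    (\<forall>x\<in>\<pi> -` R. x \<notin> m \<longrightarrow> (\<exists>y\<in>\<pi> -` R. x * y - 1 \<in> m))"
  proof (intro exI[of _ "\<pi> -` M"] conjI ballI impI)
    show "rprime (\<pi> -` R) (\<pi> -` M)" by (rule vimage_rprime[OF M(1)])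
    show "P \<subseteq> \<pi> -` M" "g \<notin> \<pi> -` M" using M by auto
    fix x assume "x \<in> \<pi> -` R" "x \<notin> \<pi> -` M"
    then obtain y where "y \<in> R" "\<pi> x * y - 1 \<in> M" using M(4) by auto
    moreover from this obtain z where "y = \<pi> z" using assms(5) by auto
    ultimately show "\<exists>y\<in>\<pi> -` R. x * y - 1 \<in> \<pi> -` M" by (intro bexI[of _ z]) auto
  qed
qed

lemma image_rspan:
  assumes "x \<in> rspan (\<pi> -` R) W"
  shows "\<pi> x \<in> rspan R (\<pi> ` W)"
  using assms by (induction rule: rspan.induct) (auto intro: rspan.intros)

lemma rspan_lift:
  assumes "y \<in> rspan R (\<pi> ` W)" "R \<subseteq> range \<pi>"
  shows "\<exists>x. x \<in> rspan (\<pi> -` R) W \<and> \<pi> x = y"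
  using assms(1)
proof (induction rule: rspan.induct)
  case zero
  then show ?case using rspan.zero hom0 by blast
next
  case (step y c w)
  then obtain x v d where "x \<in> rspan (\<pi> -` R) W" "\<pi> x = y" "v \<in> W" "w = \<pi> v" "c = \<pi> d"
    using assms(2) by blast
  then show ?case using step.hyps(2)
    by (intro exI[of _ "x + d * v"]) (auto intro: rspan.step)
qed

lemma vimage_polyring_UNIV:
  assumes "range \<pi> \<subseteq> polyring R n (\<pi> \<circ> a)" "R \<subseteq> range \<pi>" "rsub R"
  shows "polyring (\<pi> -` R) n a = UNIV"
proof -
  have "x \<in> polyring (\<pi> -` R) n a" for x
  proof -
    have im: "meval (\<pi> \<circ> a) ` T = \<pi> ` meval a ` T" for T by (auto simp: hom_meval image_comp)
    have "\<pi> x \<in> rspan R (\<pi> ` meval a ` monomials n)"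
      using assms(1) unfolding polyring_def im by auto
    then obtain y where y: "y \<in> polyring (\<pi> -` R) n a" "\<pi> y = \<pi> x"
      using rspan_lift[OF _ assms(2)] unfolding polyring_def by blast
    have "x - y \<in> \<pi> -` R" using y(2) rsub_0[OF assms(3)] by simp
    then have "x - y \<in> polyring (\<pi> -` R) n a" using polyring_base[OF vimage_rsub[OF assms(3)]] by blast
    then have "(x - y) + y \<in> polyring (\<pi> -` R) n a"
      by (rule rsub_add[OF rsub_polyring[OF vimage_rsub[OF assms(3)]] _ y(1)])
    then show ?thesis by simp
  qed
  then show ?thesis by auto
qed

lemma image_subm:
  assumes "x \<in> subm r (\<pi> -` R) n a"
  shows "\<pi> x \<in> subm r R n (\<pi> \<circ> a)"
proof -
  obtain t y where ty: "set_mset t \<subseteq> {..<n}" "x = meval a t + y"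
    "y \<in> rspan (\<pi> -` R) (meval a ` above r n t)"
    using assms by (auto simp: subm_def)
  have im: "meval (\<pi> \<circ> a) ` T = \<pi> ` meval a ` T" for T by (auto simp: hom_meval image_comp)
  have "\<pi> y \<in> rspan R (meval (\<pi> \<circ> a) ` above r n t)"
    unfolding im by (rule image_rspan[OF ty(3)])
  then show ?thesis unfolding ty(2) using ty(1) by (simp add: hom_meval submI)
qed

end

text \<open>Every commutative ring with carrier in \<open>'a\<close> is a quotient of the product of all of them, which is
  a ring on a whole type. The factor \<open>int\<close> makes the product nontrivial.\<close>

typedef 'a ring_product =
  "{f :: 'a ring \<Rightarrow> 'a. \<forall>A. f A \<in> (if cring A then carrier A else {undefined})} \<times> (UNIV :: int set)"
proof -
  have "(\<lambda>A. if cring A then \<zero>\<^bsub>A\<^esub> else undefined) \<in>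
      {f :: 'a ring \<Rightarrow> 'a. \<forall>A. f A \<in> (if cring A then carrier A else {undefined})}"
    by (auto simp: cring.cring_simprules(2))
  then show ?thesis
    by (intro exI[of _ "(\<lambda>A. if cring A then \<zero>\<^bsub>A\<^esub> else undefined, 0)"]) simp
qed

definition proj :: "'a ring \<Rightarrow> 'a ring_product \<Rightarrow> 'a" where
  "proj A x = fst (Rep_ring_product x) A"

definition tuple :: "('a ring \<Rightarrow> 'a) \<Rightarrow> int \<Rightarrow> 'a ring_product" where
  "tuple f k = Abs_ring_product (\<lambda>A. if cring A then f A else undefined, k)"

lemma proj_carrier: "cring A \<Longrightarrow> proj A x \<in> carrier A"
  using Rep_ring_product[of x]
  by (auto simp: proj_def mem_Times_iff split: if_splits dest: spec[of _ A])

lemma Rep_tuple: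
  assumes "\<And>A. cring A \<Longrightarrow> f A \<in> carrier A"
  shows "Rep_ring_product (tuple f k) = (\<lambda>A. if cring A then f A else undefined, k)"
  unfolding tuple_def using assms by (intro Abs_ring_product_inverse) auto

lemma proj_tuple:
  "(\<And>A. cring A \<Longrightarrow> f A \<in> carrier A) \<Longrightarrow> cring A \<Longrightarrow> proj A (tuple f k) = f A"
  by (simp add: proj_def Rep_tuple)

lemma ring_product_eqI:
  assumes "\<And>A. cring A \<Longrightarrow> proj A x = proj A y" "snd (Rep_ring_product x) = snd (Rep_ring_product y)"
  shows "x = y"
proof -
  have "fst (Rep_ring_product x) A = fst (Rep_ring_product y) A" for A
  proof (cases "cring A")
    case False
    then have "fst (Rep_ring_product z) A = undefined" for z :: "'a ring_product"
      using Rep_ring_product[of z] by (auto simp: mem_Times_iff split: if_splits dest: spec[of _ A])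
    then show ?thesis by simp
  qed (use assms(1) in \<open>simp add: proj_def\<close>)
  then have "Rep_ring_product x = Rep_ring_product y" using assms(2) by (auto simp: prod_eq_iff)
  then show ?thesis by (simp add: Rep_ring_product_inject)
qed

instantiation ring_product :: (type) comm_ring_1
begin

definition "0 = tuple (\<lambda>A. \<zero>\<^bsub>A\<^esub>) 0"
definition "1 = tuple (\<lambda>A. \<one>\<^bsub>A\<^esub>) 1"
definition "x + y = tuple (\<lambda>A. proj A x \<oplus>\<^bsub>A\<^esub> proj A y) (snd (Rep_ring_product x) + snd (Rep_ring_product y))"
definition "x * y = tuple (\<lambda>A. proj A x \<otimes>\<^bsub>A\<^esub> proj A y) (snd (Rep_ring_product x) * snd (Rep_ring_product y))"
definition "- x = tuple (\<lambda>A. \<ominus>\<^bsub>A\<^esub> proj A x) (- snd (Rep_ring_product x))"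
definition "x - y = x + - (y :: 'a ring_product)"

lemma ring_product_ops:
  "snd (Rep_ring_product (0 :: 'a ring_product)) = 0"
  "snd (Rep_ring_product (1 :: 'a ring_product)) = 1"
  "snd (Rep_ring_product (x + y)) = snd (Rep_ring_product x) + snd (Rep_ring_product y)"
  "snd (Rep_ring_product (x * y)) = snd (Rep_ring_product x) * snd (Rep_ring_product y)"
  "snd (Rep_ring_product (- x)) = - snd (Rep_ring_product x)"
  "cring A \<Longrightarrow> proj A (0 :: 'a ring_product) = \<zero>\<^bsub>A\<^esub>"
  "cring A \<Longrightarrow> proj A (1 :: 'a ring_product) = \<one>\<^bsub>A\<^esub>"
  "cring A \<Longrightarrow> proj A (x + y) = proj A x \<oplus>\<^bsub>A\<^esub> proj A y"
  "cring A \<Longrightarrow> proj A (x * y) = proj A x \<otimes>\<^bsub>A\<^esub> proj A y"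
  "cring A \<Longrightarrow> proj A (- x) = \<ominus>\<^bsub>A\<^esub> proj A x"
  unfolding zero_ring_product_def one_ring_product_def plus_ring_product_def times_ring_product_def
    uminus_ring_product_def
  by (simp_all add: Rep_tuple proj_tuple proj_carrier cring.cring_simprules)

instance
proof
  fix a b c :: "'a ring_product"
  show "a + b + c = a + (b + c)" "a + b = b + a" "0 + a = a" "- a + a = 0"
    "a * b * c = a * (b * c)" "a * b = b * a" "1 * a = a" "(a + b) * c = a * c + b * c"
    by (rule ring_product_eqI;
        simp add: ring_product_ops proj_carrier cring.cring_simprules algebra_simps)+
  show "a - b = a + - b" by (simp add: minus_ring_product_def)
  show "(0 :: 'a ring_product) \<noteq> 1"
    using ring_product_ops(1,2) by (metis zero_neq_one)
qed

end

lemma proj_surj: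
  assumes "cring A" "a \<in> carrier A"
  obtains x where "proj A x = a"
proof -
  let ?f = "\<lambda>B. if B = A then a else \<zero>\<^bsub>B\<^esub>"
  have "proj A (tuple ?f 0) = ?f A"
    by (rule proj_tuple) (use assms in \<open>auto simp: cring.cring_simprules\<close>)
  then show thesis using that[of "tuple ?f 0"] by simp
qed

text \<open>Transfer to the subring \<open>B = R[a\<^sub>0, a\<^sub>1]\<close>, viewed as a ring on a type of its own.\<close>

lemma jacobson_no_relation2_subring:
  assumes r: "monomial_ordering r" and noeth: "noeth R I" and R: "rsub R" and J: "jac R I"
    and gen: "polyring R m c = UNIV" and IR: "I \<subseteq> R" and I: "rmod UNIV I"
    and q: "rprime UNIV q" "I \<subseteq> q" and no: "subm r R 2 a \<inter> q = {}"
  obtains Q Q' u v where "rprime UNIV Q" "rprime UNIV Q'" "q \<subseteq> Q" "Q \<subseteq> Q'"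
    "u \<in> polyring R 2 a" "u \<in> Q" "u \<notin> q" "v \<in> polyring R 2 a" "v \<in> Q'" "v \<notin> Q"
proof -
  define B where "B = polyring R 2 a"
  have B: "rsub B" and RB: "R \<subseteq> B" unfolding B_def by (rule rsub_polyring[OF R], rule polyring_base[OF R])
  have "polyring R m c \<subseteq> polyring B m c" unfolding polyring_def[of _ m] using RB by (intro rspan_mono) auto
  then have "generic_lifting q B UNIV" using generic_lifting_polyring[OF B q(1), of m c] gen by (metis top.extremum_uniqueI)
  then obtain g where g: "g \<in> B" "g \<notin> q" "\<And>p. rprime B p \<Longrightarrow> q \<inter> B \<subseteq> p \<Longrightarrow> g \<notin> p \<Longrightarrow>
    \<exists>Q. rprime UNIV Q \<and> q \<inter> UNIV \<subseteq> Q \<and> Q \<inter> B = p \<and> 1 \<notin> Q"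
    using generic_liftingD[of q B UNIV 1] rprime_1[OF q(1)] by blast

  define G :: "'a ring" where "G = \<lparr>carrier = B, monoid.mult = (*), one = 1, zero = 0, add = (+)\<rparr>"
  have "cring G"
  proof (rule cringI)
    show "abelian_group G"
    proof (rule abelian_groupI)
      fix x assume "x \<in> carrier G"
      then show "\<exists>y\<in>carrier G. y \<oplus>\<^bsub>G\<^esub> x = \<zero>\<^bsub>G\<^esub>"
        using rsub_minus[OF B] by (intro bexI[of _ "- x"]) (auto simp: G_def)
    qed (use B in \<open>auto simp: G_def rsub_intros\<close>)
    show "comm_monoid G" by (rule comm_monoidI) (use B in \<open>auto simp: G_def rsub_intros mult.assoc mult.commute\<close>)
  qed (auto simp: G_def distrib_right)
  define \<pi> where "\<pi> = proj G"
  interpret comm_ring_hom_type \<pi>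
    by unfold_locales (use \<open>cring G\<close> in \<open>simp_all add: \<pi>_def ring_product_ops\<close>, simp_all add: G_def)
  have range: "range \<pi> = B"
    using proj_carrier[OF \<open>cring G\<close>] proj_surj[OF \<open>cring G\<close>] unfolding \<pi>_def
    by (simp add: G_def) (metis (no_types, lifting) image_subset_iff rangeI subsetI subset_antisym)
  have aB: "a i \<in> B" if "i < 2" for i unfolding B_def by (rule polyring_var[OF R that])
  have "\<exists>x. i < 2 \<longrightarrow> \<pi> x = a i" for i using aB[of i] unfolding range[symmetric] by (cases "i < 2") auto
  then obtain a' where a': "\<And>i. i < 2 \<Longrightarrow> \<pi> (a' i) = a i" by metis
  have mev: "meval (\<pi> \<circ> a') t = meval a t" if "set_mset t \<subseteq> {..<2}" for t
    by (rule meval_cong) (use that a' in auto)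
  have mevim: "meval (\<pi> \<circ> a') ` T = meval a ` T" if "T \<subseteq> monomials 2" for T
    using mev that by (intro image_cong) auto
  have pr: "polyring R 2 (\<pi> \<circ> a') = B" unfolding polyring_def B_def by (simp add: mevim)
  have sm: "subm r R 2 (\<pi> \<circ> a') \<subseteq> subm r R 2 a"
  proof
    fix x assume "x \<in> subm r R 2 (\<pi> \<circ> a')"
    then obtain t y where ty: "set_mset t \<subseteq> {..<2}" "x = meval (\<pi> \<circ> a') t + y"
      "y \<in> rspan R (meval (\<pi> \<circ> a') ` above r 2 t)"
      by (auto simp: subm_def)
    then have "y \<in> rspan R (meval a ` above r 2 t)"
      by (subst (asm) mevim) auto
    then show "x \<in> subm r R 2 a" unfolding ty(2) mev[OF ty(1)] by (rule submI[OF ty(1)])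
  qed
  have I0: "0 \<in> I" by (rule rmod_0[OF I])
  have Rr: "R \<subseteq> range \<pi>" using RB range by simp
  have BU: "\<pi> -` B = UNIV" using range by auto
  have nB: "noeth B I" unfolding B_def by (rule noeth_polyring[OF R noeth IR])
  have "noeth UNIV (\<pi> -` I)"
    using vimage_noeth[OF nB I0 _ B] IR RB range BU by auto
  moreover have "rprime UNIV (\<pi> -` q)" using vimage_rprime[OF q(1)] by simp
  moreover obtain g' where g': "\<pi> g' = g" using g(1) range by (metis rangeE)
  moreover have "subm r (\<pi> -` R) 2 a' \<inter> \<pi> -` q = {}" using image_subm sm no by fastforce
  ultimately have "\<exists>Q M. rprime UNIV Q \<and> rprime UNIV M \<and> \<pi> -` q \<subset> Q \<and> Q \<subset> M \<and> g' \<notin> Q"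
    using q(2) IR g(2)
    by (intro jacobson_no_relation2[OF r _ vimage_rsub[OF R] vimage_jac[OF J I0 IR R Rr] vimage_polyring_UNIV[OF _ Rr R]])
      (auto simp: pr range)
  then obtain Q2 M2 where Q2: "rprime UNIV Q2" "rprime UNIV M2" "\<pi> -` q \<subset> Q2" "Q2 \<subset> M2" "g' \<notin> Q2" by auto
  have kerQ: "\<pi> -` {0} \<subseteq> Q2" using Q2(3) rmod_0[OF rprime_rmod[OF q(1)]] by auto
  have kerM: "\<pi> -` {0} \<subseteq> M2" using kerQ Q2(4) by auto
  have viQ: "\<pi> -` (\<pi> ` Q2) = Q2" by (rule vimage_image[OF rprime_rmod[OF Q2(1)] rsub_UNIV kerQ])
  have viM: "\<pi> -` (\<pi> ` M2) = M2" by (rule vimage_image[OF rprime_rmod[OF Q2(2)] rsub_UNIV kerM])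
  define P where "P = \<pi> ` Q2"
  define M where "M = \<pi> ` M2"
  have P: "rprime B P" unfolding P_def using image_rprime[of B Q2] Q2(1) kerQ B range BU by simp
  have M: "rprime B M" unfolding M_def using image_rprime[of B M2] Q2(2) kerM B range BU by simp
  have qP: "q \<inter> B \<subseteq> P" unfolding P_def using Q2(3) range by blast
  have gP: "g \<notin> P" unfolding P_def using viQ Q2(5) g' by blast
  obtain u where u: "u \<in> P" "u \<notin> q" unfolding P_def using Q2(3) by blast
  obtain v where v: "v \<in> M" "v \<notin> P" unfolding P_def M_def using Q2(4) viQ by blast
  have PM: "P \<subseteq> M" unfolding P_def M_def using Q2(4) by auto
  obtain Q where Q: "rprime UNIV Q" "q \<subseteq> Q" "Q \<inter> B = P" using g(3)[OF P qP gP] by auto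
  obtain Q' where Q': "rprime UNIV Q'" "Q \<subseteq> Q'" "\<And>Q''. rprime UNIV Q'' \<Longrightarrow> Q' \<subseteq> Q'' \<Longrightarrow> Q'' = Q'"
    using exists_maximal_above[OF rprime_rmod[OF Q(1)] rprime_1[OF Q(1)]] by metis
  have IQ': "I \<subseteq> Q'" using q(2) Q(2) Q'(2) by auto
  have ns: "\<exists>y\<in>R. x * y - 1 \<in> Q'" if "x \<in> R" "x \<notin> Q'" for x
    by (rule nullstellensatz(1)[OF R J gen IR Q'(1) IQ' _ that]) (rule Q'(3))
  have alg: "alg R Q' z" for z
    by (rule nullstellensatz(2)[OF R J gen IR Q'(1) IQ']) (rule Q'(3))
  have vB: "v \<in> B" using rprime_sub[OF M] v by auto
  have "\<exists>w\<in>B. w \<in> Q' \<and> w \<notin> Q"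
  proof (cases "v \<in> Q'")
    case True
    then show ?thesis using v vB Q(3) by auto
  next
    case False
    obtain e p where e: "e \<in> R" "e \<notin> Q'" "\<forall>i. coeff p i \<in> R" "e + v * poly p v \<in> Q'"
      using alg_constant_term[OF Q'(1) False alg] by metis
    obtain y where y: "y \<in> R" "e * y - 1 \<in> Q'" using ns[OF e(1,2)] by auto
    define w where "w = y * (e + v * poly p v) - (e * y - 1)"
    have pB: "poly p v \<in> B" using e(3) RB vB by (intro poly_in_rsub[OF B]) auto
    have w1: "w = 1 + (y * poly p v) * v" by (simp add: w_def algebra_simps)
    note Q'm = rprime_rmod[OF Q'(1)]
    have "w \<in> Q'" unfolding w_def by (rule rmod_diff[OF rsub_UNIV Q'm rmod_mult[OF Q'm UNIV_I e(4)] y(2)])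
    moreover have yB: "y * poly p v \<in> B" using y(1) RB pB by (intro rsub_mult[OF B]) auto
    moreover have wB: "w \<in> B" unfolding w1 by (rule rsub_add[OF B rsub_1[OF B] rsub_mult[OF B yB vB]])
    moreover have "w \<notin> Q"
    proof
      assume "w \<in> Q"
      then have "w \<in> M" using wB Q(3) PM by auto
      moreover have "(y * poly p v) * v \<in> M" by (rule rmod_mult[OF rprime_rmod[OF M] yB v(1)])
      ultimately have "1 \<in> M" unfolding w1 using rmod_add_cancel[OF B rprime_rmod[OF M]] by blast
      then show False using rprime_1[OF M] by simp
    qed
    ultimately show ?thesis by blast
  qed
  then obtain w where "w \<in> B" "w \<in> Q'" "w \<notin> Q" by auto
  moreover have "u \<in> B" "u \<in> Q" using u Q(3) by auto
  ultimately show thesis using that[OF Q(1) Q'(1) Q(2) Q'(2), of u w] u(2) unfolding B_def by simp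
qed

section \<open>Affine algebras over a field\<close>

definition fin :: "'a::comm_ring_1 set \<Rightarrow> 'a set \<Rightarrow> nat \<Rightarrow> (nat \<Rightarrow> 'a) \<Rightarrow> bool" where
  "fin K Q m z \<longleftrightarrow> (\<exists>W. finite W \<and> rspan (polyring K m z) (W \<union> Q) = UNIV)"

lemma digits_inject:
  fixes a b :: "nat \<Rightarrow> nat"
  assumes "\<And>i. i < m \<Longrightarrow> a i < D" "\<And>i. i < m \<Longrightarrow> b i < D"
    "(\<Sum>i<m. D ^ (m - 1 - i) * a i) = (\<Sum>i<m. D ^ (m - 1 - i) * b i)" "i < m"
  shows "a i = b i"
  using assms
proof (induction m)
  case (Suc m)
  have horner: "(\<Sum>i<Suc m. D ^ (Suc m - 1 - i) * f i) = D * (\<Sum>i<m. D ^ (m - 1 - i) * f i) + f m" for f :: "nat \<Rightarrow> nat"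
  proof -
    have "(\<Sum>i<m. D ^ (m - i) * f i) = (\<Sum>i<m. D * (D ^ (m - 1 - i) * f i))"
    proof (intro sum.cong refl)
      fix i assume "i \<in> {..<m}"
      then have "m - i = Suc (m - 1 - i)" by auto
      then show "D ^ (m - i) * f i = D * (D ^ (m - 1 - i) * f i)" by (simp only: power_Suc mult.assoc)
    qed
    then show ?thesis by (simp add: sum_distrib_left)
  qed
  let ?A = "\<Sum>i<m. D ^ (m - 1 - i) * a i" and ?B = "\<Sum>i<m. D ^ (m - 1 - i) * b i"
  have eq: "D * ?A + a m = D * ?B + b m" using Suc.prems(3) unfolding horner .
  have lt: "a m < D" "b m < D" using Suc.prems(1,2) by auto
  have "a m = (D * ?A + a m) mod D" using lt by simp
  also have "\<dots> = b m" unfolding eq using lt by simp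
  finally have am: "a m = b m" .
  then have "D * ?A = D * ?B" using eq by simp
  then have "?A = ?B" using lt by simp
  then show ?case using am Suc by (cases "i = m") auto
qed simp

lemma rspan_power_mult:
  assumes Z: "rsub Z" and Q: "rmod UNIV Q" and u: "u \<in> rspan Z ((^) y ` {..<w} \<union> Q)"
  shows "y ^ e * u \<in> rspan Z ((^) y ` {..<w + e} \<union> Q)"
proof -
  let ?U = "rspan Z ((^) y ` {..<w + e} \<union> Q)"
  have sup: "(^) y ` {..<w + e} \<union> Q \<subseteq> ?U" by (rule rspan_superset[OF Z])
  have "rspan Z ((^) y ` {..<w} \<union> Q) \<subseteq> colon ?U (y ^ e)"
  proof (rule rspan_least[OF colon_rmod[OF rspan_rmod[OF Z]]])
    have "y ^ j * y ^ e \<in> ?U" if "j < w" for j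
      unfolding power_add[symmetric] using sup that by auto
    moreover have "x * y ^ e \<in> ?U" if "x \<in> Q" for x
      using sup rmod_mult2[OF Q UNIV_I that] by auto
    ultimately show "(^) y ` {..<w} \<union> Q \<subseteq> colon ?U (y ^ e)" by (auto simp: colon_def)
  qed
  then show ?thesis using u by (auto simp: colon_def mult.commute)
qed

text \<open>The weights \<open>D ^ (n - i)\<close> separate the monomials of the relation, so that \<open>z n\<close> becomes integral over
  the ring generated by \<open>z'\<close>.\<close>

lemma nagata:
  assumes K: "rsub K" and Q: "rprime UNIV Q" and inv: "\<And>x. x \<in> K \<Longrightarrow> x \<notin> Q \<Longrightarrow> \<exists>y\<in>K. x * y - 1 \<in> Q"
    and F: "finite F" "\<And>t. t \<in> F \<Longrightarrow> set_mset t \<subseteq> {..<Suc n}" "\<And>t. t \<in> F \<Longrightarrow> c t \<in> K"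
      "\<And>t. t \<in> F \<Longrightarrow> c t \<notin> Q" "\<exists>t\<in>F. t \<noteq> {#}"
  obtains z' V where "z' n = (\<Sum>t\<in>F. c t * meval z t)" "finite V"
    "polyring K (Suc n) z \<subseteq> rspan (polyring K (Suc n) z') (V \<union> Q)"
proof -
  note Qm = rprime_rmod[OF Q]
  define D where "D = Suc (\<Sum>t\<in>F. size t)"
  define e where "e i = D ^ (n - i)" for i
  define y where "y = z n"
  define f where "f = (\<Sum>t\<in>F. c t * meval z t)"
  define z' where "z' i = (if i = n then f else z i - y ^ e i)" for i
  let ?Z = "polyring K (Suc n) z'"
  note Z = rsub_polyring[OF K, of "Suc n" z']
  define U where "U M = rspan ?Z ((^) y ` {..<M} \<union> Q)" for M
  have Um: "rmod ?Z (U M)" for M unfolding U_def by (rule rspan_rmod[OF Z])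
  have Usup: "(^) y ` {..<M} \<union> Q \<subseteq> U M" for M unfolding U_def by (rule rspan_superset[OF Z])
  have Umono: "U M \<subseteq> U M'" if "M \<le> M'" for M M'
    unfolding U_def using that by (intro rspan_mono) auto
  have Upow: "y ^ k * u \<in> U (M + k)" if "u \<in> U M" for k u M
    using rspan_power_mult[OF Z Qm] that unfolding U_def by blast
  have z'Z: "z' i \<in> ?Z" if "i < Suc n" for i by (rule polyring_var[OF K that])
  have KZ: "K \<subseteq> ?Z" by (rule polyring_base[OF K])
  have e1: "1 \<le> e i" for i by (simp add: e_def D_def)
  have lead: "\<exists>u\<in>U (wt e t). meval z t = y ^ wt e t + u" if "set_mset t \<subseteq> {..<Suc n}" for t
    using that
  proof (induction t)
    case empty
    show ?case using rmod_0[OF Um] by (intro bexI[of _ 0]) auto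
  next
    case (add i t)
    then obtain u where u: "u \<in> U (wt e t)" "meval z t = y ^ wt e t + u" by auto
    have yu: "y ^ e i * u \<in> U (wt e t + e i)" by (rule Upow[OF u(1)])
    show ?case
    proof (cases "i = n")
      case True
      then have "e i = 1" by (simp add: e_def)
      then have "meval z (add_mset i t) = y ^ wt e (add_mset i t) + y ^ e i * u"
        using True u(2) by (simp add: y_def algebra_simps)
      then show ?thesis using yu by (intro bexI[of _ "y ^ e i * u"]) (auto simp: add.commute)
    next
      case False
      then have i: "i < Suc n" "z i = z' i + y ^ e i" using add.prems by (auto simp: z'_def)
      have "y ^ wt e t \<in> U (Suc (wt e t))" using Usup by auto
      also have "U (Suc (wt e t)) \<subseteq> U (wt e t + e i)" using e1[of i] by (intro Umono) simp
      finally have 1: "z' i * y ^ wt e t \<in> U (wt e t + e i)" by (rule rmod_mult[OF Um z'Z[OF i(1)]])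
      have "u \<in> U (wt e t + e i)" using u(1) Umono[of "wt e t" "wt e t + e i"] by auto
      then have 2: "z' i * u \<in> U (wt e t + e i)" by (rule rmod_mult[OF Um z'Z[OF i(1)]])
      have "meval z (add_mset i t) = y ^ wt e (add_mset i t) + (z' i * y ^ wt e t + z' i * u + y ^ e i * u)"
        using u(2) i(2) by (simp add: power_add algebra_simps)
      moreover have "z' i * y ^ wt e t + z' i * u + y ^ e i * u \<in> U (wt e (add_mset i t))"
        using rmod_add[OF Um rmod_add[OF Um 1 2] yu] by (simp add: add.commute)
      ultimately show ?thesis by blast
    qed
  qed
  have count_lt: "count t i < D" if "t \<in> F" for t i
  proof -
    have "count t i \<le> size t" by (rule count_le_size)
    also have "\<dots> \<le> (\<Sum>t\<in>F. size t)" using F(1) that by (intro member_le_sum) auto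
    finally show ?thesis by (simp add: D_def)
  qed
  have wtinj: "s = t" if st: "s \<in> F" "t \<in> F" "wt e s = wt e t" for s t
  proof (rule multiset_eqI)
    fix i
    show "count s i = count t i"
    proof (cases "i < Suc n")
      case True
      show ?thesis
      proof (rule digits_inject[of "Suc n" "count s" D "count t" i])
        show "(\<Sum>i<Suc n. D ^ (Suc n - 1 - i) * count s i) = (\<Sum>i<Suc n. D ^ (Suc n - 1 - i) * count t i)"
          using st(3) unfolding wt_eq_sum[OF F(2)[OF st(1)]] wt_eq_sum[OF F(2)[OF st(2)]] e_def by simp
      qed (use count_lt st True in auto)
    next
      case False
      then have "i \<notin># s" "i \<notin># t" using F(2) st by auto
      then show ?thesis by (simp add: not_in_iff)
    qed
  qed
  have "Max (wt e ` F) \<in> wt e ` F" using F(1,5) by (intro Max_in) auto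
  then obtain t0 where t0F: "t0 \<in> F" "Max (wt e ` F) = wt e t0" by blast
  then have t0: "t0 \<in> F" "\<And>t. t \<in> F \<Longrightarrow> wt e t \<le> wt e t0"
    using Max_ge[of "wt e ` F"] F(1) by (simp, metis finite_imageI imageI)
  define M where "M = wt e t0"
  have "0 < M"
  proof -
    obtain t where t: "t \<in> F" "t \<noteq> {#}" using F(5) by auto
    then obtain i s where "t = add_mset i s" by (cases t) auto
    then have "0 < wt e t" using e1[of i] by simp
    then show ?thesis using t0(2)[OF t(1)] by (simp add: M_def)
  qed
  have QU: "x \<in> U k" if "x \<in> Q" for x k using Usup[of k] that by auto
  have yM: "y ^ M \<in> U M"
  proof -
    obtain u0 where u0: "u0 \<in> U M" "meval z t0 = y ^ M + u0" 
      using lead[OF F(2)[OF t0(1)]] unfolding M_def by blast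
    have rest: "(\<Sum>t\<in>F - {t0}. c t * meval z t) \<in> U M"
    proof (rule rmod_sum[OF Um])
      fix t assume t: "t \<in> F - {t0}"
      then have "wt e t \<noteq> M" using wtinj[of t t0] t0(1) by (auto simp: M_def)
      then have lt: "wt e t < M" using t0(2)[of t] t by (simp add: M_def)
      have "set_mset t \<subseteq> {..<Suc n}" using F(2) t by simp
      from lead[OF this] obtain u where u: "u \<in> U (wt e t)" "meval z t = y ^ wt e t + u" by blast
      have "y ^ wt e t \<in> U M" "u \<in> U M" using Usup[of M] lt u(1) Umono[of "wt e t" M] by auto
      then have "meval z t \<in> U M" unfolding u(2) by (rule rmod_add[OF Um])
      moreover have "c t \<in> ?Z" using F(3) t KZ by auto
      ultimately show "c t * meval z t \<in> U M" by (intro rmod_mult[OF Um])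
    qed
    have fU: "f \<in> U M"
    proof -
      have "y ^ 0 \<in> U M" using Usup[of M] \<open>0 < M\<close> by blast
      then have "f * y ^ 0 \<in> U M" using z'Z[of n] by (intro rmod_mult[OF Um]) (simp_all add: z'_def)
      then show ?thesis by simp
    qed
    have c0: "c t0 \<in> ?Z" using F(3)[OF t0(1)] KZ by auto
    have "f = c t0 * meval z t0 + (\<Sum>t\<in>F - {t0}. c t * meval z t)"
      unfolding f_def using F(1) t0(1) by (rule sum.remove)
    then have "c t0 * y ^ M = f - (\<Sum>t\<in>F - {t0}. c t * meval z t) - c t0 * u0"
      using u0(2) by (simp add: algebra_simps)
    then have *: "c t0 * y ^ M \<in> U M"
      using rmod_diff[OF Z Um rmod_diff[OF Z Um fU rest] rmod_mult[OF Um c0 u0(1)]] by simp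
    obtain k where k: "k \<in> K" "c t0 * k - 1 \<in> Q" using inv F(3,4) t0(1) by blast
    have "k * (c t0 * y ^ M) - (c t0 * k - 1) * y ^ M \<in> U M"
      using k KZ QU rmod_mult2[OF Qm UNIV_I k(2)] by (intro rmod_diff[OF Z Um] rmod_mult[OF Um _ *]) auto
    then show ?thesis by (simp add: algebra_simps)
  qed
  have yall: "y ^ j \<in> U M" for j
  proof (induction j)
    case 0
    show ?case using Usup[of M] \<open>0 < M\<close> by blast
  next
    case (Suc j)
    then show ?case using rspan_powers_mult[OF Z Qm rsub_1[OF Z], of y M "y ^ j"] yM unfolding U_def by simp
  qed
  have UU: "U k \<subseteq> U M" for k
    unfolding U_def[of k] using yall QU by (intro rspan_least[OF Um]) auto
  have "polyring K (Suc n) z \<subseteq> U M"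
    unfolding polyring_def[of K "Suc n" z]
  proof (rule rspan_least)
    show "rmod K (U M)" by (rule rmod_mono[OF Um KZ])
    show "meval z ` (monomials (Suc n)) \<subseteq> U M"
    proof (clarify)
      fix t assume "set_mset t \<subseteq> {..<Suc n}"
      then obtain u where u: "u \<in> U (wt e t)" "meval z t = y ^ wt e t + u" using lead by blast
      show "meval z t \<in> U M" unfolding u(2) using yall UU u(1) by (intro rmod_add[OF Um]) auto
    qed
  qed
  then show thesis using that[of z' "(^) y ` {..<M}"] unfolding U_def f_def z'_def by simp
qed

lemma fin_trans:
  assumes K: "rsub K" and Q: "rmod UNIV Q" and fin: "fin K Q m z" and V: "finite V"
    and sub: "polyring K m z \<subseteq> rspan (polyring K m' z') (V \<union> Q)"
  shows "fin K Q m' z'"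
proof -
  obtain W where W: "finite W" "rspan (polyring K m z) (W \<union> Q) = UNIV" using fin unfolding fin_def by auto
  let ?Z = "polyring K m' z'"
  note Z = rsub_polyring[OF K, of m' z']
  define N where "N = rspan ?Z ((\<lambda>(v, w). v * w) ` (V \<times> W) \<union> Q)"
  have Nm: "rmod ?Z N" unfolding N_def by (rule rspan_rmod[OF Z])
  have Ns: "(\<lambda>(v, w). v * w) ` (V \<times> W) \<union> Q \<subseteq> N" unfolding N_def by (rule rspan_superset[OF Z])
  have "x \<in> N" for x
  proof -
    have "x \<in> rspan (polyring K m z) (W \<union> Q)" using W(2) by simp
    then show ?thesis
    proof (induction rule: rspan.induct)
      case zero
      show ?case by (rule rmod_0[OF Nm])
    next
      case (step x a w)
      have "a * w \<in> N"
      proof (cases "w \<in> Q")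
        case True
        then show ?thesis using Ns rmod_mult[OF Q UNIV_I True] by auto
      next
        case False
        then have w: "w \<in> W" using step.hyps by auto
        have "a \<in> rspan ?Z (V \<union> Q)" using sub step.hyps by auto
        then show ?thesis
        proof (rule rspan_mult[OF Z _ rspan_base[OF Z, of w "{w}"] _ Nm])
          fix v x assume "v \<in> V \<union> Q" "x \<in> {w}"
          then show "v * x \<in> N" using Ns w rmod_mult2[OF Q UNIV_I, of v w] by auto
        qed simp
      qed
      then show ?case by (rule rmod_add[OF Nm step.IH])
    qed
  qed
  then have "N = UNIV" by auto
  then show ?thesis unfolding fin_def N_def using V W(1)
    by (intro exI[of _ "(\<lambda>(v, w). v * w) ` (V \<times> W)"]) auto
qed

lemma fin_reduce:
  assumes K: "rsub K" and Q: "rmod UNIV Q" and fin: "fin K Q (Suc n) z" and zn: "z n \<in> Q"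
  shows "fin K Q n z"
proof -
  obtain W where W: "finite W" "rspan (polyring K (Suc n) z) (W \<union> Q) = UNIV" using fin unfolding fin_def by auto
  let ?Z = "polyring K n z"
  note Z = rsub_polyring[OF K, of n z]
  note Nm = rspan_rmod[OF Z, of "W \<union> Q"] and Ns = rspan_superset[OF Z, of "W \<union> Q"]
  have "x \<in> rspan ?Z (W \<union> Q)" for x
  proof -
    have "x \<in> rspan (polyring K (Suc n) z) (W \<union> Q)" using W(2) by simp
    then show ?thesis
    proof (induction rule: rspan.induct)
      case zero
      show ?case by (rule rmod_0[OF Nm])
    next
      case (step x a w)
      then obtain p where p: "\<forall>i. coeff p i \<in> ?Z" "a = poly p (z n)"
        unfolding polyring_Suc[OF K] adj_iff by auto
      obtain b p' where bp: "p = pCons b p'" by (cases p)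
      have "b \<in> ?Z" using p(1) bp by (metis coeff_pCons_0)
      have "z n * (poly p' (z n) * w) \<in> Q" using rmod_mult2[OF Q UNIV_I zn] .
      then have "z n * (poly p' (z n) * w) \<in> rspan ?Z (W \<union> Q)" using Ns by auto
      moreover have "b * w \<in> rspan ?Z (W \<union> Q)" using step.hyps Ns \<open>b \<in> ?Z\<close> by (intro rmod_mult[OF Nm]) auto
      moreover have "a * w = b * w + z n * (poly p' (z n) * w)" unfolding p(2) bp by (simp add: algebra_simps)
      ultimately have "a * w \<in> rspan ?Z (W \<union> Q)" using rmod_add[OF Nm] by simp
      then show ?case by (rule rmod_add[OF Nm step.IH])
    qed
  qed
  then show ?thesis unfolding fin_def using W(1) by auto
qed

lemma fin_minimal_indep:
  assumes K: "rsub K" and Q: "rprime UNIV Q" and inv: "\<And>x. x \<in> K \<Longrightarrow> x \<notin> Q \<Longrightarrow> \<exists>y\<in>K. x * y - 1 \<in> Q"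
    and fin: "fin K Q m z" and min: "\<And>m' z. m' < m \<Longrightarrow> \<not> fin K Q m' z"
  shows "indep K Q m z"
proof (rule ccontr)
  note Qm = rprime_rmod[OF Q]
  assume "\<not> indep K Q m z"
  then obtain F c t1 where F: "finite F" "\<forall>t\<in>F. set_mset t \<subseteq> {..<m} \<and> c t \<in> K"
    "(\<Sum>t\<in>F. c t * meval z t) \<in> Q" "t1 \<in> F" "c t1 \<notin> Q" unfolding indep_def by auto
  define G where "G = {t \<in> F. c t \<notin> Q}"
  have "(\<Sum>t\<in>F. c t * meval z t) = (\<Sum>t\<in>G. c t * meval z t) + (\<Sum>t\<in>F - G. c t * meval z t)"
    using F(1) by (simp add: sum.subset_diff[of G F] add.commute G_def)
  moreover have "(\<Sum>t\<in>F - G. c t * meval z t) \<in> Q"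
    by (intro rmod_sum[OF Qm] rmod_mult2[OF Qm]) (auto simp: G_def)
  ultimately have sum: "(\<Sum>t\<in>G. c t * meval z t) \<in> Q"
    using F(3) rmod_add_cancel[OF rsub_UNIV Qm] by simp
  have ne: "\<exists>t\<in>G. t \<noteq> {#}"
  proof (rule ccontr)
    assume "\<not> ?thesis"
    then have "G = {t1}" "t1 = {#}" using F(4,5) by (auto simp: G_def)
    then show False using sum F(5) by simp
  qed
  then have "0 < m" using F(2) by (cases m) (auto simp: G_def)
  then obtain n where m: "m = Suc n" by (cases m) auto
  have "finite G" using F(1) by (simp add: G_def)
  obtain z' V where z': "z' n = (\<Sum>t\<in>G. c t * meval z t)" "finite V"
    "polyring K (Suc n) z \<subseteq> rspan (polyring K (Suc n) z') (V \<union> Q)"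
    by (rule nagata[OF K Q inv \<open>finite G\<close> _ _ _ ne, of n c z]) (use F(2) m in \<open>auto simp: G_def\<close>)
  have "fin K Q (Suc n) z'" using fin_trans[OF K Qm _ z'(2,3)] fin m by simp
  then have "fin K Q n z'" using fin_reduce[OF K Qm] sum z'(1) by simp
  then show False using min[of n z'] m by simp
qed

definition box :: "nat \<Rightarrow> nat \<Rightarrow> (nat \<Rightarrow> nat) set" where
  "box n d = {..<n} \<rightarrow>\<^sub>E {..d}"

lemma finite_box [simp]: "finite (box n d)" and card_box: "card (box n d) = Suc d ^ n"
  by (auto simp: box_def card_PiE intro!: finite_PiE)

definition mse :: "nat \<Rightarrow> (nat \<Rightarrow> nat) \<Rightarrow> nat multiset" where
  "mse n e = (\<Sum>i<n. replicate_mset (e i) i)"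

lemma count_mse: "i < n \<Longrightarrow> count (mse n e) i = e i"
  by (simp add: mse_def count_sum sum.delta)

lemma set_mse: "set_mset (mse n e) \<subseteq> {..<n}"
  by (auto simp: mse_def set_mset_sum split: if_splits)

lemma meval_mse: "meval a (mse n e) = (\<Prod>i<n. a i ^ e i)"
  unfolding meval_eq_prod[OF set_mse] by (intro prod.cong) (auto simp: count_mse)

lemma inj_mse: "inj_on (mse n) (box n d)"
proof (rule inj_onI)
  fix e e' assume e: "e \<in> box n d" "e' \<in> box n d" "mse n e = mse n e'"
  show "e = e'"
  proof (rule PiE_ext[of e "{..<n}" "\<lambda>_. {..d}" e'])
    fix i assume "i \<in> {..<n}"
    then show "e i = e' i" using count_mse[of i n e] count_mse[of i n e'] e(3) by simp
  qed (use e in \<open>simp_all add: box_def\<close>)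
qed

text \<open>A finite module over a polynomial ring in \<open>m\<close> indeterminates has room for only \<open>O(N\<^sup>m)\<close> linearly
  independent monomials of degree \<open>N\<close>; this bounds transcendence degrees, also for fractions \<open>u i / s i\<close>.\<close>

lemma box_dependence:
  assumes K: "rsub K" and Q: "rprime UNIV Q" and fin: "fin K Q m z" and m: "m < p + n"
  shows "\<exists>N c. (\<forall>d\<in>box p N. \<forall>e\<in>box n N. c d e \<in> K) \<and> (\<exists>d\<in>box p N. \<exists>e\<in>box n N. c d e \<notin> Q) \<and>
    (\<Sum>e\<in>box n N. (\<Sum>d\<in>box p N. c d e * (\<Prod>i<p. x i ^ d i)) * (\<Prod>i<n. u i ^ e i * s i ^ (N - e i))) \<in> Q"
proof -
  note Qm = rprime_rmod[OF Q]
  obtain W where W: "finite W" "rspan (polyring K m z) (W \<union> Q) = UNIV" using fin unfolding fin_def by auto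
  define Gn where "Gn d = (\<lambda>(e, w). (\<Prod>i<m. z i ^ e i) * w) ` (box m d \<times> W)" for d
  define B where "B d = rspan K (Gn d \<union> Q)" for d
  have Bm: "rmod K (B d)" for d unfolding B_def by (rule rspan_rmod[OF K])
  have Bs: "Gn d \<union> Q \<subseteq> B d" for d unfolding B_def by (rule rspan_superset[OF K])
  have boxmono: "box n d \<subseteq> box n d'" if "d \<le> d'" for n d d'
    unfolding box_def by (rule PiE_mono) (use that in auto)
  have Gmono: "Gn d \<subseteq> Gn d'" if "d \<le> d'" for d d'
    unfolding Gn_def by (intro image_mono Sigma_mono boxmono[OF that] order_refl)
  have Bmono: "B d \<subseteq> B d'" if "d \<le> d'" for d d'
    unfolding B_def using Gmono[OF that] by (intro rspan_mono) auto
  have all: "\<exists>d. v \<in> B d" for v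
  proof -
    have "v \<in> rspan (polyring K m z) (W \<union> Q)" using W(2) by simp
    then show ?thesis
    proof (induction rule: rspan.induct)
      case zero
      show ?case using rmod_0[OF Bm] by blast
    next
      case (step v a w)
      then obtain d1 where d1: "v \<in> B d1" by auto
      have "\<exists>d. a * w \<in> B d"
      proof (cases "w \<in> Q")
        case True
        then show ?thesis using Bs[of 0] rmod_mult[OF Qm UNIV_I True] by auto
      next
        case False
        then have w: "w \<in> W" using step.hyps by auto
        have "a \<in> rspan K (meval z ` monomials m)" using step.hyps by (simp add: polyring_def)
        then show ?thesis
        proof (induction rule: rspan.induct)
          case zero
          show ?case using rmod_0[OF Bm] by auto
        next
          case (step a k v)
          then obtain d t where dt: "a * w \<in> B d" "set_mset t \<subseteq> {..<m}" "v = meval z t" by auto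
          have "restrict (count t) {..<m} \<in> box m (size t)"
            by (auto simp: box_def count_le_size)
          moreover have "v * w = (\<Prod>i<m. z i ^ restrict (count t) {..<m} i) * w"
            unfolding dt(3) meval_eq_prod[OF dt(2)] by simp
          ultimately have "v * w \<in> Gn (size t)"
            unfolding Gn_def using w by (intro image_eqI[of _ _ "(restrict (count t) {..<m}, w)"]) auto
          then have "v * w \<in> B (size t)" using Bs by auto
          then have "k * (v * w) \<in> B (size t)" by (rule rmod_mult[OF Bm step.hyps(2)])
          then have "k * (v * w) \<in> B (d + size t)" "a * w \<in> B (d + size t)"
            using Bmono[of "size t" "d + size t"] Bmono[of d "d + size t"] dt(1) by auto
          then have "a * w + k * (v * w) \<in> B (d + size t)" using rmod_add[OF Bm] by blast
          then show ?case by (intro exI[of _ "d + size t"]) (simp add: algebra_simps)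
        qed
      qed
      then obtain d2 where "a * w \<in> B d2" by auto
      then have "v \<in> B (d1 + d2)" "a * w \<in> B (d1 + d2)"
        using d1 Bmono[of d1 "d1 + d2"] Bmono[of d2 "d1 + d2"] by auto
      then show ?case using rmod_add[OF Bm] by blast
    qed
  qed
  define T where "T = x ` {..<p} \<union> u ` {..<n} \<union> s ` {..<n}"
  have "finite ((\<lambda>(v, w). v * w) ` (T \<times> W))" unfolding T_def using W(1) by auto
  moreover have "\<exists>d. A \<subseteq> B d" if "finite A" for A
    using that
  proof (induction A rule: finite_induct)
    case (insert a A)
    obtain d d' where "A \<subseteq> B d" "a \<in> B d'" using insert.IH all by blast
    then have "insert a A \<subseteq> B (d + d')" using Bmono[of d "d + d'"] Bmono[of d' "d + d'"] by auto
    then show ?case by blast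
  qed simp
  ultimately obtain d0 where d0: "(\<lambda>(v, w). v * w) ` (T \<times> W) \<subseteq> B d0" by blast
  obtain d1 where d1: "1 \<in> B d1" using all by blast
  have step: "v * b \<in> B (d + d0)" if v: "v \<in> T" and b: "b \<in> B d" for v b d
  proof -
    have QB: "x * y \<in> B d" if "x \<in> Q" for x y d using Bs[of d] rmod_mult2[OF Qm UNIV_I that] by auto
    have mono: "(\<Prod>i<m. z i ^ e i) * h \<in> B (d + d0)" if e: "e \<in> box m d" and h: "h \<in> B d0" for e h
    proof (rule rspan_mult[OF K rspan_base[OF K singletonI] h[unfolded B_def] _ Bm])
      fix g h assume g: "g \<in> {\<Prod>i<m. z i ^ e i}" and h: "h \<in> Gn d0 \<union> Q"
      from h consider "h \<in> Q" | e' w' where "e' \<in> box m d0" "w' \<in> W" "h = (\<Prod>i<m. z i ^ e' i) * w'"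
        by (auto simp: Gn_def)
      then show "g * h \<in> B (d + d0)"
      proof cases
        case 1
        then show ?thesis using QB[OF 1, of g "d + d0"] by (simp only: mult.commute)
      next
        case h: 2
        let ?e = "restrict (\<lambda>i. e i + e' i) {..<m}"
        have "?e \<in> box m (d + d0)" using e h(1) by (auto simp: box_def PiE_iff add_mono)
        moreover have "g * h = (\<Prod>i<m. z i ^ ?e i) * w'"
          using g by (simp add: h(3) power_add prod.distrib mult.assoc)
        ultimately have "g * h \<in> Gn (d + d0)"
          unfolding Gn_def using h(2) by (intro image_eqI[of _ _ "(?e, w')"]) auto
        then show ?thesis using Bs by blast
      qed
    qed
    have "b * v \<in> B (d + d0)"
    proof (rule rspan_mult[OF K b[unfolded B_def] rspan_base[OF K singletonI] _ Bm])
      fix g y assume "g \<in> Gn d \<union> Q" and y: "y \<in> {v}"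
      then consider "g \<in> Q" | e w where "e \<in> box m d" "w \<in> W" "g = (\<Prod>i<m. z i ^ e i) * w" by (auto simp: Gn_def)
      then show "g * y \<in> B (d + d0)"
      proof cases
        case 2
        have "v * w \<in> B d0" using d0 v 2(2) by auto
        from mono[OF 2(1) this] show ?thesis using y unfolding 2(3) by (simp only: singleton_iff ac_simps)
      qed (rule QB)
    qed
    then show ?thesis by (simp add: mult.commute)
  qed
  have pow: "v ^ k * b \<in> B (d + k * d0)" if v: "v \<in> T" and b: "b \<in> B d" for v b d k
  proof (induction k)
    case (Suc k)
    show ?case using step[OF v Suc] by (simp add: ac_simps)
  qed (use b in simp)
  have prods: "(\<Prod>i\<in>A. v i ^ k i) * b \<in> B (d + (\<Sum>i\<in>A. k i) * d0)"
    if "finite A" "\<And>i. i \<in> A \<Longrightarrow> v i \<in> T" "b \<in> B d" for A v k b d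
    using that
  proof (induction A rule: finite_induct)
    case (insert i A)
    have "v i ^ k i * ((\<Prod>i\<in>A. v i ^ k i) * b) \<in> B ((d + (\<Sum>i\<in>A. k i) * d0) + k i * d0)"
      using insert by (intro pow) auto
    then show ?case using insert by (simp add: algebra_simps)
  qed simp
  define N where "N = (d1 + (p + n) * d0 + 1) ^ m * card W"
  define Dg where "Dg = d1 + (p + n) * N * d0"
  define f where "f = (\<lambda>(d, e). (\<Prod>i<p. x i ^ d i) * (\<Prod>i<n. u i ^ e i * s i ^ (N - e i)))"
  have fB: "f de \<in> rspan K (Gn Dg \<union> Q)" if de: "de \<in> box p N \<times> box n N" for de
  proof -
    obtain d e where de': "de = (d, e)" "d \<in> box p N" "e \<in> box n N" using de by auto
    have b1: "(\<Prod>i<n. s i ^ (N - e i)) * 1 \<in> B (d1 + (\<Sum>i<n. N - e i) * d0)"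
      by (rule prods[OF _ _ d1]) (auto simp: T_def)
    have b2: "(\<Prod>i<n. u i ^ e i) * ((\<Prod>i<n. s i ^ (N - e i)) * 1) \<in> B (d1 + (\<Sum>i<n. N - e i) * d0 + (\<Sum>i<n. e i) * d0)"
      by (rule prods[OF _ _ b1]) (auto simp: T_def)
    have "(\<Prod>i<p. x i ^ d i) * ((\<Prod>i<n. u i ^ e i) * ((\<Prod>i<n. s i ^ (N - e i)) * 1))
        \<in> B (d1 + (\<Sum>i<n. N - e i) * d0 + (\<Sum>i<n. e i) * d0 + (\<Sum>i<p. d i) * d0)"
      by (rule prods[OF _ _ b2]) (auto simp: T_def)
    moreover have "d1 + (\<Sum>i<n. N - e i) * d0 + (\<Sum>i<n. e i) * d0 + (\<Sum>i<p. d i) * d0 \<le> Dg"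
    proof -
      have "(\<Sum>i<n. N - e i) + (\<Sum>i<n. e i) = (\<Sum>i<n. N)"
        unfolding sum.distrib[symmetric] using de'(3) by (intro sum.cong) (auto simp: box_def PiE_iff)
      moreover have "(\<Sum>i<p. d i) \<le> (\<Sum>i<p. N)"
        using de'(2) by (intro sum_mono) (auto simp: box_def PiE_iff)
      ultimately have "(\<Sum>i<n. N - e i) + (\<Sum>i<n. e i) + (\<Sum>i<p. d i) \<le> (p + n) * N"
        by (simp add: add_mult_distrib)
      then have "((\<Sum>i<n. N - e i) + (\<Sum>i<n. e i) + (\<Sum>i<p. d i)) * d0 \<le> (p + n) * N * d0"
        by (rule mult_le_mono1)
      then show ?thesis by (simp add: Dg_def add_mult_distrib)
    qed
    ultimately have "(\<Prod>i<p. x i ^ d i) * ((\<Prod>i<n. u i ^ e i) * ((\<Prod>i<n. s i ^ (N - e i)) * 1)) \<in> B Dg"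
      using Bmono by blast
    moreover have "f de = (\<Prod>i<p. x i ^ d i) * ((\<Prod>i<n. u i ^ e i) * ((\<Prod>i<n. s i ^ (N - e i)) * 1))"
      by (simp add: f_def de' prod.distrib)
    ultimately show ?thesis by (simp add: B_def)
  qed
  have "card (Gn Dg) < card (box p N \<times> box n N)"
  proof -
    let ?C = "d1 + (p + n) * d0 + 1"
    have "card (Gn Dg) \<le> card (box m Dg \<times> W)" unfolding Gn_def using W(1) by (intro card_image_le) simp
    also have "\<dots> = Suc Dg ^ m * card W" by (simp add: card_cartesian_product card_box)
    also have "Suc Dg \<le> ?C * Suc N" by (simp add: Dg_def algebra_simps)
    then have "Suc Dg ^ m * card W \<le> (?C * Suc N) ^ m * card W" by (intro mult_le_mono1 power_mono) auto
    also have "\<dots> = (?C ^ m * card W) * Suc N ^ m" by (simp only: power_mult_distrib mult_ac)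
    also have "\<dots> < Suc N * Suc N ^ m" unfolding N_def[symmetric] by simp
    also have "\<dots> = Suc N ^ Suc m" by simp
    also have "\<dots> \<le> Suc N ^ (p + n)" using m by (intro power_increasing) auto
    also have "\<dots> = card (box p N \<times> box n N)" by (simp add: card_cartesian_product card_box power_add)
    finally show ?thesis .
  qed
  note card = this
  have finG: "finite (Gn Dg)" unfolding Gn_def using W(1) by simp
  have "\<exists>c. (\<forall>i\<in>box p N \<times> box n N. c i \<in> K) \<and> (\<exists>i\<in>box p N \<times> box n N. c i \<notin> Q) \<and>
    (\<Sum>i\<in>box p N \<times> box n N. c i * f i) \<in> Q"
    by (rule linear_dependence[OF finG _ card fB K Q]) simp
  then obtain c where c: "\<forall>i\<in>box p N \<times> box n N. c i \<in> K" "\<exists>i\<in>box p N \<times> box n N. c i \<notin> Q"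
    "(\<Sum>i\<in>box p N \<times> box n N. c i * f i) \<in> Q"
    by blast
  have "(\<Sum>i\<in>box p N \<times> box n N. c i * f i) = (\<Sum>d\<in>box p N. \<Sum>e\<in>box n N. c (d, e) * f (d, e))"
    by (simp add: sum.cartesian_product)
  also have "\<dots> = (\<Sum>e\<in>box n N. \<Sum>d\<in>box p N. c (d, e) * f (d, e))" by (rule sum.swap)
  also have "\<dots> = (\<Sum>e\<in>box n N. (\<Sum>d\<in>box p N. c (d, e) * (\<Prod>i<p. x i ^ d i)) * (\<Prod>i<n. u i ^ e i * s i ^ (N - e i)))"
    by (simp add: f_def sum_distrib_right mult.assoc)
  finally show ?thesis using c by (intro exI[of _ N] exI[of _ "\<lambda>d e. c (d, e)"]) auto
qed

lemma indep_box:
  assumes "indep K P p x" "rmod UNIV P" "\<And>d. d \<in> box p N \<Longrightarrow> c d \<in> K"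
    "(\<Sum>d\<in>box p N. c d * (\<Prod>i<p. x i ^ d i)) \<in> P" "d \<in> box p N"
  shows "c d \<in> P"
proof -
  define c' where "c' t = c (the_inv_into (box p N) (mse p) t)" for t
  have c': "c' (mse p d) = c d" if "d \<in> box p N" for d
    unfolding c'_def using the_inv_into_f_f[OF inj_mse that] by simp
  have "(\<Sum>t\<in>mse p ` box p N. c' t * meval x t) = (\<Sum>d\<in>box p N. c d * (\<Prod>i<p. x i ^ d i))"
    by (simp add: sum.reindex[OF inj_mse] c' meval_mse)
  then have "c' (mse p d) \<in> P"
    using assms(3-5) c' by (intro indepD[OF assms(1), of "mse p ` box p N" c']) (auto dest: subsetD[OF set_mse])
  then show ?thesis using c' assms(5) by simp
qed

lemma indep_le_fin:
  assumes K: "rsub K" and Q: "rprime UNIV Q" and "fin K Q m z" "indep K Q p x"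
  shows "p \<le> m"
proof (rule ccontr)
  assume "\<not> p \<le> m"
  then have "m < p + 0" by simp
  from box_dependence[OF K Q assms(3) this, of x "\<lambda>_. 1" "\<lambda>_. 1"] obtain N c where
    c: "\<forall>d\<in>box p N. \<forall>e\<in>box 0 N. c d e \<in> K" "\<exists>d\<in>box p N. \<exists>e\<in>box 0 N. c d e \<notin> Q"
    "(\<Sum>e\<in>box 0 N. (\<Sum>d\<in>box p N. c d e * (\<Prod>i<p. x i ^ d i)) * (\<Prod>i<(0::nat). 1 ^ e i * 1 ^ (N - e i))) \<in> Q"
    by blast
  have box0: "box 0 N = {\<lambda>_. undefined}" by (simp add: box_def)
  obtain d where "d \<in> box p N" "c d (\<lambda>_. undefined) \<notin> Q" using c(2) box0 by auto
  moreover have "(\<Sum>d\<in>box p N. c d (\<lambda>_. undefined) * (\<Prod>i<p. x i ^ d i)) \<in> Q" using c(3) by (simp add: box0)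
  ultimately show False
    using indep_box[OF assms(4) rprime_rmod[OF Q], of N "\<lambda>d. c d (\<lambda>_. undefined)" d] c(1) box0 by auto
qed

lemma indep_mono: "indep K Q n a \<Longrightarrow> m \<le> n \<Longrightarrow> indep K Q m a"
  unfolding indep_def by (meson lessThan_subset_iff order_trans)

lemma generic_basis:
  assumes Z: "rsub Z" and Q: "rprime UNIV Q" and "finite W"
  shows "\<exists>V g. V \<subseteq> W \<and> g \<in> Z \<and> g \<notin> Q \<and>
    (\<forall>c. (\<forall>v\<in>V. c v \<in> Z) \<and> (\<Sum>v\<in>V. c v * v) \<in> Q \<longrightarrow> (\<forall>v\<in>V. c v \<in> Q)) \<and>
    (\<forall>u\<in>rspan Z (W \<union> Q). g * u \<in> rspan Z (V \<union> Q))"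
  using assms(3)
proof (induction W rule: finite_induct)
  case empty
  show ?case using rsub_1[OF Z] rprime_1[OF Q] by (intro exI[of _ "{}"] exI[of _ 1]) auto
next
  case (insert w W)
  note Qm = rprime_rmod[OF Q]
  obtain V g where V: "V \<subseteq> W" "g \<in> Z" "g \<notin> Q"
    "\<forall>c. (\<forall>v\<in>V. c v \<in> Z) \<and> (\<Sum>v\<in>V. c v * v) \<in> Q \<longrightarrow> (\<forall>v\<in>V. c v \<in> Q)"
    "\<forall>u\<in>rspan Z (W \<union> Q). g * u \<in> rspan Z (V \<union> Q)"
    using insert.IH by blast
  have fV: "finite V" "w \<notin> V" using V(1) insert.hyps finite_subset by auto
  let ?ind = "\<forall>c. (\<forall>v\<in>insert w V. c v \<in> Z) \<and> (\<Sum>v\<in>insert w V. c v * v) \<in> Q \<longrightarrow> (\<forall>v\<in>insert w V. c v \<in> Q)"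
  have Wb: "x \<in> rspan Z (W \<union> Q)" if "x \<in> W \<union> Q" for x
    using rspan_superset[OF Z, of "W \<union> Q"] that by blast
  show ?case
  proof (cases ?ind)
    case True
    let ?M = "rspan Z (insert w V \<union> Q)"
    note Mm = rspan_rmod[OF Z, of "insert w V \<union> Q"]
    have "rspan Z (V \<union> Q) \<subseteq> ?M" by (rule rspan_mono) auto
    moreover have "w \<in> ?M" using rspan_superset[OF Z, of "insert w V \<union> Q"] by auto
    then have "w * g \<in> ?M" by (rule rmod_mult2[OF Mm V(2)])
    ultimately have "insert w W \<union> Q \<subseteq> colon ?M g" using V(5) Wb by (auto simp: colon_def mult.commute)
    then have "rspan Z (insert w W \<union> Q) \<subseteq> colon ?M g" by (rule rspan_least[OF colon_rmod[OF Mm]])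
    then have "\<forall>u\<in>rspan Z (insert w W \<union> Q). g * u \<in> ?M" by (auto simp: colon_def mult.commute)
    then show ?thesis using True V(1-3) by (intro exI[of _ "insert w V"] exI[of _ g]) auto
  next
    case False
    then obtain c where c: "\<forall>v\<in>insert w V. c v \<in> Z" "(\<Sum>v\<in>insert w V. c v * v) \<in> Q" "\<exists>v\<in>insert w V. c v \<notin> Q" by blast
    have sum: "c w * w + (\<Sum>v\<in>V. c v * v) \<in> Q" using c(2) fV by simp
    have cw: "c w \<notin> Q"
    proof
      assume cw: "c w \<in> Q"
      have "(\<Sum>v\<in>V. c v * v) \<in> Q"
        using rmod_diff[OF rsub_UNIV Qm sum rmod_mult2[OF Qm UNIV_I cw, of w]] by simp
      then show False using V(4) c cw by blast
    qed
    let ?M = "rspan Z (V \<union> Q)"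
    note Mm = rspan_rmod[OF Z, of "V \<union> Q"] and Ms = rspan_superset[OF Z, of "V \<union> Q"]
    have 1: "c w * w + (\<Sum>v\<in>V. c v * v) \<in> ?M" using Ms sum by auto
    have 2: "(\<Sum>v\<in>V. c v * v) \<in> ?M" using c(1) Ms by (intro rmod_sum[OF Mm] rmod_mult[OF Mm]) auto
    have w: "c w * w \<in> ?M" using rmod_diff[OF Z Mm 1 2] by simp
    have cZ: "c w \<in> Z" using c(1) by simp
    have "insert w W \<union> Q \<subseteq> colon ?M (g * c w)"
    proof
      fix x assume x: "x \<in> insert w W \<union> Q"
      show "x \<in> colon ?M (g * c w)"
      proof (cases "x = w")
        case True
        have "g * (c w * w) \<in> ?M" by (rule rmod_mult[OF Mm V(2) w])
        then show ?thesis unfolding True colon_def by (simp add: ac_simps)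
      next
        case False
        then have "g * x \<in> ?M" using V(5) Wb x by blast
        then have "c w * (g * x) \<in> ?M" by (rule rmod_mult[OF Mm cZ])
        then show ?thesis unfolding colon_def by (simp add: ac_simps)
      qed
    qed
    then have "rspan Z (insert w W \<union> Q) \<subseteq> colon ?M (g * c w)" by (rule rspan_least[OF colon_rmod[OF Mm]])
    then have "\<forall>u\<in>rspan Z (insert w W \<union> Q). (g * c w) * u \<in> ?M" by (auto simp: colon_def mult.commute)
    moreover have "g * c w \<notin> Q" using rprime_mult[OF Q] V(3) cw by blast
    ultimately show ?thesis using V(1,4) rsub_mult[OF Z V(2) cZ]
      by (intro exI[of _ V] exI[of _ "g * c w"]) auto
  qed
qed

lemma rspan_Un_sum:
  assumes Z: "rsub Z" and Q: "rmod UNIV Q" and V: "finite V" and x: "x \<in> rspan Z (V \<union> Q)"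
  obtains c where "\<forall>v. c v \<in> Z" "x - (\<Sum>v\<in>V. c v * v) \<in> Q"
proof -
  have "rmod Z Q" by (rule rmod_mono[OF Q]) simp
  moreover have "x \<in> rspan Z (Q \<union> V)" using x by (simp add: Un_commute)
  ultimately obtain q v where q: "q \<in> Q" "v \<in> rspan Z V" "x = q + v"
    using rspan_Un_iff[OF Z] by blast
  have "v \<in> rspan Z (id ` V)" using q(2) by simp
  then obtain F c where F: "finite F" "F \<subseteq> V" "\<And>t. t \<in> F \<Longrightarrow> c t \<in> Z" "v = (\<Sum>t\<in>F. c t * id t)"
    by (rule rspan_image_sum[OF Z]) blast
  let ?c = "\<lambda>v. if v \<in> F then c v else 0"
  have "(\<Sum>v\<in>V. ?c v * v) = (\<Sum>v\<in>F. ?c v * v)"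
    using F(2) V by (intro sum.mono_neutral_right) auto
  also have "\<dots> = v" unfolding F(4) by simp
  finally have "x - (\<Sum>v\<in>V. ?c v * v) \<in> Q" using q by simp
  moreover have "\<forall>v. ?c v \<in> Z" using F(3) rsub_0[OF Z] by simp
  ultimately show thesis by (rule that[rotated])
qed

lemma transcendental_divisibility:
  assumes B: "rsub B" and Q: "rmod UNIV Q" and tr: "\<not> alg B Q f"
    and ab: "a \<in> adj B f" "b \<in> adj B f" and s: "s \<in> B" and rel: "f ^ N * a - s * b \<in> Q"
  shows "\<exists>c\<in>adj B f. a - s * c \<in> Q"
proof -
  obtain p p' where p: "\<forall>i. coeff p i \<in> B" "a = poly p f" "\<forall>i. coeff p' i \<in> B" "b = poly p' f"
    using ab unfolding adj_iff by auto
  let ?h = "monom 1 N * p - smult s p'"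
  have "\<forall>i. coeff ?h i \<in> B" using p s B by (auto simp: coeff_monom_mult intro!: rsub_intros)
  moreover have "poly ?h f \<in> Q" using rel p by (simp add: poly_monom)
  ultimately have "coeff ?h i \<in> Q" for i using tr unfolding alg_def by blast
  then have "coeff ?h (i + N) \<in> Q" for i .
  then have *: "coeff p i - s * coeff p' (i + N) \<in> Q" for i by (simp add: coeff_monom_mult)
  have "a - s * poly (poly_shift N p') f = poly (p - smult s (poly_shift N p')) f" by (simp add: p)
  also have "\<dots> \<in> Q"
    using * by (intro poly_in_ideal[OF Q]) (simp add: coeff_poly_shift)
  finally have "a - s * poly (poly_shift N p') f \<in> Q" .
  moreover have "poly (poly_shift N p') f \<in> adj B f"
    unfolding adj_iff using p(3) by (intro exI[of _ "poly_shift N p'"]) (auto simp: coeff_poly_shift)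
  ultimately show ?thesis by blast
qed

text \<open>This replaces going-down. Modulo \<open>Q\<close>, some \<open>y\<close> outside \<open>P\<close> satisfies \<open>y f\<^sup>\<mu> = e s\<close>. As \<open>f\<close> is transcendental
  over the ring that contains \<open>s\<close>, a fixed \<open>g\<close> makes \<open>g y\<^sup>k\<close> divisible by \<open>s\<^sup>k\<close> for all \<open>k\<close>; the chain condition
  for the quotients then forces \<open>y\<close> into \<open>P\<close>.\<close>

lemma affine_contradiction:
  assumes K: "rsub K" and noeth: "noeth UNIV Q" and Q: "rprime UNIV Q" and P: "rprime UNIV P" and QP: "Q \<subset> P"
    and adj: "\<And>Q'. rprime UNIV Q' \<Longrightarrow> Q \<subseteq> Q' \<Longrightarrow> Q' \<subset> P \<Longrightarrow> Q' = Q"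
    and fin: "fin K Q (Suc n) z" and ind: "indep K Q (Suc n) z"
    and zP: "z n \<in> P" and s: "s \<in> polyring K n z" "s \<in> P" "s \<notin> Q"
  shows False
proof -
  note Qm = rprime_rmod[OF Q] and Pm = rprime_rmod[OF P]
  let ?B = "polyring K n z" and ?Z = "polyring K (Suc n) z"
  note B = rsub_polyring[OF K, of n z] and Z = rsub_polyring[OF K, of "Suc n" z]
  have tr: "\<not> alg ?B Q (z n)" by (rule indep_not_alg[OF K Qm ind])
  define f where "f = z n"
  have sZ: "s \<in> ?Z" using s(1) adj_base[OF B] polyring_Suc[OF K, of n z] by auto
  have fZ: "f \<in> ?Z" unfolding f_def by (rule polyring_var[OF K]) simp
  have "minimal_over (insert s Q) P"
    unfolding minimal_over_def
  proof (intro conjI allI impI P)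
    show "insert s Q \<subseteq> P" using s(2) QP by auto
    fix Q' assume Q': "rprime UNIV Q' \<and> insert s Q \<subseteq> Q' \<and> Q' \<subseteq> P"
    show "Q' = P"
    proof (rule ccontr)
      assume "Q' \<noteq> P"
      then have "Q' \<subset> P" using Q' by auto
      then have "Q' = Q" using Q' by (intro adj) auto
      then show False using Q' s(3) by auto
    qed
  qed
  then have min: "minimal_over (rspan UNIV (insert s Q)) P" by (simp add: minimal_over_rspan)
  have fP: "f \<in> P" using zP by (simp add: f_def)
  obtain y \<mu> where y: "y \<notin> P" "y * f ^ \<mu> \<in> rspan UNIV (insert s Q)"
    by (rule minimal_over_power[OF min rspan_rmod[OF rsub_UNIV] fP])
  obtain q e where qe: "q \<in> Q" "y * f ^ \<mu> = q + e * s"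
    using y(2) unfolding rspan_insert_iff[OF rsub_UNIV Qm] by blast
  obtain W where W: "finite W" "rspan ?Z (W \<union> Q) = UNIV" using fin unfolding fin_def by auto
  obtain V g where V: "V \<subseteq> W" "g \<in> ?Z" "g \<notin> Q"
    "\<forall>c. (\<forall>v\<in>V. c v \<in> ?Z) \<and> (\<Sum>v\<in>V. c v * v) \<in> Q \<longrightarrow> (\<forall>v\<in>V. c v \<in> Q)"
    "\<forall>u\<in>rspan ?Z (W \<union> Q). g * u \<in> rspan ?Z (V \<union> Q)"
    using generic_basis[OF Z Q W(1)] by blast
  have fV: "finite V" by (rule finite_subset[OF V(1) W(1)])
  have "\<exists>Y. g * y ^ k - s ^ k * Y \<in> Q" for k
  proof -
    have "g * y ^ k \<in> rspan ?Z (V \<union> Q)" using V(5) W(2) by simp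
    then obtain \<alpha> where \<alpha>: "\<forall>v. \<alpha> v \<in> ?Z" "g * y ^ k - (\<Sum>v\<in>V. \<alpha> v * v) \<in> Q" by (rule rspan_Un_sum[OF Z Qm fV])
    have "g * e ^ k \<in> rspan ?Z (V \<union> Q)" using V(5) W(2) by simp
    then obtain \<beta> where \<beta>: "\<forall>v. \<beta> v \<in> ?Z" "g * e ^ k - (\<Sum>v\<in>V. \<beta> v * v) \<in> Q" by (rule rspan_Un_sum[OF Z Qm fV])
    let ?a = "\<Sum>v\<in>V. \<alpha> v * v" and ?b = "\<Sum>v\<in>V. \<beta> v * v"
    let ?F = "f ^ (\<mu> * k)" and ?S = "s ^ k"
    have "y * f ^ \<mu> - e * s \<in> Q" using qe by simp
    then have "(y * f ^ \<mu>) ^ k - (e * s) ^ k \<in> Q" by (rule cong_power[OF Qm])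
    then have 1: "g * ((y * f ^ \<mu>) ^ k - (e * s) ^ k) \<in> Q" by (rule rmod_mult[OF Qm UNIV_I])
    have 2: "?S * (g * e ^ k - ?b) - ?F * (g * y ^ k - ?a) \<in> Q"
      by (rule rmod_diff[OF rsub_UNIV Qm rmod_mult[OF Qm UNIV_I \<beta>(2)] rmod_mult[OF Qm UNIV_I \<alpha>(2)]])
    have "g * ((y * f ^ \<mu>) ^ k - (e * s) ^ k) = ?F * (g * y ^ k) - ?S * (g * e ^ k)"
      by (simp add: power_mult_distrib power_mult algebra_simps)
    then have "?F * ?a - ?S * ?b = g * ((y * f ^ \<mu>) ^ k - (e * s) ^ k) + (?S * (g * e ^ k - ?b) - ?F * (g * y ^ k - ?a))"
      by (simp add: right_diff_distrib)
    also have "\<dots> \<in> Q" by (rule rmod_add[OF Qm 1 2])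
    also have "?F * ?a - ?S * ?b = (\<Sum>v\<in>V. (?F * \<alpha> v - ?S * \<beta> v) * v)"
      by (simp add: sum_subtractf sum_distrib_left left_diff_distrib mult.assoc)
    finally have rel: "(\<Sum>v\<in>V. (?F * \<alpha> v - ?S * \<beta> v) * v) \<in> Q" .
    have "\<forall>v\<in>V. ?F * \<alpha> v - ?S * \<beta> v \<in> ?Z"
      using \<alpha>(1) \<beta>(1) sZ fZ by (intro ballI rsub_diff[OF Z] rsub_mult[OF Z] rsub_power[OF Z]) auto
    then have "\<forall>v\<in>V. ?F * \<alpha> v - ?S * \<beta> v \<in> Q" using rel
      by (intro mp[OF spec[OF V(4), of "\<lambda>v. ?F * \<alpha> v - ?S * \<beta> v"]] conjI)
    then have "\<forall>v\<in>V. \<exists>c\<in>?Z. \<alpha> v - ?S * c \<in> Q"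
      using transcendental_divisibility[OF B Qm tr] \<alpha>(1) \<beta>(1) rsub_power[OF B s(1), of k]
      unfolding polyring_Suc[OF K] f_def by blast
    then obtain \<gamma> where \<gamma>: "\<forall>v\<in>V. \<alpha> v - ?S * \<gamma> v \<in> Q" by metis
    have "(\<Sum>v\<in>V. (\<alpha> v - ?S * \<gamma> v) * v) \<in> Q" using \<gamma> by (intro rmod_sum[OF Qm] rmod_mult2[OF Qm]) auto
    then have "?a - ?S * (\<Sum>v\<in>V. \<gamma> v * v) \<in> Q"
      by (simp add: sum_subtractf sum_distrib_left left_diff_distrib mult.assoc)
    from rmod_add[OF Qm \<alpha>(2) this] show ?thesis by (intro exI[of _ "\<Sum>v\<in>V. \<gamma> v * v"]) simp
  qed
  then obtain Y where Y: "\<And>k. g * y ^ k - s ^ k * Y k \<in> Q" by metis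
  define J where "J N = rspan UNIV (Q \<union> Y ` {..N})" for N
  have Js: "Q \<union> Y ` {..N} \<subseteq> J N" for N unfolding J_def by (rule rspan_superset[OF rsub_UNIV])
  have "\<forall>i. rmod UNIV (J i) \<and> J i \<subseteq> UNIV \<and> Q \<subseteq> J i \<and> J i \<subseteq> J (Suc i)"
    using Js by (auto simp: J_def intro!: rspan_rmod[OF rsub_UNIV] elim!: subsetD[OF rspan_mono, rotated -1])
  then obtain N where N: "\<forall>m\<ge>N. J m = J N" using noeth unfolding noeth_def by metis
  let ?G = "rspan UNIV (insert g Q)"
  note Gm = rspan_rmod[OF rsub_UNIV, of "insert g Q"] and Gs = rspan_superset[OF rsub_UNIV, of "insert g Q"]
  have "J N \<subseteq> colon ?G (s ^ N)"
    unfolding J_def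
  proof (rule rspan_least[OF colon_rmod[OF Gm]])
    have "Y j * s ^ N \<in> ?G" if "j \<le> N" for j
    proof -
      have "s ^ N = s ^ (N - j) * s ^ j" using that by (simp flip: power_add)
      then have "Y j * s ^ N = s ^ (N - j) * (y ^ j * g - (g * y ^ j - s ^ j * Y j))" by (simp add: algebra_simps)
      moreover have "y ^ j * g - (g * y ^ j - s ^ j * Y j) \<in> ?G"
        by (rule rmod_diff[OF rsub_UNIV Gm rmod_mult[OF Gm UNIV_I subsetD[OF Gs]] subsetD[OF Gs]]) (use Y in auto)
      ultimately show ?thesis using rmod_mult[OF Gm UNIV_I] by metis
    qed
    moreover have "x * s ^ N \<in> ?G" if "x \<in> Q" for x
      using rmod_mult2[OF Gm UNIV_I, of x] Gs that by auto
    ultimately show "Q \<union> Y ` {..N} \<subseteq> colon ?G (s ^ N)" by (auto simp: colon_def)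
  qed
  moreover have "J (Suc N) = J N" using N by (meson le_SucI order_refl)
  then have "Y (Suc N) \<in> J N" using Js[of "Suc N"] by auto
  ultimately have "Y (Suc N) * s ^ N \<in> ?G" by (auto simp: colon_def)
  then obtain q' c where c: "q' \<in> Q" "Y (Suc N) * s ^ N = q' + c * g"
    unfolding rspan_insert_iff[OF rsub_UNIV Qm] by blast
  have "g * (y ^ Suc N - s * c) = (g * y ^ Suc N - s ^ Suc N * Y (Suc N)) + s * (Y (Suc N) * s ^ N - c * g)"
    by (simp add: algebra_simps)
  also have "\<dots> = (g * y ^ Suc N - s ^ Suc N * Y (Suc N)) + s * q'" using c(2) by simp
  also have "\<dots> \<in> Q" by (rule rmod_add[OF Qm Y rmod_mult[OF Qm UNIV_I c(1)]])
  finally have "y ^ Suc N - s * c \<in> Q" using rprime_mult[OF Q] V(3) by blast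
  then have "y ^ Suc N - s * c + s * c \<in> P" using QP s(2) by (intro rmod_add[OF Pm] rmod_mult2[OF Pm]) auto
  then have "y ^ Suc N \<in> P" by simp
  then have "y \<in> P" by (rule rprime_power[OF P rsub_UNIV UNIV_I])
  then show False using y(1) by simp
qed

lemma fin_generators:
  assumes "rsub K" "polyring K m c = UNIV"
  shows "fin K Q m c"
  unfolding fin_def
proof (intro exI conjI)
  show "rspan (polyring K m c) ({1} \<union> Q) = UNIV"
    unfolding assms(2) using rspan_superset[OF rsub_UNIV, of "{1} \<union> Q"] by (intro rmod_eq_UNIV[OF rspan_rmod]) auto
qed simp

lemma field_mod_prime:
  assumes P: "rprime UNIV P" "Q \<subseteq> P" and inv: "\<And>x. x \<in> K \<Longrightarrow> x \<notin> Q \<Longrightarrow> \<exists>y\<in>K. x * y - 1 \<in> Q"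
    and x: "x \<in> K" "x \<in> P"
  shows "x \<in> Q"
proof (rule ccontr)
  note Pm = rprime_rmod[OF P(1)]
  assume "x \<notin> Q"
  then obtain y where y: "x * y - 1 \<in> Q" using inv[OF x(1)] by blast
  have "x * y - (x * y - 1) \<in> P"
    by (rule rmod_diff[OF rsub_UNIV Pm rmod_mult2[OF Pm UNIV_I x(2)] subsetD[OF P(2) y]])
  then show False using rprime_1[OF P(1)] by simp
qed

lemma exists_minimal_fin:
  assumes K: "rsub K" and Q: "rprime UNIV Q" and inv: "\<And>x. x \<in> K \<Longrightarrow> x \<notin> Q \<Longrightarrow> \<exists>y\<in>K. x * y - 1 \<in> Q"
    and gen: "polyring K m c = UNIV"
  obtains m0 z where "fin K Q m0 z" "indep K Q m0 z" "\<And>m' z. m' < m0 \<Longrightarrow> \<not> fin K Q m' z"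
proof -
  define m0 where "m0 = (LEAST m. \<exists>z. fin K Q m z)"
  have "\<exists>z. fin K Q m z" using fin_generators[OF K gen] by blast
  then have "\<exists>z. fin K Q m0 z" unfolding m0_def by (rule LeastI)
  then obtain z where z: "fin K Q m0 z" by blast
  have min: "\<not> fin K Q m' z" if "m' < m0" for m' z
    using not_less_Least[of m' "\<lambda>m. \<exists>z. fin K Q m z"] that unfolding m0_def by blast
  show thesis by (rule that[OF z fin_minimal_indep[OF K Q inv z min] min])
qed

lemma affine_adjacent:
  assumes K: "rsub K" and noeth: "noeth UNIV Q" and Q: "rprime UNIV Q" and P: "rprime UNIV P" and QP: "Q \<subset> P"
    and adj: "\<And>Q'. rprime UNIV Q' \<Longrightarrow> Q \<subseteq> Q' \<Longrightarrow> Q' \<subset> P \<Longrightarrow> Q' = Q"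
    and inv: "\<And>x. x \<in> K \<Longrightarrow> x \<notin> Q \<Longrightarrow> \<exists>y\<in>K. x * y - 1 \<in> Q"
    and gen: "polyring K m c = UNIV"
  shows "\<exists>n z z'. fin K Q (Suc n) z \<and> indep K P n z'"
proof -
  note Qm = rprime_rmod[OF Q] and Pm = rprime_rmod[OF P]
  note KP = field_mod_prime[OF P less_imp_le[OF QP] inv]
  obtain m0 z where z: "fin K Q m0 z" "indep K Q m0 z" and min: "\<And>m' z. m' < m0 \<Longrightarrow> \<not> fin K Q m' z"
    by (rule exists_minimal_fin[OF K Q inv gen]) (assumption | rule that)+
  let ?Z = "polyring K m0 z"
  note Z = rsub_polyring[OF K, of m0 z]
  obtain W where W: "finite W" "rspan ?Z (W \<union> Q) = UNIV" using z(1) unfolding fin_def by auto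
  obtain x where x: "x \<in> P" "x \<notin> Q" using QP by auto
  have "alg ?Z Q x"
    by (rule finite_imp_alg[OF Z Q W(1) rsub_1[OF Z] rprime_1[OF Q]]) (simp add: W(2))
  then obtain e p where e: "e \<in> ?Z" "e \<notin> Q" "e + x * poly p x \<in> Q"
    by (rule alg_constant_term[OF Q x(2)]) blast
  have "e + x * poly p x - x * poly p x \<in> P"
    by (rule rmod_diff[OF rsub_UNIV Pm subsetD[OF less_imp_le[OF QP] e(3)] rmod_mult2[OF Pm UNIV_I x(1)]])
  then have eP: "e \<in> P" by simp
  have "e \<in> rspan K (meval z ` monomials m0)" using e(1) by (simp add: polyring_def)
  then obtain F a where F: "finite F" "F \<subseteq> monomials m0" "\<And>t. t \<in> F \<Longrightarrow> a t \<in> K"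
    "e = (\<Sum>t\<in>F. a t * meval z t)"
    by (rule rspan_image_sum[OF K]) blast
  define G where "G = {t \<in> F. a t \<notin> Q}"
  define \<zeta> where "\<zeta> = (\<Sum>t\<in>G. a t * meval z t)"
  have "e = \<zeta> + (\<Sum>t\<in>F - G. a t * meval z t)"
    unfolding F(4) \<zeta>_def using F(1) by (simp add: sum.subset_diff[of G F] add.commute G_def)
  moreover have rest: "(\<Sum>t\<in>F - G. a t * meval z t) \<in> Q"
    by (intro rmod_sum[OF Qm] rmod_mult2[OF Qm]) (auto simp: G_def)
  ultimately have "\<zeta> \<in> P \<longleftrightarrow> e \<in> P" "\<zeta> \<in> Q \<longleftrightarrow> e \<in> Q"
    using rmod_add_cancel[OF rsub_UNIV Pm] rmod_add_cancel[OF rsub_UNIV Qm] QP by auto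
  then have \<zeta>: "\<zeta> \<in> P" "\<zeta> \<notin> Q" using e eP by auto
  have ne: "\<exists>t\<in>G. t \<noteq> {#}"
  proof (rule ccontr)
    assume "\<not> ?thesis"
    then have "G = {} \<or> G = {{#}}" by auto
    moreover have "G \<noteq> {}" using \<zeta>(2) rmod_0[OF Qm] by (auto simp: \<zeta>_def)
    ultimately have G: "G = {{#}}" by blast
    then have "\<zeta> = a {#}" "a {#} \<in> K" using F(3) by (auto simp: \<zeta>_def G_def)
    then show False using KP \<zeta> by auto
  qed
  then have "0 < m0" using F(2) by (cases m0) (auto simp: G_def)
  then obtain n where n: "m0 = Suc n" by (cases m0) auto
  have "finite G" using F(1) by (simp add: G_def)
  obtain z' V where z': "z' n = (\<Sum>t\<in>G. a t * meval z t)" "finite V"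
    "polyring K (Suc n) z \<subseteq> rspan (polyring K (Suc n) z') (V \<union> Q)"
    by (rule nagata[OF K Q inv \<open>finite G\<close> _ _ _ ne, of n a z]) (use F(2,3) n in \<open>auto simp: G_def\<close>)
  have fin': "fin K Q (Suc n) z'" using fin_trans[OF K Qm _ z'(2,3)] z(1) n by simp
  have ind': "indep K Q (Suc n) z'" by (rule fin_minimal_indep[OF K Q inv fin']) (use min n in auto)
  have "indep K P n z'"
  proof (rule ccontr)
    assume "\<not> ?thesis"
    then obtain F b t where F: "finite F" "\<forall>t\<in>F. set_mset t \<subseteq> {..<n} \<and> b t \<in> K" "(\<Sum>t\<in>F. b t * meval z' t) \<in> P"
      "t \<in> F" "b t \<notin> P" unfolding indep_def by blast
    define s where "s = (\<Sum>t\<in>F. b t * meval z' t)"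
    have "s \<in> polyring K n z'" unfolding s_def polyring_def using F(2) by (intro rspan_sum[OF K]) auto
    moreover have "s \<notin> Q"
    proof
      assume "s \<in> Q"
      then have "b t \<in> Q"
        using F(1,2,4) by (intro indepD[OF indep_mono[OF ind', of n], of F b t]) (auto simp: s_def)
      then show False using F(5) QP by auto
    qed
    ultimately show False
      using affine_contradiction[OF K noeth Q P QP adj fin' ind'] \<zeta>(1) z'(1) F(3) by (simp add: \<zeta>_def s_def)
  qed
  then show ?thesis using fin' by blast
qed

lemma affine_chain:
  assumes K: "rsub K" and noeth: "noeth UNIV I"
    and inv: "\<And>x. x \<in> K \<Longrightarrow> x \<notin> I \<Longrightarrow> \<exists>y\<in>K. x * y - 1 \<in> I"
    and gen: "polyring K m c = UNIV"
    and Q: "rprime UNIV Q" "I \<subseteq> Q" and P: "rprime UNIV P" "Q \<subseteq> P"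
    and "indep K Q (t + n) z" "\<And>z. \<not> indep K P (Suc t) z"
  shows "ht_ge I n P"
  using assms(9,10) P
proof (induction n arbitrary: t P)
  case 0
  then show ?case using ht_ge_0 Q(2) by blast
next
  case (Suc n)
  have "Q \<noteq> P" using indep_mono[OF Suc.prems(1), of "Suc t"] Suc.prems(2) by auto
  then have "Q \<subset> P" using Suc.prems(4) by auto
  then obtain Q' where Q': "rprime UNIV Q'" "Q \<subseteq> Q'" "Q' \<subset> P"
    "\<And>L. rprime UNIV L \<Longrightarrow> Q' \<subseteq> L \<Longrightarrow> L \<subset> P \<Longrightarrow> L = Q'"
    by (rule exists_adjacent_prime[OF noeth Q]) blast
  have IQ': "I \<subseteq> Q'" using Q(2) Q'(2) by auto
  have "\<exists>n z z'. fin K Q' (Suc n) z \<and> indep K P n z'"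
  proof (rule affine_adjacent[OF K noeth_mono[OF noeth IQ'] Q'(1) Suc.prems(3) Q'(3,4) _ gen])
    fix x assume "x \<in> K" "x \<notin> Q'"
    then show "\<exists>y\<in>K. x * y - 1 \<in> Q'" using inv[of x] IQ' by auto
  qed
  then obtain l w w' where l: "fin K Q' (Suc l) w" "indep K P l w'" by blast
  have "l \<le> t" using indep_mono[OF l(2), of "Suc t"] Suc.prems(2) by (meson not_less_eq_eq)
  have "ht_ge I n Q'"
  proof (rule Suc.IH[of "Suc t"])
    show "indep K Q (Suc t + n) z" using Suc.prems(1) by simp
    show "\<not> indep K Q' (Suc (Suc t)) z" for z
      using indep_le_fin[OF K Q'(1) l(1), of "Suc (Suc t)" z] \<open>l \<le> t\<close> by auto
  qed (use Q' in auto)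
  then show ?case by (rule ht_ge_Suc[OF _ Q'(3) Suc.prems(3)])
qed

lemma affine_local:
  assumes K: "rsub K" and noeth: "noeth UNIV I"
    and inv: "\<And>x. x \<in> K \<Longrightarrow> x \<notin> I \<Longrightarrow> \<exists>y\<in>K. x * y - 1 \<in> I"
    and gen: "polyring K m c = UNIV"
    and Q: "rprime UNIV Q" "I \<subseteq> Q" and P: "rprime UNIV P" "Q \<subseteq> P" and ht: "\<not> ht_ge I n P"
  shows "\<exists>N C. (\<forall>e\<in>box n N. C e \<in> Q \<or> C e \<notin> P) \<and> (\<exists>e\<in>box n N. C e \<notin> P) \<and>
    (\<Sum>e\<in>box n N. C e * (\<Prod>i<n. u i ^ e i * s i ^ (N - e i))) \<in> Q"
proof -
  note Qm = rprime_rmod[OF Q(1)] and Pm = rprime_rmod[OF P(1)]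
  have invQ: "\<exists>y\<in>K. x * y - 1 \<in> Q" if "x \<in> K" "x \<notin> Q" for x using inv[of x] that Q(2) by blast
  note KP = field_mod_prime[OF P invQ]
  define p where "p = (GREATEST p. \<exists>x. indep K P p x)"
  have "indep K P 0 c"
    unfolding indep_def
  proof (intro allI impI ballI)
    fix F and b :: "nat multiset \<Rightarrow> 'a" and t
    assume F: "finite F \<and> (\<forall>t\<in>F. set_mset t \<subseteq> {..<0} \<and> b t \<in> K) \<and> (\<Sum>t\<in>F. b t * meval c t) \<in> P" and t: "t \<in> F"
    then have "F = {{#}}" by auto
    then show "b t \<in> P" using F t by auto
  qed
  then have ex: "\<exists>x. indep K P 0 x" by blast
  have bound: "\<exists>x. indep K P p x \<Longrightarrow> p \<le> m" for p
    using indep_le_fin[OF K P(1) fin_generators[OF K gen]] by blast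
  have "\<exists>x. indep K P p x" unfolding p_def by (rule GreatestI_nat[of "\<lambda>p. \<exists>x. indep K P p x", OF ex bound])
  then obtain x where x: "indep K P p x" by blast
  have nop: "\<not> indep K P (Suc p) w" for w
    using Greatest_le_nat[of "\<lambda>p. \<exists>x. indep K P p x" "Suc p" m] bound unfolding p_def[symmetric] by auto
  have noQ: "\<not> indep K Q (p + n) w" for w
    using affine_chain[OF K noeth inv gen Q P, of p n w] nop ht by blast
  obtain m0 z where z: "fin K Q m0 z" "indep K Q m0 z"
    by (rule exists_minimal_fin[OF K Q(1) invQ gen]) blast
  have "m0 < p + n" using indep_mono[OF z(2)] noQ by (meson not_le)
  from box_dependence[OF K Q(1) z(1) this, of x u s] obtain N b where
    b: "\<forall>d\<in>box p N. \<forall>e\<in>box n N. b d e \<in> K" "\<exists>d\<in>box p N. \<exists>e\<in>box n N. b d e \<notin> Q"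
    "(\<Sum>e\<in>box n N. (\<Sum>d\<in>box p N. b d e * (\<Prod>i<p. x i ^ d i)) * (\<Prod>i<n. u i ^ e i * s i ^ (N - e i))) \<in> Q"
    by blast
  define C where "C e = (\<Sum>d\<in>box p N. b d e * (\<Prod>i<p. x i ^ d i))" for e
  have CP: "C e \<notin> P" if de: "d \<in> box p N" "e \<in> box n N" "b d e \<notin> Q" for d e
  proof
    assume "C e \<in> P"
    then have "b d e \<in> P"
      using indep_box[OF x Pm, of N "\<lambda>d. b d e" d] b(1) de by (simp add: C_def)
    then show False using KP b(1) de by blast
  qed
  have "C e \<in> Q" if "e \<in> box n N" "\<forall>d\<in>box p N. b d e \<in> Q" for e
    unfolding C_def using that by (intro rmod_sum[OF Qm] rmod_mult2[OF Qm]) auto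
  then have "\<forall>e\<in>box n N. C e \<in> Q \<or> C e \<notin> P" using CP by blast
  moreover have "\<exists>e\<in>box n N. C e \<notin> P" using b(2) CP by blast
  ultimately show ?thesis using b(3) unfolding C_def[symmetric] by blast
qed

section \<open>Ring records\<close>

definition kr :: "'a ring \<Rightarrow> 'a ring_product set" where
  "kr A = {x. proj A x = \<zero>\<^bsub>A\<^esub>}"

lemma kr_rmod:
  assumes A: "cring A"
  shows "rmod UNIV (kr A)"
proof -
  interpret cring A by fact
  show ?thesis by (simp add: rmod_def kr_def ring_product_ops proj_carrier assms)
qed

lemma proj_diff:
  assumes "cring A"
  shows "proj A (x - y) = proj A x \<ominus>\<^bsub>A\<^esub> proj A y"
  unfolding a_minus_def minus_ring_product_def ring_product_ops(8)[OF assms] ring_product_ops(10)[OF assms] by (rule refl)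

lemma kr_diff_iff:
  assumes "cring A"
  shows "x - y \<in> kr A \<longleftrightarrow> proj A x = proj A y"
proof -
  interpret cring A by fact
  show ?thesis unfolding kr_def mem_Collect_eq proj_diff[OF assms]
    by (rule r_right_minus_eq[OF proj_carrier[OF assms] proj_carrier[OF assms]])
qed

lemma proj_sum:
  assumes "cring A" "finite F"
  shows "proj A (sum f F) = (\<Oplus>\<^bsub>A\<^esub>i\<in>F. proj A (f i))"
proof -
  interpret cring A by fact
  show ?thesis using assms(2)
    by (induction F rule: finite_induct) (simp_all add: ring_product_ops proj_carrier[OF assms(1)] assms(1))
qed

lemma proj_power:
  assumes "cring A"
  shows "proj A (x ^ n) = proj A x [^]\<^bsub>A\<^esub> n"
proof -
  interpret cring A by fact
  show ?thesis
    by (induction n) (simp_all add: ring_product_ops m_comm proj_carrier assms)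
qed

lemma proj_prod:
  assumes "cring A" "finite F"
  shows "proj A (prod f F) = (\<Otimes>\<^bsub>A\<^esub>i\<in>F. proj A (f i))"
proof -
  interpret cring A by fact
  show ?thesis using assms(2)
    by (induction F rule: finite_induct) (simp_all add: ring_product_ops proj_carrier[OF assms(1)] assms(1))
qed

lemma proj_meval:
  assumes A: "cring A"
  shows "proj A (meval a t) = (\<Otimes>\<^bsub>A\<^esub>i\<in>set_mset t. proj A (a i) [^]\<^bsub>A\<^esub> count t i)"
proof -
  have "meval a t = (\<Prod>i\<in>set_mset t. a i ^ count t i)"
    unfolding meval_def by (simp add: image_prod_mset_multiplicity)
  then show ?thesis by (simp add: proj_prod[OF A] proj_power[OF A])
qed

lemma ideal_vimage_rmod:
  assumes A: "cring A" and "ideal J A"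
  shows "rmod UNIV (proj A -` J)" "kr A \<subseteq> proj A -` J"
proof -
  interpret ideal J A by fact
  show "rmod UNIV (proj A -` J)"
    using proj_carrier[OF A] by (auto simp: rmod_def ring_product_ops A I_l_closed)
  show "kr A \<subseteq> proj A -` J" by (auto simp: kr_def)
qed

lemma rmod_image_ideal:
  assumes A: "cring A" and Q: "rmod UNIV Q" "kr A \<subseteq> Q"
  shows "ideal (proj A ` Q) A" "proj A x \<in> proj A ` Q \<longleftrightarrow> x \<in> Q"
proof -
  interpret cring A by fact
  show "ideal (proj A ` Q) A"
  proof (rule idealI[OF ring_axioms])
    show "subgroup (proj A ` Q) (add_monoid A)"
    proof (rule add.subgroupI)
      show "proj A ` Q \<subseteq> carrier A" using proj_carrier[OF A] by blast
      show "proj A ` Q \<noteq> {}" using rmod_0[OF Q(1)] by blast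
    next
      fix a assume "a \<in> proj A ` Q"
      then obtain x where x: "x \<in> Q" "a = proj A x" by blast
      have "- x \<in> Q" by (rule rmod_minus[OF rsub_UNIV Q(1) x(1)])
      then have "proj A (- x) \<in> proj A ` Q" by (rule imageI)
      then show "\<ominus>\<^bsub>A\<^esub> a \<in> proj A ` Q" using x(2) by (simp add: ring_product_ops(10)[OF A])
    next
      fix a b assume "a \<in> proj A ` Q" "b \<in> proj A ` Q"
      then obtain x y where xy: "x \<in> Q" "a = proj A x" "y \<in> Q" "b = proj A y" by blast
      have "proj A (x + y) \<in> proj A ` Q" using rmod_add[OF Q(1) xy(1,3)] by (rule imageI)
      then show "a \<oplus>\<^bsub>A\<^esub> b \<in> proj A ` Q" using xy by (simp add: ring_product_ops(8)[OF A])
    qed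
    fix a y assume "a \<in> proj A ` Q" "y \<in> carrier A"
    then obtain x where x: "x \<in> Q" "a = proj A x" by blast
    obtain z where z: "proj A z = y" using proj_surj[OF A \<open>y \<in> carrier A\<close>] .
    have "proj A (z * x) \<in> proj A ` Q" using rmod_mult[OF Q(1) UNIV_I x(1)] by (rule imageI)
    then show "y \<otimes>\<^bsub>A\<^esub> a \<in> proj A ` Q" using x z by (simp add: ring_product_ops(9)[OF A])
    then show "a \<otimes>\<^bsub>A\<^esub> y \<in> proj A ` Q"
      using m_comm[OF \<open>y \<in> carrier A\<close>, of a] x(2) proj_carrier[OF A] by simp
  qed
  show "proj A x \<in> proj A ` Q \<longleftrightarrow> x \<in> Q"
  proof
    assume "proj A x \<in> proj A ` Q"
    then obtain y where "y \<in> Q" "proj A x = proj A y" by auto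
    then have "x - y \<in> Q" using kr_diff_iff[OF A] Q(2) by blast
    then show "x \<in> Q" using rmod_diff_cancel[OF rsub_UNIV Q(1)] \<open>y \<in> Q\<close> by blast
  qed simp
qed

lemma prime_vimage:
  assumes A: "cring A" and "primeideal J A"
  shows "rprime UNIV (proj A -` J)" "kr A \<subseteq> proj A -` J" "proj A ` (proj A -` J) = J"
proof -
  interpret primeideal J A by fact
  show "kr A \<subseteq> proj A -` J" using ideal_vimage_rmod[OF A is_ideal] by simp
  have "\<one>\<^bsub>A\<^esub> \<notin> J" using I_notcarr one_imp_carrier by auto
  then show "rprime UNIV (proj A -` J)"
    using ideal_vimage_rmod(1)[OF A is_ideal] I_prime proj_carrier[OF A]
    by (auto simp: rprime_def ring_product_ops A)
  show "proj A ` (proj A -` J) = J"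
  proof
    show "J \<subseteq> proj A ` (proj A -` J)"
    proof
      fix a assume "a \<in> J"
      then obtain x where "proj A x = a" using proj_surj[OF A] Icarr by metis
      then show "a \<in> proj A ` (proj A -` J)" using \<open>a \<in> J\<close> by auto
    qed
  qed auto
qed

lemma rprime_image:
  assumes A: "cring A" and Q: "rprime UNIV Q" "kr A \<subseteq> Q"
  shows "primeideal (proj A ` Q) A"
proof -
  note Qm = rprime_rmod[OF Q(1)]
  note iff = rmod_image_ideal(2)[OF A Qm Q(2)]
  show ?thesis
  proof (rule primeidealI[OF rmod_image_ideal(1)[OF A Qm Q(2)] A])
    have "proj A 1 \<notin> proj A ` Q" using iff rprime_1[OF Q(1)] by blast
    then show "carrier A \<noteq> proj A ` Q" using proj_carrier[OF A] by metis
    fix a b assume ab: "a \<in> carrier A" "b \<in> carrier A" "a \<otimes>\<^bsub>A\<^esub> b \<in> proj A ` Q"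
    obtain x where x: "proj A x = a" using proj_surj[OF A ab(1)] .
    obtain y where y: "proj A y = b" using proj_surj[OF A ab(2)] .
    have "proj A (x * y) \<in> proj A ` Q" using ab(3) x y by (simp add: ring_product_ops A)
    then have "x * y \<in> Q" using iff by blast
    then show "a \<in> proj A ` Q \<or> b \<in> proj A ` Q" using rprime_mult[OF Q(1)] x y by blast
  qed
qed

lemma prime_chain_iff_ht_ge:
  assumes A: "cring A"
  shows "(\<exists>P. prime_chain A n P) \<longleftrightarrow> (\<exists>Q. ht_ge (kr A) n Q)"
proof
  assume "\<exists>P. prime_chain A n P"
  then obtain P where P: "\<forall>i\<le>n. primeideal (P i) A" "\<forall>i<n. P i \<subset> P (Suc i)" unfolding prime_chain_def by auto
  have "proj A -` P i \<subset> proj A -` P (Suc i)" if "i < n" for i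
    using P that prime_vimage(3)[OF A, of "P i"] prime_vimage(3)[OF A, of "P (Suc i)"] by fastforce
  moreover have "rprime UNIV (proj A -` P i) \<and> kr A \<subseteq> proj A -` P i" if "i \<le> n" for i
    using P(1) that by (intro conjI prime_vimage(1,2)[OF A]) simp_all
  ultimately have "ht_ge (kr A) n (proj A -` P n)"
    unfolding ht_ge_def by (intro exI[of _ "\<lambda>i. proj A -` P i"]) simp
  then show "\<exists>Q. ht_ge (kr A) n Q" by blast
next
  assume "\<exists>Q. ht_ge (kr A) n Q"
  then obtain c where c: "\<forall>i\<le>n. rprime UNIV (c i) \<and> kr A \<subseteq> c i" "\<forall>i<n. c i \<subset> c (Suc i)"
    unfolding ht_ge_def by auto
  have "proj A ` c i \<subset> proj A ` c (Suc i)" if i: "i < n" for i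
  proof -
    obtain x where x: "x \<in> c (Suc i)" "x \<notin> c i" using c(2) i by blast
    have "rprime UNIV (c i)" "kr A \<subseteq> c i" using c(1) i by auto
    then have "proj A x \<notin> proj A ` c i" using rmod_image_ideal(2)[OF A rprime_rmod] x(2) by blast
    moreover have "c i \<subseteq> c (Suc i)" using c(2) i by blast
    ultimately show ?thesis using x(1) by blast
  qed
  moreover have "primeideal (proj A ` c i) A" if "i \<le> n" for i
    using c(1) that by (intro rprime_image[OF A]) simp_all
  ultimately have "prime_chain A n (\<lambda>i. proj A ` c i)" unfolding prime_chain_def by simp
  then show "\<exists>P. prime_chain A n P" by blast
qed

lemma noetherian_noeth:
  assumes A: "cring A" and N: "noetherian_ring A"
  shows "noeth UNIV (kr A)"
  unfolding noeth_def
proof (intro allI impI)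
  fix J :: "nat \<Rightarrow> 'a ring_product set"
  assume J: "\<forall>i. rmod UNIV (J i) \<and> J i \<subseteq> UNIV \<and> kr A \<subseteq> J i \<and> J i \<subseteq> J (Suc i)"
  have Jm: "rmod UNIV (J i)" "kr A \<subseteq> J i" "J i \<subseteq> J (Suc i)" for i using J by auto
  have mono: "J i \<subseteq> J j" if "i \<le> j" for i j by (rule lift_Suc_mono_le[of J, OF Jm(3) that])
  let ?C = "range (\<lambda>i. proj A ` J i)"
  have "subset.chain {I. ideal I A} ?C"
  proof (rule subset.chainI)
    show "?C \<subseteq> {I. ideal I A}"
      by (rule subsetI, elim rangeE) (simp add: rmod_image_ideal(1)[OF A Jm(1,2)])
    fix U V assume XY: "U \<in> ?C" "V \<in> ?C"
    obtain i where i: "U = proj A ` J i" using XY(1) by (rule rangeE)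
    obtain j where j: "V = proj A ` J j" using XY(2) by (rule rangeE)
    have "J i \<subseteq> J j \<or> J j \<subseteq> J i" using mono nat_le_linear[of i j] by metis
    then have "U \<subseteq> V \<or> V \<subseteq> U" unfolding i j by (metis image_mono)
    then show "(\<subset>)\<^sup>=\<^sup>= U V \<or> (\<subset>)\<^sup>=\<^sup>= V U" by auto
  qed
  then have "\<Union>?C \<in> ?C" by (intro noetherian_ring.ideal_chain_is_trivial[OF N]) simp_all
  then obtain n where n: "\<Union>?C = proj A ` J n" by (rule rangeE)
  have "J m = J n" if "n \<le> m" for m
  proof
    show "J n \<subseteq> J m" by (rule mono[OF that])
    show "J m \<subseteq> J n"
    proof
      fix x assume "x \<in> J m"
      then have "proj A x \<in> proj A ` J n" using n by blast
      then show "x \<in> J n" using rmod_image_ideal(2)[OF A Jm(1,2)] by blast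
    qed
  qed
  then show "\<exists>n. \<forall>m\<ge>n. J m = J n" by blast
qed

lemma jacobson_jac:
  assumes "jacobson_ring A"
  shows "jac UNIV (kr A)"
  unfolding jac_def
proof (intro allI impI, elim conjE)
  have A: "cring A" using assms by (simp add: jacobson_ring_def)
  fix p g assume p: "rprime UNIV p" "kr A \<subseteq> p" "g \<notin> p"
  obtain \<M> where \<M>: "\<forall>M\<in>\<M>. maximalideal M A" "proj A ` p = \<Inter>\<M>"
    using assms rprime_image[OF A p(1,2)] unfolding jacobson_ring_def by blast
  have "proj A g \<notin> proj A ` p" using rmod_image_ideal(2)[OF A rprime_rmod[OF p(1)] p(2)] p(3) by blast
  then obtain M where M: "M \<in> \<M>" "proj A g \<notin> M" using \<M>(2) by auto
  interpret maximalideal M A using \<M>(1) M(1) by blast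
  have pr: "primeideal M A" by (rule cring.maximalideal_prime[OF A]) unfold_locales
  have inv: "\<exists>y. x * y - 1 \<in> proj A -` M" if x: "x \<notin> proj A -` M" for x
  proof -
    have xA: "proj A x \<in> carrier A" by (rule proj_carrier[OF A])
    let ?J = "M <+>\<^bsub>A\<^esub> PIdl\<^bsub>A\<^esub> (proj A x)"
    have id: "ideal ?J A" by (rule ring.add_ideals[OF ring_axioms is_ideal cring.cgenideal_ideal[OF A xA]])
    have Jadd: "a \<oplus>\<^bsub>A\<^esub> b \<in> ?J" if "a \<in> M" "b \<in> PIdl\<^bsub>A\<^esub> (proj A x)" for a b
      unfolding set_add_def' using that by blast
    have MJ: "M \<subseteq> ?J"
    proof
      fix a assume a: "a \<in> M"
      show "a \<in> ?J"
        using Jadd[OF a additive_subgroup.zero_closed[OF ideal.axioms(1)[OF cring.cgenideal_ideal[OF A xA]]]]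
          r_zero[OF Icarr[OF a]] by simp
    qed
    have xJ: "proj A x \<in> ?J"
      using Jadd[OF additive_subgroup.zero_closed[OF ideal.axioms(1)[OF is_ideal]] ring.cgenideal_self[OF ring_axioms xA]]
        l_zero[OF xA] by simp
    have "?J = carrier A"
      using I_maximal[OF id MJ] xJ x ideal.Icarr[OF id] by blast
    then have "\<one>\<^bsub>A\<^esub> \<in> ?J" using one_closed by simp
    then obtain a b where ab: "a \<in> M" "b \<in> carrier A" "\<one>\<^bsub>A\<^esub> = a \<oplus>\<^bsub>A\<^esub> b \<otimes>\<^bsub>A\<^esub> proj A x"
      unfolding set_add_def' cgenideal_def by blast
    obtain y where y: "proj A y = b" using proj_surj[OF A ab(2)] .
    obtain z where z: "proj A z = a" using proj_surj[OF A Icarr[OF ab(1)]] .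
    have "proj A (z + y * x) = proj A 1" using ab(3) y z by (simp add: ring_product_ops A)
    then have "(z + y * x) - 1 \<in> kr A" using kr_diff_iff[OF A] by blast
    then have 1: "(z + y * x) - 1 \<in> proj A -` M" using ideal_vimage_rmod(2)[OF A is_ideal] by blast
    have 2: "z \<in> proj A -` M" using z ab(1) by simp
    have "(z + y * x) - 1 - z \<in> proj A -` M"
      by (rule rmod_diff[OF rsub_UNIV ideal_vimage_rmod(1)[OF A is_ideal] 1 2])
    then have "x * y - 1 \<in> proj A -` M" by (simp add: mult.commute)
    then show ?thesis by blast
  qed
  show "\<exists>m. rprime UNIV m \<and> p \<subseteq> m \<and> g \<notin> m \<and> (\<forall>x\<in>UNIV. x \<notin> m \<longrightarrow> (\<exists>y\<in>UNIV. x * y - 1 \<in> m))"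
  proof (intro exI[of _ "proj A -` M"] conjI ballI impI)
    show "rprime UNIV (proj A -` M)" by (rule prime_vimage(1)[OF A pr])
    show "p \<subseteq> proj A -` M" using \<M>(2) M(1) by auto
    show "g \<notin> proj A -` M" using M(2) by simp
    fix x assume "x \<notin> proj A -` M"
    from inv[OF this] show "\<exists>y\<in>UNIV. x * y - 1 \<in> proj A -` M" by blast
  qed
qed

text \<open>The integer component makes every homomorphism of records lift to one of the product rings.\<close>

lemma hom_lift:
  fixes B :: "'b ring" and A :: "'a ring"
  assumes B: "cring B" and A: "cring A" and h: "\<psi> \<in> ring_hom B A"
  obtains \<theta> where "comm_ring_hom_type \<theta>" "\<And>x. proj A (\<theta> x) = \<psi> (proj B x)"
proof -
  define k where "k x = snd (Rep_ring_product x)" for x :: "'b ring_product"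
  define f where "f x A' = (if A' = A then \<psi> (proj B x) else proj A' (of_int (k x)))" for x and A' :: "'a ring"
  define \<theta> where "\<theta> x = tuple (f x) (k x)" for x
  have car: "cring A' \<Longrightarrow> f x A' \<in> carrier A'" for x A'
    using ring_hom_closed[OF h proj_carrier[OF B]] by (auto simp: f_def proj_carrier)
  have pr: "proj A' (\<theta> x) = f x A'" if "cring A'" for x A'
    unfolding \<theta>_def by (rule proj_tuple) (use car that in auto)
  have sn: "snd (Rep_ring_product (\<theta> x)) = k x" for x
    unfolding \<theta>_def using Rep_tuple[of "f x" "k x"] car by simp
  note ops = ring_product_ops
  have "comm_ring_hom_type \<theta>"
  proof
    show "\<theta> 1 = 1"
      by (rule ring_product_eqI) (use ring_hom_one[OF h] B in \<open>auto simp: pr sn ops f_def k_def\<close>)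
    show "\<theta> (x + y) = \<theta> x + \<theta> y" for x y
      by (rule ring_product_eqI)
        (use ring_hom_add[OF h proj_carrier[OF B] proj_carrier[OF B]] B in \<open>auto simp: pr sn ops f_def k_def\<close>)
    show "\<theta> (x * y) = \<theta> x * \<theta> y" for x y
      by (rule ring_product_eqI)
        (use ring_hom_mult[OF h proj_carrier[OF B] proj_carrier[OF B]] B in \<open>auto simp: pr sn ops f_def k_def\<close>)
  qed
  moreover have "proj A (\<theta> x) = \<psi> (proj B x)" for x using pr[OF A] by (simp add: f_def)
  ultimately show thesis by (rule that)
qed

lemma indexed_psetD:
  assumes "ring R" "f \<in> ring.indexed_pset R I (carrier R)"
  shows "finite (monomials_of R f)" "t \<in> monomials_of R f \<Longrightarrow> set_mset t \<subseteq> I" "f t \<in> carrier R"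
proof -
  interpret ring R by fact
  have "finite (monomials_of R f) \<and> (\<forall>t\<in>monomials_of R f. set_mset t \<subseteq> I)"
    using assms(2)
  proof (induction rule: indexed_pset.induct)
    case (indexed_const k)
    have "monomials_of R (local.indexed_const k) \<subseteq> {{#}}" by (auto simp: monomials_of_def indexed_const_def)
    then show ?case using finite_subset[of _ "{{#}}"] by auto
  next
    case (indexed_padd P Q)
    have "monomials_of R (P \<Oplus> Q) \<subseteq> monomials_of R P \<union> monomials_of R Q"
      by (auto simp: monomials_of_def indexed_padd_def)
    then show ?case using indexed_padd.IH finite_subset[of _ "monomials_of R P \<union> monomials_of R Q"] by blast
  next
    case (indexed_pmult P i)
    have "monomials_of R (P \<Otimes> i) \<subseteq> add_mset i ` monomials_of R P"
    proof
      fix t assume "t \<in> monomials_of R (P \<Otimes> i)"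
      then have "i \<in># t" "t - {#i#} \<in> monomials_of R P"
        by (auto simp: monomials_of_def indexed_pmult_def split: if_splits)
      then show "t \<in> add_mset i ` monomials_of R P" by (intro image_eqI[of _ _ "t - {#i#}"]) auto
    qed
    then show ?case using indexed_pmult finite_subset[of _ "add_mset i ` monomials_of R P"] by fastforce
  qed
  then show "finite (monomials_of R f)" "t \<in> monomials_of R f \<Longrightarrow> set_mset t \<subseteq> I" by auto
  show "f t \<in> carrier R" using indexed_pset_in_carrier[OF _ assms(2)] carrier_coeffE by blast
qed

lemma indexed_psetI:
  assumes "ring R" "finite F" "\<And>t. t \<in> F \<Longrightarrow> set_mset t \<subseteq> I" "\<And>t. t \<in> F \<Longrightarrow> f t \<in> carrier R"
    "\<And>t. t \<notin> F \<Longrightarrow> f t = \<zero>\<^bsub>R\<^esub>"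
  shows "f \<in> ring.indexed_pset R I (carrier R)"
proof -
  interpret ring R by fact
  have mono: "(\<lambda>m. if m = t then k else \<zero>\<^bsub>R\<^esub>) \<in> indexed_pset I (carrier R)"
    if "k \<in> carrier R" "set_mset t \<subseteq> I" for k t
    using that(2)
  proof (induction t)
    case empty
    show ?case using indexed_pset.indexed_const[OF that(1), of I] unfolding indexed_const_def .
  next
    case (add i t)
    then have i: "i \<in> I" "(\<lambda>m. if m = t then k else \<zero>\<^bsub>R\<^esub>) \<in> indexed_pset I (carrier R)" by auto
    have "(\<lambda>m. if m = add_mset i t then k else \<zero>\<^bsub>R\<^esub>) = indexed_pmult (\<lambda>m. if m = t then k else \<zero>\<^bsub>R\<^esub>) i"
      by (auto simp: indexed_pmult_def fun_eq_iff)
    then show ?case using indexed_pset.indexed_pmult[OF i(2,1)] by (simp only:)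
  qed
  show ?thesis
    using assms(2-5)
  proof (induction F arbitrary: f rule: finite_induct)
    case empty
    then have "f = indexed_const \<zero>\<^bsub>R\<^esub>" by (auto simp: indexed_const_def)
    then show ?case using indexed_pset.indexed_const[OF zero_closed, of I] by (simp only:)
  next
    case (insert t F)
    let ?g = "\<lambda>m. if m = t then \<zero>\<^bsub>R\<^esub> else f m"
    have car: "f m \<in> carrier R" for m using insert.prems(2,3)[of m] by (cases "m \<in> insert t F") simp_all
    have "?g \<in> indexed_pset I (carrier R)"
    proof (rule insert.IH)
      show "set_mset u \<subseteq> I" if "u \<in> F" for u using insert.prems(1)[of u] that by simp
      show "?g u \<in> carrier R" for u using car by simp
      show "?g u = \<zero>\<^bsub>R\<^esub>" if "u \<notin> F" for u using insert.prems(3)[of u] that by simp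
    qed
    moreover have "(\<lambda>m. if m = t then f t else \<zero>\<^bsub>R\<^esub>) \<in> indexed_pset I (carrier R)"
      by (rule mono[OF car insert.prems(1)]) simp
    ultimately have "indexed_padd ?g (\<lambda>m. if m = t then f t else \<zero>\<^bsub>R\<^esub>) \<in> indexed_pset I (carrier R)"
      by (rule indexed_pset.indexed_padd)
    also have "indexed_padd ?g (\<lambda>m. if m = t then f t else \<zero>\<^bsub>R\<^esub>) = f"
      using car by (simp add: indexed_padd_def fun_eq_iff)
    finally show ?case .
  qed
qed

lemma trailing_coeff_eq:
  assumes r: "monomial_ordering r" and "t0 \<in> monomials_of R f" "\<And>t. t \<in> monomials_of R f \<Longrightarrow> (t0, t) \<in> r"
  shows "trailing_coeff r R f = f t0"
proof -
  have "(THE m. m \<in> monomials_of R f \<and> (\<forall>m' \<in> monomials_of R f. (m, m') \<in> r)) = t0"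
    by (rule the_equality) (use assms mono_ordD(3)[OF r] in blast)+
  then show ?thesis by (simp add: trailing_coeff_def)
qed

lemma proj_poly_eval:
  assumes A: "cring A" and fin: "finite (monomials_of R f)"
    and n: "\<And>t. t \<in> monomials_of R f \<Longrightarrow> set_mset t \<subseteq> {..<n}"
    and g: "\<And>t. t \<in> monomials_of R f \<Longrightarrow> proj A (g t) = \<phi> (f t)"
    and a: "\<And>i. i < n \<Longrightarrow> proj A (a i) = b i"
  shows "proj A (\<Sum>t\<in>monomials_of R f. g t * meval a t) = poly_eval R A \<phi> b f"
proof -
  interpret cring A by fact
  have "proj A (\<Sum>t\<in>monomials_of R f. g t * meval a t) =
      (\<Oplus>\<^bsub>A\<^esub>t\<in>monomials_of R f. proj A (g t * meval a t))"
    by (rule proj_sum[OF A fin])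
  also have "\<dots> = (\<Oplus>\<^bsub>A\<^esub>t\<in>monomials_of R f. \<phi> (f t) \<otimes>\<^bsub>A\<^esub> (\<Otimes>\<^bsub>A\<^esub>i\<in>set_mset t. b i [^]\<^bsub>A\<^esub> count t i))"
  proof (rule finsum_cong'[OF refl])
    have *: "proj A (g t * meval a t) = \<phi> (f t) \<otimes>\<^bsub>A\<^esub> (\<Otimes>\<^bsub>A\<^esub>i\<in>set_mset t. b i [^]\<^bsub>A\<^esub> count t i)"
      if t: "t \<in> monomials_of R f" for t
    proof -
      have b: "proj A (a i) = b i" if "i \<in> set_mset t" for i using a n[OF t] that by auto
      have "(\<Otimes>\<^bsub>A\<^esub>i\<in>set_mset t. proj A (a i) [^]\<^bsub>A\<^esub> count t i) = (\<Otimes>\<^bsub>A\<^esub>i\<in>set_mset t. b i [^]\<^bsub>A\<^esub> count t i)"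
      proof (rule finprod_cong'[OF refl])
        show "(\<lambda>i. b i [^]\<^bsub>A\<^esub> count t i) \<in> set_mset t \<rightarrow> carrier A"
          by (rule Pi_I, subst b[symmetric]) (simp_all add: proj_carrier[OF A])
      qed (simp add: b)
      then show ?thesis by (simp add: ring_product_ops(9)[OF A] g[OF t] proj_meval[OF A])
    qed
    then show "proj A (g t * meval a t) = \<phi> (f t) \<otimes>\<^bsub>A\<^esub> (\<Otimes>\<^bsub>A\<^esub>i\<in>set_mset t. b i [^]\<^bsub>A\<^esub> count t i)"
      if "t \<in> monomials_of R f" for t using that .
    show "(\<lambda>t. \<phi> (f t) \<otimes>\<^bsub>A\<^esub> (\<Otimes>\<^bsub>A\<^esub>i\<in>set_mset t. b i [^]\<^bsub>A\<^esub> count t i)) \<in> monomials_of R f \<rightarrow> carrier A"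
      by (rule Pi_I, subst *[symmetric]) (simp_all add: proj_carrier[OF A])
  qed
  finally show ?thesis unfolding poly_eval_def .
qed

lemma one_not_zero_base:
  assumes "ring_algebra R A \<phi>" "\<one>\<^bsub>A\<^esub> \<noteq> \<zero>\<^bsub>A\<^esub>"
  shows "\<one>\<^bsub>R\<^esub> \<noteq> \<zero>\<^bsub>R\<^esub>"
proof
  assume 0: "\<one>\<^bsub>R\<^esub> = \<zero>\<^bsub>R\<^esub>"
  have alg: "cring R" "cring A" "\<phi> \<in> ring_hom R A" using assms(1) by (auto simp: ring_algebra_def)
  then have "\<phi> \<zero>\<^bsub>R\<^esub> = \<zero>\<^bsub>A\<^esub>" using ring_hom_zero cring.axioms(1) by metis
  then show False using ring_hom_one[OF alg(3)] 0 assms(2) by simp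
qed

lemma alg_dependent_imp_subm:
  assumes r: "monomial_ordering r" and alg: "ring_algebra R A \<phi>" and nz: "\<one>\<^bsub>A\<^esub> \<noteq> \<zero>\<^bsub>A\<^esub>"
    and dep: "alg_dependent r R A \<phi> n b" and a: "\<And>i. i < n \<Longrightarrow> proj A (a i) = b i"
  shows "subm r UNIV n a \<inter> kr A \<noteq> {}"
proof -
  have R: "cring R" and A: "cring A" and h: "\<phi> \<in> ring_hom R A" using alg by (auto simp: ring_algebra_def)
  interpret R: cring R by fact
  obtain f where f: "f \<in> ring.indexed_pset R {..<n} (carrier R)" "submonic r R f" "poly_eval R A \<phi> b f = \<zero>\<^bsub>A\<^esub>"
    using dep unfolding alg_dependent_def by auto
  note fD = indexed_psetD[OF R.ring_axioms f(1)]
  let ?M = "monomials_of R f"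
  have "carrier R \<noteq> {\<zero>\<^bsub>R\<^esub>}" using one_not_zero_base[OF alg nz] R.one_closed by auto
  then have M: "?M \<noteq> {}" "trailing_coeff r R f = \<one>\<^bsub>R\<^esub>" using f(2) unfolding submonic_def by auto
  obtain t0 where t0: "t0 \<in> ?M" "\<And>t. t \<in> ?M \<Longrightarrow> (t0, t) \<in> r"
    by (rule finite_monomials_min[OF r fD(1) M(1)]) blast
  have f0: "f t0 = \<one>\<^bsub>R\<^esub>" using trailing_coeff_eq[OF r t0] M(2) by simp
  have "\<exists>x. proj A x = \<phi> (f t)" for t
    using proj_surj[OF A ring_hom_closed[OF h fD(3)]] by metis
  then obtain c where c: "\<And>t. proj A (c t) = \<phi> (f t)" by metis
  define g where "g t = (if t = t0 then 1 else c t)" for t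
  have "proj A (\<Sum>t\<in>?M. g t * meval a t) = \<zero>\<^bsub>A\<^esub>"
    unfolding f(3)[symmetric]
    by (rule proj_poly_eval[OF A fD(1,2) _ a])
      (use c f0 ring_hom_one[OF h] in \<open>auto simp: g_def ring_product_ops A\<close>)
  moreover have "(\<Sum>t\<in>?M. g t * meval a t) = meval a t0 + (\<Sum>t\<in>?M - {t0}. g t * meval a t)"
    using fD(1) t0(1) by (simp add: sum.remove[of ?M t0] g_def)
  moreover have "meval a t0 + (\<Sum>t\<in>?M - {t0}. g t * meval a t) \<in> subm r UNIV n a"
  proof (rule submI[OF fD(2)[OF t0(1)]])
    have "?M - {t0} \<subseteq> above r n t0"
      using fD(2) t0(2) by blast
    then show "(\<Sum>t\<in>?M - {t0}. g t * meval a t)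
        \<in> rspan UNIV (meval a ` above r n t0)"
      by (intro rspan_sum[OF rsub_UNIV]) auto
  qed
  ultimately show ?thesis by (auto simp: kr_def)
qed

lemma subm_imp_alg_dependent:
  assumes r: "monomial_ordering r" and alg: "ring_algebra R A \<phi>" and nz: "\<one>\<^bsub>A\<^esub> \<noteq> \<zero>\<^bsub>A\<^esub>"
    and dep: "subm r (proj A -` \<phi> ` carrier R) n a \<inter> kr A \<noteq> {}" and a: "\<And>i. i < n \<Longrightarrow> proj A (a i) = b i"
    and R': "rsub (proj A -` \<phi> ` carrier R)"
  shows "alg_dependent r R A \<phi> n b"
proof -
  have R: "cring R" and A: "cring A" and h: "\<phi> \<in> ring_hom R A" using alg by (auto simp: ring_algebra_def)
  interpret R: cring R by fact
  have nzR: "\<one>\<^bsub>R\<^esub> \<noteq> \<zero>\<^bsub>R\<^esub>" by (rule one_not_zero_base[OF alg nz])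
  obtain t0 y where t0: "set_mset t0 \<subseteq> {..<n}" "meval a t0 + y \<in> kr A"
    "y \<in> rspan (proj A -` \<phi> ` carrier R) (meval a ` above r n t0)"
    using dep unfolding subm_def by blast
  obtain F c where F: "finite F" "F \<subseteq> above r n t0"
    "\<And>t. t \<in> F \<Longrightarrow> c t \<in> proj A -` \<phi> ` carrier R" "y = (\<Sum>t\<in>F. c t * meval a t)"
    by (rule rspan_image_sum[OF R' t0(3)]) blast
  have "\<forall>t\<in>F. \<exists>k\<in>carrier R. proj A (c t) = \<phi> k" using F(3) by auto
  then obtain d where d: "\<And>t. t \<in> F \<Longrightarrow> d t \<in> carrier R" "\<And>t. t \<in> F \<Longrightarrow> proj A (c t) = \<phi> (d t)" by metis
  define G where "G = {t \<in> F. d t \<noteq> \<zero>\<^bsub>R\<^esub>}"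
  define f where "f m = (if m = t0 then \<one>\<^bsub>R\<^esub> else if m \<in> G then d m else \<zero>\<^bsub>R\<^esub>)" for m
  define g where "g m = (if m = t0 then 1 else c m)" for m
  have t0G: "t0 \<notin> G" "finite G" "G \<subseteq> F" using F(1,2) by (auto simp: G_def)
  have M: "monomials_of R f = insert t0 G" using nzR by (auto simp: monomials_of_def f_def G_def)
  have vars: "set_mset t \<subseteq> {..<n}" if "t \<in> insert t0 G" for t using that F(2) t0(1) t0G(3) by blast
  have "f \<in> ring.indexed_pset R {..<n} (carrier R)"
  proof (rule indexed_psetI[OF R.ring_axioms, of "insert t0 G"])
    show "f t \<in> carrier R" if "t \<in> insert t0 G" for t
      using that d(1) t0G(3) by (auto simp: f_def)
  qed (use t0G vars in \<open>auto simp: f_def\<close>)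
  moreover have "submonic r R f"
  proof -
    have "trailing_coeff r R f = f t0"
      by (rule trailing_coeff_eq[OF r]) (use M F(2) t0G(3) mono_ordD(1)[OF r] in auto)
    then show ?thesis using M by (simp add: submonic_def f_def)
  qed
  moreover have "poly_eval R A \<phi> b f = \<zero>\<^bsub>A\<^esub>"
  proof -
    have "proj A (\<Sum>t\<in>monomials_of R f. g t * meval a t) = poly_eval R A \<phi> b f"
    proof (rule proj_poly_eval[OF A _ _ _ a])
      show "finite (monomials_of R f)" using M t0G(2) by simp
      show "set_mset t \<subseteq> {..<n}" if "t \<in> monomials_of R f" for t using that M vars by simp
      show "proj A (g t) = \<phi> (f t)" if "t \<in> monomials_of R f" for t
        using that M d(2) t0G ring_hom_one[OF h] by (auto simp: g_def f_def ring_product_ops(7)[OF A])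
    qed
    moreover have "(\<Sum>t\<in>monomials_of R f. g t * meval a t) = meval a t0 + (\<Sum>t\<in>G. c t * meval a t)"
    proof -
      have "(\<Sum>t\<in>G. g t * meval a t) = (\<Sum>t\<in>G. c t * meval a t)"
        using t0G(1) by (intro sum.cong) (auto simp: g_def)
      then show ?thesis using M t0G(1,2) by (simp add: g_def)
    qed
    moreover have "(\<Sum>t\<in>F - G. c t * meval a t) \<in> kr A"
    proof (rule rmod_sum[OF kr_rmod[OF A]])
      fix t assume "t \<in> F - G"
      then have "proj A (c t) = \<phi> \<zero>\<^bsub>R\<^esub>" using d(2) by (auto simp: G_def)
      then have "c t \<in> kr A"
        using ring_hom_zero[OF h R.ring_axioms cring.axioms(1)[OF A]] by (simp add: kr_def)
      then show "c t * meval a t \<in> kr A" by (rule rmod_mult2[OF kr_rmod[OF A] UNIV_I])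
    qed
    then have "(meval a t0 + y) - (\<Sum>t\<in>F - G. c t * meval a t) \<in> kr A"
      by (rule rmod_diff[OF rsub_UNIV kr_rmod[OF A] t0(2)])
    moreover have "(meval a t0 + y) - (\<Sum>t\<in>F - G. c t * meval a t) = meval a t0 + (\<Sum>t\<in>G. c t * meval a t)"
      unfolding F(4) using F(1) t0G(3) by (simp add: sum.subset_diff[of G F])
    ultimately show ?thesis by (simp add: kr_def)
  qed
  ultimately show ?thesis unfolding alg_dependent_def by blast
qed

lemma ring_algebraD:
  assumes "ring_algebra R A \<phi>"
  shows "cring R" "cring A" "\<phi> \<in> ring_hom R A"
  using assms by (auto simp: ring_algebra_def)

lemma prime_chain_mono:
  assumes "prime_chain A n P" "m \<le> n"
  shows "prime_chain A m P"
  using assms by (auto simp: prime_chain_def)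

lemma krull_dim_le_1:
  assumes "krull_dim A \<le> 1" "carrier A \<noteq> {\<zero>\<^bsub>A\<^esub>}" "prime_chain A n P"
  shows "n \<le> 1"
proof -
  have "ereal (real n) \<le> krull_dim A"
    unfolding krull_dim_def using assms(2,3) by (auto intro!: SUP_upper)
  then have "ereal (real n) \<le> ereal 1" using assms(1) by (metis one_ereal_def order_trans)
  then show ?thesis by simp
qed

lemma chain_imp_independent:
  fixes R :: "'r ring" and A :: "'a ring"
  assumes r: "monomial_ordering r" and alg: "ring_algebra R A \<phi>" and N: "noetherian_ring A"
    and nz: "\<one>\<^bsub>A\<^esub> \<noteq> \<zero>\<^bsub>A\<^esub>" and "0 < n" and P: "prime_chain A n P"
  obtains a where "\<And>i. a i \<in> carrier A"
    "\<And>b. (\<And>i. i < n \<Longrightarrow> b i = a i) \<Longrightarrow> \<not> alg_dependent r R A \<phi> n b"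
proof -
  note A = ring_algebraD(2)[OF alg]
  obtain Q where Q: "ht_ge (kr A) n Q" using prime_chain_iff_ht_ge[OF A] P by blast
  obtain a where a: "subm r UNIV n a \<inter> kr A = {}"
    using exists_subm_disjoint[OF noetherian_noeth[OF A N] kr_rmod[OF A] Q \<open>0 < n\<close> r] by blast
  show thesis
  proof (rule that[of "\<lambda>i. proj A (a i)"])
    show "\<not> alg_dependent r R A \<phi> n b" if "\<And>i. i < n \<Longrightarrow> b i = proj A (a i)" for b
      using alg_dependent_imp_subm[OF r alg nz, of n b a] a that by auto
  qed (rule proj_carrier[OF A])
qed

lemma trdeg_eq_krull_dim:
  fixes R :: "'r ring" and A :: "'a ring"
  assumes r: "monomial_ordering r" and alg: "ring_algebra R A \<phi>" and N: "noetherian_ring A"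
    and upper: "\<And>n a. \<one>\<^bsub>A\<^esub> \<noteq> \<zero>\<^bsub>A\<^esub> \<Longrightarrow> 0 < n \<Longrightarrow> (\<And>i. i < n \<Longrightarrow> a i \<in> carrier A) \<Longrightarrow>
      \<not> alg_dependent r R A \<phi> n a \<Longrightarrow> \<exists>P. prime_chain A n P"
  shows "trdeg r R A \<phi> = krull_dim A"
proof -
  note R = ring_algebraD(1)[OF alg] and A = ring_algebraD(2)[OF alg] and h = ring_algebraD(3)[OF alg]
  interpret A: cring A by fact
  interpret R: cring R by fact
  show ?thesis
  proof (cases "carrier A = {\<zero>\<^bsub>A\<^esub>}")
    case True
    have "alg_dependent r R A \<phi> 1 (\<lambda>_. x)" for x
      unfolding alg_dependent_def
    proof (intro bexI conjI)
      let ?f = "R.indexed_const \<one>\<^bsub>R\<^esub> :: nat multiset \<Rightarrow> _"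
      show "?f \<in> R.indexed_pset {..<1} (carrier R)" by (rule R.indexed_pset.indexed_const) simp
      show "submonic r R ?f"
      proof (cases "\<one>\<^bsub>R\<^esub> = \<zero>\<^bsub>R\<^esub>")
        case True
        then have "carrier R = {\<zero>\<^bsub>R\<^esub>}" using R.one_zeroD by simp
        then show ?thesis using True by (auto simp: submonic_def monomials_of_def R.indexed_const_def)
      next
        case False
        then have M: "monomials_of R ?f = {{#}}" by (auto simp: monomials_of_def R.indexed_const_def)
        have "trailing_coeff r R ?f = ?f {#}"
          by (rule trailing_coeff_eq[OF r]) (use M mono_ordD(1)[OF r] in auto)
        then show ?thesis using M by (simp add: submonic_def R.indexed_const_def)
      qed
      have "\<phi> (?f m) \<otimes>\<^bsub>A\<^esub> (\<Otimes>\<^bsub>A\<^esub>i\<in>set_mset m. x [^]\<^bsub>A\<^esub> count m i) \<in> carrier A" if "m \<in> monomials_of R ?f" for m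
      proof -
        have "m = {#}" using that by (auto simp: monomials_of_def R.indexed_const_def split: if_splits)
        then show ?thesis using ring_hom_closed[OF h R.one_closed] by (simp add: R.indexed_const_def)
      qed
      then have "poly_eval R A \<phi> (\<lambda>_. x) ?f \<in> carrier A"
        unfolding poly_eval_def by (intro A.finsum_closed) blast
      then show "poly_eval R A \<phi> (\<lambda>_. x) ?f = \<zero>\<^bsub>A\<^esub>" using True by simp
    qed
    then show ?thesis using True by (simp add: trdeg_def krull_dim_def)
  next
    case False
    then have nz: "\<one>\<^bsub>A\<^esub> \<noteq> \<zero>\<^bsub>A\<^esub>" using A.one_zeroD by blast
    let ?C = "{n. \<exists>P. prime_chain A n P}"
    let ?D = "{n. 0 < n \<and> (\<exists>a. (\<forall>i < n. a i \<in> carrier A) \<and> \<not> alg_dependent r R A \<phi> n a)}"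
    have "1 \<notin> kr A" using nz by (simp add: kr_def ring_product_ops(7)[OF A])
    then obtain Q where "rprime UNIV Q" "kr A \<subseteq> Q" using exists_prime_above[OF kr_rmod[OF A]] by blast
    then have C0: "0 \<in> ?C" using prime_chain_iff_ht_ge[OF A, of 0] ht_ge_0 by blast
    have D: "?D = ?C - {0}"
    proof (rule subset_antisym; rule subsetI)
      fix n assume "n \<in> ?D"
      then show "n \<in> ?C - {0}" using upper[OF nz] by blast
    next
      fix n assume "n \<in> ?C - {0}"
      then obtain P where n: "0 < n" "prime_chain A n P" by auto
      obtain a where "\<And>i. a i \<in> carrier A"
        "\<And>b. (\<And>i. i < n \<Longrightarrow> b i = a i) \<Longrightarrow> \<not> alg_dependent r R A \<phi> n b"
        by (rule chain_imp_independent[OF r alg N nz n]) blast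
      then show "n \<in> ?D" using n(1) by blast
    qed
    show ?thesis
    proof (cases "\<forall>x \<in> carrier A. alg_dependent r R A \<phi> 1 (\<lambda>_. x)")
      case True
      have "n = 0" if n: "n \<in> ?C" for n
      proof (rule ccontr)
        assume "n \<noteq> 0"
        then have "1 \<le> n" by simp
        obtain P where "prime_chain A n P" using n by blast
        then have P: "prime_chain A 1 P" using \<open>1 \<le> n\<close> by (rule prime_chain_mono)
        obtain a where a: "\<And>i. a i \<in> carrier A"
          "\<And>b. (\<And>i. i < 1 \<Longrightarrow> b i = a i) \<Longrightarrow> \<not> alg_dependent r R A \<phi> 1 b"
          by (rule chain_imp_independent[OF r alg N nz zero_less_one P]) blast
        then show False using a(1)[of 0] a(2)[of "\<lambda>_. a 0"] True by (metis less_one)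
      qed
      then have "?C = {0}" using C0 by blast
      then have "krull_dim A = 0" using False by (simp add: krull_dim_def zero_ereal_def)
      moreover have "trdeg r R A \<phi> = 0" unfolding trdeg_def if_P[OF True] by (rule if_not_P[OF False])
      ultimately show ?thesis by simp
    next
      case F: False
      then obtain x where x: "x \<in> carrier A" "\<not> alg_dependent r R A \<phi> 1 (\<lambda>_. x)" by blast
      then have "1 \<in> ?D" by (intro CollectI conjI exI[of _ "\<lambda>_. x"]) simp_all
      then have 1: "1 \<in> ?C" "1 \<in> ?C - {0}" using D by auto
      have "ereal (real 0) \<le> (SUP n\<in>?C - {0}. ereal (real n))" by (rule SUP_upper2[OF 1(2)]) simp
      then have "(SUP n\<in>insert 0 (?C - {0}). ereal (real n)) = (SUP n\<in>?C - {0}. ereal (real n))"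
        unfolding SUP_insert by (rule sup_absorb2)
      then have "(SUP n\<in>?C - {0}. ereal (real n)) = (SUP n\<in>?C. ereal (real n))"
        unfolding insert_Diff[OF C0] by (rule sym)
      then show ?thesis unfolding trdeg_def krull_dim_def if_not_P[OF F] if_not_P[OF False] D .
    qed
  qed
qed

lemma independent_imp_disjoint:
  fixes R :: "'r ring" and A :: "'a ring"
  assumes r: "monomial_ordering r" and alg: "ring_algebra R A \<phi>" and nz: "\<one>\<^bsub>A\<^esub> \<noteq> \<zero>\<^bsub>A\<^esub>"
    and a: "\<And>i. i < n \<Longrightarrow> a i \<in> carrier A" "\<not> alg_dependent r R A \<phi> n a"
    and R': "rsub (proj A -` \<phi> ` carrier R)"
  obtains a' where "\<And>i. i < n \<Longrightarrow> proj A (a' i) = a i" "subm r (proj A -` \<phi> ` carrier R) n a' \<inter> kr A = {}"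
proof -
  note A = ring_algebraD(2)[OF alg]
  have "\<exists>x. i < n \<longrightarrow> proj A x = a i" for i using proj_surj[OF A a(1)] by metis
  then obtain a' where a': "\<And>i. i < n \<Longrightarrow> proj A (a' i) = a i" by metis
  show thesis
    by (rule that[OF a']) (use subm_imp_alg_dependent[OF r alg nz _ a' R', of n "\<lambda>i. i"] a(2) in auto)
qed

lemma dim_le_1_upper:
  fixes A :: "'a ring"
  assumes r: "monomial_ordering r" and A: "cring A" and N: "noetherian_ring A" and dim: "krull_dim A \<le> 1"
    and nz: "\<one>\<^bsub>A\<^esub> \<noteq> \<zero>\<^bsub>A\<^esub>" and n: "0 < n"
    and a: "\<And>i. i < n \<Longrightarrow> a i \<in> carrier A" "\<not> alg_dependent r A A (\<lambda>x. x) n a"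
  shows "\<exists>P. prime_chain A n P"
proof -
  interpret cring A by fact
  have alg: "ring_algebra A A (\<lambda>x. x)" by (auto simp: ring_algebra_def A ring_hom_def)
  have U: "proj A -` (\<lambda>x. x) ` carrier A = UNIV" using proj_carrier[OF A] by auto
  have nc: "carrier A \<noteq> {\<zero>\<^bsub>A\<^esub>}" using nz by auto
  obtain a' where a': "subm r UNIV n a' \<inter> kr A = {}"
    by (rule independent_imp_disjoint[OF r alg nz a, unfolded U]) (blast intro: rsub_UNIV)+
  have sub: "subm r UNIV m a' \<inter> kr A = {}" if "m \<le> n" for m
    using subm_mono[OF that, of r UNIV a'] a' by blast
  have "n \<le> 1"
  proof (rule ccontr)
    assume "\<not> n \<le> 1"
    then have "subm r UNIV 2 a' \<inter> kr A = {}" by (intro sub) simp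
    from no_relation_chain2[OF noetherian_noeth[OF A N] kr_rmod[OF A] r this]
    obtain Q0 Q1 Q2 where "rprime UNIV Q0" "rprime UNIV Q1" "rprime UNIV Q2" "kr A \<subseteq> Q0" "Q0 \<subset> Q1" "Q1 \<subset> Q2"
      by blast
    then have "ht_ge (kr A) (Suc (Suc 0)) Q2" by (intro ht_ge_Suc[OF ht_ge_Suc[OF ht_ge_0]])
    then obtain P where "prime_chain A (Suc (Suc 0)) P" using prime_chain_iff_ht_ge[OF A] by blast
    then show False using krull_dim_le_1[OF dim nc] by fastforce
  qed
  then have n1: "n = Suc 0" using n by simp
  have "subm r UNIV 1 a' \<inter> kr A = {}" using n by (intro sub) simp
  from no_relation_chain1[OF kr_rmod[OF A] r this]
  obtain Q0 Q1 where "rprime UNIV Q0" "rprime UNIV Q1" "kr A \<subseteq> Q0" "Q0 \<subset> Q1" by blast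
  then have "ht_ge (kr A) (Suc 0) Q1" by (intro ht_ge_Suc[OF ht_ge_0])
  then show ?thesis unfolding n1 using prime_chain_iff_ht_ge[OF A] by blast
qed

lemma rsub_hom_image:
  fixes R :: "'r ring" and A :: "'a ring"
  assumes alg: "ring_algebra R A \<phi>"
  shows "rsub (proj A -` \<phi> ` carrier R)"
proof -
  note R = ring_algebraD(1)[OF alg] and A = ring_algebraD(2)[OF alg] and h = ring_algebraD(3)[OF alg]
  interpret ring_hom_ring R A \<phi>
    by (rule ring_hom_ringI2[OF cring.axioms(1)[OF R] cring.axioms(1)[OF A] h])
  note S = subringE[OF img_is_subring[OF R.carrier_is_subring]]
  show ?thesis
    using S(3,5,6,7) by (simp add: rsub_def ring_product_ops(7,9)[OF A] proj_diff[OF A] a_minus_def)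
qed

lemma subm_mono_ring: "R \<subseteq> S \<Longrightarrow> subm r R n a \<subseteq> subm r S n a"
  unfolding subm_def using rspan_mono[OF order_refl, of R S] by blast

lemma noeth_hom_image:
  assumes \<theta>: "comm_ring_hom_type \<theta>" and I: "rmod UNIV I" and N: "noeth UNIV (\<theta> -` I)"
    and R: "rsub R" "\<And>x. \<theta> x \<in> R" "\<And>y. y \<in> R \<Longrightarrow> \<exists>x. y - \<theta> x \<in> I"
  shows "noeth R I"
  unfolding noeth_def
proof (intro allI impI)
  interpret comm_ring_hom_type \<theta> by fact
  fix J :: "nat \<Rightarrow> _" assume "\<forall>i. rmod R (J i) \<and> J i \<subseteq> R \<and> I \<subseteq> J i \<and> J i \<subseteq> J (Suc i)"
  then have J: "rmod R (J i)" "J i \<subseteq> R" "I \<subseteq> J i" "J i \<subseteq> J (Suc i)" for i by auto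
  have "rmod UNIV (\<theta> -` J i)" for i
  proof -
    have "rmod (\<theta> -` R) (\<theta> -` J i)" by (rule vimage_rmod[OF J(1)])
    moreover have "\<theta> -` R = UNIV" using R(2) by auto
    ultimately show ?thesis by simp
  qed
  then have "\<forall>i. rmod UNIV (\<theta> -` J i) \<and> \<theta> -` J i \<subseteq> UNIV \<and> \<theta> -` I \<subseteq> \<theta> -` J i \<and> \<theta> -` J i \<subseteq> \<theta> -` J (Suc i)"
    using J(3,4) by (simp add: vimage_mono)
  then have "\<exists>n. \<forall>m\<ge>n. \<theta> -` J m = \<theta> -` J n"
    by (rule N[unfolded noeth_def, THEN spec[of _ "\<lambda>i. \<theta> -` J i"], THEN mp])
  then obtain n where n: "\<forall>m\<ge>n. \<theta> -` J m = \<theta> -` J n" ..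
  have iff: "y \<in> J i \<longleftrightarrow> x \<in> \<theta> -` J i" if "y - \<theta> x \<in> I" for x y i
    using rmod_diff_cancel[OF R(1) J(1), of y "\<theta> x" i] subsetD[OF J(3) that, of i] by simp
  have "J m = J n" if m: "n \<le> m" for m
  proof (rule Set.set_eqI)
    fix y
    show "y \<in> J m \<longleftrightarrow> y \<in> J n"
    proof (cases "y \<in> R")
      case True
      then obtain x where "y - \<theta> x \<in> I" using R(3) by blast
      then show ?thesis using iff[of y x m] iff[of y x n] n m by blast
    next
      case False
      then show ?thesis using J(2) by blast
    qed
  qed
  then show "\<exists>n. \<forall>m\<ge>n. J m = J n" by blast
qed

lemma jac_hom_image:
  assumes \<theta>: "comm_ring_hom_type \<theta>" and I: "rmod UNIV I" and J: "jac UNIV I0" and I0: "\<And>x. x \<in> I0 \<Longrightarrow> \<theta> x \<in> I"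
    and R: "rsub R" "\<And>x. \<theta> x \<in> R" "\<And>y. y \<in> R \<Longrightarrow> \<exists>x. y - \<theta> x \<in> I" and IR: "I \<subseteq> R"
  shows "jac R I"
  unfolding jac_def
proof (intro allI impI, elim conjE)
  interpret comm_ring_hom_type \<theta> by fact
  fix p g assume p: "rprime R p" "I \<subseteq> p" and g: "g \<in> R" "g \<notin> p"
  note pm = rprime_rmod[OF p(1)]
  have UR: "\<theta> -` R = UNIV" using R(2) by auto
  have p0: "rprime UNIV (\<theta> -` p)" using vimage_rprime[OF p(1)] UR by simp
  obtain x0 where x0: "g - \<theta> x0 \<in> I" using R(3) g(1) by blast
  have "x0 \<notin> \<theta> -` p" using rmod_diff_cancel[OF R(1) pm, of g "\<theta> x0"] x0 p(2) g(2) by auto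
  moreover have "I0 \<subseteq> \<theta> -` p" using I0 p(2) by auto
  ultimately have "\<exists>m. rprime UNIV m \<and> \<theta> -` p \<subseteq> m \<and> x0 \<notin> m \<and>
      (\<forall>x\<in>UNIV. x \<notin> m \<longrightarrow> (\<exists>y\<in>UNIV. x * y - 1 \<in> m))"
    using p0 by (intro J[unfolded jac_def, THEN spec[of _ "\<theta> -` p"], THEN spec[of _ x0], THEN mp]) simp
  then obtain m0 where m0: "rprime UNIV m0" "\<theta> -` p \<subseteq> m0" "x0 \<notin> m0"
    "\<forall>x\<in>UNIV. x \<notin> m0 \<longrightarrow> (\<exists>y\<in>UNIV. x * y - 1 \<in> m0)"
    by (elim exE conjE) rule
  note m0m = rprime_rmod[OF m0(1)]
  define m where "m = {y \<in> R. \<exists>x\<in>m0. y - \<theta> x \<in> I}"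
  have iff: "y \<in> m \<longleftrightarrow> z \<in> m0" if y: "y \<in> R" "y - \<theta> z \<in> I" for y z
  proof
    assume "y \<in> m"
    then obtain x where x: "x \<in> m0" "y - \<theta> x \<in> I" by (auto simp: m_def)
    have "(y - \<theta> x) - (y - \<theta> z) \<in> I" by (rule rmod_diff[OF rsub_UNIV I x(2) y(2)])
    then have "\<theta> (z - x) \<in> p" using p(2) by auto
    then have "z - x \<in> m0" using m0(2) by auto
    then show "z \<in> m0" using rmod_diff_cancel[OF rsub_UNIV m0m] x(1) by blast
  next
    assume "z \<in> m0"
    then show "y \<in> m" using y by (auto simp: m_def)
  qed
  have "rmod R m"
    unfolding rmod_def
  proof (intro conjI ballI)
    have "(0::'b) - \<theta> 0 \<in> I" using rmod_0[OF I] by simp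
    then show "0 \<in> m" using iff rsub_0[OF R(1)] rmod_0[OF m0m] by blast
  next
    fix y y' assume yy: "y \<in> m" "y' \<in> m"
    then obtain x x' where x: "y \<in> R" "x \<in> m0" "y - \<theta> x \<in> I" "y' \<in> R" "x' \<in> m0" "y' - \<theta> x' \<in> I" by (auto simp: m_def)
    have "(y + y') - \<theta> (x + x') \<in> I" using rmod_add[OF I x(3,6)] by (simp add: algebra_simps)
    then show "y + y' \<in> m" using iff[of "y + y'" "x + x'"] rsub_add[OF R(1) x(1,4)] rmod_add[OF m0m x(2,5)] by blast
  next
    fix c y assume c: "c \<in> R" "y \<in> m"
    then obtain x where x: "y \<in> R" "x \<in> m0" "y - \<theta> x \<in> I" by (auto simp: m_def)
    obtain z where z: "c - \<theta> z \<in> I" using R(3) c(1) by blast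
    have "c * y - \<theta> (z * x) \<in> I" using cong_mult[OF I z x(3)] by simp
    then show "c * y \<in> m" using iff[of "c * y" "z * x"] rsub_mult[OF R(1) c(1) x(1)] rmod_mult[OF m0m UNIV_I x(2)] by blast
  qed
  moreover have "1 \<notin> m"
  proof -
    have "(1::'b) - \<theta> 1 \<in> I" using rmod_0[OF I] by simp
    then show ?thesis using iff[of 1 1] rsub_1[OF R(1)] rprime_1[OF m0(1)] by blast
  qed
  moreover have "y \<in> m \<or> y' \<in> m" if y: "y \<in> R" "y' \<in> R" "y * y' \<in> m" for y y'
  proof -
    obtain x x' where x: "y - \<theta> x \<in> I" "y' - \<theta> x' \<in> I" using R(3) y(1,2) by meson
    have "y * y' - \<theta> (x * x') \<in> I" using cong_mult[OF I x] by simp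
    then have "x * x' \<in> m0" using iff[of "y * y'" "x * x'"] y rsub_mult[OF R(1)] by blast
    then have "x \<in> m0 \<or> x' \<in> m0" using rprime_mult[OF m0(1)] by blast
    then show ?thesis using iff[OF y(1) x(1)] iff[OF y(2) x(2)] by blast
  qed
  ultimately have pr: "rprime R m" unfolding rprime_def m_def by blast
  have pm': "p \<subseteq> m"
  proof
    fix y assume y: "y \<in> p"
    then have yR: "y \<in> R" using rprime_sub[OF p(1)] by blast
    then obtain x where x: "y - \<theta> x \<in> I" using R(3) by blast
    then have "\<theta> x \<in> p" using rmod_diff_cancel[OF R(1) pm, of y "\<theta> x"] p(2) y by blast
    then show "y \<in> m" using iff[OF yR x] m0(2) by auto
  qed
  have inv: "\<exists>z\<in>R. y * z - 1 \<in> m" if y: "y \<in> R" "y \<notin> m" for y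
  proof -
    obtain x where x: "y - \<theta> x \<in> I" using R(3) y(1) by blast
    then have "x \<notin> m0" using iff[OF y(1) x] y(2) by blast
    then obtain w where w: "x * w - 1 \<in> m0" using m0(4) by blast
    have "y * \<theta> w - \<theta> x * \<theta> w \<in> I" using rmod_mult2[OF I UNIV_I x, of "\<theta> w"] by (simp add: left_diff_distrib)
    then have "(y * \<theta> w - 1) - \<theta> (x * w - 1) \<in> I" by simp
    moreover have "y * \<theta> w - 1 \<in> R" using R(1,2) y(1) by (intro rsub_intros)
    ultimately have "y * \<theta> w - 1 \<in> m" using iff w by blast
    then show ?thesis using R(2) by blast
  qed
  have "g \<notin> m" using iff[OF g(1) x0] m0(3) by blast
  then show "\<exists>m. rprime R m \<and> p \<subseteq> m \<and> g \<notin> m \<and> (\<forall>x\<in>R. x \<notin> m \<longrightarrow> (\<exists>y\<in>R. x * y - 1 \<in> m))"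
    using pr pm' inv by (intro exI[of _ m]) blast
qed

lemma hom_image_data:
  fixes R :: "'r ring" and A :: "'a ring"
  assumes alg: "ring_algebra R A \<phi>"
  obtains \<theta> where "comm_ring_hom_type \<theta>" "\<And>x. proj A (\<theta> x) = \<phi> (proj R x)"
    "\<And>x. \<theta> x \<in> proj A -` \<phi> ` carrier R" "\<And>y. y \<in> proj A -` \<phi> ` carrier R \<Longrightarrow> \<exists>x. y - \<theta> x \<in> kr A"
    "\<And>x. x \<in> kr R \<Longrightarrow> \<theta> x \<in> kr A" "kr A \<subseteq> proj A -` \<phi> ` carrier R"
proof -
  note R = ring_algebraD(1)[OF alg] and A = ring_algebraD(2)[OF alg] and h = ring_algebraD(3)[OF alg]
  obtain \<theta> where \<theta>: "comm_ring_hom_type \<theta>" "\<And>x. proj A (\<theta> x) = \<phi> (proj R x)" by (rule hom_lift[OF R A h]) blast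
  have z: "\<phi> \<zero>\<^bsub>R\<^esub> = \<zero>\<^bsub>A\<^esub>" by (rule ring_hom_zero[OF h cring.axioms(1)[OF R] cring.axioms(1)[OF A]])
  show thesis
  proof (rule that[OF \<theta>])
    show "\<theta> x \<in> proj A -` \<phi> ` carrier R" for x using \<theta>(2) proj_carrier[OF R] by auto
    show "\<exists>x. y - \<theta> x \<in> kr A" if y: "y \<in> proj A -` \<phi> ` carrier R" for y
    proof -
      obtain k where k: "k \<in> carrier R" "proj A y = \<phi> k" using y by auto
      obtain x where "proj R x = k" using proj_surj[OF R k(1)] .
      then have "proj A y = proj A (\<theta> x)" using k(2) \<theta>(2) by simp
      then show ?thesis using kr_diff_iff[OF A] by blast
    qed
    show "\<theta> x \<in> kr A" if "x \<in> kr R" for x using that \<theta>(2) z by (simp add: kr_def)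
    have "\<zero>\<^bsub>A\<^esub> \<in> \<phi> ` carrier R" using z cring.cring_simprules(2)[OF R] by (metis imageI)
    then show "kr A \<subseteq> proj A -` \<phi> ` carrier R" by (auto simp: kr_def)
  qed
qed

lemma fg_algebra_polyring:
  fixes R :: "'r ring" and C :: "'c ring"
  assumes fg: "fg_algebra R C \<chi>"
  obtains m c where "polyring (proj C -` \<chi> ` carrier R) m c = UNIV"
proof -
  have alg: "ring_algebra R C \<chi>" using fg by (simp add: fg_algebra_def)
  note C = ring_algebraD(2)[OF alg]
  obtain S where S: "finite S" "S \<subseteq> carrier C" "generate_ring C (\<chi> ` carrier R \<union> S) = carrier C"
    using fg unfolding fg_algebra_def by blast
  obtain m f where mf: "S = f ` {i::nat. i < m}" using finite_imp_nat_seg_image_inj_on[OF S(1)] by blast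
  have "\<exists>x. i < m \<longrightarrow> proj C x = f i" for i using proj_surj[OF C, of "f i"] S(2) mf by blast
  then obtain c where c: "\<And>i. i < m \<Longrightarrow> proj C (c i) = f i" by metis
  let ?R = "proj C -` \<chi> ` carrier R"
  note R' = rsub_hom_image[OF alg]
  let ?P = "polyring ?R m c"
  note P = rsub_polyring[OF R', of m c]
  have RP: "?R \<subseteq> ?P" by (rule polyring_base[OF R'])
  obtain \<theta> where "kr C \<subseteq> ?R" by (rule hom_image_data[OF alg]) blast
  then have kP: "kr C \<subseteq> ?P" using RP by blast
  have gen: "\<forall>x. proj C x = h \<longrightarrow> x \<in> ?P" if h: "h \<in> generate_ring C (\<chi> ` carrier R \<union> S)" for h
  proof -
    have *: "\<exists>x\<in>?P. proj C x = h"
      using h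
    proof (induction rule: generate_ring.induct)
      case one
      show ?case using rsub_1[OF P] ring_product_ops(7)[OF C] by blast
    next
      case (incl h)
      show ?case
      proof (cases "h \<in> S")
        case True
        then obtain i where "i < m" "h = f i" using mf by auto
        then show ?thesis using polyring_var[OF R', of i m c] c by blast
      next
        case False
        then have h: "h \<in> \<chi> ` carrier R" using incl by blast
        then have "h \<in> carrier C" using ring_hom_closed[OF ring_algebraD(3)[OF alg]] by blast
        then obtain x where x: "proj C x = h" using proj_surj[OF C] by blast
        then have "x \<in> ?P" using h RP by blast
        then show ?thesis using x by blast
      qed
    next
      case (a_inv h)
      then obtain x where x: "x \<in> ?P" "proj C x = h" by blast
      then show ?case using rsub_minus[OF P x(1)] ring_product_ops(10)[OF C, of x] by (intro bexI[of _ "- x"]) simp_all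
    next
      case (eng_add h1 h2)
      then obtain x y where x: "x \<in> ?P" "proj C x = h1" "y \<in> ?P" "proj C y = h2" by blast
      then show ?case using rsub_add[OF P x(1,3)] ring_product_ops(8)[OF C, of x y] by (intro bexI[of _ "x + y"]) simp_all
    next
      case (eng_mult h1 h2)
      then obtain x y where x: "x \<in> ?P" "proj C x = h1" "y \<in> ?P" "proj C y = h2" by blast
      then show ?case using rsub_mult[OF P x(1,3)] ring_product_ops(9)[OF C, of x y] by (intro bexI[of _ "x * y"]) simp_all
    qed
    show ?thesis
    proof (intro allI impI)
      fix x assume x: "proj C x = h"
      obtain y where y: "y \<in> ?P" "proj C y = h" using * by blast
      then have "x - y \<in> kr C" using x by (simp add: kr_diff_iff[OF C])
      then have "(x - y) + y \<in> ?P" using kP y(1) by (intro rsub_add[OF P]) auto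
      then show "x \<in> ?P" by simp
    qed
  qed
  have "x \<in> ?P" for x using gen[of "proj C x"] proj_carrier[OF C] S(3) by blast
  then show thesis by (intro that[of m c]) blast
qed

lemma hom_prime_chain:
  fixes A :: "'a ring" and C :: "'c ring"
  assumes A: "cring A" and C: "cring C" and h: "\<iota> \<in> ring_hom A C"
    and Q: "\<And>i. i \<le> n \<Longrightarrow> rprime UNIV (Q i)" "\<And>i. i \<le> n \<Longrightarrow> kr C \<subseteq> Q i" "\<And>i. i < n \<Longrightarrow> Q i \<subseteq> Q (Suc i)"
    and sep: "\<And>i. i < n \<Longrightarrow> \<exists>u \<in> Q (Suc i) - Q i. proj C u \<in> \<iota> ` carrier A"
  shows "\<exists>P. prime_chain A n P"
proof -
  have alg: "ring_algebra A C \<iota>" using A C h by (simp add: ring_algebra_def)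
  obtain \<theta> where \<theta>: "comm_ring_hom_type \<theta>" "\<And>x. proj C (\<theta> x) = \<iota> (proj A x)" "\<And>x. x \<in> kr A \<Longrightarrow> \<theta> x \<in> kr C"
    by (rule hom_image_data[OF alg]) blast
  interpret comm_ring_hom_type \<theta> by fact
  have pr: "rprime UNIV (\<theta> -` Q i) \<and> kr A \<subseteq> \<theta> -` Q i" if "i \<le> n" for i
    using vimage_rprime[OF Q(1)[OF that]] \<theta>(3) Q(2)[OF that] by auto
  have "\<theta> -` Q i \<subset> \<theta> -` Q (Suc i)" if i: "i < n" for i
  proof -
    obtain u where u: "u \<in> Q (Suc i)" "u \<notin> Q i" "proj C u \<in> \<iota> ` carrier A" using sep[OF i] by blast
    then obtain a where a: "a \<in> carrier A" "proj C u = \<iota> a" by blast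
    obtain x where x: "proj A x = a" using proj_surj[OF A a(1)] .
    have d: "\<theta> x - u \<in> kr C" using kr_diff_iff[OF C] a(2) x \<theta>(2) by simp
    have "\<theta> x \<in> Q j \<longleftrightarrow> u \<in> Q j" if "j \<le> n" for j
      using rmod_diff_cancel[OF rsub_UNIV rprime_rmod[OF Q(1)[OF that]], of "\<theta> x" u] d Q(2)[OF that] by blast
    then have "x \<in> \<theta> -` Q (Suc i)" "x \<notin> \<theta> -` Q i" using u i by auto
    then show ?thesis using Q(3)[OF i] by blast
  qed
  then have "ht_ge (kr A) n (\<theta> -` Q n)"
    unfolding ht_ge_def using pr by (intro exI[of _ "\<lambda>i. \<theta> -` Q i"]) simp
  then show ?thesis using prime_chain_iff_ht_ge[OF A] by blast
qed

lemma subfinite_lift: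
  fixes F :: "'r ring" and A :: "'a ring"
  assumes sub: "subfinite_algebra TYPE('c) F A \<phi>" and no: "subm r (proj A -` \<phi> ` carrier F) n a \<inter> kr A = {}"
  obtains C :: "'c ring" and \<chi> \<iota> a' where "fg_algebra F C \<chi>" "\<iota> \<in> ring_hom A C"
    "subm r (proj C -` \<chi> ` carrier F) n a' \<inter> kr C = {}"
    "\<And>u. u \<in> polyring (proj C -` \<chi> ` carrier F) n a' \<Longrightarrow> proj C u \<in> \<iota> ` carrier A"
proof -
  obtain C :: "'c ring" and \<chi> \<iota> where C: "fg_algebra F C \<chi>" "\<iota> \<in> ring_hom A C" "inj_on \<iota> (carrier A)"
    "\<forall>x \<in> carrier F. \<iota> (\<phi> x) = \<chi> x"
    using sub unfolding subfinite_algebra_def by blast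
  have algA: "ring_algebra F A \<phi>" using sub by (simp add: subfinite_algebra_def)
  have algC: "ring_algebra F C \<chi>" using C(1) by (simp add: fg_algebra_def)
  note A = ring_algebraD(2)[OF algA] and cC = ring_algebraD(2)[OF algC]
  have algAC: "ring_algebra A C \<iota>" using A cC C(2) by (simp add: ring_algebra_def)
  obtain \<theta> where \<theta>: "comm_ring_hom_type \<theta>" "\<And>x. proj C (\<theta> x) = \<iota> (proj A x)"
    by (rule hom_image_data[OF algAC]) blast
  interpret comm_ring_hom_type \<theta> by fact
  let ?RA = "proj A -` \<phi> ` carrier F" and ?RC = "proj C -` \<chi> ` carrier F"
  note RA = rsub_hom_image[OF algA] and RC = rsub_hom_image[OF algC]
  have lift: "\<exists>d\<in>?RA. \<theta> d - c \<in> kr C" if c: "c \<in> ?RC" for c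
  proof -
    obtain k where k: "k \<in> carrier F" "proj C c = \<chi> k" using c by auto
    obtain d where d: "proj A d = \<phi> k" using proj_surj[OF A ring_hom_closed[OF ring_algebraD(3)[OF algA] k(1)]] .
    have "proj C (\<theta> d) = proj C c" using C(4) k d \<theta>(2) by simp
    then show ?thesis using d k(1) kr_diff_iff[OF cC] by (intro bexI[of _ d]) auto
  qed
  have "subm r ?RC n (\<theta> \<circ> a) \<inter> kr C = {}"
  proof (rule ccontr)
    assume "\<not> ?thesis"
    then obtain t0 y where t0: "set_mset t0 \<subseteq> {..<n}" "meval (\<theta> \<circ> a) t0 + y \<in> kr C"
      "y \<in> rspan ?RC (meval (\<theta> \<circ> a) ` above r n t0)"
      unfolding subm_def by blast
    obtain G c where G: "finite G" "G \<subseteq> above r n t0"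
      "\<And>t. t \<in> G \<Longrightarrow> c t \<in> ?RC" "y = (\<Sum>t\<in>G. c t * meval (\<theta> \<circ> a) t)"
      by (rule rspan_image_sum[OF RC t0(3)]) blast
    have "\<forall>t\<in>G. \<exists>d. d \<in> ?RA \<and> \<theta> d - c t \<in> kr C" using lift[OF G(3)] by blast
    from bchoice[OF this] obtain d where d: "\<forall>t\<in>G. d t \<in> ?RA \<and> \<theta> (d t) - c t \<in> kr C" by blast
    define y' where "y' = (\<Sum>t\<in>G. d t * meval a t)"
    have "meval a t0 + y' \<in> subm r ?RA n a"
      unfolding y'_def by (rule submI[OF t0(1) rspan_sum[OF RA G(2)]]) (use d in blast)
    moreover have "meval a t0 + y' \<in> kr A"
    proof -
      have "(\<Sum>t\<in>G. (\<theta> (d t) - c t) * meval (\<theta> \<circ> a) t) \<in> kr C"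
        using d by (intro rmod_sum[OF kr_rmod[OF cC]] rmod_mult2[OF kr_rmod[OF cC]]) auto
      then have "(meval (\<theta> \<circ> a) t0 + y) + (\<Sum>t\<in>G. (\<theta> (d t) - c t) * meval (\<theta> \<circ> a) t) \<in> kr C"
        by (rule rmod_add[OF kr_rmod[OF cC] t0(2)])
      also have "(meval (\<theta> \<circ> a) t0 + y) + (\<Sum>t\<in>G. (\<theta> (d t) - c t) * meval (\<theta> \<circ> a) t) = \<theta> (meval a t0 + y')"
        unfolding G(4) y'_def by (simp add: hom_sum hom_meval left_diff_distrib sum_subtractf)
      finally have "\<iota> (proj A (meval a t0 + y')) = \<zero>\<^bsub>C\<^esub>" unfolding \<theta>(2)[symmetric] by (simp add: kr_def)
      also have "\<dots> = \<iota> \<zero>\<^bsub>A\<^esub>"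
        using ring_hom_zero[OF C(2) cring.axioms(1)[OF A] cring.axioms(1)[OF cC]] by simp
      finally have "proj A (meval a t0 + y') = \<zero>\<^bsub>A\<^esub>"
        by (rule inj_onD[OF C(3) _ proj_carrier[OF A] cring.cring_simprules(2)[OF A]])
      then show ?thesis by (simp add: kr_def)
    qed
    ultimately show False using no by blast
  qed
  moreover have "polyring ?RC n (\<theta> \<circ> a) \<subseteq> proj C -` \<iota> ` carrier A"
  proof (rule polyring_least[OF rsub_hom_image[OF algAC]])
    show "?RC \<subseteq> proj C -` \<iota> ` carrier A"
    proof
      fix x assume "x \<in> ?RC"
      then obtain k where k: "k \<in> carrier F" "proj C x = \<chi> k" by auto
      then have "proj C x = \<iota> (\<phi> k)" using C(4) by simp
      then show "x \<in> proj C -` \<iota> ` carrier A" using ring_hom_closed[OF ring_algebraD(3)[OF algA] k(1)] by simp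
    qed
    show "(\<theta> \<circ> a) i \<in> proj C -` \<iota> ` carrier A" for i using \<theta>(2) proj_carrier[OF A] by simp
  qed
  ultimately show thesis using that[OF C(1,2), of "\<theta> \<circ> a"] by blast
qed

lemma field_image_inverse:
  fixes F :: "'r ring" and C :: "'c ring"
  assumes F: "field F" and alg: "ring_algebra F C \<chi>" and x: "x \<in> proj C -` \<chi> ` carrier F" "x \<notin> kr C"
  shows "\<exists>y \<in> proj C -` \<chi> ` carrier F. x * y - 1 \<in> kr C"
proof -
  interpret F: field F by fact
  note C = ring_algebraD(2)[OF alg] and h = ring_algebraD(3)[OF alg]
  obtain k where k: "k \<in> carrier F" "proj C x = \<chi> k" using x(1) by auto
  have "\<chi> \<zero>\<^bsub>F\<^esub> = \<zero>\<^bsub>C\<^esub>" by (rule ring_hom_zero[OF h F.ring_axioms cring.axioms(1)[OF C]])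
  then have "k \<noteq> \<zero>\<^bsub>F\<^esub>" using x(2) k(2) by (auto simp: kr_def)
  then have "k \<in> Units F" using F.field_Units k(1) by auto
  then have inv: "inv\<^bsub>F\<^esub> k \<in> carrier F" "k \<otimes>\<^bsub>F\<^esub> inv\<^bsub>F\<^esub> k = \<one>\<^bsub>F\<^esub>" by auto
  obtain y where y: "proj C y = \<chi> (inv\<^bsub>F\<^esub> k)" using proj_surj[OF C ring_hom_closed[OF h inv(1)]] .
  have "proj C (x * y) = \<chi> (k \<otimes>\<^bsub>F\<^esub> inv\<^bsub>F\<^esub> k)"
    using ring_hom_mult[OF h k(1) inv(1)] by (simp add: ring_product_ops(9)[OF C] k(2) y)
  then have "x * y - 1 \<in> kr C" using inv(2) ring_hom_one[OF h] by (simp add: kr_diff_iff[OF C] ring_product_ops(7)[OF C])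
  then show ?thesis using y inv(1) by (intro bexI[of _ y]) auto
qed

lemma field_subfinite_upper:
  fixes F :: "'r ring" and A :: "'a ring"
  assumes r: "monomial_ordering r" and F: "field F" and sub: "subfinite_algebra TYPE('c) F A \<phi>"
    and no: "subm r (proj A -` \<phi> ` carrier F) n a \<inter> kr A = {}"
  shows "\<exists>P. prime_chain A n P"
proof -
  have A: "cring A" using sub by (auto simp: subfinite_algebra_def ring_algebra_def)
  obtain C :: "'c ring" and \<chi> \<iota> a' where C: "fg_algebra F C \<chi>" "\<iota> \<in> ring_hom A C"
    "subm r (proj C -` \<chi> ` carrier F) n a' \<inter> kr C = {}"
    "\<And>u. u \<in> polyring (proj C -` \<chi> ` carrier F) n a' \<Longrightarrow> proj C u \<in> \<iota> ` carrier A"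
    by (rule subfinite_lift[OF sub no]) blast
  have alg: "ring_algebra F C \<chi>" using C(1) by (simp add: fg_algebra_def)
  note cC = ring_algebraD(2)[OF alg]
  let ?K = "proj C -` \<chi> ` carrier F"
  note K = rsub_hom_image[OF alg]
  obtain m c where gen: "polyring ?K m c = UNIV" by (rule fg_algebra_polyring[OF C(1)])
  obtain q where q: "rprime UNIV q" "kr C \<subseteq> q" "subm r ?K n a' \<inter> q = {}"
    by (rule exists_prime_subm_disjoint[OF r K kr_rmod[OF cC] C(3)])
  have "indep ?K q n a'"
  proof (rule no_relation_imp_indep[OF r K rprime_rmod[OF q(1)] _ q(3)])
    fix x assume "x \<in> ?K" "x \<notin> q"
    then show "\<exists>y\<in>?K. x * y - 1 \<in> q" using field_image_inverse[OF F alg, of x] q(2) by blast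
  qed
  from indep_chain[OF K gen q(1) this] obtain Q where Q: "\<forall>i\<le>n. rprime UNIV (Q i) \<and> q \<subseteq> Q i"
    "\<forall>i<n. Q i \<subseteq> Q (Suc i) \<and> (\<exists>u\<in>polyring ?K n a'. u \<in> Q (Suc i) \<and> u \<notin> Q i)" by blast
  show ?thesis
  proof (rule hom_prime_chain[OF A cC C(2), of n Q])
    show "\<exists>u\<in>Q (Suc i) - Q i. proj C u \<in> \<iota> ` carrier A" if "i < n" for i
      using Q(2) C(4) that by blast
    show "kr C \<subseteq> Q i" if "i \<le> n" for i using Q(1) q(2) that by blast
  qed (use Q in auto)
qed

lemma jacobson_subfinite_upper:
  fixes R :: "'r ring" and A :: "'a ring"
  assumes r: "monomial_ordering r" and N: "noetherian_ring R" and J: "jacobson_ring R"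
    and sub: "subfinite_algebra TYPE('c) R A \<phi>" and "n = 1 \<or> n = 2"
    and no: "subm r (proj A -` \<phi> ` carrier R) n a \<inter> kr A = {}"
  shows "\<exists>P. prime_chain A n P"
proof -
  have A: "cring A" and R: "cring R" using sub by (auto simp: subfinite_algebra_def ring_algebra_def)
  obtain C :: "'c ring" and \<chi> \<iota> a' where C: "fg_algebra R C \<chi>" "\<iota> \<in> ring_hom A C"
    "subm r (proj C -` \<chi> ` carrier R) n a' \<inter> kr C = {}"
    "\<And>u. u \<in> polyring (proj C -` \<chi> ` carrier R) n a' \<Longrightarrow> proj C u \<in> \<iota> ` carrier A"
    by (rule subfinite_lift[OF sub no]) blast
  have alg: "ring_algebra R C \<chi>" using C(1) by (simp add: fg_algebra_def)
  note cC = ring_algebraD(2)[OF alg]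
  let ?R = "proj C -` \<chi> ` carrier R"
  note R' = rsub_hom_image[OF alg] and I = kr_rmod[OF cC]
  obtain m c where gen: "polyring ?R m c = UNIV" by (rule fg_algebra_polyring[OF C(1)])
  obtain \<theta> where \<theta>: "comm_ring_hom_type \<theta>" "\<And>x. \<theta> x \<in> ?R" "\<And>y. y \<in> ?R \<Longrightarrow> \<exists>x. y - \<theta> x \<in> kr C"
    "\<And>x. x \<in> kr R \<Longrightarrow> \<theta> x \<in> kr C" "kr C \<subseteq> ?R"
    by (rule hom_image_data[OF alg]) blast
  have jac: "jac ?R (kr C)" by (rule jac_hom_image[OF \<theta>(1) I jacobson_jac[OF J] \<theta>(4) R' \<theta>(2,3,5)])
  have "kr R \<subseteq> \<theta> -` kr C" using \<theta>(4) by blast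
  then have noeth: "noeth ?R (kr C)"
    by (rule noeth_hom_image[OF \<theta>(1) I noeth_mono[OF noetherian_noeth[OF R N]] R' \<theta>(2,3)])
  obtain q where q: "rprime UNIV q" "kr C \<subseteq> q" "subm r ?R n a' \<inter> q = {}"
    by (rule exists_prime_subm_disjoint[OF r R' I C(3)])
  from \<open>n = 1 \<or> n = 2\<close> show ?thesis
  proof
    assume n: "n = 1"
    obtain Q u where Q: "rprime UNIV Q" "q \<subseteq> Q" "u \<in> polyring ?R 1 a'" "u \<in> Q" "u \<notin> q"
      by (rule jacobson_no_relation1[OF r R' jac gen \<theta>(5) q(1,2) q(3)[unfolded n]])
    show ?thesis
    proof (rule hom_prime_chain[OF A cC C(2), of n "\<lambda>i. if i = 0 then q else Q"])
      show "\<exists>u\<in>(if Suc i = 0 then q else Q) - (if i = 0 then q else Q). proj C u \<in> \<iota> ` carrier A" if "i < n" for i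
        using Q(3-5) C(4)[of u] that n by auto
    qed (use Q q(1,2) n in auto)
  next
    assume n: "n = 2"
    obtain Q Q' u v where Q: "rprime UNIV Q" "rprime UNIV Q'" "q \<subseteq> Q" "Q \<subseteq> Q'"
      "u \<in> polyring ?R 2 a'" "u \<in> Q" "u \<notin> q" "v \<in> polyring ?R 2 a'" "v \<in> Q'" "v \<notin> Q"
      by (rule jacobson_no_relation2_subring[OF r noeth R' jac gen \<theta>(5) I q(1,2) q(3)[unfolded n]])
    let ?Q = "\<lambda>i::nat. if i = 0 then q else if i = 1 then Q else Q'"
    show ?thesis
    proof (rule hom_prime_chain[OF A cC C(2), of n ?Q])
      fix i assume "i < n"
      then consider "i = 0" | "i = 1" using n by linarith
      then show "\<exists>u\<in>?Q (Suc i) - ?Q i. proj C u \<in> \<iota> ` carrier A"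
      proof cases
        case 1
        then show ?thesis using Q(5-7) C(4)[of u] n by (intro bexI[of _ u]) auto
      next
        case 2
        then show ?thesis using Q(8-10) C(4)[of v] n by (intro bexI[of _ v]) auto
      qed
      show "?Q i \<subseteq> ?Q (Suc i)" using Q(3,4) by auto
    next
      fix i
      show "rprime UNIV (?Q i)" using Q(1,2) q(1) by simp
      show "kr C \<subseteq> ?Q i" using Q(3,4) q(2) by auto
    qed
  qed
qed

section \<open>Localizations\<close>

definition fclass :: "'b ring \<Rightarrow> 'b set \<Rightarrow> 'b ring_product \<Rightarrow> 'b ring_product \<Rightarrow> ('b \<times> 'b) set" where
  "fclass B P x s = frac_rel B (carrier B - P) `` {(proj B x, proj B s)}"

context
  fixes B :: "'b ring" and P :: "'b set"
  assumes B: "cring B" and P: "primeideal P B"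
begin

lemma rprime_vimage: "rprime UNIV (proj B -` P)" "kr B \<subseteq> (proj B -` P)"
  using prime_vimage[OF B P] by auto

lemma notin_prime_mult: "s \<notin> proj B -` P \<Longrightarrow> t \<notin> proj B -` P \<Longrightarrow> s * t \<notin> proj B -` P"
  using rprime_mult[OF rprime_vimage(1)] by blast

lemma frac_rel_proj_iff:
  "((proj B x, proj B s), (proj B y, proj B t)) \<in> frac_rel B (carrier B - P) \<longleftrightarrow>
    s \<notin> proj B -` P \<and> t \<notin> proj B -` P \<and> (\<exists>u. u \<notin> proj B -` P \<and> u * (t * x - s * y) \<in> kr B)"
proof -
  interpret cring B by (rule B)
  have eq: "proj B u \<otimes>\<^bsub>B\<^esub> (proj B t \<otimes>\<^bsub>B\<^esub> proj B x \<ominus>\<^bsub>B\<^esub> proj B s \<otimes>\<^bsub>B\<^esub> proj B y) = proj B (u * (t * x - s * y))" for u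
    by (simp only: ring_product_ops(9)[OF B] proj_diff[OF B])
  have "(\<exists>u\<in>carrier B - P. u \<otimes>\<^bsub>B\<^esub> (proj B t \<otimes>\<^bsub>B\<^esub> proj B x \<ominus>\<^bsub>B\<^esub> proj B s \<otimes>\<^bsub>B\<^esub> proj B y) = \<zero>\<^bsub>B\<^esub>)
      \<longleftrightarrow> (\<exists>u. u \<notin> proj B -` P \<and> u * (t * x - s * y) \<in> kr B)" (is "?l \<longleftrightarrow> ?r")
  proof
    assume ?l
    then obtain v where v: "v \<in> carrier B" "v \<notin> P"
      "v \<otimes>\<^bsub>B\<^esub> (proj B t \<otimes>\<^bsub>B\<^esub> proj B x \<ominus>\<^bsub>B\<^esub> proj B s \<otimes>\<^bsub>B\<^esub> proj B y) = \<zero>\<^bsub>B\<^esub>" by blast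
    obtain u where u: "proj B u = v" using proj_surj[OF B v(1)] .
    have "proj B (u * (t * x - s * y)) = \<zero>\<^bsub>B\<^esub>" using v(3) by (simp only: eq[symmetric] u)
    then show ?r using u(1) v(2) by (intro exI[of _ u]) (simp add: kr_def)
  next
    assume ?r
    then obtain u where u: "u \<notin> proj B -` P" "u * (t * x - s * y) \<in> kr B" by blast
    then have "proj B (u * (t * x - s * y)) = \<zero>\<^bsub>B\<^esub>" by (simp add: kr_def)
    moreover have "proj B u \<in> carrier B - P" using u(1) proj_carrier[OF B] by simp
    ultimately show ?l by (intro bexI[of _ "proj B u"]) (simp_all only: eq)
  qed
  then show ?thesis using proj_carrier[OF B] by (auto simp: frac_rel_def)
qed

lemma frac_rel_proj_sym:
  assumes "((proj B x, proj B s), (proj B y, proj B t)) \<in> frac_rel B (carrier B - P)"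
  shows "((proj B y, proj B t), (proj B x, proj B s)) \<in> frac_rel B (carrier B - P)"
proof -
  obtain u where u: "s \<notin> proj B -` P" "t \<notin> proj B -` P" "u \<notin> proj B -` P" "u * (t * x - s * y) \<in> kr B"
    using assms unfolding frac_rel_proj_iff by blast
  have "- (u * (t * x - s * y)) \<in> kr B" by (rule rmod_minus[OF rsub_UNIV kr_rmod[OF B] u(4)])
  then have "u * (s * y - t * x) \<in> kr B" by (simp add: algebra_simps)
  then show ?thesis unfolding frac_rel_proj_iff using u by blast
qed

lemma frac_rel_proj_trans:
  assumes "((proj B x, proj B s), (proj B y, proj B t)) \<in> frac_rel B (carrier B - P)"
    "((proj B y, proj B t), (proj B z, proj B w)) \<in> frac_rel B (carrier B - P)"
  shows "((proj B x, proj B s), (proj B z, proj B w)) \<in> frac_rel B (carrier B - P)"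
proof -
  note Im = kr_rmod[OF B]
  obtain u where u: "s \<notin> proj B -` P" "t \<notin> proj B -` P" "u \<notin> proj B -` P" "u * (t * x - s * y) \<in> kr B"
    using assms(1) unfolding frac_rel_proj_iff by blast
  obtain v where v: "w \<notin> proj B -` P" "v \<notin> proj B -` P" "v * (w * y - t * z) \<in> kr B"
    using assms(2) unfolding frac_rel_proj_iff by blast
  have "(v * w) * (u * (t * x - s * y)) + (u * s) * (v * (w * y - t * z)) \<in> kr B"
    by (rule rmod_add[OF Im rmod_mult[OF Im UNIV_I u(4)] rmod_mult[OF Im UNIV_I v(3)]])
  also have "(v * w) * (u * (t * x - s * y)) + (u * s) * (v * (w * y - t * z)) = (u * v * t) * (w * x - s * z)"
    by (simp add: algebra_simps)
  finally show ?thesis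
    unfolding frac_rel_proj_iff using u(1) v(1) notin_prime_mult[OF notin_prime_mult[OF u(3) v(2)] u(2)]
    by (intro conjI exI[of _ "u * v * t"])
qed

lemma fclass_rep:
  assumes p: "p \<in> fclass B P x s"
  obtains x' s' where "p = (proj B x', proj B s')"
    "((proj B x, proj B s), (proj B x', proj B s')) \<in> frac_rel B (carrier B - P)"
proof -
  have *: "((proj B x, proj B s), p) \<in> frac_rel B (carrier B - P)" using p by (simp add: fclass_def)
  then have "fst p \<in> carrier B" "snd p \<in> carrier B" by (auto simp: frac_rel_def)
  then obtain x' s' where "proj B x' = fst p" "proj B s' = snd p" using proj_surj[OF B] by metis
  then have "p = (proj B x', proj B s')" by simp
  then show thesis using * that by blast
qed

lemma fclass_self:
  assumes "s \<notin> proj B -` P"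
  shows "(proj B x, proj B s) \<in> fclass B P x s"
proof -
  have "1 * (s * x - s * x) \<in> kr B" using rmod_0[OF kr_rmod[OF B]] by simp
  then show ?thesis
    unfolding fclass_def Image_singleton_iff frac_rel_proj_iff using assms rprime_1[OF rprime_vimage(1)] by blast
qed

lemma fclass_eq_iff:
  assumes st: "s \<notin> proj B -` P" "t \<notin> proj B -` P"
  shows "fclass B P x s = fclass B P y t \<longleftrightarrow> (\<exists>u. u \<notin> proj B -` P \<and> u * (t * x - s * y) \<in> kr B)"
proof -
  have sub: "fclass B P x s \<subseteq> fclass B P y t"
    if "((proj B y, proj B t), (proj B x, proj B s)) \<in> frac_rel B (carrier B - P)" for x s y t
  proof
    fix p assume "p \<in> fclass B P x s"
    then obtain x' s' where "p = (proj B x', proj B s')"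
      "((proj B x, proj B s), (proj B x', proj B s')) \<in> frac_rel B (carrier B - P)" by (rule fclass_rep)
    then show "p \<in> fclass B P y t" using frac_rel_proj_trans[OF that] by (simp add: fclass_def)
  qed
  have "fclass B P x s = fclass B P y t \<longleftrightarrow>
      ((proj B x, proj B s), (proj B y, proj B t)) \<in> frac_rel B (carrier B - P)"
  proof
    assume "fclass B P x s = fclass B P y t"
    then have "(proj B y, proj B t) \<in> fclass B P x s" using fclass_self[OF st(2), of y] by simp
    then show "((proj B x, proj B s), (proj B y, proj B t)) \<in> frac_rel B (carrier B - P)" by (simp add: fclass_def)
  qed (use sub frac_rel_proj_sym in blast)
  then show ?thesis unfolding frac_rel_proj_iff using st by simp
qed

lemma UN_fclass:
  assumes s: "s \<notin> proj B -` P" "t \<notin> proj B -` P"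
    and f: "\<And>x' s' y' t' u v. s' \<notin> proj B -` P \<Longrightarrow> t' \<notin> proj B -` P \<Longrightarrow> u \<notin> proj B -` P \<Longrightarrow> v \<notin> proj B -` P \<Longrightarrow> u * (s' * x - s * x') \<in> kr B \<Longrightarrow>
      v * (t' * y - t * y') \<in> kr B \<Longrightarrow> f (proj B x', proj B s') (proj B y', proj B t') = c"
  shows "(\<Union>p \<in> fclass B P x s. \<Union>q \<in> fclass B P y t. f p q) = c"
proof -
  have fc: "f p q = c" if p: "p \<in> fclass B P x s" and q: "q \<in> fclass B P y t" for p q
  proof -
    obtain x' s' where 1: "p = (proj B x', proj B s')"
      "((proj B x, proj B s), (proj B x', proj B s')) \<in> frac_rel B (carrier B - P)" by (rule fclass_rep[OF p])
    obtain y' t' where 2: "q = (proj B y', proj B t')"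
      "((proj B y, proj B t), (proj B y', proj B t')) \<in> frac_rel B (carrier B - P)" by (rule fclass_rep[OF q])
    show ?thesis unfolding 1(1) 2(1) using 1(2) 2(2) f[of s' t'] unfolding frac_rel_proj_iff by blast
  qed
  have "(\<Union>q \<in> fclass B P y t. f p q) = c" if "p \<in> fclass B P x s" for p
    using fc[OF that] by (intro UN_constant_eq[OF fclass_self[OF s(2)]]) blast
  then show ?thesis by (intro UN_constant_eq[OF fclass_self[OF s(1)]]) blast
qed

lemma fclass_mult:
  assumes "s \<notin> proj B -` P" "t \<notin> proj B -` P"
  shows "fclass B P x s \<otimes>\<^bsub>localization_at_prime B P\<^esub> fclass B P y t = fclass B P (x * y) (s * t)"
proof -
  note Im = kr_rmod[OF B]
  have "(\<Union>p \<in> fclass B P x s. \<Union>q \<in> fclass B P y t.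
      frac_rel B (carrier B - P) `` {(fst p \<otimes>\<^bsub>B\<^esub> fst q, snd p \<otimes>\<^bsub>B\<^esub> snd q)}) = fclass B P (x * y) (s * t)"
  proof (rule UN_fclass[OF assms])
    fix x' s' y' t' u v
    assume h: "s' \<notin> proj B -` P" "t' \<notin> proj B -` P" "u \<notin> proj B -` P" "v \<notin> proj B -` P" "u * (s' * x - s * x') \<in> kr B" "v * (t' * y - t * y') \<in> kr B"
    have "- ((v * t' * y) * (u * (s' * x - s * x')) + (u * s * x') * (v * (t' * y - t * y'))) \<in> kr B"
      by (rule rmod_minus[OF rsub_UNIV Im rmod_add[OF Im rmod_mult[OF Im UNIV_I h(5)] rmod_mult[OF Im UNIV_I h(6)]]])
    also have "- ((v * t' * y) * (u * (s' * x - s * x')) + (u * s * x') * (v * (t' * y - t * y')))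
        = (u * v) * ((s * t) * (x' * y') - (s' * t') * (x * y))" by (simp add: algebra_simps)
    finally have "fclass B P (x' * y') (s' * t') = fclass B P (x * y) (s * t)"
      unfolding fclass_eq_iff[OF notin_prime_mult[OF h(1,2)] notin_prime_mult[OF assms]] using notin_prime_mult[OF h(3,4)] by blast
    then show "frac_rel B (carrier B - P) `` {(fst (proj B x', proj B s') \<otimes>\<^bsub>B\<^esub> fst (proj B y', proj B t'),
        snd (proj B x', proj B s') \<otimes>\<^bsub>B\<^esub> snd (proj B y', proj B t'))} = fclass B P (x * y) (s * t)"
      by (simp add: fclass_def ring_product_ops(9)[OF B])
  qed
  then show ?thesis by (simp add: localization_at_prime_def localization_def)
qed

lemma fclass_add:
  assumes "s \<notin> proj B -` P" "t \<notin> proj B -` P"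
  shows "fclass B P x s \<oplus>\<^bsub>localization_at_prime B P\<^esub> fclass B P y t = fclass B P (t * x + s * y) (s * t)"
proof -
  note Im = kr_rmod[OF B]
  have "(\<Union>p \<in> fclass B P x s. \<Union>q \<in> fclass B P y t.
      frac_rel B (carrier B - P) `` {(snd q \<otimes>\<^bsub>B\<^esub> fst p \<oplus>\<^bsub>B\<^esub> snd p \<otimes>\<^bsub>B\<^esub> fst q, snd p \<otimes>\<^bsub>B\<^esub> snd q)}) =
      fclass B P (t * x + s * y) (s * t)"
  proof (rule UN_fclass[OF assms])
    fix x' s' y' t' u v
    assume h: "s' \<notin> proj B -` P" "t' \<notin> proj B -` P" "u \<notin> proj B -` P" "v \<notin> proj B -` P" "u * (s' * x - s * x') \<in> kr B" "v * (t' * y - t * y') \<in> kr B"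
    have "- ((v * t * t') * (u * (s' * x - s * x')) + (u * s * s') * (v * (t' * y - t * y'))) \<in> kr B"
      by (rule rmod_minus[OF rsub_UNIV Im rmod_add[OF Im rmod_mult[OF Im UNIV_I h(5)] rmod_mult[OF Im UNIV_I h(6)]]])
    also have "- ((v * t * t') * (u * (s' * x - s * x')) + (u * s * s') * (v * (t' * y - t * y')))
        = (u * v) * ((s * t) * (t' * x' + s' * y') - (s' * t') * (t * x + s * y))" by (simp add: algebra_simps)
    finally have "fclass B P (t' * x' + s' * y') (s' * t') = fclass B P (t * x + s * y) (s * t)"
      unfolding fclass_eq_iff[OF notin_prime_mult[OF h(1,2)] notin_prime_mult[OF assms]] using notin_prime_mult[OF h(3,4)] by blast
    then show "frac_rel B (carrier B - P) ``
        {(snd (proj B y', proj B t') \<otimes>\<^bsub>B\<^esub> fst (proj B x', proj B s') \<oplus>\<^bsub>B\<^esub>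
          snd (proj B x', proj B s') \<otimes>\<^bsub>B\<^esub> fst (proj B y', proj B t'),
        snd (proj B x', proj B s') \<otimes>\<^bsub>B\<^esub> snd (proj B y', proj B t'))} = fclass B P (t * x + s * y) (s * t)"
      by (simp add: fclass_def ring_product_ops(8,9)[OF B])
  qed
  then show ?thesis by (simp add: localization_at_prime_def localization_def)
qed

lemma fclass_one: "\<one>\<^bsub>localization_at_prime B P\<^esub> = fclass B P 1 1"
  by (simp add: localization_at_prime_def localization_def fclass_def ring_product_ops(7)[OF B])

lemma fclass_carrier: "s \<notin> proj B -` P \<Longrightarrow> fclass B P x s \<in> carrier (localization_at_prime B P)"
  unfolding localization_at_prime_def localization_def fclass_def
  using proj_carrier[OF B] by (simp add: quotientI)

lemma fclass_cases:
  assumes "U \<in> carrier (localization_at_prime B P)"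
  obtains x s where "s \<notin> proj B -` P" "U = fclass B P x s"
proof -
  have "U \<in> (carrier B \<times> (carrier B - P)) // frac_rel B (carrier B - P)"
    using assms by (simp add: localization_at_prime_def localization_def)
  then obtain p where p: "U = frac_rel B (carrier B - P) `` {p}" "p \<in> carrier B \<times> (carrier B - P)" by (rule quotientE)
  obtain b c where bc: "p = (b, c)" "b \<in> carrier B" "c \<in> carrier B" "c \<notin> P" using p(2) by blast
  obtain x where x: "proj B x = b" using proj_surj[OF B bc(2)] .
  obtain s where s: "proj B s = c" using proj_surj[OF B bc(3)] .
  show thesis using bc p(1) x s by (intro that[of s x]) (simp_all add: fclass_def)
qed

lemma localization_data:
  fixes A :: "'a ring"
  assumes A: "cring A" and iso: "A \<simeq> localization_at_prime B P"
  obtains \<theta> :: "'b ring_product \<Rightarrow> 'a ring_product" where "comm_ring_hom_type \<theta>"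
    "\<And>x. x \<in> kr B \<Longrightarrow> \<theta> x \<in> kr A" "\<And>x. \<theta> x \<in> kr A \<Longrightarrow> \<exists>u. u \<notin> proj B -` P \<and> u * x \<in> kr B"
    "\<And>s. s \<notin> proj B -` P \<Longrightarrow> \<exists>y. \<theta> s * y - 1 \<in> kr A" "\<And>y. \<exists>x s. s \<notin> proj B -` P \<and> y * \<theta> s - \<theta> x \<in> kr A"
proof -
  let ?L = "localization_at_prime B P"
  obtain h where "h \<in> ring_iso A ?L" using iso unfolding is_ring_iso_def by blast
  then have "inv_into (carrier A) h \<in> ring_iso ?L A" by (rule ring_iso_set_sym[OF cring.axioms(1)[OF A]])
  then obtain g where g: "g \<in> ring_hom ?L A" "bij_betw g (carrier ?L) (carrier A)" unfolding ring_iso_def by blast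
  have n1: "1 \<notin> proj B -` P" by (rule rprime_1[OF rprime_vimage(1)])
  let ?k = "fclass B P"
  have gm: "g (?k x s) \<otimes>\<^bsub>A\<^esub> g (?k y t) = g (?k (x * y) (s * t))" if "s \<notin> proj B -` P" "t \<notin> proj B -` P" for x s y t
    using ring_hom_mult[OF g(1) fclass_carrier fclass_carrier] fclass_mult that by metis
  have ga: "g (?k x 1) \<oplus>\<^bsub>A\<^esub> g (?k y 1) = g (?k (x + y) 1)" for x y
    using ring_hom_add[OF g(1) fclass_carrier[OF n1] fclass_carrier[OF n1], of x y] fclass_add[OF n1 n1, of x y] by simp
  have gi: "?k x s = ?k y t" if "g (?k x s) = g (?k y t)" "s \<notin> proj B -` P" "t \<notin> proj B -` P" for x s y t
    using inj_onD[OF bij_betw_imp_inj_on[OF g(2)] that(1) fclass_carrier[OF that(2)] fclass_carrier[OF that(3)]] .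
  have gc: "g (?k x s) \<in> carrier A" if "s \<notin> proj B -` P" for x s
    by (rule ring_hom_closed[OF g(1) fclass_carrier[OF that]])
  have g1: "g (?k s s) = \<one>\<^bsub>A\<^esub>" if s: "s \<notin> proj B -` P" for s
  proof -
    have "1 * (1 * s - s * 1) \<in> kr B" using rmod_0[OF kr_rmod[OF B]] by simp
    then have "?k s s = ?k 1 1" unfolding fclass_eq_iff[OF s n1] using n1 by blast
    then show ?thesis using ring_hom_one[OF g(1)] fclass_one by simp
  qed
  define \<psi> where "\<psi> b = g (frac_rel B (carrier B - P) `` {(b, \<one>\<^bsub>B\<^esub>)})" for b
  have \<psi>: "\<psi> (proj B x) = g (?k x 1)" for x
    by (simp add: \<psi>_def fclass_def ring_product_ops(7)[OF B])
  have hom: "\<psi> \<in> ring_hom B A"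
  proof (rule ring_hom_memI)
    fix b assume "b \<in> carrier B"
    then obtain x where x: "proj B x = b" using proj_surj[OF B] by blast
    show "\<psi> b \<in> carrier A" using gc[OF n1] unfolding x[symmetric] \<psi> .
  next
    fix b c assume "b \<in> carrier B" "c \<in> carrier B"
    then obtain x y where x: "proj B x = b" and y: "proj B y = c" using proj_surj[OF B] by metis
    show "\<psi> (b \<otimes>\<^bsub>B\<^esub> c) = \<psi> b \<otimes>\<^bsub>A\<^esub> \<psi> c"
      unfolding x[symmetric] y[symmetric] ring_product_ops(9)[OF B, symmetric] \<psi> gm[OF n1 n1] by simp
    show "\<psi> (b \<oplus>\<^bsub>B\<^esub> c) = \<psi> b \<oplus>\<^bsub>A\<^esub> \<psi> c"
      unfolding x[symmetric] y[symmetric] ring_product_ops(8)[OF B, symmetric] \<psi> ga ..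
  next
    show "\<psi> \<one>\<^bsub>B\<^esub> = \<one>\<^bsub>A\<^esub>"
      unfolding ring_product_ops(7)[OF B, symmetric] \<psi> by (rule g1[OF n1])
  qed
  obtain \<theta> where \<theta>: "comm_ring_hom_type \<theta>" "\<And>x. proj A (\<theta> x) = \<psi> (proj B x)" by (rule hom_lift[OF B A hom]) blast
  interpret comm_ring_hom_type \<theta> by fact
  have \<theta>g: "proj A (\<theta> x) = g (?k x 1)" for x using \<theta>(2) \<psi> by simp
  show thesis
  proof (rule that[OF \<theta>(1)])
    fix x assume "x \<in> kr B"
    then have "proj B x = proj B 0" by (simp add: kr_def ring_product_ops(6)[OF B])
    then have "proj A (\<theta> x) = proj A (\<theta> 0)" by (simp only: \<theta>(2))
    then show "\<theta> x \<in> kr A" by (simp add: kr_def ring_product_ops(6)[OF A])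
  next
    fix x assume "\<theta> x \<in> kr A"
    then have "proj A (\<theta> x) = proj A (\<theta> 0)" by (simp add: kr_def ring_product_ops(6)[OF A])
    then have "?k x 1 = ?k 0 1" unfolding \<theta>g by (rule gi[OF _ n1 n1])
    then show "\<exists>u. u \<notin> proj B -` P \<and> u * x \<in> kr B" unfolding fclass_eq_iff[OF n1 n1] by simp
  next
    fix s assume s: "s \<notin> proj B -` P"
    obtain y where y: "proj A y = g (?k 1 s)" using proj_surj[OF A gc[OF s]] .
    have "proj A (\<theta> s * y) = g (?k s s)"
      unfolding ring_product_ops(9)[OF A] y \<theta>g gm[OF n1 s] by simp
    then have "proj A (\<theta> s * y) = proj A 1" using g1[OF s] by (simp add: ring_product_ops(7)[OF A])
    then show "\<exists>y. \<theta> s * y - 1 \<in> kr A" using kr_diff_iff[OF A] by blast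
  next
    fix y
    have "proj A y \<in> g ` carrier ?L" using bij_betw_imp_surj_on[OF g(2)] proj_carrier[OF A] by simp
    then obtain U where U: "U \<in> carrier ?L" "proj A y = g U" by blast
    obtain x s where x: "s \<notin> proj B -` P" "U = ?k x s" by (rule fclass_cases[OF U(1)])
    have "1 * (1 * (x * s) - (s * 1) * x) \<in> kr B" using rmod_0[OF kr_rmod[OF B]] by (simp add: mult.commute)
    then have "?k (x * s) (s * 1) = ?k x 1"
      unfolding fclass_eq_iff[OF notin_prime_mult[OF x(1) n1] n1] using n1 by blast
    then have "proj A (y * \<theta> s) = proj A (\<theta> x)"
      unfolding ring_product_ops(9)[OF A] U(2) x(2) \<theta>g gm[OF x(1) n1] by simp
    then show "\<exists>x s. s \<notin> proj B -` P \<and> y * \<theta> s - \<theta> x \<in> kr A" using x(1) kr_diff_iff[OF A] by blast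
  qed
qed

end

lemma localization_ht:
  fixes \<theta> :: "'b::comm_ring_1 \<Rightarrow> 'a::comm_ring_1"
  assumes \<theta>: "comm_ring_hom_type \<theta>" and IA: "rmod UNIV IA" and P: "rprime UNIV P"
    and ker: "\<And>x. \<theta> x \<in> IA \<Longrightarrow> \<exists>u. u \<notin> P \<and> u * x \<in> IB"
    and frac: "\<And>y. \<exists>x s. s \<notin> P \<and> y * \<theta> s - \<theta> x \<in> IA" and ht: "ht_ge IB n P"
  shows "\<exists>Q. ht_ge IA n Q"
proof -
  interpret comm_ring_hom_type \<theta> by fact
  obtain c where c: "c n = P" "\<forall>i\<le>n. rprime UNIV (c i) \<and> IB \<subseteq> c i" "\<forall>i<n. c i \<subset> c (Suc i)"
    using ht unfolding ht_ge_def by blast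
  have cP: "c i \<subseteq> P" if "i \<le> n" for i
    using that
  proof (induction rule: inc_induct)
    case base
    then show ?case using c(1) by simp
  next
    case (step i)
    then show ?case using c(3) by blast
  qed
  have mP: "s * t \<notin> P" if "s \<notin> P" "t \<notin> P" for s t using rprime_mult[OF P] that by blast
  define D where "D J = {y. \<exists>x s. x \<in> J \<and> s \<notin> P \<and> y * \<theta> s - \<theta> x \<in> IA}" for J
  have eqD: "y \<in> D J \<longleftrightarrow> x \<in> J" if J: "rprime UNIV J" "IB \<subseteq> J" "J \<subseteq> P" and y: "s \<notin> P" "y * \<theta> s - \<theta> x \<in> IA" for x y s J
  proof
    assume "y \<in> D J"
    then obtain w t where w: "w \<in> J" "t \<notin> P" "y * \<theta> t - \<theta> w \<in> IA" by (auto simp: D_def)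
    have "\<theta> s * (y * \<theta> t - \<theta> w) - \<theta> t * (y * \<theta> s - \<theta> x) \<in> IA"
      by (rule rmod_diff[OF rsub_UNIV IA rmod_mult[OF IA UNIV_I w(3)] rmod_mult[OF IA UNIV_I y(2)]])
    then have "\<theta> (x * t - s * w) \<in> IA" by (simp add: algebra_simps)
    then obtain u where u: "u \<notin> P" "u * (x * t - s * w) \<in> IB" using ker by blast
    then have "x * t - s * w \<in> J" using rprime_mult[OF J(1), of u] J(2,3) by blast
    then have "x * t \<in> J"
      using rmod_diff_cancel[OF rsub_UNIV rprime_rmod[OF J(1)]] rmod_mult[OF rprime_rmod[OF J(1)] UNIV_I w(1)] by blast
    then show "x \<in> J" using rprime_mult[OF J(1)] w(2) J(3) by blast
  next
    assume "x \<in> J"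
    then show "y \<in> D J" unfolding D_def using y by blast
  qed
  have \<theta>D: "\<theta> x \<in> D J \<longleftrightarrow> x \<in> J" if J: "rprime UNIV J" "IB \<subseteq> J" "J \<subseteq> P" for x J
    using eqD[OF J rprime_1[OF P], of "\<theta> x" x] rmod_0[OF IA] by simp
  have Dprime: "rprime UNIV (D J)" "IA \<subseteq> D J" if J: "rprime UNIV J" "IB \<subseteq> J" "J \<subseteq> P" for J
  proof -
    note Jm = rprime_rmod[OF J(1)]
    have "rmod UNIV (D J)"
      unfolding rmod_def
    proof (intro conjI ballI)
      show "0 \<in> D J" using \<theta>D[OF J, of 0] rmod_0[OF Jm] by simp
    next
      fix y y' assume yy: "y \<in> D J" "y' \<in> D J"
      obtain x s where x: "s \<notin> P" "y * \<theta> s - \<theta> x \<in> IA" using frac by blast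
      obtain x' s' where x': "s' \<notin> P" "y' * \<theta> s' - \<theta> x' \<in> IA" using frac by blast
      have "\<theta> s' * (y * \<theta> s - \<theta> x) + \<theta> s * (y' * \<theta> s' - \<theta> x') \<in> IA"
        by (rule rmod_add[OF IA rmod_mult[OF IA UNIV_I x(2)] rmod_mult[OF IA UNIV_I x'(2)]])
      then have "(y + y') * \<theta> (s * s') - \<theta> (s' * x + s * x') \<in> IA" by (simp add: algebra_simps)
      moreover have "x \<in> J" "x' \<in> J" using eqD[OF J x] eqD[OF J x'] yy by auto
      then have "s' * x + s * x' \<in> J" by (intro rmod_add[OF Jm] rmod_mult[OF Jm UNIV_I])
      ultimately show "y + y' \<in> D J" using eqD[OF J mP[OF x(1) x'(1)]] by blast
    next
      fix z y assume y: "y \<in> D J"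
      obtain x s where x: "s \<notin> P" "y * \<theta> s - \<theta> x \<in> IA" using frac by blast
      obtain w t where w: "t \<notin> P" "z * \<theta> t - \<theta> w \<in> IA" using frac by blast
      have "(z * \<theta> t) * (y * \<theta> s) - \<theta> w * \<theta> x \<in> IA" by (rule cong_mult[OF IA w(2) x(2)])
      then have "(z * y) * \<theta> (t * s) - \<theta> (w * x) \<in> IA" by (simp add: ac_simps)
      moreover have "w * x \<in> J" using eqD[OF J x] y rmod_mult[OF Jm UNIV_I] by blast
      ultimately show "z * y \<in> D J" using eqD[OF J mP[OF w(1) x(1)]] by blast
    qed
    moreover have "1 \<notin> D J" using \<theta>D[OF J, of 1] rprime_1[OF J(1)] by simp
    moreover have "y \<in> D J \<or> y' \<in> D J" if yy: "y * y' \<in> D J" for y y'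
    proof -
      obtain x s where x: "s \<notin> P" "y * \<theta> s - \<theta> x \<in> IA" using frac by blast
      obtain x' s' where x': "s' \<notin> P" "y' * \<theta> s' - \<theta> x' \<in> IA" using frac by blast
      have "(y * \<theta> s) * (y' * \<theta> s') - \<theta> x * \<theta> x' \<in> IA" by (rule cong_mult[OF IA x(2) x'(2)])
      then have "(y * y') * \<theta> (s * s') - \<theta> (x * x') \<in> IA" by (simp add: ac_simps)
      then have "x * x' \<in> J" using eqD[OF J mP[OF x(1) x'(1)]] yy by blast
      then have "x \<in> J \<or> x' \<in> J" using rprime_mult[OF J(1)] by blast
      then show ?thesis using eqD[OF J x] eqD[OF J x'] by blast
    qed
    ultimately show "rprime UNIV (D J)" unfolding rprime_def by blast
    show "IA \<subseteq> D J"
    proof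
      fix y assume "y \<in> IA"
      then have "y * \<theta> 1 - \<theta> 0 \<in> IA" by simp
      then show "y \<in> D J" unfolding D_def using rmod_0[OF Jm] rprime_1[OF P] by blast
    qed
  qed
  have "D (c i) \<subset> D (c (Suc i))" if i: "i < n" for i
  proof -
    have ci: "rprime UNIV (c i)" "IB \<subseteq> c i" "c i \<subseteq> P" "rprime UNIV (c (Suc i))" "IB \<subseteq> c (Suc i)" "c (Suc i) \<subseteq> P"
      using c(2) cP[of i] cP[of "Suc i"] i by simp_all
    obtain x where x: "x \<in> c (Suc i)" "x \<notin> c i" using c(3) i by blast
    have "D (c i) \<subseteq> D (c (Suc i))" unfolding D_def using c(3) i by blast
    moreover have "\<theta> x \<in> D (c (Suc i))" "\<theta> x \<notin> D (c i)" using \<theta>D[OF ci(4-6)] \<theta>D[OF ci(1-3)] x by simp_all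
    ultimately show ?thesis by blast
  qed
  moreover have "rprime UNIV (D (c i)) \<and> IA \<subseteq> D (c i)" if "i \<le> n" for i
    using Dprime[of "c i"] c(2) cP[OF that] that by simp
  ultimately have "ht_ge IA n (D (c n))" unfolding ht_ge_def by (intro exI[of _ "\<lambda>i. D (c i)"]) simp
  then show ?thesis by blast
qed

lemma localization_relation:
  fixes \<theta> :: "'b::comm_ring_1 \<Rightarrow> 'a::comm_ring_1"
  assumes r: "monomial_ordering r" and \<theta>: "comm_ring_hom_type \<theta>" and IA: "rmod UNIV IA" and P: "rprime UNIV P"
    and ker: "\<And>x. x \<in> IB \<Longrightarrow> \<theta> x \<in> IA" and unit: "\<And>s. s \<notin> P \<Longrightarrow> \<exists>y. \<theta> s * y - 1 \<in> IA"
    and frac: "\<And>y. \<exists>x s. s \<notin> P \<and> y * \<theta> s - \<theta> x \<in> IA"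
    and K: "rsub K" and noeth: "noeth UNIV IB" and inv: "\<And>x. x \<in> K \<Longrightarrow> x \<notin> IB \<Longrightarrow> \<exists>y\<in>K. x * y - 1 \<in> IB"
    and gen: "polyring K m g = UNIV" and ht: "\<not> ht_ge IB n P"
  shows "subm r UNIV n a \<inter> IA \<noteq> {}"
proof
  interpret comm_ring_hom_type \<theta> by fact
  assume "subm r UNIV n a \<inter> IA = {}"
  then obtain q where q: "rprime UNIV q" "IA \<subseteq> q" "subm r UNIV n a \<inter> q = {}"
    by (rule exists_prime_subm_disjoint[OF r rsub_UNIV IA])
  note qm = rprime_rmod[OF q(1)]
  have Q: "rprime UNIV (\<theta> -` q)" using vimage_rprime[OF q(1)] by simp
  have IQ: "IB \<subseteq> \<theta> -` q" using ker q(2) by blast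
  have unitq: "\<exists>y. \<theta> s * y - 1 \<in> q" if "s \<notin> P" for s using unit[OF that] q(2) by blast
  have notq: "\<theta> s \<notin> q" if s: "s \<notin> P" for s
  proof
    assume sq: "\<theta> s \<in> q"
    obtain y where y: "\<theta> s * y - 1 \<in> q" using unitq[OF s] by blast
    have "\<theta> s * y - (\<theta> s * y - 1) \<in> q" by (rule rmod_diff[OF rsub_UNIV qm rmod_mult2[OF qm UNIV_I sq] y])
    then show False using rprime_1[OF q(1)] by simp
  qed
  then have QP: "\<theta> -` q \<subseteq> P" by blast
  have "\<forall>i. \<exists>x s. s \<notin> P \<and> a i * \<theta> s - \<theta> x \<in> q" using frac q(2) by blast
  then obtain u s where us: "\<And>i. s i \<notin> P" "\<And>i. a i * \<theta> (s i) - \<theta> (u i) \<in> q" by metis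
  obtain N C where C: "\<forall>e\<in>box n N. C e \<in> \<theta> -` q \<or> C e \<notin> P" "\<exists>e\<in>box n N. C e \<notin> P"
    "(\<Sum>e\<in>box n N. C e * (\<Prod>i<n. u i ^ e i * s i ^ (N - e i))) \<in> \<theta> -` q"
    using affine_local[OF K noeth inv gen Q IQ P QP ht, of u s] by blast
  have hprod: "\<theta> (prod f F) = (\<Prod>i\<in>F. \<theta> (f i))" for f :: "nat \<Rightarrow> 'b" and F
    by (induction F rule: infinite_finite_induct) simp_all
  have hpow: "\<theta> (x ^ k) = \<theta> x ^ k" for x k by (induction k) simp_all
  define S where "S = (\<Prod>i<n. \<theta> (s i) ^ N)"
  have Sq: "S \<notin> q"
  proof
    assume "S \<in> q"
    then obtain i where "\<theta> (s i) ^ N \<in> q" using rprime_prod[OF q(1), of "{..<n}"] unfolding S_def by blast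
    then have "\<theta> (s i) \<in> q" by (rule rprime_power[OF q(1) rsub_UNIV UNIV_I])
    then show False using notq us(1) by blast
  qed
  have tm: "(\<Prod>i<n. a i ^ e i) * S - \<theta> (\<Prod>i<n. u i ^ e i * s i ^ (N - e i)) \<in> q" if e: "e \<in> box n N" for e
  proof -
    have "(\<Prod>i<n. (a i * \<theta> (s i)) ^ e i * \<theta> (s i) ^ (N - e i)) - (\<Prod>i<n. \<theta> (u i) ^ e i * \<theta> (s i) ^ (N - e i)) \<in> q"
    proof (rule cong_prod[OF qm])
      fix i
      have 0: "\<theta> (s i) ^ (N - e i) - \<theta> (s i) ^ (N - e i) \<in> q" using rmod_0[OF qm] by simp
      show "(a i * \<theta> (s i)) ^ e i * \<theta> (s i) ^ (N - e i) - \<theta> (u i) ^ e i * \<theta> (s i) ^ (N - e i) \<in> q"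
        by (rule cong_mult[OF qm cong_power[OF qm us(2)] 0])
    qed
    moreover have "(\<Prod>i<n. (a i * \<theta> (s i)) ^ e i * \<theta> (s i) ^ (N - e i)) = (\<Prod>i<n. a i ^ e i) * S"
    proof -
      have "(a i * \<theta> (s i)) ^ e i * \<theta> (s i) ^ (N - e i) = a i ^ e i * \<theta> (s i) ^ N" if "i < n" for i
      proof -
        have "e i \<le> N" using e that by (auto simp: box_def PiE_iff)
        then have "N = e i + (N - e i)" by simp
        then have "\<theta> (s i) ^ N = \<theta> (s i) ^ e i * \<theta> (s i) ^ (N - e i)" by (metis power_add)
        then show ?thesis by (simp add: power_mult_distrib mult.assoc)
      qed
      then show ?thesis unfolding S_def by (simp add: prod.distrib[symmetric])
    qed
    ultimately show ?thesis by (simp add: hprod hpow)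
  qed
  have "(\<Sum>e\<in>box n N. \<theta> (C e) * ((\<Prod>i<n. a i ^ e i) * S - \<theta> (\<Prod>i<n. u i ^ e i * s i ^ (N - e i)))) \<in> q"
    by (rule rmod_sum[OF qm], rule rmod_mult[OF qm UNIV_I], rule tm)
  moreover have "(\<Sum>e\<in>box n N. \<theta> (C e) * \<theta> (\<Prod>i<n. u i ^ e i * s i ^ (N - e i))) \<in> q"
    using C(3) by (simp add: hom_sum)
  ultimately have "(\<Sum>e\<in>box n N. \<theta> (C e) * ((\<Prod>i<n. a i ^ e i) * S - \<theta> (\<Prod>i<n. u i ^ e i * s i ^ (N - e i))))
      + (\<Sum>e\<in>box n N. \<theta> (C e) * \<theta> (\<Prod>i<n. u i ^ e i * s i ^ (N - e i))) \<in> q"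
    by (rule rmod_add[OF qm])
  also have "(\<Sum>e\<in>box n N. \<theta> (C e) * ((\<Prod>i<n. a i ^ e i) * S - \<theta> (\<Prod>i<n. u i ^ e i * s i ^ (N - e i))))
      + (\<Sum>e\<in>box n N. \<theta> (C e) * \<theta> (\<Prod>i<n. u i ^ e i * s i ^ (N - e i)))
      = (\<Sum>e\<in>box n N. \<theta> (C e) * (\<Prod>i<n. a i ^ e i)) * S"
    unfolding sum.distrib[symmetric] sum_distrib_right by (intro sum.cong refl) (simp add: right_diff_distrib mult.assoc)
  finally have sum: "(\<Sum>e\<in>box n N. \<theta> (C e) * (\<Prod>i<n. a i ^ e i)) \<in> q"
    using rprime_mult[OF q(1)] Sq by blast
  define c where "c t = \<theta> (C (the_inv_into (box n N) (mse n) t))" for t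
  have c: "c (mse n e) = \<theta> (C e)" if "e \<in> box n N" for e
    unfolding c_def using the_inv_into_f_f[OF inj_mse that] by simp
  have "(\<Sum>t\<in>mse n ` box n N. c t * meval a t) = (\<Sum>e\<in>box n N. \<theta> (C e) * (\<Prod>i<n. a i ^ e i))"
    by (simp add: sum.reindex[OF inj_mse] c meval_mse)
  then have sum': "(\<Sum>t\<in>mse n ` box n N. c t * meval a t) \<in> q" using sum by simp
  obtain e where e: "e \<in> box n N" "C e \<notin> P" using C(2) by blast
  have ce: "mse n e \<in> mse n ` box n N" "c (mse n e) \<notin> q" using e notq c by auto
  have vars: "set_mset t \<subseteq> {..<n}" if "t \<in> mse n ` box n N" for t using that set_mse by blast
  have inv': "\<exists>y\<in>UNIV. c t * y - 1 \<in> q" if t: "t \<in> mse n ` box n N" "c t \<notin> q" for t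
  proof -
    obtain e where e: "e \<in> box n N" "t = mse n e" using t(1) by blast
    then have "\<theta> (C e) \<notin> q" using c[OF e(1)] t(2) by simp
    then have "C e \<notin> P" using C(1) e(1) by blast
    then show ?thesis using unitq c[OF e(1)] e(2) by simp
  qed
  have "subm r UNIV n a \<inter> q \<noteq> {}"
    by (rule relation_imp_subm[OF r rsub_UNIV qm _ vars UNIV_I sum' ce inv']) simp_all
  then show False using q(3) by blast
qed

lemma noeth_field:
  assumes R: "rsub R" and I: "rmod UNIV I" and inv: "\<And>x. x \<in> R \<Longrightarrow> x \<notin> I \<Longrightarrow> \<exists>y\<in>R. x * y - 1 \<in> I"
  shows "noeth R I"
  unfolding noeth_def
proof (intro allI impI)
  fix J :: "nat \<Rightarrow> 'a set" assume "\<forall>i. rmod R (J i) \<and> J i \<subseteq> R \<and> I \<subseteq> J i \<and> J i \<subseteq> J (Suc i)"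
  then have J: "rmod R (J i)" "J i \<subseteq> R" "I \<subseteq> J i" "J i \<subseteq> J (Suc i)" for i by auto
  have mono: "J i \<subseteq> J j" if "i \<le> j" for i j by (rule lift_Suc_mono_le[of J, OF J(4) that])
  have all: "J i = I \<or> J i = R" for i
  proof (cases "J i \<subseteq> I")
    case False
    then obtain x where x: "x \<in> J i" "x \<notin> I" by blast
    have xR: "x \<in> R" using J(2) x(1) by blast
    obtain y where y: "y \<in> R" "x * y - 1 \<in> I" using inv[OF xR x(2)] by blast
    have "x * y - (x * y - 1) \<in> J i"
      by (rule rmod_diff[OF R J(1) rmod_mult2[OF J(1) y(1) x(1)] subsetD[OF J(3) y(2)]])
    then have "1 \<in> J i" by simp
    then have "z \<in> J i" if "z \<in> R" for z using rmod_mult[OF J(1) that] by fastforce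
    then show ?thesis using J(2) by blast
  qed (use J(3) in blast)
  show "\<exists>n. \<forall>m\<ge>n. J m = J n"
  proof (cases "\<exists>n. J n = R")
    case True
    then obtain n where n: "J n = R" by blast
    have "J m = J n" if "n \<le> m" for m using mono[OF that] J(2)[of m] n by blast
    then show ?thesis by blast
  next
    case False
    then have "J i = I" for i using all by blast
    then show ?thesis by simp
  qed
qed

lemma localization_upper:
  fixes A :: "'a ring" and B :: "'b ring" and k :: "'k ring"
  assumes r: "monomial_ordering r" and A: "cring A" and k: "field k" and fg: "fg_algebra k B \<beta>"
    and P: "primeideal P B" and iso: "A \<simeq> localization_at_prime B P"
    and no: "subm r UNIV n a \<inter> kr A = {}"
  shows "\<exists>Q. prime_chain A n Q"
proof -
  have alg: "ring_algebra k B \<beta>" using fg by (simp add: fg_algebra_def)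
  note B = ring_algebraD(2)[OF alg] and K = rsub_hom_image[OF alg]
  let ?K = "proj B -` \<beta> ` carrier k" and ?P = "proj B -` P"
  note inv = field_image_inverse[OF k alg]
  obtain m g where gen: "polyring ?K m g = UNIV" by (rule fg_algebra_polyring[OF fg])
  have IK: "kr B \<subseteq> ?K" by (rule hom_image_data[OF alg]) blast
  have "noeth (polyring ?K m g) (kr B)"
    by (rule noeth_polyring[OF K noeth_field[OF K kr_rmod[OF B] inv] IK])
  then have noeth: "noeth UNIV (kr B)" by (simp only: gen)
  obtain \<theta> :: "'b ring_product \<Rightarrow> 'a ring_product" where \<theta>: "comm_ring_hom_type \<theta>"
    "\<And>x. x \<in> kr B \<Longrightarrow> \<theta> x \<in> kr A" "\<And>x. \<theta> x \<in> kr A \<Longrightarrow> \<exists>u. u \<notin> ?P \<and> u * x \<in> kr B"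
    "\<And>s. s \<notin> ?P \<Longrightarrow> \<exists>y. \<theta> s * y - 1 \<in> kr A" "\<And>y. \<exists>x s. s \<notin> ?P \<and> y * \<theta> s - \<theta> x \<in> kr A"
    by (rule localization_data[OF B P A iso]) blast
  note Pp = prime_vimage(1)[OF B P]
  have "ht_ge (kr B) n ?P"
  proof (rule ccontr)
    assume ht: "\<not> ht_ge (kr B) n ?P"
    have "subm r UNIV n a \<inter> kr A \<noteq> {}"
      by (rule localization_relation[OF r \<theta>(1) kr_rmod[OF A] Pp \<theta>(2,4,5) K noeth inv gen ht])
    then show False using no by blast
  qed
  from localization_ht[OF \<theta>(1) kr_rmod[OF A] Pp \<theta>(3,5) this] have "\<exists>Q. ht_ge (kr A) n Q" .
  then show ?thesis using prime_chain_iff_ht_ge[OF A] by blast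
qed

theorem theorem3p7:
  fixes A :: "'a ring" and r :: "(nat multiset \<times> nat multiset) set"
  assumes "cring A" and "noetherian_ring A" and "monomial_ordering r"
  shows
    "(\<forall>(R :: 'r ring) \<phi> K.
        ring_algebra R A \<phi> \<and> subfield K R \<and>
        subfinite_algebra TYPE('c) (R\<lparr>carrier := K\<rparr>) A \<phi> \<longrightarrow>
        trdeg r R A \<phi> = krull_dim A) \<and>
     (\<forall>(k :: 'k ring) (B :: 'b ring) \<beta> P.
        field k \<and> fg_algebra k B \<beta> \<and> primeideal P B \<and> A \<simeq> localization_at_prime B P \<longrightarrow>
        trdeg_self r A = krull_dim A) \<and>
     (krull_dim A \<le> 1 \<longrightarrow> trdeg_self r A = krull_dim A) \<and>
     (\<forall>(R :: 's ring) \<phi>.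
        krull_dim A \<le> 1 \<and> noetherian_ring R \<and> jacobson_ring R \<and>
        subfinite_algebra TYPE('d) R A \<phi> \<longrightarrow>
        trdeg r R A \<phi> = krull_dim A)"
proof -
  note A = assms(1) and N = assms(2) and r = assms(3)
  have self: "ring_algebra A A (\<lambda>x. x)" by (auto simp: ring_algebra_def A ring_hom_def)
  show ?thesis
  proof (intro conjI allI impI; (elim conjE)?)
    fix R :: "'r ring" and \<phi> K
    assume alg: "ring_algebra R A \<phi>" and K: "subfield K R"
      and sub: "subfinite_algebra TYPE('c) (R\<lparr>carrier := K\<rparr>) A \<phi>"
    have R: "ring R" by (rule cring.axioms(1)[OF ring_algebraD(1)[OF alg]])
    show "trdeg r R A \<phi> = krull_dim A"
    proof (rule trdeg_eq_krull_dim[OF r alg N])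
      fix n a assume h: "\<one>\<^bsub>A\<^esub> \<noteq> \<zero>\<^bsub>A\<^esub>" "\<And>i. i < n \<Longrightarrow> a i \<in> carrier A" "\<not> alg_dependent r R A \<phi> n a"
      obtain a' where a': "subm r (proj A -` \<phi> ` carrier R) n a' \<inter> kr A = {}"
        by (rule independent_imp_disjoint[OF r alg h rsub_hom_image[OF alg]]) blast
      have "proj A -` \<phi> ` K \<subseteq> proj A -` \<phi> ` carrier R" using subfieldE(3)[OF K] by blast
      from subm_mono_ring[OF this, of r n a'] have "subm r (proj A -` \<phi> ` K) n a' \<inter> kr A = {}" using a' by blast
      then show "\<exists>P. prime_chain A n P"
        using field_subfinite_upper[OF r ring.subfield_iff(2)[OF R K] sub] by simp
    qed
  next
    fix k :: "'k ring" and B :: "'b ring" and \<beta> P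
    assume b: "field k" "fg_algebra k B \<beta>" "primeideal P B" "A \<simeq> localization_at_prime B P"
    show "trdeg_self r A = krull_dim A"
    proof (rule trdeg_eq_krull_dim[OF r self N])
      fix n a assume h: "\<one>\<^bsub>A\<^esub> \<noteq> \<zero>\<^bsub>A\<^esub>" "\<And>i. i < n \<Longrightarrow> a i \<in> carrier A" "\<not> alg_dependent r A A (\<lambda>x. x) n a"
      obtain a' where a': "subm r (proj A -` (\<lambda>x. x) ` carrier A) n a' \<inter> kr A = {}"
        by (rule independent_imp_disjoint[OF r self h rsub_hom_image[OF self]]) blast
      have "proj A -` (\<lambda>x. x) ` carrier A = UNIV" using proj_carrier[OF A] by auto
      then show "\<exists>P. prime_chain A n P" using localization_upper[OF r A b, of n a'] a' by simp
    qed
  next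
    assume dim: "krull_dim A \<le> 1"
    show "trdeg_self r A = krull_dim A"
      by (rule trdeg_eq_krull_dim[OF r self N]) (rule dim_le_1_upper[OF r A N dim])
  next
    fix R :: "'s ring" and \<phi>
    assume dim: "krull_dim A \<le> 1" and NR: "noetherian_ring R" and J: "jacobson_ring R"
      and sub: "subfinite_algebra TYPE('d) R A \<phi>"
    have alg: "ring_algebra R A \<phi>" using sub by (simp add: subfinite_algebra_def)
    show "trdeg r R A \<phi> = krull_dim A"
    proof (rule trdeg_eq_krull_dim[OF r alg N])
      fix n a assume h: "\<one>\<^bsub>A\<^esub> \<noteq> \<zero>\<^bsub>A\<^esub>" "0 < n" "\<And>i. i < n \<Longrightarrow> a i \<in> carrier A" "\<not> alg_dependent r R A \<phi> n a"
      obtain a' where a': "subm r (proj A -` \<phi> ` carrier R) n a' \<inter> kr A = {}"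
        by (rule independent_imp_disjoint[OF r alg h(1,3,4) rsub_hom_image[OF alg]]) blast
      have chain: "\<exists>P. prime_chain A m P" if m: "m = 1 \<or> m = 2" "m \<le> n" for m
      proof (rule jacobson_subfinite_upper[OF r NR J sub m(1)])
        show "subm r (proj A -` \<phi> ` carrier R) m a' \<inter> kr A = {}" using a' subm_mono[OF m(2), of r "proj A -` \<phi> ` carrier R" a'] by blast
      qed
      have nc: "carrier A \<noteq> {\<zero>\<^bsub>A\<^esub>}" using h(1) cring.cring_simprules(6)[OF A] by auto
      have "n \<le> 1"
      proof (rule ccontr)
        assume "\<not> n \<le> 1"
        then obtain P where "prime_chain A 2 P" using chain[of 2] by auto
        then show False using krull_dim_le_1[OF dim nc] by fastforce
      qed
      then have "n = 1" using h(2) by simp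
      then show "\<exists>P. prime_chain A n P" using chain[of n] by simp
    qed
  qed
qed

end
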